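(* Suppose that the $q$-difference module $\mathcal{M}=(M,\Sigma_q)$ over $\mathbf{K}$ is almost admissible, with Newton polygon $\{(\mu_1,r_1),\dots,(\mu_k,r_k)\}$. Then $$M=M_1\oplus M_2\oplus\dots\oplus M_k,$$ where the $q$-difference modules $\mathcal{M}_i=(M_i,\Sigma_q|_{M_i})$ are defined over $\mathbf{K}$, almost admissible and pure of slope $\mu_i$ and rank $r_i$. Moreover each $\mathcal{M}_i$ is a direct sum of almost admissible indecomposable $q$-difference modules, i.e. iterated non-trivial extensions of a simple almost admissible $q$-difference module by itself.
   Context: Let $(\mathbf{C},|\cdot|)$ be either $\mathbb{C}$ with the usual norm or an algebraically closed field with an ultrametric norm. Fix $q\in\mathbf{C}$ with $|q|=1$, not a root of unity, and elements $q^{1/n}\in\mathbf{C}$ with $(q^{1/n})^n=q$. Put $(\lambda;q)_0=1$, $(\lambda;q)_n=(1-\lambda)(1-q\lambda)\cdots(1-q^{n-1}\lambda)$ for $n\ge1$. "Convergent" means with positive radius of convergence. Standing assumption: $\sum_{n\ge0}\frac{x^n}{(q;q)_n}$ is convergent. For a finite set $\Lambda\subset\mathbf{C}^\ast\smallsetminus q^{\mathbb{Z}_{\le0}}$ put $\phi_{(q;\Lambda)}(x)=\sum_{n\ge0}\frac{x^n}{\prod_{\lambda\in\Lambda}(\lambda;q)_n}$. Operators. $\mathbf{C}\{x\}$ is the ring of germs of analytic functions at $0$ and $\mathbf{C}\{x\}[\sigma_q]$ is the skew polynomial ring with $\sigma_q f(x)=f(qx)\sigma_q$. For $\mathcal{L}=\sum_{i=0}^{\nu}a_i(x)\sigma_q^i\in\mathbf{C}\{x\}[\sigma_q]$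 with $a_\nu\ne0$, $\nu$ is the order and the Newton polygon $NP(\mathcal{L})$ is the convex hull in $\mathbb{R}^2$ of $\{(i,k)\in\mathbb{Z}\times\mathbb{R}:0\le i\le\nu,\ a_i\ne0,\ k\ge\mathrm{ord}_xa_i\}$. Common powers of $x$ in the coefficients are cleared so that it meets the horizontal axis. It is identified with $\{(\mu_1,r_1),\dots,(\mu_k,r_k)\}$, where $\mu_1<\dots<\mu_k$ are its finite slopes and $r_i$ the lengths of their projections on the horizontal axis. $\mathcal{L}$ is pure of slope $\mu$ if $\mu$ is its only slope. Exponents. If $0$ is a slope, its characteristic polynomial is $\sum_i a_i(0)T^i$. For a slope $\mu\in\mathbb{Z}$ the characteristic polynomial is that of the zero slope of the operator $x^C\sum_i a_i(x)(x^{-\mu}\sigma_q)^i$, with $C$ a convenient integer (clearing powers of $x$). For $\mu\in\mathbb{Q}$, put $t=x^{1/n}$ with $n\mu\in\mathbb{Z}$, replace $\mathcal{L}$ by $\sum a_i(t^n)\sigma_{q^{1/n}}^i$ and use its slope $n\mu$. The exponents of $\mu$ are the non-zero roots $\lambda_1,\dots,\lambda_r$ of the characteristic polynomial, with multiplicities. Admissibility. A slope $\mu\in\mathbb{Z}$ is admissible if $\phi_{(q;\underline\Lambda)}(x)$ is convergent for $\underline\Lambda=\{\lambda_i\lambda_j^{-1}: 1\le i,j\le r,\ \lambda_i\lambda_j^{-1}\notin q^{\mathbb{Z}_{\le0}}\}$. A slope $\mu\in\mathbb{Q}$ is almost admissible if it becomes admissible in $\mathbf{C}\{x^{1/n}\}[\sigma_{q^{1/n}}]$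 (with $x,q$ replaced by $x^{1/n},q^{1/n}$) for a convenient $n\ge1$. $\mathcal{L}$ is almost admissible if all its slopes are. Modules. $\mathbf{K}=\mathbf{C}(\{x\})=\mathrm{Frac}(\mathbf{C}\{x\})$. A $q$-difference module over $\mathbf{K}$ (of rank $\dim_{\mathbf{K}}M$) is a finite-dimensional $\mathbf{K}$-vector space $M$ with a bijective $\mathbf{C}$-linear map $\Sigma_q:M\to M$ with $\Sigma_q(fm)=\sigma_q(f)\Sigma_q(m)$; morphisms are $\mathbf{K}$-linear maps commuting with the $\Sigma_q$'s. By the cyclic vector lemma $M\cong\mathbf{K}[\sigma_q,\sigma_q^{-1}]/\mathbf{K}[\sigma_q,\sigma_q^{-1}]\mathcal{L}$ for some $\mathcal{L}\in\mathbf{C}\{x\}[\sigma_q]$; the Newton polygon of $\mathcal{L}$ depends only on $M$ and is the Newton polygon of $\mathcal{M}$. $\mathcal{M}$ is almost admissible (resp. pure of slope $\mu$) if such an $\mathcal{L}$ can be chosen almost admissible (resp. pure of slope $\mu$). Simple means having no proper non-zero $q$-difference submodule; indecomposable means not a direct sum of two non-zero submodules. *)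

theory Defs
  imports
    "HOL-Computational_Algebra.Computational_Algebra"
    "HOL-Analysis.Summation_Tests"
    "HOL-Analysis.Polytope"
    "HOL-Library.Poly_Mapping"
begin

section \<open>The base field\<close>

class valued_field = field +
  fixes absv :: "'a \<Rightarrow> real"
  assumes absv_nonneg: "0 \<le> absv x"
    and absv_eq_0_iff: "absv x = 0 \<longleftrightarrow> x = 0"
    and absv_mult: "absv (x * y) = absv x * absv y"
    and absv_triangle: "absv (x + y) \<le> absv x + absv y"

text \<open>
  The second alternative of the last axiom says that the valued field is the field of complex
  numbers with its usual norm (up to an isometric isomorphism of fields). In the ultrametric
  case completeness is not assumed.
\<close>

class base_field = alg_closed_field + valued_field +
  assumes ultrametric_or_complex:
    "(\<forall>x y. absv (x + y) \<le> max (absv x) (absv y)) \<or>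
     (\<exists>\<iota> :: 'a \<Rightarrow> complex. bij \<iota> \<and> (\<forall>x y. \<iota> (x + y) = \<iota> x + \<iota> y) \<and>
        (\<forall>x y. \<iota> (x * y) = \<iota> x * \<iota> y) \<and> (\<forall>x. norm (\<iota> x) = absv x))"

instantiation complex :: base_field
begin

definition absv_complex :: "complex \<Rightarrow> real" where "absv_complex = norm"

instance
  by standard
    (auto simp: absv_complex_def norm_mult norm_triangle_ineq intro!: disjI2 exI[of _ id])

end

lemma absv_zero [simp]: "absv (0 :: 'a :: valued_field) = 0"
  by (simp add: absv_eq_0_iff)

lemma absv_one [simp]: "absv (1 :: 'a :: valued_field) = 1"
proof -
  have "absv (1 :: 'a) * absv (1 :: 'a) = absv (1 :: 'a)"
    by (metis absv_mult mult_1)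
  moreover have "absv (1 :: 'a) \<noteq> 0" by (simp add: absv_eq_0_iff)
  ultimately show ?thesis by simp
qed

lemma absv_uminus [simp]: "absv (- x :: 'a :: valued_field) = absv x"
proof -
  have "absv (- 1 :: 'a) * absv (- 1 :: 'a) = 1"
    by (simp flip: absv_mult)
  hence "absv (- 1 :: 'a) = 1"
    using absv_nonneg[of "- 1 :: 'a"] by (simp add: square_eq_1_iff)
  thus ?thesis using absv_mult[of "- 1" x] by simp
qed

lemma absv_power: "absv (x ^ n :: 'a :: valued_field) = absv x ^ n"
  by (induction n) (simp_all add: absv_mult)

lemma absv_sum_le: "absv (sum f A :: 'a :: valued_field) \<le> (\<Sum>i\<in>A. absv (f i))"
proof (induction A rule: infinite_finite_induct)
  case (insert x A)
  thus ?case using absv_triangle[of "f x" "sum f A"] by simp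
qed auto


section \<open>Convergent power series\<close>

definition convergent_coeffs :: "(nat \<Rightarrow> 'a :: valued_field) \<Rightarrow> bool" where
  "convergent_coeffs a \<longleftrightarrow> 0 < conv_radius (\<lambda>n. absv (a n))"

lemma convergent_coeffsI:
  assumes B: "B > 0" and le: "\<And>n. absv (a n) \<le> A * B ^ n"
  shows "convergent_coeffs a"
proof -
  have "ereal (1 / B) \<le> conv_radius (\<lambda>n. absv (a n))"
  proof (rule conv_radius_geI_ex')
    fix r :: real assume r: "0 < r" "ereal r < ereal (1 / B)"
    hence "r * B < 1" using B by (simp add: field_simps)
    hence "summable (\<lambda>n. A * (B * r) ^ n)"
      using r B by (intro summable_mult summable_geometric) (simp add: abs_mult mult.commute)
    thus "summable (\<lambda>n. absv (a n) * of_real r ^ n)"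
    proof (rule summable_comparison_test')
      fix n
      have "absv (a n) * r ^ n \<le> A * B ^ n * r ^ n"
        using r le by (intro mult_right_mono) auto
      thus "norm (absv (a n) * of_real r ^ n) \<le> A * (B * r) ^ n"
        using r by (simp add: absv_nonneg power_mult_distrib mult_ac abs_mult)
    qed
  qed
  thus ?thesis unfolding convergent_coeffs_def
    by (rule less_le_trans[rotated]) (use B in auto)
qed

lemma convergent_coeffsE:
  assumes "convergent_coeffs a"
  obtains A B where "A > 0" "B \<ge> 1" "\<And>n. absv (a n) \<le> A * B ^ n"
proof -
  obtain r where r: "0 < ereal r" "ereal r < conv_radius (\<lambda>n. absv (a n))"
    using assms ereal_dense2[of 0 "conv_radius (\<lambda>n. absv (a n))"]
    unfolding convergent_coeffs_def by blast
  hence r0: "r > 0" by simp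
  have "summable (\<lambda>n. absv (a n) * r ^ n)"
    using summable_in_conv_radius[of r "\<lambda>n. absv (a n)"] r r0 by simp
  hence "Bseq (\<lambda>n. absv (a n) * r ^ n)"
    by (intro convergent_imp_Bseq convergentI[of _ 0] summable_LIMSEQ_zero)
  then obtain A where A: "A > 0" "\<And>n. norm (absv (a n) * r ^ n) \<le> A"
    unfolding Bseq_def by blast
  define B where "B = max 1 (1 / r)"
  have "absv (a n) \<le> A * B ^ n" for n
  proof -
    have "absv (a n) = (absv (a n) * r ^ n) * (1 / r) ^ n"
      using r0 by (simp add: power_one_over field_simps)
    also have "\<dots> \<le> A * B ^ n"
      using A(2)[of n] A(1) r0
      by (intro mult_mono power_mono) (auto simp: B_def)
    finally show ?thesis .
  qed
  thus ?thesis using A(1) by (intro that[of A B]) (auto simp: B_def)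
qed

text \<open>The ring of germs of analytic functions at 0, and its fraction field.\<close>

typedef (overloaded) 'a germ = "{f :: 'a :: valued_field fps. convergent_coeffs (fps_nth f)}"
  by (rule exI[of _ 0]) (auto intro: convergent_coeffsI[of 1 _ 0])

setup_lifting type_definition_germ

type_synonym 'a mero = "'a germ fract"

lift_definition germ_nth :: "'a :: valued_field germ \<Rightarrow> nat \<Rightarrow> 'a" is fps_nth .

lift_definition germ_ord :: "'a :: valued_field germ \<Rightarrow> nat" is subdegree .

lemma convergent_coeffs_add:
  assumes "convergent_coeffs a" "convergent_coeffs b"
  shows "convergent_coeffs (\<lambda>n. a n + b n)"
proof -
  obtain A B where 1: "A > 0" "B \<ge> 1" "\<And>n. absv (a n) \<le> A * B ^ n"
    using assms(1) by (elim convergent_coeffsE) blast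
  obtain A' B' where 2: "A' > 0" "B' \<ge> 1" "\<And>n. absv (b n) \<le> A' * B' ^ n"
    using assms(2) by (elim convergent_coeffsE) blast
  show ?thesis
  proof (rule convergent_coeffsI)
    show "B * B' > 0" using 1 2 by simp
    fix n
    have "absv (a n + b n) \<le> A * B ^ n + A' * B' ^ n"
      using absv_triangle[of "a n" "b n"] 1(3)[of n] 2(3)[of n] by simp
    also have "\<dots> \<le> A * (B * B') ^ n + A' * (B * B') ^ n"
      using 1 2 mult_left_mono[of 1 B' B] mult_right_mono[of 1 B B']
      by (intro add_mono mult_left_mono power_mono) auto
    finally show "absv (a n + b n) \<le> (A + A') * (B * B') ^ n" by (simp add: distrib_right)
  qed
qed

lemma convergent_coeffs_mult:
  fixes f g :: "'a :: valued_field fps"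
  assumes "convergent_coeffs (fps_nth f)" "convergent_coeffs (fps_nth g)"
  shows "convergent_coeffs (fps_nth (f * g))"
proof -
  obtain A B where 1: "A > 0" "B \<ge> 1" "\<And>n. absv (fps_nth f n) \<le> A * B ^ n"
    using assms(1) by (elim convergent_coeffsE) blast
  obtain A' B' where 2: "A' > 0" "B' \<ge> 1" "\<And>n. absv (fps_nth g n) \<le> A' * B' ^ n"
    using assms(2) by (elim convergent_coeffsE) blast
  show ?thesis
  proof (rule convergent_coeffsI)
    show "2 * (B * B') > 0" using 1 2 by simp
    fix n
    have "absv (fps_nth (f * g) n) \<le> (\<Sum>i=0..n. absv (fps_nth f i) * absv (fps_nth g (n - i)))"
      unfolding fps_mult_nth by (rule order_trans[OF absv_sum_le]) (simp add: absv_mult)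
    also have "\<dots> \<le> (\<Sum>i=0..n. (A * A') * (B * B') ^ n)"
    proof (rule sum_mono)
      fix i assume i: "i \<in> {0..n}"
      have "absv (fps_nth f i) * absv (fps_nth g (n - i)) \<le> (A * B ^ i) * (A' * B' ^ (n - i))"
        using 1 2 by (intro mult_mono) (auto simp: absv_nonneg)
      also have "\<dots> \<le> (A * B ^ n) * (A' * B' ^ n)"
        using 1 2 i by (intro mult_mono mult_left_mono power_increasing) auto
      finally show "absv (fps_nth f i) * absv (fps_nth g (n - i)) \<le> (A * A') * (B * B') ^ n"
        by (simp add: power_mult_distrib mult_ac)
    qed
    also have "\<dots> = (A * A') * (real (Suc n) * (B * B') ^ n)" by simp
    also have "\<dots> \<le> (A * A') * (2 ^ n * (B * B') ^ n)"
    proof -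
      have "real (Suc n) \<le> 2 ^ n"
        by (metis Suc_leI less_exp of_nat_le_iff of_nat_numeral of_nat_power)
      thus ?thesis using 1 2 by (intro mult_left_mono mult_right_mono) auto
    qed
    finally show "absv (fps_nth (f * g) n) \<le> (A * A') * (2 * (B * B')) ^ n"
      by (simp add: power_mult_distrib)
  qed
qed

instantiation germ :: (valued_field) idom
begin

lift_definition zero_germ :: "'a germ" is 0 by (auto intro: convergent_coeffsI[of 1 _ 0])
lift_definition one_germ :: "'a germ" is 1
  by (rule convergent_coeffsI[of 1 _ 1]) (auto simp: fps_one_nth)
lift_definition plus_germ :: "'a germ \<Rightarrow> 'a germ \<Rightarrow> 'a germ" is "(+)"
proof -
  fix f g :: "'a fps"
  assume "convergent_coeffs (fps_nth f)" "convergent_coeffs (fps_nth g)"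
  moreover have "fps_nth (f + g) = (\<lambda>n. fps_nth f n + fps_nth g n)" by (simp add: fun_eq_iff)
  ultimately show "convergent_coeffs (fps_nth (f + g))" by (simp add: convergent_coeffs_add)
qed
lift_definition uminus_germ :: "'a germ \<Rightarrow> 'a germ" is uminus
  by (simp add: convergent_coeffs_def)
lift_definition minus_germ :: "'a germ \<Rightarrow> 'a germ \<Rightarrow> 'a germ" is "(-)"
proof -
  fix f g :: "'a fps"
  assume "convergent_coeffs (fps_nth f)" "convergent_coeffs (fps_nth g)"
  hence "convergent_coeffs (\<lambda>n. fps_nth f n + - fps_nth g n)"
    by (intro convergent_coeffs_add) (simp_all add: convergent_coeffs_def)
  moreover have "fps_nth (f - g) = (\<lambda>n. fps_nth f n + - fps_nth g n)" by (simp add: fun_eq_iff)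
  ultimately show "convergent_coeffs (fps_nth (f - g))" by simp
qed
lift_definition times_germ :: "'a germ \<Rightarrow> 'a germ \<Rightarrow> 'a germ" is "(*)"
  by (rule convergent_coeffs_mult)

instance
  by standard (transfer; simp add: algebra_simps)+

end

lift_definition germ_X :: "'a :: valued_field germ" is fps_X
  by (rule convergent_coeffsI[of 1 _ 1]) (auto simp: fps_X_def)

text \<open>\<open>germ_dilate c f\<close> is \<open>f(cx)\<close>, and \<open>germ_ramify n f\<close> is \<open>f(t\<^sup>n)\<close>.\<close>

lift_definition germ_dilate :: "'a :: valued_field \<Rightarrow> 'a germ \<Rightarrow> 'a germ"
  is "\<lambda>c f. fps_compose f (fps_const c * fps_X)"
proof -
  fix c :: 'a and f :: "'a fps"
  assume "convergent_coeffs (fps_nth f)"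
  then obtain A B where 1: "A > 0" "B \<ge> 1" "\<And>n. absv (fps_nth f n) \<le> A * B ^ n"
    by (elim convergent_coeffsE) blast
  show "convergent_coeffs (fps_nth (fps_compose f (fps_const c * fps_X)))"
  proof (rule convergent_coeffsI)
    show "B * (absv c + 1) > 0" using 1 absv_nonneg[of c] by (intro mult_pos_pos) auto
    fix n
    have "absv (fps_nth (fps_compose f (fps_const c * fps_X)) n) = absv c ^ n * absv (fps_nth f n)"
      by (simp add: absv_mult absv_power)
    also have "\<dots> \<le> (absv c + 1) ^ n * (A * B ^ n)"
      using 1 absv_nonneg[of c] by (intro mult_mono power_mono) (auto simp: absv_nonneg)
    finally show "absv (fps_nth (fps_compose f (fps_const c * fps_X)) n) \<le> A * (B * (absv c + 1)) ^ n"
      by (simp add: power_mult_distrib mult_ac)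
  qed
qed

lift_definition germ_ramify :: "nat \<Rightarrow> 'a :: valued_field germ \<Rightarrow> 'a germ"
  is "\<lambda>n f. Abs_fps (\<lambda>m. if n dvd m then fps_nth f (m div n) else 0)"
proof -
  fix n :: nat and f :: "'a fps"
  assume "convergent_coeffs (fps_nth f)"
  then obtain A B where 1: "A > 0" "B \<ge> 1" "\<And>n. absv (fps_nth f n) \<le> A * B ^ n"
    by (elim convergent_coeffsE) blast
  show "convergent_coeffs (fps_nth (Abs_fps (\<lambda>m. if n dvd m then fps_nth f (m div n) else 0)))"
  proof (rule convergent_coeffsI)
    show "B > 0" using 1 by simp
    fix m
    have "absv (fps_nth f (m div n)) \<le> A * B ^ (m div n)" by (rule 1(3))
    also have "\<dots> \<le> A * B ^ m" using 1 by (intro mult_left_mono power_increasing) auto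
    finally have "absv (fps_nth f (m div n)) \<le> A * B ^ m" .
    thus "absv (fps_nth (Abs_fps (\<lambda>m. if n dvd m then fps_nth f (m div n) else 0)) m) \<le> A * B ^ m"
      using 1 by simp
  qed
qed

lemma germ_dilate_eq_0_iff:
  assumes "c \<noteq> 0"
  shows "germ_dilate c f = 0 \<longleftrightarrow> f = 0"
  using assms by transfer (auto simp: fps_eq_iff)

lemma germ_dilate_mult: "germ_dilate c (f * g) = germ_dilate c f * germ_dilate c g"
  by transfer (simp add: fps_compose_mult_distrib)

text \<open>\<open>\<sigma>\<^sub>q\<close> on the fraction field is \<open>mero_dilate q\<close>; this makes sense for \<open>q \<noteq> 0\<close> only.\<close>

definition mero_dilate :: "'a :: valued_field \<Rightarrow> 'a mero \<Rightarrow> 'a mero" where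
  "mero_dilate c z =
     (THE w. \<exists>a b. b \<noteq> 0 \<and> z = Fract a b \<and> w = Fract (germ_dilate c a) (germ_dilate c b))"

lemma mero_dilate_Fract:
  assumes "c \<noteq> 0" "b \<noteq> 0"
  shows "mero_dilate c (Fract a b) = Fract (germ_dilate c a) (germ_dilate c b)"
  unfolding mero_dilate_def
proof (rule the_equality)
  fix w assume "\<exists>a' b'. b' \<noteq> 0 \<and> Fract a b = Fract a' b' \<and>
    w = Fract (germ_dilate c a') (germ_dilate c b')"
  then obtain a' b' where *: "b' \<noteq> 0" "Fract a b = Fract a' b'"
    "w = Fract (germ_dilate c a') (germ_dilate c b')" by blast
  have "a * b' = a' * b" using * assms by (simp add: eq_fract)
  hence "germ_dilate c a * germ_dilate c b' = germ_dilate c a' * germ_dilate c b"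
    by (metis germ_dilate_mult)
  thus "w = Fract (germ_dilate c a) (germ_dilate c b)"
    using * assms by (simp add: eq_fract germ_dilate_eq_0_iff)
qed (use assms in blast)


section \<open>q-difference operators\<close>

text \<open>
  An element \<open>\<Sum>a\<^sub>i \<sigma>\<^sup>i\<close> of \<open>C{x}[\<sigma>\<^sub>q]\<close> is represented by the polynomial with coefficients \<open>a\<^sub>i\<close>
  (so \<open>degree\<close> is its order), and an element of \<open>K[\<sigma>\<^sub>q, \<sigma>\<^sub>q\<^sup>-\<^sup>1]\<close> by the finitely supported map
  of its coefficients. The skew multiplication depends on \<open>q\<close> and is \<open>ore_mult q\<close> below; the
  products that the libraries define on the types \<open>poly\<close> and \<open>poly_mapping\<close> are never used.
\<close>

type_synonym 'a qop = "'a germ poly"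
type_synonym 'a ore = "int \<Rightarrow>\<^sub>0 'a mero"

definition ore_mult :: "'a :: valued_field \<Rightarrow> 'a ore \<Rightarrow> 'a ore \<Rightarrow> 'a ore" where
  "ore_mult q P R = (\<Sum>i\<in>Poly_Mapping.keys P. \<Sum>j\<in>Poly_Mapping.keys R.
     Poly_Mapping.single (i + j)
       (Poly_Mapping.lookup P i * mero_dilate (q powi i) (Poly_Mapping.lookup R j)))"

definition ore_const :: "'a :: valued_field mero \<Rightarrow> 'a ore" where
  "ore_const f = Poly_Mapping.single 0 f"

definition ore_sigma :: "'a :: valued_field ore" where
  "ore_sigma = Poly_Mapping.single 1 1"

definition ore_power :: "'a :: valued_field \<Rightarrow> 'a ore \<Rightarrow> nat \<Rightarrow> 'a ore" where
  "ore_power q P n = (ore_mult q P ^^ n) (ore_const 1)"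

definition mero_X :: "'a :: valued_field mero" where
  "mero_X = to_fract germ_X"

definition to_ore :: "'a :: valued_field qop \<Rightarrow> 'a ore" where
  "to_ore L = (\<Sum>i\<le>degree L. Poly_Mapping.single (int i) (to_fract (coeff L i)))"

text \<open>\<open>L\<close> rewritten in \<open>t = x\<^sup>1\<^sup>/\<^sup>n\<close>; it is to be used with an \<open>n\<close>-th root of \<open>q\<close> in place of \<open>q\<close>.\<close>

definition ramify :: "nat \<Rightarrow> 'a :: valued_field qop \<Rightarrow> 'a qop" where
  "ramify n L = map_poly (germ_ramify n) L"


subsection \<open>Newton polygon\<close>

definition newton_polygon :: "'a :: valued_field qop \<Rightarrow> (real \<times> real) set" where
  "newton_polygon L =
     convex hull {(real i, k) | i k. i \<le> degree L \<and> coeff L i \<noteq> 0 \<and> real (germ_ord (coeff L i)) \<le> k}"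

text \<open>
  The finite slopes, each with the length of its projection on the horizontal axis: they are given
  by the bounded edges of the polygon (the two vertical sides are rays). This set does not change
  under the multiplication of \<open>L\<close> by a power of \<open>x\<close>, so \<open>L\<close> need not be cleared here.
\<close>

definition newton_slopes :: "'a :: valued_field qop \<Rightarrow> (real \<times> real) set" where
  "newton_slopes L =
     {(\<mu>, r). r > 0 \<and> (\<exists>a b. closed_segment (a, b) (a + r, b + \<mu> * r) edge_of newton_polygon L)}"

definition cleared :: "'a :: valued_field qop \<Rightarrow> bool" where
  "cleared L \<longleftrightarrow> (\<exists>u. (u, 0) \<in> newton_polygon L)"

definition pure_of_slope :: "'a :: valued_field qop \<Rightarrow> real \<Rightarrow> bool" where
  "pure_of_slope L \<mu> \<longleftrightarrow> fst ` newton_slopes L = {\<mu>}"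


subsection \<open>Exponents and admissibility\<close>

text \<open>\<open>slope_transform q m C L\<close> is \<open>x\<^sup>C \<Sum>a\<^sub>i(x) (x\<^sup>-\<^sup>m \<sigma>\<^sub>q)\<^sup>i\<close>.\<close>

definition slope_transform :: "'a :: valued_field \<Rightarrow> int \<Rightarrow> int \<Rightarrow> 'a qop \<Rightarrow> 'a ore" where
  "slope_transform q m C L =
     ore_mult q (ore_const (mero_X powi C))
       (\<Sum>i\<le>degree L. ore_mult q (ore_const (to_fract (coeff L i)))
          (ore_power q (ore_mult q (ore_const (mero_X powi (- m))) ore_sigma) i))"

text \<open>
  The conditions determine \<open>C\<close> and \<open>L'\<close> if \<open>L \<noteq> 0\<close>. For \<open>m = 0\<close> the operator \<open>L'\<close> is \<open>L\<close> with the
  common powers of \<open>x\<close> cleared, so this is also the characteristic polynomial of the zero slope.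
\<close>

definition char_poly :: "'a :: valued_field \<Rightarrow> int \<Rightarrow> 'a qop \<Rightarrow> 'a poly" where
  "char_poly q m L =
     (THE p. \<exists>C L'. to_ore L' = slope_transform q m C L \<and> cleared L' \<and>
        p = map_poly (\<lambda>a. germ_nth a 0) L')"

definition exponents :: "'a :: valued_field \<Rightarrow> int \<Rightarrow> 'a qop \<Rightarrow> 'a multiset" where
  "exponents q m L = filter_mset (\<lambda>z. z \<noteq> 0) (proots (char_poly q m L))"

definition qpoch :: "'a :: field \<Rightarrow> 'a \<Rightarrow> nat \<Rightarrow> 'a" where
  "qpoch z q n = (\<Prod>k<n. 1 - q ^ k * z)"

definition phi_coeff :: "'a :: field \<Rightarrow> 'a set \<Rightarrow> nat \<Rightarrow> 'a" where
  "phi_coeff q \<Lambda> n = 1 / (\<Prod>z\<in>\<Lambda>. qpoch z q n)"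

definition exponent_ratios :: "'a :: valued_field \<Rightarrow> 'a multiset \<Rightarrow> 'a set" where
  "exponent_ratios q E =
     {y * inverse z | y z. y \<in># E \<and> z \<in># E \<and> y * inverse z \<notin> {q powi k | k. k \<le> 0}}"

definition admissible_slope :: "'a :: valued_field \<Rightarrow> 'a qop \<Rightarrow> int \<Rightarrow> bool" where
  "admissible_slope q L m \<longleftrightarrow>
     of_int m \<in> fst ` newton_slopes L \<and>
     convergent_coeffs (phi_coeff q (exponent_ratios q (exponents q m L)))"

text \<open>\<open>qr n\<close> is the chosen \<open>n\<close>-th root of \<open>q\<close>; in particular \<open>qr 1 = q\<close>.\<close>

definition almost_admissible_slope ::
    "(nat \<Rightarrow> 'a :: valued_field) \<Rightarrow> 'a qop \<Rightarrow> real \<Rightarrow> bool" where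
  "almost_admissible_slope qr L \<mu> \<longleftrightarrow>
     (\<exists>n m. n \<ge> 1 \<and> real n * \<mu> = of_int m \<and> admissible_slope (qr n) (ramify n L) m)"

definition almost_admissible_op :: "(nat \<Rightarrow> 'a :: valued_field) \<Rightarrow> 'a qop \<Rightarrow> bool" where
  "almost_admissible_op qr L \<longleftrightarrow> (\<forall>\<mu> \<in> fst ` newton_slopes L. almost_admissible_slope qr L \<mu>)"


section \<open>q-difference modules\<close>

text \<open>
  The underlying space of a module is a finite-dimensional subspace \<open>M\<close> of an ambient
  \<open>K\<close>-vector space, so that submodules are modules with the same \<open>smul\<close> and \<open>\<Sigma>\<close>; only
  the values of \<open>\<Sigma>\<close> on \<open>M\<close> matter. For \<open>q \<noteq> 0\<close>, \<open>C\<close>-linearity of \<open>\<Sigma>\<close> is contained in the last two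
  axioms, since \<open>\<sigma>\<^sub>q\<close> fixes the constants.
\<close>

locale q_difference_module = vector_space smul
  for smul :: "'a :: valued_field mero \<Rightarrow> 'b :: ab_group_add \<Rightarrow> 'b" +
  fixes q :: 'a and M :: "'b set" and \<Sigma> :: "'b \<Rightarrow> 'b"
  assumes subspace_carrier: "subspace M"
    and finite_dimensional: "\<exists>B. finite B \<and> span B = M"
    and bij_sigma: "bij_betw \<Sigma> M M"
    and sigma_add: "\<And>m n. m \<in> M \<Longrightarrow> n \<in> M \<Longrightarrow> \<Sigma> (m + n) = \<Sigma> m + \<Sigma> n"
    and sigma_smul: "\<And>f m. m \<in> M \<Longrightarrow> \<Sigma> (smul f m) = smul (mero_dilate q f) (\<Sigma> m)"

definition q_submodule ::
    "('a :: valued_field mero \<Rightarrow> 'b :: ab_group_add \<Rightarrow> 'b) \<Rightarrow> 'a \<Rightarrow> ('b \<Rightarrow> 'b) \<Rightarrow> 'b set \<Rightarrow> 'b set \<Rightarrow> bool"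
  where "q_submodule smul q \<Sigma> N M \<longleftrightarrow> N \<subseteq> M \<and> q_difference_module smul q N \<Sigma>"

definition q_morphism ::
    "('a :: valued_field mero \<Rightarrow> 'b :: ab_group_add \<Rightarrow> 'b) \<Rightarrow> ('b \<Rightarrow> 'b) \<Rightarrow> 'b set \<Rightarrow> 'b set \<Rightarrow> ('b \<Rightarrow> 'b) \<Rightarrow> bool"
  where "q_morphism smul \<Sigma> M N f \<longleftrightarrow>
     f ` M \<subseteq> N \<and>
     (\<forall>m\<in>M. \<forall>n\<in>M. f (m + n) = f m + f n) \<and>
     (\<forall>c. \<forall>m\<in>M. f (smul c m) = smul c (f m)) \<and>
     (\<forall>m\<in>M. f (\<Sigma> m) = \<Sigma> (f m))"

text \<open>Every element of \<open>M\<close> is in a unique way a sum of elements of the \<open>N i\<close>, and conversely.\<close>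

definition internal_direct_sum :: "'i set \<Rightarrow> ('i \<Rightarrow> 'b :: ab_group_add set) \<Rightarrow> 'b set \<Rightarrow> bool" where
  "internal_direct_sum I N M \<longleftrightarrow> bij_betw (\<lambda>u. \<Sum>i\<in>I. u i) (Pi\<^sub>E I N) M"

definition simple_module ::
    "('a :: valued_field mero \<Rightarrow> 'b :: ab_group_add \<Rightarrow> 'b) \<Rightarrow> 'a \<Rightarrow> ('b \<Rightarrow> 'b) \<Rightarrow> 'b set \<Rightarrow> bool"
  where "simple_module smul q \<Sigma> M \<longleftrightarrow>
     q_difference_module smul q M \<Sigma> \<and> M \<noteq> {0} \<and>
     (\<forall>N. q_submodule smul q \<Sigma> N M \<longrightarrow> N = {0} \<or> N = M)"

definition indecomposable_module ::
    "('a :: valued_field mero \<Rightarrow> 'b :: ab_group_add \<Rightarrow> 'b) \<Rightarrow> 'a \<Rightarrow> ('b \<Rightarrow> 'b) \<Rightarrow> 'b set \<Rightarrow> bool"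
  where "indecomposable_module smul q \<Sigma> M \<longleftrightarrow>
     q_difference_module smul q M \<Sigma> \<and> M \<noteq> {0} \<and>
     \<not> (\<exists>N :: bool \<Rightarrow> 'b set.
          (\<forall>i. q_submodule smul q \<Sigma> (N i) M \<and> N i \<noteq> {0}) \<and> internal_direct_sum UNIV N M)"

text \<open>A non-split exact sequence \<open>0 \<rightarrow> N' \<rightarrow> N \<rightarrow> S \<rightarrow> 0\<close>.\<close>

definition nontrivial_extension ::
    "('a :: valued_field mero \<Rightarrow> 'b :: ab_group_add \<Rightarrow> 'b) \<Rightarrow> ('b \<Rightarrow> 'b) \<Rightarrow> 'b set \<Rightarrow> 'b set \<Rightarrow> 'b set \<Rightarrow> bool"
  where "nontrivial_extension smul \<Sigma> N' N S \<longleftrightarrow>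
     (\<exists>\<iota> \<pi>. q_morphism smul \<Sigma> N' N \<iota> \<and> inj_on \<iota> N' \<and>
            q_morphism smul \<Sigma> N S \<pi> \<and> \<pi> ` N = S \<and>
            \<iota> ` N' = {m \<in> N. \<pi> m = 0} \<and>
            \<not> (\<exists>\<tau>. q_morphism smul \<Sigma> S N \<tau> \<and> (\<forall>y\<in>S. \<pi> (\<tau> y) = y)))"

inductive iterated_self_extension ::
    "('a :: valued_field mero \<Rightarrow> 'b :: ab_group_add \<Rightarrow> 'b) \<Rightarrow> 'a \<Rightarrow> ('b \<Rightarrow> 'b) \<Rightarrow> 'b set \<Rightarrow> 'b set \<Rightarrow> bool"
  for smul q \<Sigma> S
  where
    base: "q_difference_module smul q N \<Sigma> \<Longrightarrow> q_morphism smul \<Sigma> N S f \<Longrightarrow> bij_betw f N S \<Longrightarrow>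
      iterated_self_extension smul q \<Sigma> S N"
  | extend: "q_difference_module smul q N \<Sigma> \<Longrightarrow> iterated_self_extension smul q \<Sigma> S N' \<Longrightarrow>
      nontrivial_extension smul \<Sigma> N' N S \<Longrightarrow> iterated_self_extension smul q \<Sigma> S N"


subsection \<open>Operators attached to a module\<close>

definition left_ideal_rel :: "'a :: valued_field \<Rightarrow> 'a qop \<Rightarrow> ('a ore \<times> 'a ore) set" where
  "left_ideal_rel q L = {(P, Q). \<exists>R. P - Q = ore_mult q R (to_ore L)}"

text \<open>
  \<open>L \<noteq> 0\<close>, and \<open>F\<close> is an isomorphism of \<open>M\<close> with the quotient of \<open>K[\<sigma>\<^sub>q, \<sigma>\<^sub>q\<^sup>-\<^sup>1]\<close> by the left ideal
  generated by \<open>L\<close>. The elements of the quotient are cosets; the quotient is a \<open>K\<close>-vector space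
  by left multiplication, on which \<open>\<Sigma>\<close> is left multiplication by \<open>\<sigma>\<^sub>q\<close>.
\<close>

definition presented_by ::
    "('a :: valued_field mero \<Rightarrow> 'b :: ab_group_add \<Rightarrow> 'b) \<Rightarrow> 'a \<Rightarrow> 'b set \<Rightarrow> ('b \<Rightarrow> 'b) \<Rightarrow> 'a qop \<Rightarrow> bool"
  where "presented_by smul q M \<Sigma> L \<longleftrightarrow> L \<noteq> 0 \<and>
     (\<exists>F. bij_betw F M (UNIV // left_ideal_rel q L) \<and>
        (\<forall>m\<in>M. \<forall>n\<in>M. \<forall>P\<in>F m. \<forall>Q\<in>F n. P + Q \<in> F (m + n)) \<and>
        (\<forall>c. \<forall>m\<in>M. \<forall>P\<in>F m. ore_mult q (ore_const c) P \<in> F (smul c m)) \<and>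
        (\<forall>m\<in>M. \<forall>P\<in>F m. ore_mult q ore_sigma P \<in> F (\<Sigma> m)))"

text \<open>The Newton polygon of a module, as its set of slopes and lengths.\<close>

definition module_has_newton_slopes ::
    "('a :: valued_field mero \<Rightarrow> 'b :: ab_group_add \<Rightarrow> 'b) \<Rightarrow> 'a \<Rightarrow> 'b set \<Rightarrow> ('b \<Rightarrow> 'b) \<Rightarrow> (real \<times> real) set \<Rightarrow> bool"
  where "module_has_newton_slopes smul q M \<Sigma> A \<longleftrightarrow>
     (\<exists>L. presented_by smul q M \<Sigma> L \<and> newton_slopes L = A)"

definition pure_module ::
    "('a :: valued_field mero \<Rightarrow> 'b :: ab_group_add \<Rightarrow> 'b) \<Rightarrow> 'a \<Rightarrow> 'b set \<Rightarrow> ('b \<Rightarrow> 'b) \<Rightarrow> real \<Rightarrow> bool"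
  where "pure_module smul q M \<Sigma> \<mu> \<longleftrightarrow>
     (\<exists>L. presented_by smul q M \<Sigma> L \<and> pure_of_slope L \<mu>)"

definition almost_admissible_module ::
    "('a :: valued_field mero \<Rightarrow> 'b :: ab_group_add \<Rightarrow> 'b) \<Rightarrow> (nat \<Rightarrow> 'a) \<Rightarrow> 'a \<Rightarrow> 'b set \<Rightarrow> ('b \<Rightarrow> 'b) \<Rightarrow> bool"
  where "almost_admissible_module smul qr q M \<Sigma> \<longleftrightarrow>
     q_difference_module smul q M \<Sigma> \<and>
     (\<exists>L. presented_by smul q M \<Sigma> L \<and> almost_admissible_op qr L)"

end

theory Submission
  imports Defs
begin

section \<open>Convergent Laurent series as a concrete model of the field \<open>K\<close> of
  meromorphic germs\<close>

section \<open>Meromorphic germs as Laurent series\<close>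

text \<open>A slope d/n in lowest terms is studied through the operator T = x^d \<Sigma>^n
  (\<open>slope_op\<close>), which is linear over the constants and semilinear over
  \<open>K\<close>. On a piece of slope d/n it behaves like an operator of slope zero, and its
  generalised eigenvectors (\<open>gen_eig\<close>) take the place of a Jordan basis. Everything
  rests on one fact: an almost admissible module is the \<open>K\<close>-span of such generalised
  eigenvectors, over all slopes (\<open>generated\<close>).

  Generation is proved by induction on the order. If the span N1 is not the whole module, the
  operator P of the quotient has some slope d/n, and a suitable root \<eta> of its characteristic
  polynomial \<open>chi\<close> gives a power series solution in t = x^(1/n). Its recursion divides
  by the values of \<open>chi\<close> at \<eta> p^k, where p^n = q; almost admissibility bounds the
  products of these values below geometrically, so the series converges
  (\<open>formal_solution\<close>, \<open>geometric_majorant\<close>,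
  \<open>solution_convergent\<close>). The solution is a nonzero homomorphism into convergent
  Laurent series that kills N1. By induction its kernel is N1, and its image contains an eigenvector
  of T (\<open>dilation_eigenvector\<close>). A lift of that eigenvector can be corrected by an
  element of N1 to a generalised eigenvector (\<open>solve\<close>), so it lies in N1, a
  contradiction. The correction reduces to scalar equations: for equal slopes there are small
  divisors and at most one resonant power of x (\<open>resonant_equation\<close>), for different
  slopes there are no small divisors (\<open>contracting_equation\<close>).

  Homomorphisms into series of a given slope kill the generalised eigenvectors of every other slope
  (\<open>no_homomorphism\<close>). Hence the span belonging to a slope has the length of the
  corresponding edge as its dimension (\<open>slope_width\<close>), and spans of disjoint sets of
  slopes meet in zero (\<open>eig_span_disjoint\<close>). This is the slope decomposition.

  An indecomposable summand P has a single slope and a single class of eigenvalues modulo powers of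
  q. It is then recovered from the space V0 of its generalised eigenvectors for one eigenvalue
  \<nu>, a vector space over the constants with the locally nilpotent map T - \<nu>. As in the proof
  of the Jordan normal form, a chain of maximal length splits off, so V0 is one Jordan block
  (\<open>chain_all\<close>). The filtration of the block gives the iterated non-trivial
  self-extension, whose simple piece has rank n (\<open>indecomposable_structure\<close>).

  What remains is translation: edges of the Newton polygon against the support of \<open>chi\<close>
  (\<open>newton_slopes_iff\<close>), convergence of the series \<phi> against bounds on small
  divisors (\<open>convergent_phi_iff\<close>, \<open>almost_admissible_op_iff\<close>), and
  presentations by operators against cyclic vectors (\<open>presented_cyc\<close>,
  \<open>cyc_presented\<close>).\<close>

definition fls_dil :: "'a :: field \<Rightarrow> 'a fls \<Rightarrow> 'a fls" where
  "fls_dil p F = fls_compose_fps F (fps_const p * fps_X)"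

context
  fixes p :: "'a :: field" assumes p: "p \<noteq> 0"
begin

lemma fls_dil_nth [simp]: "fls_nth (fls_dil p F) k = fls_nth F k * p powi k"
  unfolding fls_dil_def using p by (rule fls_nth_fls_compose_fps_linear)

lemma fls_dil_mult: "fls_dil p (F * G) = fls_dil p F * fls_dil p G"
  unfolding fls_dil_def using p by (simp add: fls_compose_fps_mult)

lemma fls_dil_add: "fls_dil p (F + G) = fls_dil p F + fls_dil p G"
  by (intro fls_eqI) (simp add: algebra_simps p)

lemma fls_dil_divide: "fls_dil p (F / G) = fls_dil p F / fls_dil p G"
  unfolding fls_dil_def using p by (simp add: fls_compose_fps_divide)

lemma fls_dil_0 [simp]: "fls_dil p 0 = 0"
  unfolding fls_dil_def by simp

lemma fls_dil_1 [simp]: "fls_dil p 1 = 1"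
  unfolding fls_dil_def by simp

lemma fls_dil_const [simp]: "fls_dil p (fls_const c) = fls_const c"
  unfolding fls_dil_def by simp

lemma fls_dil_fps: "fls_dil p (fps_to_fls f) = fps_to_fls (fps_compose f (fps_const p * fps_X))"
  unfolding fls_dil_def using p by simp

end

definition germ_fls :: "'a :: valued_field germ \<Rightarrow> 'a fls" where
  "germ_fls a = fps_to_fls (Rep_germ a)"

lemma germ_fls_add: "germ_fls (a + b) = germ_fls a + germ_fls b"
  by (simp add: germ_fls_def plus_germ.rep_eq)

lemma germ_fls_mult: "germ_fls (a * b) = germ_fls a * germ_fls b"
  by (simp add: germ_fls_def times_germ.rep_eq fls_times_fps_to_fls)

lemma germ_fls_eq_iff [simp]: "germ_fls a = germ_fls b \<longleftrightarrow> a = b"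
  by (simp add: germ_fls_def Rep_germ_inject)

lemma germ_fls_0 [simp]: "germ_fls 0 = 0" and germ_fls_1 [simp]: "germ_fls 1 = 1"
  by (simp_all add: germ_fls_def zero_germ.rep_eq one_germ.rep_eq)

lemma germ_fls_eq_0_iff [simp]: "germ_fls a = 0 \<longleftrightarrow> a = 0"
  using germ_fls_eq_iff[of a 0] by simp

lemma germ_fls_nth: "fls_nth (germ_fls a) (int k) = germ_nth a k"
  by (simp add: germ_fls_def germ_nth.rep_eq)

lemma germ_fls_subdegree: "fls_subdegree (germ_fls a) = int (germ_ord a)"
  by (simp add: germ_fls_def germ_ord.rep_eq fls_subdegree_fls_to_fps)

text \<open>Power series expansion of a quotient of germs. It is an injective field homomorphism, so
  identities in \<open>K\<close> are checked after applying it, coefficient by coefficient.\<close>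

definition mfls :: "'a :: valued_field mero \<Rightarrow> 'a fls" where
  "mfls z = (THE w. \<exists>a b. b \<noteq> 0 \<and> z = Fract a b \<and> w = germ_fls a / germ_fls b)"

lemma mfls_Fract:
  assumes "b \<noteq> 0"
  shows "mfls (Fract a b) = germ_fls a / germ_fls b"
  unfolding mfls_def
proof (rule the_equality)
  fix w assume "\<exists>a' b'. b' \<noteq> 0 \<and> Fract a b = Fract a' b' \<and> w = germ_fls a' / germ_fls b'"
  then obtain a' b' where *: "b' \<noteq> 0" "Fract a b = Fract a' b'" "w = germ_fls a' / germ_fls b'"
    by blast
  have "a * b' = a' * b" using * assms by (simp add: eq_fract)
  hence "germ_fls a * germ_fls b' = germ_fls a' * germ_fls b" by (metis germ_fls_mult)
  thus "w = germ_fls a / germ_fls b"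
    using * assms by (simp add: frac_eq_eq)
qed (use assms in blast)

lemma mfls_to_fract [simp]: "mfls (to_fract a) = germ_fls a"
  by (simp add: to_fract_def mfls_Fract)

lemma mfls_0 [simp]: "mfls 0 = 0" and mfls_1 [simp]: "mfls 1 = 1"
  by (simp_all add: Zero_fract_def One_fract_def mfls_Fract)

lemma mfls_add [simp]: "mfls (a + b) = mfls a + mfls b"
  by (cases a; cases b) (simp add: mfls_Fract germ_fls_add germ_fls_mult add_frac_eq)

lemma mfls_mult [simp]: "mfls (a * b) = mfls a * mfls b"
  by (cases a; cases b) (simp add: mfls_Fract germ_fls_mult)

lemma mfls_eq_0_iff [simp]: "mfls a = 0 \<longleftrightarrow> a = 0"
  by (cases a) (simp add: mfls_Fract Zero_fract_def eq_fract)

lemma mfls_uminus [simp]: "mfls (- a) = - mfls a"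
  using mfls_add[of a "- a"] by (simp add: eq_neg_iff_add_eq_0 add.commute)

lemma mfls_diff [simp]: "mfls (a - b) = mfls a - mfls b"
  using mfls_add[of a "- b"] by simp

lemma mfls_eq_iff [simp]: "mfls a = mfls b \<longleftrightarrow> a = b"
  using mfls_eq_0_iff[of "a - b"] by simp

lemma mfls_inverse [simp]: "mfls (inverse a) = inverse (mfls a)"
proof (cases "a = 0")
  case False
  hence "mfls a * mfls (inverse a) = 1" by (simp flip: mfls_mult)
  thus ?thesis by (metis inverse_unique)
qed simp

lemma mfls_divide [simp]: "mfls (a / b) = mfls a / mfls b"
  by (simp add: divide_inverse)

lemma mfls_power [simp]: "mfls (a ^ k) = mfls a ^ k"
  by (induction k) auto

lemma mfls_powi [simp]: "mfls (a powi k) = mfls a powi k"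
  by (simp add: power_int_def)

lemma mfls_X [simp]: "mfls mero_X = fls_X"
  by (simp add: mero_X_def germ_fls_def germ_X.rep_eq)

lemma mero_X_nonzero [simp]: "mero_X \<noteq> 0"
  using mfls_eq_0_iff[of mero_X] by auto

lemma mfls_dilate:
  assumes "c \<noteq> 0"
  shows "mfls (mero_dilate c z) = fls_dil c (mfls z)"
proof (cases z)
  case (Fract a b)
  have "germ_fls (germ_dilate c a) = fls_dil c (germ_fls a)" for a
    using assms by (simp add: germ_fls_def germ_dilate.rep_eq fls_dil_fps)
  thus ?thesis using Fract assms
    by (simp add: mero_dilate_Fract mfls_Fract germ_dilate_eq_0_iff fls_dil_divide)
qed

definition mconst :: "'a :: valued_field \<Rightarrow> 'a mero" where
  "mconst c = to_fract (Abs_germ (fps_const c))"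

lemma mfls_const [simp]: "mfls (mconst c) = fls_const c"
proof -
  have "convergent_coeffs (fps_nth (fps_const c))"
    by (rule convergent_coeffsI[of 1 _ "absv c"]) (auto simp: absv_nonneg)
  thus ?thesis by (simp add: mconst_def germ_fls_def Abs_germ_inverse)
qed

lemma mconst_0 [simp]: "mconst 0 = 0"
  and mconst_1 [simp]: "mconst 1 = 1"
  and mconst_add: "mconst (a + b) = mconst a + mconst b"
  and mconst_diff: "mconst (a - b) = mconst a - mconst b"
  and mconst_uminus: "mconst (- a) = - mconst a"
  and mconst_mult: "mconst (a * b) = mconst a * mconst b"
  by (simp_all flip: mfls_eq_iff add: fls_plus_const fls_const_mult_const fls_minus_const)

lemma mconst_eq_iff [simp]: "mconst a = mconst b \<longleftrightarrow> a = b"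
proof -
  have "fls_const a = fls_const b \<longleftrightarrow> a = b" by (metis fls_const_nth)
  thus ?thesis by (simp flip: mfls_eq_iff)
qed

lemma mconst_eq_0_iff [simp]: "mconst a = 0 \<longleftrightarrow> a = 0"
  using mconst_eq_iff[of a 0] by simp

lemma mconst_power: "mconst (a ^ k) = mconst a ^ k"
  by (induction k) (auto simp: mconst_mult)

lemma mconst_inverse: "mconst (inverse a) = inverse (mconst a)"
  by (simp flip: mfls_eq_iff add: fls_inverse_const)

lemma mconst_powi: "mconst (a powi k) = mconst a powi k"
  by (simp add: power_int_def mconst_power mconst_inverse)

context
  fixes c :: "'a :: valued_field" assumes c: "c \<noteq> 0"
begin

lemma mero_dilate_0 [simp]: "mero_dilate c 0 = 0"
  and mero_dilate_1 [simp]: "mero_dilate c 1 = 1"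
  and mero_dilate_const [simp]: "mero_dilate c (mconst a) = mconst a"
  and mero_dilate_add: "mero_dilate c (x + y) = mero_dilate c x + mero_dilate c y"
  and mero_dilate_mult: "mero_dilate c (x * y) = mero_dilate c x * mero_dilate c y"
  and mero_dilate_divide: "mero_dilate c (x / y) = mero_dilate c x / mero_dilate c y"
  using c by (simp_all flip: mfls_eq_iff add: mfls_dilate fls_dil_add fls_dil_mult fls_dil_divide)

lemma mero_dilate_inverse: "mero_dilate c (inverse x) = inverse (mero_dilate c x)"
  using mero_dilate_divide[of 1 x] by (simp add: divide_inverse)

lemma mero_dilate_eq_0_iff [simp]: "mero_dilate c x = 0 \<longleftrightarrow> x = 0"
proof -
  have "fls_dil c F = 0 \<longleftrightarrow> F = 0" for F using c by (auto simp: fls_eq_iff)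
  thus ?thesis using c mfls_eq_0_iff[of "mero_dilate c x"] by (simp add: mfls_dilate)
qed

lemma mero_dilate_power: "mero_dilate c (x ^ k) = mero_dilate c x ^ k"
  by (induction k) (auto simp: mero_dilate_mult)

lemma mero_dilate_powi: "mero_dilate c (x powi k) = mero_dilate c x powi k"
  by (simp add: power_int_def mero_dilate_power mero_dilate_inverse)

lemma mero_dilate_sum: "mero_dilate c (sum f A) = (\<Sum>i\<in>A. mero_dilate c (f i))"
  by (induction A rule: infinite_finite_induct) (auto simp: mero_dilate_add)

lemma mero_dilate_X: "mero_dilate c mero_X = mconst c * mero_X"
proof -
  have "fls_dil c fls_X = fls_const c * fls_X"
    using c by (intro fls_eqI) (simp add: fls_X_def)
  thus ?thesis using c by (simp flip: mfls_eq_iff add: mfls_dilate)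
qed

end

lemma mero_dilate_dilate:
  assumes "b \<noteq> 0" "c \<noteq> 0"
  shows "mero_dilate b (mero_dilate c x) = mero_dilate (b * c) x"
proof -
  have "fls_dil b (fls_dil c F) = fls_dil (b * c) F" for F
    using assms by (intro fls_eqI) (simp add: power_int_mult_distrib)
  thus ?thesis using assms by (simp flip: mfls_eq_iff add: mfls_dilate)
qed

lemma mero_dilate_one [simp]: "mero_dilate 1 x = x"
proof -
  have "fls_dil 1 F = F" for F :: "'a fls"
    by (intro fls_eqI) simp
  thus ?thesis by (simp flip: mfls_eq_iff add: mfls_dilate)
qed

lemma mero_dilate_inverse_dilate:
  "c \<noteq> 0 \<Longrightarrow> mero_dilate c (mero_dilate (inverse c) x) = x"
  "c \<noteq> 0 \<Longrightarrow> mero_dilate (inverse c) (mero_dilate c x) = x"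
  by (simp_all add: mero_dilate_dilate)

section \<open>Geometric bounds, convergence and small divisors\<close>

section \<open>Majorants\<close>

text \<open>Course-of-values recursion. The functional sees earlier values only, as its argument is
  masked by \<open>undefined\<close> from index i on.\<close>

lemma wf_rec_exists: "\<exists>G :: nat \<Rightarrow> 'a. \<forall>i. G i = H i (\<lambda>j. if j < i then G j else undefined)"
proof -
  define G where "G = wfrec less_than (\<lambda>f i. H i f)"
  have "G i = H i (\<lambda>j. if j < i then G j else undefined)" for i
    unfolding G_def by (subst wfrec) (auto simp: cut_def)
  thus ?thesis by blast
qed

text \<open>Only the products of the divisors \<delta> k are bounded below. Multiplying u k by
  \<delta> 0 ... \<delta> k gives a recursion free of divisors, whose solutions grow geometrically;
  dividing by the product afterwards costs one more geometric factor. This is the convergence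
  argument for inverses of germs, for contracting scalar equations and for formal solutions.\<close>

lemma geometric_majorant:
  fixes u \<delta> :: "nat \<Rightarrow> real"
  assumes u: "\<And>k. 0 \<le> u k" and \<delta>: "\<And>k. 0 < \<delta> k" "\<And>k. \<delta> k \<le> G"
    and c: "0 < c" "\<And>k. c ^ k \<le> (\<Prod>i<k. \<delta> i)"
    and A: "0 \<le> A" and B: "1 \<le> B" and E: "0 \<le> E"
    and rec: "\<And>k. u k * \<delta> k \<le> E * B ^ k + (\<Sum>j<k. A * B ^ (k - j) * u j)"
  obtains A' B' where "A' \<ge> 0" "B' \<ge> 1" "\<And>k. u k \<le> A' * B' ^ k"
proof -
  define H where "H = B * max 1 G"
  define P where "P = (\<lambda>k. \<Prod>i<k. \<delta> i)"
  \<comment> \<open>The last factor of P (Suc k) is the divisor on the left of the recursion. The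
    other ones absorb the divisors contained in the earlier terms: going from P (Suc j) to P k costs
    at most a factor max 1 G per step.\<close>
  define z where "z = (\<lambda>k. u k * P (Suc k))"
  have H: "H \<ge> 1" "H \<ge> B"
    using B mult_mono[of 1 B 1 "max 1 G"] mult_left_mono[of 1 "max 1 G" B] by (auto simp: H_def)
  have P0: "0 < P k" for k unfolding P_def using \<delta>(1) by (intro prod_pos) auto
  have PG: "P k \<le> max 1 G ^ k" for k
    unfolding P_def using \<delta> by (induction k) (auto intro!: mult_mono simp: less_imp_le prod_nonneg mult.commute max.coboundedI2)
  have PP: "P k \<le> P (Suc j) * max 1 G ^ (k - j)" if "j < k" for j k
  proof -
    from that have "Suc j \<le> k" by simp
    thus ?thesis
    proof (induction k rule: dec_induct)
      case base
      have "P (Suc j) * 1 \<le> P (Suc j) * max 1 G" using P0 by (intro mult_left_mono) (auto simp: less_imp_le)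
      thus ?case by simp
    next
      case (step k)
      have "P (Suc k) = P k * \<delta> k" by (simp add: P_def)
      also have "\<dots> \<le> (P (Suc j) * max 1 G ^ (k - j)) * max 1 G"
        using step \<delta> P0 by (intro mult_mono) (auto simp: less_imp_le max.coboundedI2)
      finally show ?case using step(1) by (simp add: Suc_diff_le mult_ac)
    qed
  qed
  have zrec: "z k \<le> E * H ^ k + (\<Sum>j<k. A * H ^ (k - j) * z j)" for k
  proof -
    have "z k = u k * \<delta> k * P k" by (simp add: z_def P_def mult_ac)
    also have "\<dots> \<le> (E * B ^ k + (\<Sum>j<k. A * B ^ (k - j) * u j)) * P k"
      using rec P0 by (intro mult_right_mono) (auto simp: less_imp_le)
    also have "\<dots> = E * B ^ k * P k + (\<Sum>j<k. A * B ^ (k - j) * (u j * P k))"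
      by (simp only: distrib_right sum_distrib_right mult.assoc)
    also have "\<dots> \<le> E * B ^ k * max 1 G ^ k + (\<Sum>j<k. A * B ^ (k - j) * (z j * max 1 G ^ (k - j)))"
    proof (intro add_mono mult_left_mono sum_mono PG)
      fix j assume "j \<in> {..<k}"
      hence "u j * P k \<le> u j * (P (Suc j) * max 1 G ^ (k - j))"
        using PP u by (intro mult_left_mono) auto
      thus "u j * P k \<le> z j * max 1 G ^ (k - j)" by (simp add: z_def mult_ac)
    qed (use A B E in auto)
    also have "\<dots> = E * H ^ k + (\<Sum>j<k. A * H ^ (k - j) * z j)"
      by (simp add: H_def power_mult_distrib mult_ac)
    finally show ?thesis .
  qed
  have zb: "z k \<le> E * (H * (1 + A)) ^ k" for k
  proof (induction k rule: less_induct)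
    case (less k)
    have "z k \<le> E * H ^ k + (\<Sum>j<k. A * H ^ (k - j) * z j)" by (rule zrec)
    also have "\<dots> \<le> E * H ^ k + (\<Sum>j<k. A * H ^ (k - j) * (E * (H * (1 + A)) ^ j))"
      using less A H by (intro add_left_mono sum_mono mult_left_mono) auto
    also have "(\<Sum>j<k. A * H ^ (k - j) * (E * (H * (1 + A)) ^ j)) = E * H ^ k * (A * (\<Sum>j<k. (1 + A) ^ j))"
      unfolding sum_distrib_left
    proof (intro sum.cong refl)
      fix j assume "j \<in> {..<k}"
      hence "H ^ k = H ^ (k - j) * H ^ j" by (simp flip: power_add)
      thus "A * H ^ (k - j) * (E * (H * (1 + A)) ^ j) = E * H ^ k * (A * (1 + A) ^ j)"
        by (simp add: power_mult_distrib mult_ac)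
    qed
    also have "A * (\<Sum>j<k. (1 + A) ^ j) = (1 + A) ^ k - 1"
      using power_diff_1_eq[of "1 + A" k] by simp
    also have "E * H ^ k + E * H ^ k * ((1 + A) ^ k - 1) = E * (H * (1 + A)) ^ k"
      by (simp only: power_mult_distrib right_diff_distrib)
    finally show ?case .
  qed
  show ?thesis
  proof (rule that[of "E / c" "max 1 (H * (1 + A) / c)"])
    fix k
    have "u k * c ^ Suc k \<le> z k"
      unfolding z_def P_def using u c(2)[of "Suc k"] by (intro mult_left_mono) auto
    also have "\<dots> \<le> E * (H * (1 + A)) ^ k" by (rule zb)
    finally have "u k \<le> E / c * (H * (1 + A) / c) ^ k"
      using c(1) by (simp add: field_simps)
    also have "\<dots> \<le> E / c * max 1 (H * (1 + A) / c) ^ k"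
      using E c(1) H A by (intro mult_left_mono power_mono) auto
    finally show "u k \<le> E / c * max 1 (H * (1 + A) / c) ^ k" .
  qed (use E c in auto)
qed

lemma convergent_coeffs_shift:
  "convergent_coeffs (\<lambda>k. a (Suc k)) \<longleftrightarrow> convergent_coeffs (a :: nat \<Rightarrow> 'a :: valued_field)"
proof
  assume "convergent_coeffs (\<lambda>k. a (Suc k))"
  then obtain A B where 1: "A > 0" "B \<ge> 1" "\<And>k. absv (a (Suc k)) \<le> A * B ^ k"
    by (elim convergent_coeffsE) blast
  show "convergent_coeffs a"
  proof (rule convergent_coeffsI[of B])
    fix k show "absv (a k) \<le> max A (absv (a 0)) * B ^ k"
    proof (cases k)
      case (Suc j)
      have "absv (a k) \<le> A * B ^ j" using 1 Suc by simp
      also have "\<dots> \<le> max A (absv (a 0)) * B ^ k"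
        using 1 Suc by (intro mult_mono power_increasing) auto
      finally show ?thesis .
    qed auto
  qed (use 1 in auto)
next
  assume "convergent_coeffs a"
  then obtain A B where 1: "A > 0" "B \<ge> 1" "\<And>k. absv (a k) \<le> A * B ^ k"
    by (elim convergent_coeffsE) blast
  show "convergent_coeffs (\<lambda>k. a (Suc k))"
    by (rule convergent_coeffsI[of B _ "A * B"]) (use 1 1(3)[of "Suc _"] in \<open>auto simp: mult_ac\<close>)
qed

text \<open>The coefficients of the inverse obey a recursion whose divisor is the constant |f(0)|,
  so \<open>geometric_majorant\<close> applies.\<close>

lemma convergent_coeffs_inverse:
  fixes f :: "'a :: valued_field fps"
  assumes f: "convergent_coeffs (fps_nth f)" and f0: "fps_nth f 0 \<noteq> 0"
  shows "convergent_coeffs (fps_nth (inverse f))"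
proof -
  define g where "g = inverse f"
  obtain A B where 1: "A > 0" "B \<ge> 1" "\<And>k. absv (fps_nth f k) \<le> A * B ^ k"
    using f by (elim convergent_coeffsE) blast
  have fg: "f * g = 1" unfolding g_def using f0 by (metis inverse_mult_eq_1 mult.commute)
  have rec: "absv (fps_nth g k) * absv (fps_nth f 0) \<le> 1 * B ^ k + (\<Sum>j<k. A * B ^ (k - j) * absv (fps_nth g j))" for k
  proof -
    have "(if k = 0 then 1 else 0) = (\<Sum>j=0..k. fps_nth g j * fps_nth f (k - j))"
      using arg_cong[OF fg, of "\<lambda>h. fps_nth h k"] by (simp add: mult.commute[of f] fps_mult_nth)
    also have "{0..k} = insert k {..<k}" by auto
    finally have "fps_nth g k * fps_nth f 0 = (if k = 0 then 1 else 0) + - (\<Sum>j<k. fps_nth g j * fps_nth f (k - j))"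
      by simp
    hence "absv (fps_nth g k) * absv (fps_nth f 0) = absv ((if k = 0 then 1 else 0) + - (\<Sum>j<k. fps_nth g j * fps_nth f (k - j)))"
      by (metis absv_mult)
    also have "\<dots> \<le> 1 + (\<Sum>j<k. absv (fps_nth g j * fps_nth f (k - j)))"
      by (intro order_trans[OF absv_triangle] add_mono) (auto simp: absv_sum_le)
    also have "\<dots> \<le> 1 * B ^ k + (\<Sum>j<k. A * B ^ (k - j) * absv (fps_nth g j))"
      using 1 by (intro add_mono sum_mono) (auto simp: absv_mult mult.commute intro!: mult_left_mono absv_nonneg)
    finally show ?thesis .
  qed
  have "absv (fps_nth f 0) > 0" using f0 absv_nonneg absv_eq_0_iff[of "fps_nth f 0"] by (simp add: less_le)
  then obtain A' B' where "B' \<ge> 1" "\<And>k. absv (fps_nth g k) \<le> A' * B' ^ k"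
    by (rule_tac geometric_majorant[of "\<lambda>k. absv (fps_nth g k)" "\<lambda>_. absv (fps_nth f 0)"
        "absv (fps_nth f 0)" "absv (fps_nth f 0)" A B 1]) (use 1 rec in \<open>auto simp: absv_nonneg\<close>)
  thus ?thesis unfolding g_def[symmetric] by (intro convergent_coeffsI[of B' _ A']) auto
qed

subsection \<open>The image of the meromorphic germs in the Laurent series\<close>

text \<open>Testing the indices from 0 on is enough: a Laurent series has finitely many other
  coefficients, and the condition is invariant under shifts (\<open>conv_fls_shift\<close>).\<close>

definition conv_fls :: "'a :: valued_field fls \<Rightarrow> bool" where
  "conv_fls F \<longleftrightarrow> convergent_coeffs (\<lambda>k. fls_nth F (int k))"

lemma conv_fls_shift [simp]: "conv_fls (fls_shift m F) \<longleftrightarrow> conv_fls F"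
proof -
  have 1: "conv_fls (fls_shift 1 F) \<longleftrightarrow> conv_fls F" for F :: "'a fls"
    using convergent_coeffs_shift[of "\<lambda>k. fls_nth F (int k)"] by (simp add: conv_fls_def add.commute)
  have 2: "conv_fls (fls_shift (int m) F) \<longleftrightarrow> conv_fls F" for m and F :: "'a fls"
  proof (induction m)
    case (Suc m)
    have "fls_shift (int (Suc m)) F = fls_shift 1 (fls_shift (int m) F)" by (simp add: add.commute)
    thus ?case using 1 Suc by metis
  qed simp
  show ?thesis
  proof (cases "m \<ge> 0")
    case True thus ?thesis using 2[of "nat m" F] by simp
  next
    case False thus ?thesis using 2[of "nat (- m)" "fls_shift m F"] by simp
  qed
qed

lemma conv_fls_fps [simp]: "conv_fls (fps_to_fls f) \<longleftrightarrow> convergent_coeffs (fps_nth f)"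
  by (simp add: conv_fls_def)

lemma conv_flsE:
  assumes "conv_fls F"
  obtains m f where "convergent_coeffs (fps_nth f)" "F = fls_shift m (fps_to_fls f)"
proof -
  define f where "f = fls_base_factor_to_fps F"
  have "F = fls_shift (- fls_subdegree F) (fps_to_fls f)"
    unfolding f_def by (metis fls_conv_base_factor_to_fps_shift_subdegree)
  thus ?thesis using assms that by (metis conv_fls_shift conv_fls_fps)
qed

lemma conv_fls_mult:
  assumes "conv_fls F" "conv_fls G" shows "conv_fls (F * G)"
proof -
  obtain m f k g where "convergent_coeffs (fps_nth f)" "F = fls_shift m (fps_to_fls f)"
    "convergent_coeffs (fps_nth g)" "G = fls_shift k (fps_to_fls g)"
    using assms by (metis conv_flsE)
  thus ?thesis
    by (simp add: fls_shifted_times_simps convergent_coeffs_mult flip: fls_times_fps_to_fls)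
qed

lemma conv_fls_inverse:
  assumes "conv_fls F" shows "conv_fls (inverse F)"
proof (cases "F = 0")
  case False
  define f where "f = fls_base_factor_to_fps F"
  have F: "F = fls_shift (- fls_subdegree F) (fps_to_fls f)"
    unfolding f_def by (metis fls_conv_base_factor_to_fps_shift_subdegree)
  have c: "convergent_coeffs (fps_nth f)" using assms F by (metis conv_fls_shift conv_fls_fps)
  have f0: "fps_nth f 0 \<noteq> 0" using False by (simp add: f_def)
  have "f * inverse f = 1" using f0 by (metis inverse_mult_eq_1 mult.commute)
  hence "F * fls_shift (fls_subdegree F) (fps_to_fls (inverse f)) = 1"
    by (subst F) (simp add: fls_shifted_times_simps flip: fls_times_fps_to_fls)
  hence "inverse F = fls_shift (fls_subdegree F) (fps_to_fls (inverse f))"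
    by (rule inverse_unique)
  thus ?thesis using convergent_coeffs_inverse[OF c f0] by simp
qed (simp add: conv_fls_def convergent_coeffsI[of 1 _ 0])

lemma conv_fls_add: "conv_fls F \<Longrightarrow> conv_fls G \<Longrightarrow> conv_fls (F + G)"
  by (simp add: conv_fls_def convergent_coeffs_add)

text \<open>Identifies \<open>K\<close> with the convergent Laurent series; solutions constructed
  coefficientwise are brought back into \<open>K\<close> through it.\<close>

lemma mfls_range: "(\<exists>g. mfls g = F) \<longleftrightarrow> conv_fls F"
proof
  have g: "conv_fls (germ_fls a)" for a :: "'a germ" using Rep_germ[of a] by (simp add: germ_fls_def)
  assume "\<exists>g. mfls g = F"
  then obtain z where z: "mfls z = F" by blast
  show "conv_fls F"
    unfolding z[symmetric] by (cases z) (auto simp: mfls_Fract divide_inverse g conv_fls_mult conv_fls_inverse)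
next
  assume "conv_fls F"
  then obtain m f where f: "convergent_coeffs (fps_nth f)" "F = fls_shift m (fps_to_fls f)"
    by (rule conv_flsE)
  have "germ_fls (Abs_germ f) = fps_to_fls f" using f by (simp add: germ_fls_def Abs_germ_inverse)
  hence "mfls (mero_X powi (- m) * to_fract (Abs_germ f)) = F"
    using f by (simp add: fls_shifted_times_simps)
  thus "\<exists>g. mfls g = F" by blast
qed

lemma conv_mfls [simp]: "conv_fls (mfls z)"
  using mfls_range by blast

lemma conv_flsI:
  assumes "B \<ge> 1" "\<And>k. absv (fls_nth F (int k)) \<le> A * B ^ k"
  shows "conv_fls F"
  unfolding conv_fls_def by (rule convergent_coeffsI[of B]) (use assms in auto)

subsection \<open>Small divisors\<close>

text \<open>A vanishing factor is replaced by 1, so that products never vanish and the bound in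
  \<open>tame\<close> keeps its meaning for resonant \<rho>.\<close>

definition divisor :: "'a :: valued_field \<Rightarrow> 'a \<Rightarrow> nat \<Rightarrow> real" where
  "divisor q \<rho> k = (if q ^ k * \<rho> = 1 then 1 else absv (1 - q ^ k * \<rho>))"

text \<open>For \<rho> that is not q^k with k \<le> 0, this is convergence of the series with
  coefficients 1/(\<rho>;q)_N (\<open>convergent_phi_iff\<close>). In the form of a bound on
  products it passes easily to shifts of \<rho>, to powers of q and to roots of q.\<close>

definition tame :: "'a :: valued_field \<Rightarrow> 'a \<Rightarrow> bool" where
  "tame q \<rho> \<longleftrightarrow> (\<exists>c>0. \<forall>N. c ^ N \<le> (\<Prod>k<N. divisor q \<rho> k))"

lemma absv_pos_iff: "0 < absv (x :: 'a :: valued_field) \<longleftrightarrow> x \<noteq> 0"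
  using absv_nonneg[of x] absv_eq_0_iff[of x] by linarith

lemma absv_diff_le: "absv (x - y :: 'a :: valued_field) \<le> absv x + absv y"
  using absv_triangle[of x "- y"] by simp

lemma absv_inverse: "absv (inverse x :: 'a :: valued_field) = inverse (absv x)"
proof (cases "x = 0")
  case False
  hence "absv x * absv (inverse x) = 1" by (simp flip: absv_mult)
  thus ?thesis by (metis inverse_unique)
qed simp

lemma absv_powi: "absv (x powi k :: 'a :: valued_field) = absv x powi k"
  by (simp add: power_int_def absv_power absv_inverse)

lemma divisor_pos [simp]: "0 < divisor q \<rho> k"
  by (auto simp: divisor_def absv_pos_iff)

context
  fixes q :: "'a :: valued_field" assumes q: "absv q = 1"
begin

lemma divisor_le: "divisor q \<rho> k \<le> 1 + absv \<rho>"
  using absv_diff_le[of 1 "q ^ k * \<rho>"] q by (auto simp: divisor_def absv_mult absv_power absv_nonneg)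

text \<open>The other factors are at most 1 + |\<rho>|, so a lower bound on the product yields one
  on its last factor.\<close>

lemma tame_divisor_ge:
  assumes "tame q \<rho>"
  obtains c where "c > 0" "c \<le> 1" "\<And>k. c ^ Suc k \<le> divisor q \<rho> k"
proof -
  obtain c where c: "c > 0" "\<And>N. c ^ N \<le> (\<Prod>k<N. divisor q \<rho> k)"
    using assms by (auto simp: tame_def)
  define G where "G = 1 + absv \<rho>"
  have G: "G \<ge> 1" by (simp add: G_def absv_nonneg)
  define c' where "c' = min 1 (c / G)"
  have c': "c' > 0" "c' \<le> 1" "c' \<le> c / G" using c G by (auto simp: c'_def)
  have "c' ^ Suc k \<le> divisor q \<rho> k" for k
  proof -
    have "(\<Prod>i<k. divisor q \<rho> i) \<le> (\<Prod>i<k. G)"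
      unfolding G_def by (intro prod_mono conjI divisor_le) (auto simp: less_imp_le)
    hence "(\<Prod>i<k. divisor q \<rho> i) \<le> G ^ k" by simp
    hence "c ^ Suc k \<le> G ^ k * divisor q \<rho> k"
      using c(2)[of "Suc k"] by (simp add: order_trans[OF _ mult_right_mono] less_imp_le)
    also have "\<dots> \<le> G ^ Suc k * divisor q \<rho> k"
      using G by (intro mult_right_mono power_increasing) (auto simp: less_imp_le)
    finally have "(c / G) ^ Suc k \<le> divisor q \<rho> k"
      using G by (simp add: power_divide field_simps)
    thus ?thesis using c' by (meson power_mono order_trans less_imp_le)
  qed
  thus ?thesis using that c' by blast
qed

lemma tame_shift_Suc:
  assumes "tame q \<rho>" shows "tame q (q * \<rho>)"
proof -
  obtain c where c: "c > 0" "\<And>N. c ^ N \<le> (\<Prod>k<N. divisor q \<rho> k)"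
    using assms by (auto simp: tame_def)
  define G where "G = max (1 + absv \<rho>) c"
  have G: "G \<ge> 1" "G \<ge> c" "divisor q \<rho> 0 \<le> G"
    using divisor_le[of \<rho> 0] absv_nonneg[of \<rho>] by (auto simp: G_def max_def)
  have sd: "divisor q (q * \<rho>) k = divisor q \<rho> (Suc k)" for k
    by (simp add: divisor_def mult_ac)
  have "(c * c / G) ^ N \<le> (\<Prod>k<N. divisor q (q * \<rho>) k)" for N
  proof (cases N)
    case (Suc M)
    have "(c * c / G) ^ N = c ^ N * (c / G) ^ N" by (simp add: power_divide power_mult_distrib)
    also have "\<dots> \<le> c ^ N * (c / G)"
      using c G Suc power_decreasing[of 1 N "c / G"] by (intro mult_left_mono) auto
    also have "\<dots> = c ^ Suc N / G" by simp
    also have "\<dots> \<le> (\<Prod>k<Suc N. divisor q \<rho> k) / G"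
      using c(2)[of "Suc N"] G by (intro divide_right_mono) simp_all
    also have "(\<Prod>k<Suc N. divisor q \<rho> k) = divisor q \<rho> 0 * (\<Prod>k<N. divisor q (q * \<rho>) k)"
      by (subst prod.lessThan_Suc_shift) (simp add: sd)
    also have "\<dots> / G \<le> G * (\<Prod>k<N. divisor q (q * \<rho>) k) / G"
      using G by (intro divide_right_mono mult_right_mono prod_nonneg) (auto simp: less_imp_le)
    finally show ?thesis using G by simp
  qed simp
  thus ?thesis unfolding tame_def using c G by (intro exI[of _ "c * c / G"]) auto
qed

lemma tame_shift_minus:
  assumes "tame q (q * \<rho>)" shows "tame q \<rho>"
proof -
  obtain c where c: "c > 0" "\<And>N. c ^ N \<le> (\<Prod>k<N. divisor q (q * \<rho>) k)"
    using assms by (auto simp: tame_def)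
  define c' where "c' = min c (divisor q \<rho> 0)"
  have c': "c' > 0" using c by (simp add: c'_def)
  have sd: "divisor q (q * \<rho>) k = divisor q \<rho> (Suc k)" for k
    by (simp add: divisor_def mult_ac)
  have "c' ^ N \<le> (\<Prod>k<N. divisor q \<rho> k)" for N
  proof (cases N)
    case (Suc M)
    have "c' ^ N = c' * c' ^ M" using Suc by simp
    also have "\<dots> \<le> divisor q \<rho> 0 * c ^ M"
      using c c' by (intro mult_mono power_mono) (auto simp: c'_def less_imp_le)
    also have "\<dots> \<le> divisor q \<rho> 0 * (\<Prod>k<M. divisor q (q * \<rho>) k)"
      using c by (intro mult_left_mono) (auto simp: less_imp_le)
    also have "\<dots> = (\<Prod>k<N. divisor q \<rho> k)"
      unfolding Suc by (subst prod.lessThan_Suc_shift) (simp add: sd)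
    finally show ?thesis .
  qed simp
  thus ?thesis unfolding tame_def using c' by auto
qed

text \<open>Passing from \<rho> to q\<rho> drops the first divisor and moves the rest by one place.
  Hence tameness depends only on the class of \<rho> modulo powers of q.\<close>

lemma tame_shift: "tame q (q powi m * \<rho>) \<longleftrightarrow> tame q \<rho>"
proof -
  have q0: "q \<noteq> 0" using q by auto
  have 1: "tame q (q * \<rho>) \<longleftrightarrow> tame q \<rho>" for \<rho> using tame_shift_Suc tame_shift_minus by blast
  have 2: "tame q (q ^ k * \<rho>) \<longleftrightarrow> tame q \<rho>" for k \<rho>
    by (induction k) (simp_all add: 1 mult.assoc)
  show ?thesis
  proof (cases "m \<ge> 0")
    case True thus ?thesis using 2[of "nat m" \<rho>] by (simp add: power_int_def)
  next
    case False thus ?thesis using 2[of "nat (- m)" "q powi m * \<rho>"] q0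
      by (simp add: power_int_def field_simps)
  qed
qed

text \<open>The divisors for q^e are every e-th divisor for q, and those left out are bounded
  above.\<close>

lemma tame_subsequence:
  assumes "tame q \<rho>" "e \<ge> 1" shows "tame (q ^ e) \<rho>"
proof -
  obtain c where c: "c > 0" "\<And>N. c ^ N \<le> (\<Prod>k<N. divisor q \<rho> k)"
    using assms by (auto simp: tame_def)
  define G where "G = 1 + absv \<rho>"
  have G: "G \<ge> 1" by (simp add: G_def absv_nonneg)
  have "(c ^ e / G ^ (e - 1)) ^ N \<le> (\<Prod>k<N. divisor (q ^ e) \<rho> k)" for N
  proof -
    have "(c ^ e) ^ N \<le> (\<Prod>k<N * e. divisor q \<rho> k)" using c(2)[of "N * e"] by (metis power_mult mult.commute)
    also have "\<dots> = (\<Prod>m<N. \<Prod>k\<in>{m * e..<m * e + e}. divisor q \<rho> k)"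
      by (rule prod.nat_group[symmetric])
    also have "\<dots> \<le> (\<Prod>m<N. divisor (q ^ e) \<rho> m * G ^ (e - 1))"
    proof (intro prod_mono conjI prod_nonneg)
      fix m
      have "{m * e..<m * e + e} = insert (m * e) {Suc (m * e)..<m * e + e}" using assms(2) by auto
      hence "(\<Prod>k\<in>{m * e..<m * e + e}. divisor q \<rho> k) = divisor q \<rho> (m * e) * (\<Prod>k\<in>{Suc (m * e)..<m * e + e}. divisor q \<rho> k)"
        by simp
      also have "(\<Prod>k\<in>{Suc (m * e)..<m * e + e}. divisor q \<rho> k) \<le> (\<Prod>k\<in>{Suc (m * e)..<m * e + e}. G)"
        unfolding G_def by (intro prod_mono conjI divisor_le) (auto simp: less_imp_le)
      also have "\<dots> = G ^ (e - 1)" by simp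
      also have "divisor q \<rho> (m * e) = divisor (q ^ e) \<rho> m" by (simp add: divisor_def power_mult mult.commute[of m])
      finally show "(\<Prod>k\<in>{m * e..<m * e + e}. divisor q \<rho> k) \<le> divisor (q ^ e) \<rho> m * G ^ (e - 1)"
        by (simp add: less_imp_le mult_left_mono)
    qed (auto simp: less_imp_le)
    finally have "(c ^ e) ^ N \<le> (\<Prod>m<N. divisor (q ^ e) \<rho> m) * (G ^ (e - 1)) ^ N"
      by (simp add: prod.distrib)
    thus ?thesis using G by (simp add: power_divide field_simps)
  qed
  thus ?thesis unfolding tame_def using c G by (intro exI[of _ "c ^ e / G ^ (e - 1)"]) auto
qed

end

section \<open>Two scalar q-difference equations over \<open>K\<close>\<close>

section \<open>Scalar equations\<close>

definition non_root_of_unity :: "'a :: field \<Rightarrow> bool" where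
  "non_root_of_unity q \<longleftrightarrow> q \<noteq> 0 \<and> (\<forall>k\<ge>1. q ^ k \<noteq> 1)"

lemma non_root_of_unityD:
  assumes "non_root_of_unity (q :: 'a :: field)"
  shows "q \<noteq> 0" and "q powi i = q powi j \<longleftrightarrow> i = j"
proof -
  show q: "q \<noteq> 0" using assms by (simp add: non_root_of_unity_def)
  have *: "i = j" if "q powi i = q powi j" "i \<le> j" for i j
  proof (rule ccontr)
    assume "i \<noteq> j"
    have "q powi (j - i) = 1" using that q by (simp add: power_int_diff)
    hence "q ^ nat (j - i) = 1" using that by (simp add: power_int_def)
    thus False using assms that \<open>i \<noteq> j\<close> by (auto simp: non_root_of_unity_def)
  qed
  show "q powi i = q powi j \<longleftrightarrow> i = j" using *[of i j] *[of j i] by (metis linear)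
qed

lemma non_root_of_unity_power:
  assumes "non_root_of_unity q" "n \<ge> 1" shows "non_root_of_unity (q ^ n)"
  using assms by (auto simp: non_root_of_unity_def simp flip: power_mult)

lemma non_root_of_unity_root:
  assumes "non_root_of_unity (p ^ n)" "n \<ge> 1" shows "non_root_of_unity p"
proof -
  have "p ^ k \<noteq> 1" if "k \<ge> 1" for k
  proof
    assume "p ^ k = 1"
    hence "(p ^ n) ^ k = 1" by (metis power_mult mult.commute power_one)
    thus False using assms that by (auto simp: non_root_of_unity_def)
  qed
  thus ?thesis using assms by (auto simp: non_root_of_unity_def power_0_left)
qed

text \<open>The equation decouples into one equation per power of x, with divisor \<alpha> q^k -
  \<beta>. As q is not a root of unity, this vanishes for at most one k, and the coefficient there
  survives as the term c x^k. The other divisors have a geometric lower bound by tameness, so the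
  solution converges.\<close>

lemma resonant_equation:
  fixes f :: "'a :: valued_field mero"
  assumes q: "absv q = 1" "non_root_of_unity q" and \<alpha>\<beta>: "\<alpha> \<noteq> 0" "\<beta> \<noteq> 0" and tame: "tame q (\<alpha> / \<beta>)"
  obtains g c k where
    "f = mconst \<alpha> * mero_dilate q g - mconst \<beta> * g + mconst c * mero_X powi k"
    "c \<noteq> 0 \<Longrightarrow> \<alpha> * q powi k = \<beta>"
proof -
  have q0: "q \<noteq> 0" using q by auto
  define F where "F = mfls f"
  \<comment> \<open>The resonant coefficient of the unknown is free; the default 0 is
    chosen.\<close>
  define G where "G = Abs_fls (\<lambda>k. if \<alpha> * q powi k = \<beta> then 0 else fls_nth F k / (\<alpha> * q powi k - \<beta>))"
  have Gnth: "fls_nth G k = (if \<alpha> * q powi k = \<beta> then 0 else fls_nth F k / (\<alpha> * q powi k - \<beta>))" for k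
    unfolding G_def by (rule nth_Abs_fls_lower_bound[of "fls_subdegree F"]) auto
  obtain c where c: "c > 0" "c \<le> 1" "\<And>k. c ^ Suc k \<le> divisor q (\<alpha> / \<beta>) k"
    using tame_divisor_ge[OF q(1) tame] by metis
  obtain A B where AB: "A > 0" "B \<ge> 1" "\<And>k. absv (fls_nth F (int k)) \<le> A * B ^ k"
    using conv_mfls[of f] unfolding F_def[symmetric] conv_fls_def by (elim convergent_coeffsE) blast
  have "conv_fls G"
  proof (rule conv_flsI[of "B / c"])
    show "1 \<le> B / c" using AB c by (simp add: field_simps)
    fix k
    show "absv (fls_nth G (int k)) \<le> A / (absv \<beta> * c) * (B / c) ^ k"
    proof (cases "\<alpha> * q powi int k = \<beta>")
      case True
      thus ?thesis using AB c by (simp add: Gnth absv_nonneg)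
    next
      case False
      have "\<alpha> * q powi int k - \<beta> = - \<beta> * (1 - q ^ k * (\<alpha> / \<beta>))" using \<alpha>\<beta> by (simp add: field_simps)
      hence "absv (\<alpha> * q powi int k - \<beta>) = absv \<beta> * absv (1 - q ^ k * (\<alpha> / \<beta>))"
        by (simp only: absv_mult absv_uminus)
      also have "absv (1 - q ^ k * (\<alpha> / \<beta>)) = divisor q (\<alpha> / \<beta>) k"
        using False \<alpha>\<beta> by (auto simp: divisor_def field_simps)
      finally have ge: "absv \<beta> * c ^ Suc k \<le> absv (\<alpha> * q powi int k - \<beta>)"
        using c(3)[of k] by (simp add: mult_left_mono absv_nonneg)
      have "absv (fls_nth G (int k)) = absv (fls_nth F (int k)) / absv (\<alpha> * q powi int k - \<beta>)"
        using False by (simp add: Gnth divide_inverse absv_mult absv_inverse)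
      also have "\<dots> \<le> (A * B ^ k) / (absv \<beta> * c ^ Suc k)"
        using AB ge c \<alpha>\<beta> by (intro frac_le) (auto simp: absv_pos_iff)
      finally show ?thesis by (simp add: power_divide mult_ac)
    qed
  qed
  then obtain g where g: "mfls g = G" using mfls_range by metis
  define R where "R = fls_const \<alpha> * fls_dil q G - fls_const \<beta> * G"
  have R: "fls_nth R k = (if \<alpha> * q powi k = \<beta> then 0 else fls_nth F k)" for k
    using q0 by (simp add: R_def Gnth field_simps)
  show ?thesis
  proof (cases "\<exists>k. \<alpha> * q powi k = \<beta>")
    case True
    then obtain k where k: "\<alpha> * q powi k = \<beta>" by blast
    have uniq: "\<alpha> * q powi j = \<beta> \<longleftrightarrow> j = k" for j
      using k \<alpha>\<beta> non_root_of_unityD(2)[OF q(2), of j k] by auto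
    have "F = R + fls_const (fls_nth F k) * fls_X_intpow k"
      by (intro fls_eqI) (auto simp: R uniq)
    hence "f = mconst \<alpha> * mero_dilate q g - mconst \<beta> * g + mconst (fls_nth F k) * mero_X powi k"
      using q0 by (simp flip: mfls_eq_iff add: mfls_dilate g F_def R_def)
    thus ?thesis using that k by blast
  next
    case False
    have "F = R" by (intro fls_eqI) (use False in \<open>auto simp: R\<close>)
    hence "f = mconst \<alpha> * mero_dilate q g - mconst \<beta> * g + mconst 0 * mero_X powi 0"
      using q0 by (simp flip: mfls_eq_iff add: mfls_dilate g F_def R_def)
    thus ?thesis using that by blast
  qed
qed

text \<open>The coefficient of index i of the unknown is determined by the one of index i - s with
  the constant divisor b, and the factors q^k have norm 1. So no small divisors arise and the formal
  solution converges. This is why pieces of different slopes can be separated.\<close>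

lemma contracting_equation_pos:
  fixes f :: "'a :: valued_field mero"
  assumes q: "absv q = 1" and a: "a \<noteq> 0" and b: "b \<noteq> 0" and s: "s > 0"
  shows "\<exists>g. f = mconst a * mero_X powi (int s) * mero_dilate q g - mconst b * g"
proof -
  have q0: "q \<noteq> 0" using q by auto
  define F where "F = mfls f"
  define m where "m = fls_subdegree F"
  define H where "H = (\<lambda>i (G :: nat \<Rightarrow> 'a).
     ((if i < s then 0 else a * q powi (m + int i - int s) * G (i - s)) - fls_nth F (m + int i)) / b)"
  obtain u where u: "\<And>i. u i = H i (\<lambda>j. if j < i then u j else undefined)"
    using wf_rec_exists[of H] by blast
  have u: "u i = ((if i < s then 0 else a * q powi (m + int i - int s) * u (i - s)) - fls_nth F (m + int i)) / b" for i
    using u[of i] s unfolding H_def by (auto split: if_splits)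
  have "conv_fls (fls_shift m F)" by (simp add: F_def)
  then obtain A B where AB: "A > 0" "B \<ge> 1" "\<And>k. absv (fls_nth F (int k + m)) \<le> A * B ^ k"
    unfolding conv_fls_def by (elim convergent_coeffsE) auto
  have rec: "absv (u k) * absv b \<le> A * B ^ k + (\<Sum>j<k. absv a * B ^ (k - j) * absv (u j))" for k
  proof -
    have *: "absv (if k < s then 0 else a * q powi (m + int k - int s) * u (k - s)) \<le> (\<Sum>j<k. absv a * B ^ (k - j) * absv (u j))"
    proof (cases "k < s")
      case False
      have "absv (a * q powi (m + int k - int s) * u (k - s)) = absv a * 1 * absv (u (k - s))"
        using q by (simp add: absv_mult absv_powi)
      also have "\<dots> \<le> absv a * B ^ (k - (k - s)) * absv (u (k - s))"
        using AB by (intro mult_mono mult_left_mono) (auto simp: absv_nonneg)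
      also have "\<dots> \<le> (\<Sum>j<k. absv a * B ^ (k - j) * absv (u j))"
        by (rule member_le_sum[of "k - s"]) (use s False AB in \<open>auto simp: absv_nonneg\<close>)
      finally show ?thesis using False by simp
    qed (use AB in \<open>auto intro!: sum_nonneg simp: absv_nonneg\<close>)
    have "absv (u k) * absv b = absv ((if k < s then 0 else a * q powi (m + int k - int s) * u (k - s)) - fls_nth F (m + int k))"
      using u[of k] b by (simp flip: absv_mult)
    also have "\<dots> \<le> absv (if k < s then 0 else a * q powi (m + int k - int s) * u (k - s)) + absv (fls_nth F (m + int k))"
      by (rule absv_diff_le)
    also have "\<dots> \<le> (\<Sum>j<k. absv a * B ^ (k - j) * absv (u j)) + A * B ^ k"
      using * AB(3)[of k] by (intro add_mono) (auto simp: add.commute)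
    finally show ?thesis by simp
  qed
  obtain A' B' where AB': "B' \<ge> 1" "\<And>k. absv (u k) \<le> A' * B' ^ k"
    by (rule geometric_majorant[of "\<lambda>k. absv (u k)" "\<lambda>_. absv b" "absv b" "absv b" "absv a" B A])
       (use AB rec b in \<open>auto simp: absv_nonneg absv_pos_iff\<close>)
  have conv: "conv_fls (fls_shift (- m) (fps_to_fls (Abs_fps u)))"
    by (simp, rule convergent_coeffsI[of B']) (use AB' in auto)
  then obtain g where g: "mfls g = fls_shift (- m) (fps_to_fls (Abs_fps u))" using mfls_range by metis
  have Gnth: "fls_nth (mfls g) k = (if k < m then 0 else u (nat (k - m)))" for k
    by (simp add: g)
  have "F = fls_const a * fls_X_intpow (int s) * fls_dil q (mfls g) - fls_const b * mfls g"
  proof (rule fls_eqI)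
    fix k
    have eq: "fls_nth (fls_const a * fls_X_intpow (int s) * fls_dil q (mfls g) - fls_const b * mfls g) k =
      a * (fls_nth (mfls g) (k - int s) * q powi (k - int s)) - b * fls_nth (mfls g) k"
      using q0 by (simp add: mult.assoc fls_shifted_times_simps)
    show "fls_nth F k = fls_nth (fls_const a * fls_X_intpow (int s) * fls_dil q (mfls g) - fls_const b * mfls g) k"
    proof (cases "k < m")
      case True thus ?thesis unfolding eq by (simp add: Gnth m_def)
    next
      case False
      define i where "i = nat (k - m)"
      have k: "k = m + int i" using False by (simp add: i_def)
      have *: "m + int i - int s < m \<longleftrightarrow> i < s" "nat (m + int i - int s - m) = i - s" by auto
      have "b * u i = (if i < s then 0 else a * q powi (m + int i - int s) * u (i - s)) - fls_nth F (m + int i)"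
        using u[of i] b by simp
      thus ?thesis unfolding eq unfolding Gnth k * by auto
    qed
  qed
  hence "f = mconst a * mero_X powi (int s) * mero_dilate q g - mconst b * g"
    using q0 by (simp flip: mfls_eq_iff add: mfls_dilate F_def fls_X_power_conv_shift_1)
  thus ?thesis by blast
qed

lemma contracting_equation:
  fixes f :: "'a :: valued_field mero"
  assumes q: "absv q = 1" and a: "a \<noteq> 0" and b: "b \<noteq> 0" and s: "s \<noteq> 0"
  shows "\<exists>g. f = mconst a * mero_X powi s * mero_dilate q g - mconst b * g"
proof (cases "s > 0")
  case True
  thus ?thesis using contracting_equation_pos[OF q a b, of "nat s" f] by simp
next
  case False
  have q0: "q \<noteq> 0" using q by auto
  \<comment> \<open>Take the leading term as the new unknown.\<close>
  define c where "c = b * q powi s / a"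
  have "c \<noteq> 0" "absv (inverse q) = 1" using a b q0 q by (auto simp: c_def absv_inverse)
  from contracting_equation_pos[OF this(2) this(1), of 1 "nat (- s)" "- f"] False s
  obtain h where h: "- f = mconst c * mero_X powi (- s) * mero_dilate (inverse q) h - h"
    by auto
  define g where "g = mero_dilate (inverse q) (h * mero_X powi (- s) / mconst a)"
  have 1: "mconst a * mero_X powi s * mero_dilate q g = h"
  proof -
    have "mero_dilate q g = h * mero_X powi (- s) / mconst a"
      unfolding g_def by (rule mero_dilate_inverse_dilate(1)[OF q0])
    thus ?thesis using a by (simp add: power_int_minus field_simps)
  qed
  have "inverse q powi (- s) = q powi s" by (simp add: power_int_inverse power_int_minus)
  hence 3: "mero_dilate (inverse q) (mero_X powi (- s)) = mconst (q powi s) * mero_X powi (- s)"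
    using q0 by (simp only: mero_dilate_powi mero_dilate_X power_int_mult_distrib
        inverse_nonzero_iff_nonzero not_False_eq_True flip: mconst_powi)
  have 2: "g = mero_dilate (inverse q) h * mconst (q powi s) * mero_X powi (- s) / mconst a"
    using q0 by (simp add: g_def mero_dilate_divide mero_dilate_mult 3 del: power_int_minus)
  have "mconst b * g = mconst c * mero_X powi (- s) * mero_dilate (inverse q) h"
    using a by (simp flip: mfls_eq_iff add: 2 c_def fls_const_mult_const[symmetric] divide_inverse fls_inverse_const mult_ac del: fls_const_mult_const)
  hence "f = mconst a * mero_X powi s * mero_dilate q g - mconst b * g"
    using h 1 by (simp add: algebra_simps)
  thus ?thesis by blast
qed

section \<open>Skew polynomials acting on semilinear spaces, and cyclic modules\<close>

section \<open>Semilinear maps and skew polynomials\<close>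

definition act :: "('a :: valued_field mero \<Rightarrow> 'b :: ab_group_add \<Rightarrow> 'b) \<Rightarrow> ('b \<Rightarrow> 'b) \<Rightarrow> 'a mero poly \<Rightarrow> 'b \<Rightarrow> 'b" where
  "act smul \<Sigma> P v = (\<Sum>i\<le>degree P. smul (coeff P i) ((\<Sigma> ^^ i) v))"

definition sigma_times :: "'a :: valued_field \<Rightarrow> 'a mero poly \<Rightarrow> 'a mero poly" where
  "sigma_times q R = pCons 0 (map_poly (mero_dilate q) R)"

text \<open>The product of the ring \<open>K\<close>[\<sigma>], obtained by letting skew polynomials
  act on the ring itself with \<sigma> acting by left multiplication. Associativity is then an
  instance of \<open>act_skew_mult\<close>.\<close>

definition skew_mult :: "'a :: valued_field \<Rightarrow> 'a mero poly \<Rightarrow> 'a mero poly \<Rightarrow> 'a mero poly" where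
  "skew_mult q = act smult (sigma_times q)"

lemma coeff_sigma_times:
  "q \<noteq> 0 \<Longrightarrow> coeff (sigma_times q P) k = (case k of 0 \<Rightarrow> 0 | Suc j \<Rightarrow> mero_dilate q (coeff P j))"
  by (auto simp: sigma_times_def coeff_pCons coeff_map_poly split: nat.split)

context vector_space
begin

lemma family_independent:
  assumes fin: "finite I"
    and zero: "\<And>c. (\<Sum>i\<in>I. scale (c i) (b i)) = 0 \<Longrightarrow> \<forall>i\<in>I. c i = 0"
  shows "inj_on b I" "independent (b ` I)"
proof -
  show inj: "inj_on b I"
  proof (rule inj_onI, rule ccontr)
    fix i j assume ij: "i \<in> I" "j \<in> I" "b i = b j" "i \<noteq> j"
    define c where "c = (\<lambda>k. if k = i then 1 else if k = j then -1 else 0 :: 'a)"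
    have "(\<Sum>k\<in>I. scale (c k) (b k)) = (\<Sum>k\<in>{i, j}. scale (c k) (b k))"
      using ij fin by (intro sum.mono_neutral_right) (auto simp: c_def)
    also have "\<dots> = 0" using ij by (simp add: c_def)
    finally have "c i = 0" using zero ij by blast
    thus False by (simp add: c_def)
  qed
  show "independent (b ` I)"
    unfolding dependent_finite[OF finite_imageI[OF fin]]
  proof safe
    fix u i assume i: "i \<in> I" "u (b i) \<noteq> 0" and 0: "(\<Sum>v\<in>b ` I. scale (u v) v) = 0"
    have "(\<Sum>k\<in>I. scale (u (b k)) (b k)) = 0"
      using 0 by (subst (asm) sum.reindex[OF inj]) simp
    from zero[OF this] i show False by auto
  qed
qed

end

text \<open>Weaker than a q-difference module: neither finite dimension nor bijectivity is asked
  for. It therefore covers modules, powers of \<Sigma>, the operators x^d \<Sigma>^n, the ring of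
  skew polynomials and the spaces of Laurent series alike.\<close>

locale semilinear = vector_space smul
  for smul :: "'a :: valued_field mero \<Rightarrow> 'b :: ab_group_add \<Rightarrow> 'b" +
  fixes q :: 'a and M :: "'b set" and \<Sigma> :: "'b \<Rightarrow> 'b"
  assumes q0: "q \<noteq> 0"
    and subspace_M: "subspace M"
    and closed: "\<And>v. v \<in> M \<Longrightarrow> \<Sigma> v \<in> M"
    and add: "\<And>u v. u \<in> M \<Longrightarrow> v \<in> M \<Longrightarrow> \<Sigma> (u + v) = \<Sigma> u + \<Sigma> v"
    and scale: "\<And>f v. v \<in> M \<Longrightarrow> \<Sigma> (smul f v) = smul (mero_dilate q f) (\<Sigma> v)"
begin

lemma M_0 [simp]: "0 \<in> M" using subspace_M by (rule subspace_0)
lemma M_add [simp]: "u \<in> M \<Longrightarrow> v \<in> M \<Longrightarrow> u + v \<in> M" using subspace_M by (rule subspace_add)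
lemma M_diff [simp]: "u \<in> M \<Longrightarrow> v \<in> M \<Longrightarrow> u - v \<in> M" using subspace_M by (rule subspace_diff)
lemma M_scale [simp]: "u \<in> M \<Longrightarrow> smul c u \<in> M" using subspace_M by (rule subspace_scale)
lemma M_sum: "(\<And>i. i \<in> A \<Longrightarrow> f i \<in> M) \<Longrightarrow> sum f A \<in> M" using subspace_M by (rule subspace_sum)

lemma sigma_0 [simp]: "\<Sigma> 0 = 0"
  using add[of 0 0] by simp

lemma sigma_diff: "u \<in> M \<Longrightarrow> v \<in> M \<Longrightarrow> \<Sigma> (u - v) = \<Sigma> u - \<Sigma> v"
  using add[of "u - v" v] by simp

lemma sigma_sum: "(\<And>i. i \<in> A \<Longrightarrow> f i \<in> M) \<Longrightarrow> \<Sigma> (sum f A) = (\<Sum>i\<in>A. \<Sigma> (f i))"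
  by (induction A rule: infinite_finite_induct) (auto simp: add M_sum)

lemma pow_closed [simp]: "v \<in> M \<Longrightarrow> (\<Sigma> ^^ i) v \<in> M"
  by (induction i) (auto simp: closed)

lemma pow_semilinear: "semilinear smul (q ^ i) M (\<Sigma> ^^ i)"
proof (intro semilinear.intro semilinear_axioms.intro)
  show "vector_space smul" by unfold_locales
  fix u v f
  show "u \<in> M \<Longrightarrow> v \<in> M \<Longrightarrow> (\<Sigma> ^^ i) (u + v) = (\<Sigma> ^^ i) u + (\<Sigma> ^^ i) v"
    by (induction i) (auto simp: add)
  show "v \<in> M \<Longrightarrow> (\<Sigma> ^^ i) (smul f v) = smul (mero_dilate (q ^ i) f) ((\<Sigma> ^^ i) v)"
    by (induction i) (auto simp: scale mero_dilate_dilate q0)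
qed (use q0 subspace_M in auto)

lemma pow_add: "u \<in> M \<Longrightarrow> v \<in> M \<Longrightarrow> (\<Sigma> ^^ i) (u + v) = (\<Sigma> ^^ i) u + (\<Sigma> ^^ i) v"
  and pow_scale: "v \<in> M \<Longrightarrow> (\<Sigma> ^^ i) (smul f v) = smul (mero_dilate (q ^ i) f) ((\<Sigma> ^^ i) v)"
  and pow_0 [simp]: "(\<Sigma> ^^ i) 0 = 0"
  and pow_diff: "u \<in> M \<Longrightarrow> v \<in> M \<Longrightarrow> (\<Sigma> ^^ i) (u - v) = (\<Sigma> ^^ i) u - (\<Sigma> ^^ i) v"
  and pow_sum: "(\<And>j. j \<in> A \<Longrightarrow> h j \<in> M) \<Longrightarrow> (\<Sigma> ^^ i) (sum h A) = (\<Sum>j\<in>A. (\<Sigma> ^^ i) (h j))"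
proof -
  interpret p: semilinear smul "q ^ i" M "\<Sigma> ^^ i" by (rule pow_semilinear)
  show "u \<in> M \<Longrightarrow> v \<in> M \<Longrightarrow> (\<Sigma> ^^ i) (u + v) = (\<Sigma> ^^ i) u + (\<Sigma> ^^ i) v"
    "v \<in> M \<Longrightarrow> (\<Sigma> ^^ i) (smul f v) = smul (mero_dilate (q ^ i) f) ((\<Sigma> ^^ i) v)"
    "(\<Sigma> ^^ i) 0 = 0"
    "u \<in> M \<Longrightarrow> v \<in> M \<Longrightarrow> (\<Sigma> ^^ i) (u - v) = (\<Sigma> ^^ i) u - (\<Sigma> ^^ i) v"
    "(\<And>j. j \<in> A \<Longrightarrow> h j \<in> M) \<Longrightarrow> (\<Sigma> ^^ i) (sum h A) = (\<Sum>j\<in>A. (\<Sigma> ^^ i) (h j))"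
    using p.add p.scale p.sigma_0 p.sigma_diff p.sigma_sum by blast+
qed

abbreviation app :: "'a mero poly \<Rightarrow> 'b \<Rightarrow> 'b" where "app \<equiv> act smul \<Sigma>"

lemma act_ge: "degree P \<le> n \<Longrightarrow> app P v = (\<Sum>i\<le>n. smul (coeff P i) ((\<Sigma> ^^ i) v))"
  unfolding act_def by (rule sum.mono_neutral_left) (auto simp: coeff_eq_0)

lemma act_closed [simp]: "v \<in> M \<Longrightarrow> app P v \<in> M"
  unfolding act_def by (rule M_sum) auto

lemma act_0 [simp]: "app 0 v = 0"
  by (simp add: act_def)

lemma act_zero_right [simp]: "app P 0 = 0"
  by (simp add: act_def)

lemma act_1 [simp]: "app 1 v = v"
  by (simp add: act_def)

lemma act_add: "app (P + R) v = app P v + app R v"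
proof -
  define n where "n = max (degree P) (degree R)"
  have "degree P \<le> n" "degree R \<le> n" "degree (P + R) \<le> n" by (auto simp: n_def degree_add_le_max)
  thus ?thesis by (simp add: act_ge[of _ n] scale_left_distrib sum.distrib)
qed

lemma act_smult: "app (smult c P) v = smul c (app P v)"
  by (subst act_ge[of _ "degree P"]) (auto simp: act_def scale_sum_right degree_smult_le)

lemma act_uminus: "app (- P) v = - app P v"
  using act_add[of P "- P" v] by (simp add: eq_neg_iff_add_eq_0 add.commute)

lemma act_diff: "app (P - R) v = app P v - app R v"
  using act_add[of P "- R" v] by (simp add: act_uminus)

lemma act_sum: "app (sum f A) v = (\<Sum>i\<in>A. app (f i) v)"
  by (induction A rule: infinite_finite_induct) (auto simp: act_add)

lemma act_monom: "app (monom c i) v = smul c ((\<Sigma> ^^ i) v)"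
proof -
  have "app (monom c i) v = (\<Sum>j\<le>i. smul (coeff (monom c i) j) ((\<Sigma> ^^ j) v))"
    by (rule act_ge) (rule degree_monom_le)
  also have "\<dots> = (\<Sum>j\<le>i. if j = i then smul c ((\<Sigma> ^^ i) v) else 0)"
    by (intro sum.cong) auto
  finally show ?thesis by simp
qed

lemma act_sigma_times:
  assumes "v \<in> M" shows "app (sigma_times q P) v = \<Sigma> (app P v)"
proof -
  have "degree (sigma_times q P) \<le> Suc (degree P)"
    by (rule degree_le) (auto simp: coeff_sigma_times q0 coeff_eq_0 split: nat.split)
  hence "app (sigma_times q P) v = (\<Sum>i\<le>Suc (degree P). smul (coeff (sigma_times q P) i) ((\<Sigma> ^^ i) v))"
    by (rule act_ge)
  also have "\<dots> = (\<Sum>i\<le>degree P. smul (mero_dilate q (coeff P i)) (\<Sigma> ((\<Sigma> ^^ i) v)))"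
    by (subst sum.atMost_Suc_shift) (simp add: coeff_sigma_times q0)
  also have "\<dots> = \<Sigma> (app P v)"
    unfolding act_def using assms by (simp add: sigma_sum scale)
  finally show ?thesis .
qed

lemma act_sigma_times_pow: "v \<in> M \<Longrightarrow> app ((sigma_times q ^^ i) P) v = (\<Sigma> ^^ i) (app P v)"
  by (induction i) (auto simp: act_sigma_times)

lemma act_skew_mult:
  assumes "v \<in> M" shows "app (skew_mult q P R) v = app P (app R v)"
proof -
  have "app (skew_mult q P R) v = (\<Sum>i\<le>degree P. app (smult (coeff P i) ((sigma_times q ^^ i) R)) v)"
    by (simp add: skew_mult_def act_def[of smult] act_sum)
  also have "\<dots> = app P (app R v)"
    using assms by (simp add: act_smult act_sigma_times_pow act_def[of smul _ P])
  finally show ?thesis .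
qed

end

lemma semilinear_poly:
  assumes q0: "q \<noteq> 0"
  shows "semilinear smult q UNIV (sigma_times q)"
proof (intro semilinear.intro semilinear_axioms.intro)
  fix f :: "'a mero" and u v :: "'a mero poly"
  show vs: "vector_space (smult :: 'a mero \<Rightarrow> _)"
    by unfold_locales (auto simp: smult_add_right smult_add_left)
  interpret vs: vector_space "smult :: 'a mero \<Rightarrow> _" by (rule vs)
  show "module.subspace (smult :: 'a mero \<Rightarrow> _) UNIV" by (rule vs.subspace_UNIV)
  show "sigma_times q (u + v) = sigma_times q u + sigma_times q v"
    by (intro poly_eqI) (auto simp: coeff_sigma_times mero_dilate_add q0 split: nat.split)
  show "sigma_times q (smult f v) = smult (mero_dilate q f) (sigma_times q v)"
    by (intro poly_eqI) (auto simp: coeff_sigma_times mero_dilate_mult q0 split: nat.split)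
qed (use q0 in auto)

context
  fixes q :: "'a :: valued_field" assumes q0: "q \<noteq> 0"
begin

interpretation poly: semilinear smult q UNIV "sigma_times q"
  by (rule semilinear_poly[OF q0])

lemma coeff_sigma_times_pow:
  "coeff ((sigma_times q ^^ i) R) k = (if k < i then 0 else mero_dilate (q ^ i) (coeff R (k - i)))"
proof (induction i arbitrary: k)
  case (Suc i)
  show ?case
    by (cases k) (auto simp: coeff_sigma_times Suc mero_dilate_dilate q0)
qed simp

lemma coeff_skew_mult:
  "coeff (skew_mult q P R) k =
     (\<Sum>i\<le>degree P. if k < i then 0 else coeff P i * mero_dilate (q ^ i) (coeff R (k - i)))"
  unfolding skew_mult_def act_def by (auto simp: coeff_sum coeff_sigma_times_pow intro!: sum.cong)

lemma coeff_skew_mult_0: "coeff (skew_mult q P R) 0 = coeff P 0 * coeff R 0"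
proof -
  have "coeff (skew_mult q P R) 0 = (\<Sum>i\<le>degree P. if i = 0 then coeff P 0 * coeff R 0 else 0)"
    unfolding coeff_skew_mult by (intro sum.cong) auto
  thus ?thesis by simp
qed

lemma skew_mult_0 [simp]: "skew_mult q 0 R = 0" "skew_mult q P 0 = 0"
  and skew_mult_1 [simp]: "skew_mult q 1 R = R"
  and skew_mult_add: "skew_mult q (P + S) R = skew_mult q P R + skew_mult q S R"
  and skew_mult_diff: "skew_mult q (P - S) R = skew_mult q P R - skew_mult q S R"
  and skew_mult_smult: "skew_mult q (smult c P) R = smult c (skew_mult q P R)"
  and skew_mult_assoc: "skew_mult q (skew_mult q P R) S = skew_mult q P (skew_mult q R S)"
  by (simp_all add: skew_mult_def poly.act_add poly.act_diff poly.act_smult poly.act_skew_mult[unfolded skew_mult_def])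

lemma skew_mult_degree:
  assumes "P \<noteq> 0" "R \<noteq> 0"
  shows "degree (skew_mult q P R) = degree P + degree R" "skew_mult q P R \<noteq> 0"
    "coeff (skew_mult q P R) (degree P + degree R) = lead_coeff P * mero_dilate (q ^ degree P) (lead_coeff R)"
proof -
  have "coeff (skew_mult q P R) (degree P + degree R) =
    (\<Sum>i\<le>degree P. if i = degree P then lead_coeff P * mero_dilate (q ^ degree P) (lead_coeff R) else 0)"
    unfolding coeff_skew_mult using q0 by (intro sum.cong) (auto simp: coeff_eq_0)
  thus top: "coeff (skew_mult q P R) (degree P + degree R) = lead_coeff P * mero_dilate (q ^ degree P) (lead_coeff R)"
    by simp
  have nz: "coeff (skew_mult q P R) (degree P + degree R) \<noteq> 0"
    unfolding top using assms q0 by simp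
  show "skew_mult q P R \<noteq> 0" using nz by auto
  have "degree (skew_mult q P R) \<le> degree P + degree R"
    by (rule degree_le) (auto simp: coeff_skew_mult coeff_eq_0 q0 intro!: sum.neutral)
  thus "degree (skew_mult q P R) = degree P + degree R" using nz le_degree by (metis antisym)
qed

lemma skew_mult_cancel:
  assumes "R \<noteq> 0" "skew_mult q P R = skew_mult q S R" shows "P = S"
proof (rule ccontr)
  assume "P \<noteq> S"
  hence "skew_mult q (P - S) R \<noteq> 0" using skew_mult_degree(2)[of "P - S" R] assms by simp
  thus False using assms by (simp add: skew_mult_diff)
qed

text \<open>Euclidean division on the right. It makes every left ideal principal, which is the
  source of all the factorisations L = R P below.\<close>

lemma skew_division:
  assumes R: "R \<noteq> 0"
  shows "\<exists>S T. P = skew_mult q S R + T \<and> (T = 0 \<or> degree T < degree R)"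
proof (induction "degree P" arbitrary: P rule: less_induct)
  case less
  show ?case
  proof (cases "P = 0 \<or> degree P < degree R")
    case True
    thus ?thesis by (intro exI[of _ 0] exI[of _ P]) auto
  next
    case False
    define k where "k = degree P - degree R"
    \<comment> \<open>The leading coefficient of R gets twisted by \<sigma>^k when it passes to the
      left of \<sigma>^k, hence the dilated denominator.\<close>
    define S where "S = monom (lead_coeff P / mero_dilate (q ^ k) (lead_coeff R)) k"
    have qk: "q ^ k \<noteq> 0" using q0 by simp
    have S0: "S \<noteq> 0" "degree S = k" "lead_coeff S = lead_coeff P / mero_dilate (q ^ k) (lead_coeff R)"
      using False R qk by (auto simp: S_def degree_monom_eq)
    have deg: "degree (skew_mult q S R) = degree P"
      using skew_mult_degree(1)[OF S0(1) R] S0 False by (simp add: k_def)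
    have top: "coeff (skew_mult q S R) (degree P) = lead_coeff P"
      using skew_mult_degree(3)[OF S0(1) R] S0 False R qk by (simp add: k_def)
    define P' where "P' = P - skew_mult q S R"
    have P: "P = skew_mult q S R + P'" by (simp add: P'_def)
    show ?thesis
    proof (cases "P' = 0 \<or> degree P = 0")
      case True
      have "P' = 0"
      proof (rule ccontr)
        assume "P' \<noteq> 0"
        hence "degree P = 0" using True by simp
        hence "degree P' = 0" "coeff P' 0 = 0"
          using degree_diff_le_max[of P "skew_mult q S R"] deg top by (auto simp: P'_def)
        thus False using \<open>P' \<noteq> 0\<close> by (metis leading_coeff_0_iff)
      qed
      thus ?thesis using P by (intro exI[of _ S] exI[of _ 0]) auto
    next
      case False
      have "degree P' \<le> degree P - 1"
      proof (rule degree_le, safe)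
        fix i assume i: "i > degree P - 1"
        show "coeff P' i = 0"
        proof (cases "i = degree P")
          case True thus ?thesis using top by (simp add: P'_def)
        next
          case False
          hence "i > degree P" using i by simp
          thus ?thesis using deg by (simp add: P'_def coeff_eq_0)
        qed
      qed
      hence "degree P' < degree P" using False by linarith
      from less[OF this] obtain S' T where T: "P' = skew_mult q S' R + T" "T = 0 \<or> degree T < degree R" by blast
      have "P = skew_mult q (S + S') R + T" using P T by (simp add: skew_mult_add)
      thus ?thesis using T by blast
    qed
  qed
qed

end

subsection \<open>Cyclic modules\<close>

text \<open>e is a cyclic vector of N whose annihilator in \<open>K\<close>[\<sigma>] is the left
  ideal generated by L. The nonzero constant coefficient of L is what makes \<Sigma> invertible on N
  (\<open>cyc_image\<close>).\<close>

definition cyc :: "('a :: valued_field mero \<Rightarrow> 'b :: ab_group_add \<Rightarrow> 'b) \<Rightarrow> 'a \<Rightarrow> ('b \<Rightarrow> 'b) \<Rightarrow> 'b \<Rightarrow> 'a mero poly \<Rightarrow> 'b set \<Rightarrow> bool" where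
  "cyc smul q \<Sigma> e L N \<longleftrightarrow> coeff L 0 \<noteq> 0 \<and> e \<in> N \<and> N = range (\<lambda>P. act smul \<Sigma> P e) \<and>
     (\<forall>P. act smul \<Sigma> P e = 0 \<longleftrightarrow> (\<exists>S. P = skew_mult q S L))"

context semilinear
begin

definition stable :: "'b set \<Rightarrow> bool" where
  "stable N \<longleftrightarrow> subspace N \<and> N \<subseteq> M \<and> (\<forall>v\<in>N. \<Sigma> v \<in> N)"

lemma stable_act: "stable N \<Longrightarrow> v \<in> N \<Longrightarrow> app P v \<in> N"
proof -
  assume N: "stable N" "v \<in> N"
  then interpret N: semilinear smul q N \<Sigma>
    by unfold_locales (auto simp: stable_def q0 add scale subset_iff)
  show ?thesis using N by (intro N.act_closed) auto
qed

lemma cyc_zero: "cyc smul q \<Sigma> e L N \<Longrightarrow> app P e = 0 \<longleftrightarrow> (\<exists>S. P = skew_mult q S L)"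
  by (simp add: cyc_def)

lemma cyc_annihilates: "cyc smul q \<Sigma> e L N \<Longrightarrow> app L e = 0"
  using cyc_zero[of e L N L] skew_mult_1[OF q0, of L] by metis

lemma cyc_nonzero: "cyc smul q \<Sigma> e L N \<Longrightarrow> L \<noteq> 0"
  by (auto simp: cyc_def)

lemma cyc_elem: "cyc smul q \<Sigma> e L N \<Longrightarrow> v \<in> N \<Longrightarrow> \<exists>P. v = app P e"
  by (auto simp: cyc_def)

lemma cyc_stable:
  assumes "cyc smul q \<Sigma> e L N" "N \<subseteq> M" shows "stable N"
proof -
  have e: "e \<in> M" and N: "N = range (\<lambda>P. app P e)" using assms by (auto simp: cyc_def)
  have "subspace N"
  proof (rule subspaceI)
    show "0 \<in> N" unfolding N by (metis act_0 rangeI)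
    show "x + y \<in> N" if "x \<in> N" "y \<in> N" for x y
      using that unfolding N by (auto simp flip: act_add)
    show "smul c x \<in> N" if "x \<in> N" for c x
      using that unfolding N by (auto simp flip: act_smult)
  qed
  moreover have "\<Sigma> v \<in> N" if "v \<in> N" for v
    using that e unfolding N by (auto simp flip: act_sigma_times)
  ultimately show ?thesis using assms by (auto simp: stable_def)
qed

text \<open>Division by L leaves remainders of degree below that of L, and a nonzero remainder
  cannot annihilate e.\<close>

lemma cyc_basis:
  assumes c: "cyc smul q \<Sigma> e L N" and NM: "N \<subseteq> M"
  defines "B \<equiv> (\<lambda>i. (\<Sigma> ^^ i) e) ` {..<degree L}"
  shows "inj_on (\<lambda>i. (\<Sigma> ^^ i) e) {..<degree L}" "independent B" "span B = N" "dim N = degree L"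
proof -
  have N: "stable N" "e \<in> N" using cyc_stable[OF c NM] c by (auto simp: cyc_def)
  have 1: "\<forall>i\<in>{..<degree L}. u i = 0" if u: "(\<Sum>i<degree L. smul (u i) ((\<Sigma> ^^ i) e)) = 0" for u
  proof -
    define P where "P = (\<Sum>i<degree L. monom (u i) i)"
    have cP: "coeff P j = (if j < degree L then u j else 0)" for j
      by (simp add: P_def coeff_sum)
    have "app P e = 0" using u by (simp add: P_def act_sum act_monom)
    then obtain S where S: "P = skew_mult q S L" using c by (auto simp: cyc_def)
    have "S = 0"
    proof (rule ccontr)
      assume S0: "S \<noteq> 0"
      hence "degree P \<ge> degree L" "P \<noteq> 0"
        using skew_mult_degree[OF q0 S0 cyc_nonzero[OF c]] S by auto
      hence "coeff P (degree P) \<noteq> 0" "\<not> degree P < degree L" by auto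
      thus False by (simp add: cP)
    qed
    hence "P = 0" using S q0 by simp
    thus ?thesis using cP by (metis coeff_0 lessThan_iff)
  qed
  show inj: "inj_on (\<lambda>i. (\<Sigma> ^^ i) e) {..<degree L}" and ind: "independent B"
    unfolding B_def using family_independent[OF _ 1] by auto
  show sp: "span B = N"
  proof
    have "app (monom 1 i) e \<in> N" for i using N by (intro stable_act)
    hence "B \<subseteq> N" by (auto simp: B_def act_monom)
    thus "span B \<subseteq> N" using N span_minimal by (auto simp: stable_def)
    show "N \<subseteq> span B"
    proof
      fix v assume "v \<in> N"
      then obtain P where P: "v = app P e" using c by (auto simp: cyc_def)
      obtain S T where T: "P = skew_mult q S L + T" "T = 0 \<or> degree T < degree L"
        using skew_division[OF q0 cyc_nonzero[OF c]] by blast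
      have "v = app T e"
        using P T c NM N act_skew_mult[of e S L] cyc_annihilates[OF c] by (simp add: act_add subset_iff)
      also have "\<dots> \<in> span B"
        unfolding act_def
      proof (rule span_sum)
        fix i assume i: "i \<in> {..degree T}"
        show "smul (coeff T i) ((\<Sigma> ^^ i) e) \<in> span B"
        proof (cases "T = 0")
          case False
          thus ?thesis using i T by (intro span_scale span_base) (auto simp: B_def)
        qed (simp add: span_zero)
      qed
      finally show "v \<in> span B" .
    qed
  qed
  show "dim N = degree L"
    unfolding sp[symmetric] dim_span dim_eq_card_independent[OF ind]
    using inj by (simp add: B_def card_image)
qed

text \<open>The P with P e in N' form a left ideal. Its generator P divides L on the right, presents
  the quotient of N by N', and P e is a cyclic vector of N' with annihilator R. Inductions on the
  order go through this factorisation.\<close>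

lemma cyc_factor:
  assumes c: "cyc smul q \<Sigma> e L N" and NM: "N \<subseteq> M" and N': "stable N'" "N' \<subseteq> N"
  obtains R P where "L = skew_mult q R P" "cyc smul q \<Sigma> (app P e) R N'" "coeff P 0 \<noteq> 0"
    "degree P = 0 \<Longrightarrow> N' = N"
proof -
  have e: "e \<in> N" "e \<in> M" and N: "N = range (\<lambda>P. app P e)" using c NM by (auto simp: cyc_def)
  \<comment> \<open>An element of least degree generates the ideal.\<close>
  define Q where "Q = (\<lambda>P. P \<noteq> 0 \<and> app P e \<in> N')"
  have "Q L" using c N' cyc_annihilates[OF c] cyc_nonzero[OF c] subspace_0 by (auto simp: Q_def stable_def)
  then obtain P where P: "Q P" "\<And>S. Q S \<Longrightarrow> degree P \<le> degree S"
    using ex_has_least_nat[of Q L degree] by blast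
  have P0: "P \<noteq> 0" and PN: "app P e \<in> N'" using P by (auto simp: Q_def)
  have div: "\<exists>S. A = skew_mult q S P" if "app A e \<in> N'" for A
  proof -
    obtain S T where T: "A = skew_mult q S P + T" "T = 0 \<or> degree T < degree P"
      using skew_division[OF q0 P0] by blast
    have "app T e = app A e - app S (app P e)" using T act_skew_mult[OF e(2)] by (simp add: act_add)
    also have "\<dots> \<in> N'" using that PN N' stable_act[OF N'(1) PN] by (auto simp: stable_def subspace_diff)
    finally have "app T e \<in> N'" .
    hence "T = 0" using T(2) P(2)[of T] unfolding Q_def by linarith
    thus ?thesis using T by auto
  qed
  obtain R where R: "L = skew_mult q R P" using div[of L] \<open>Q L\<close> by (auto simp: Q_def)
  have c0: "coeff R 0 \<noteq> 0" "coeff P 0 \<noteq> 0"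
    using c R coeff_skew_mult_0[OF q0, of R P] by (auto simp: cyc_def)
  have "cyc smul q \<Sigma> (app P e) R N'"
    unfolding cyc_def
  proof (intro conjI allI)
    show "N' = range (\<lambda>S. app S (app P e))"
    proof
      show "range (\<lambda>S. app S (app P e)) \<subseteq> N'" using stable_act[OF N'(1) PN] by auto
      show "N' \<subseteq> range (\<lambda>S. app S (app P e))"
      proof
        fix v assume v: "v \<in> N'"
        then obtain A where A: "v = app A e" using N' N by auto
        then obtain S where "A = skew_mult q S P" using div v by auto
        thus "v \<in> range (\<lambda>S. app S (app P e))" using A act_skew_mult[OF e(2)] by auto
      qed
    qed
    fix A
    have "app A (app P e) = 0 \<longleftrightarrow> (\<exists>S. skew_mult q A P = skew_mult q S L)"
      using c act_skew_mult[OF e(2), of A P] by (metis cyc_zero)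
    also have "\<dots> \<longleftrightarrow> (\<exists>S. A = skew_mult q S R)"
      unfolding R skew_mult_assoc[OF q0, symmetric] using skew_mult_cancel[OF q0 P0] by metis
    finally show "app A (app P e) = 0 \<longleftrightarrow> (\<exists>S. A = skew_mult q S R)" .
  qed (use c0 PN in auto)
  moreover have "N' = N" if deg: "degree P = 0"
  proof -
    obtain a where aP: "P = [:a:]" using deg by (rule degree_eq_zeroE)
    hence a: "P = [:a:]" "a \<noteq> 0" using P0 by auto
    have "app P e = smul a e" using act_monom[of a 0 e] a by (simp add: monom_0)
    hence "smul (inverse a) (smul a e) \<in> N'" using PN N' by (metis stable_def subspace_scale)
    hence "e \<in> N'" using a by simp
    hence "N \<subseteq> N'" unfolding N using stable_act[OF N'(1)] by auto
    thus ?thesis using N' by auto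
  qed
  ultimately show ?thesis by (intro that[OF R]) (use c0 in auto)
qed

end

text \<open>Universal property of a cyclic module: sending e to any solution y of L extends to a
  homomorphism, well defined because the annihilator of e is generated by L.\<close>

lemma cyc_hom:
  fixes smul :: "'a :: valued_field mero \<Rightarrow> 'b :: ab_group_add \<Rightarrow> 'b"
    and smul' :: "'a mero \<Rightarrow> 'c :: ab_group_add \<Rightarrow> 'c"
  assumes S: "semilinear smul q M \<Sigma>" and S': "semilinear smul' q UNIV \<Sigma>'"
    and c: "cyc smul q \<Sigma> e L N" and NM: "N \<subseteq> M" and y: "act smul' \<Sigma>' L y = 0"
  obtains \<phi> where "\<And>P. \<phi> (act smul \<Sigma> P e) = act smul' \<Sigma>' P y"
    "\<And>u v. u \<in> N \<Longrightarrow> v \<in> N \<Longrightarrow> \<phi> (u + v) = \<phi> u + \<phi> v"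
    "\<And>a v. v \<in> N \<Longrightarrow> \<phi> (smul a v) = smul' a (\<phi> v)"
    "\<And>v. v \<in> N \<Longrightarrow> \<phi> (\<Sigma> v) = \<Sigma>' (\<phi> v)"
proof -
  interpret S: semilinear smul q M \<Sigma> by fact
  interpret S': semilinear smul' q UNIV \<Sigma>' by fact
  have e: "e \<in> M" using c NM by (auto simp: cyc_def)
  define \<phi> where "\<phi> = (\<lambda>v. S'.app (SOME P. v = S.app P e) y)"
  have \<phi>: "\<phi> (S.app P e) = S'.app P y" for P
  proof -
    define P' where "P' = (SOME A. S.app P e = S.app A e)"
    have "S.app P e = S.app P' e" unfolding P'_def by (rule someI[of _ P]) simp
    hence "S.app (P - P') e = 0" by (simp add: S.act_diff)
    then obtain A where "P - P' = skew_mult q A L" using c S.cyc_zero by blast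
    hence "S'.app (P - P') y = 0" using y S'.act_skew_mult[of y A L] by simp
    thus ?thesis by (simp add: \<phi>_def P'_def S'.act_diff)
  qed
  show ?thesis
  proof (rule that[OF \<phi>])
    fix u v a assume v: "v \<in> N"
    then obtain P where P: "v = S.app P e" using S.cyc_elem[OF c] by blast
    show "\<phi> (smul a v) = smul' a (\<phi> v)" using \<phi>[of "smult a P"] by (simp add: P \<phi> S.act_smult S'.act_smult)
    show "\<phi> (\<Sigma> v) = \<Sigma>' (\<phi> v)"
      using \<phi>[of "sigma_times q P"] by (simp add: P \<phi> S.act_sigma_times[OF e] S'.act_sigma_times)
    assume "u \<in> N"
    then obtain R where R: "u = S.app R e" using S.cyc_elem[OF c] by blast
    show "\<phi> (u + v) = \<phi> u + \<phi> v" using \<phi>[of "R + P"] by (simp add: P R \<phi> S.act_add S'.act_add)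
  qed
qed

section \<open>Characteristic polynomials and solutions in Laurent series in t = x^(1/n)\<close>

section \<open>Formal solutions\<close>

text \<open>c(x) read as c(t^n), where t^n = x.\<close>

definition emb :: "nat \<Rightarrow> 'a :: valued_field mero \<Rightarrow> 'a fls" where
  "emb n c = fls_compose_power (mfls c) n"

text \<open>This is y(t) \<mapsto> \<eta> t^(-d) y(pt), the action of \<sigma> on products of y with
  a symbol \<theta> satisfying \<sigma> \<theta> = \<eta> t^(-d) \<theta>. Solutions of slope d/n
  are of this shape.\<close>

definition ssig :: "'a :: field \<Rightarrow> int \<Rightarrow> 'a \<Rightarrow> 'a fls \<Rightarrow> 'a fls" where
  "ssig p d \<eta> y = fls_const \<eta> * fls_shift d (fls_dil p y)"

text \<open>The triangular number i(i-1)/2, which arises from (t^(-d) \<sigma>)^i = p^(-d tri(i))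
  t^(-di) \<sigma>^i.\<close>

definition tri :: "nat \<Rightarrow> int" where
  "tri i = (\<Sum>j<i. int j)"

lemma tri_0 [simp]: "tri 0 = 0" and tri_Suc [simp]: "tri (Suc i) = tri i + int i"
  by (simp_all add: tri_def)

lemma ssig_nth: "p \<noteq> 0 \<Longrightarrow> fls_nth (ssig p d \<eta> y) k = \<eta> * (fls_nth y (k + d) * p powi (k + d))"
  by (simp add: ssig_def)

lemma ssig_pow_nth:
  assumes p: "p \<noteq> 0"
  shows "fls_nth ((ssig p d \<eta> ^^ i) y) k =
    \<eta> ^ i * p powi (int i * (k + d * int i) - d * tri i) * fls_nth y (k + d * int i)"
proof (induction i arbitrary: k)
  case (Suc i)
  have "(k + d) + (int i * (k + d + d * int i) - d * tri i) =
      int (Suc i) * (k + d * int (Suc i)) - d * tri (Suc i)"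
    by (simp add: algebra_simps)
  hence e: "p powi (int (Suc i) * (k + d * int (Suc i)) - d * tri (Suc i)) =
      p powi (k + d) * p powi (int i * (k + d + d * int i) - d * tri i)"
    using p power_int_add[of p "k + d"] by metis
  have "fls_nth ((ssig p d \<eta> ^^ Suc i) y) k = \<eta> * (fls_nth ((ssig p d \<eta> ^^ i) y) (k + d) * p powi (k + d))"
    using p by (simp add: ssig_nth)
  also have "\<dots> = \<eta> ^ Suc i * p powi (int (Suc i) * (k + d * int (Suc i)) - d * tri (Suc i)) * fls_nth y (k + d * int (Suc i))"
    unfolding Suc e by (simp add: algebra_simps)
  finally show ?case .
qed simp

lemma fls_lower_boundE:
  assumes "\<And>k. k < a \<Longrightarrow> fls_nth F k = 0"
  shows "F = fls_shift (- a) (fps_to_fls (fls_regpart (fls_shift a F)))"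
  by (intro fls_eqI) (use assms in auto)

lemma fls_mult_lower_bound:
  fixes F G :: "'a :: field fls"
  assumes F: "\<And>k. k < a \<Longrightarrow> fls_nth F k = 0" and G: "\<And>k. k < b \<Longrightarrow> fls_nth G k = 0"
  shows "k < a + b \<Longrightarrow> fls_nth (F * G) k = 0"
    "fls_nth (F * G) (a + b) = fls_nth F a * fls_nth G b"
proof -
  define f g where "f = fls_regpart (fls_shift a F)" and "g = fls_regpart (fls_shift b G)"
  have F': "F = fls_shift (- a) (fps_to_fls f)" and G': "G = fls_shift (- b) (fps_to_fls g)"
    using fls_lower_boundE F G unfolding f_def g_def by blast+
  have FG: "F * G = fls_shift (- (a + b)) (fps_to_fls (f * g))"
    by (simp add: F' G' fls_shifted_times_simps fls_times_fps_to_fls)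
  show "k < a + b \<Longrightarrow> fls_nth (F * G) k = 0" unfolding FG by simp
  show "fls_nth (F * G) (a + b) = fls_nth F a * fls_nth G b" unfolding FG by (simp add: f_def g_def)
qed

text \<open>The height of the supporting line of slope d/n of the Newton polygon, scaled by n to be
  an integer.\<close>

definition wt :: "nat \<Rightarrow> int \<Rightarrow> 'a :: valued_field mero poly \<Rightarrow> int" where
  "wt n d L = Min ((\<lambda>i. int n * fls_subdegree (mfls (coeff L i)) - d * int i) ` {i. coeff L i \<noteq> 0})"

definition slope_coeff :: "nat \<Rightarrow> int \<Rightarrow> 'a :: valued_field mero poly \<Rightarrow> nat \<Rightarrow> 'a fps" where
  "slope_coeff n d L i = fls_regpart (fls_shift (wt n d L + d * int i) (emb n (coeff L i)))"

text \<open>The characteristic polynomial of the slope d/n for the n-th root p of q: it collects the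
  leading coefficients of those a_i whose point lies on the supporting line, with the powers of p
  that come from (t^(-d) \<sigma>)^i. If d/n is not a slope, a single monomial is left.\<close>

definition chi :: "nat \<Rightarrow> int \<Rightarrow> 'a :: valued_field \<Rightarrow> 'a mero poly \<Rightarrow> 'a poly" where
  "chi n d p L = (\<Sum>i\<le>degree L. monom (fps_nth (slope_coeff n d L i) 0 * p powi (- d * tri i)) i)"

lemma finite_coeff_nonzero: "finite {i. coeff (L :: 'b :: zero poly) i \<noteq> 0}"
  by (rule finite_subset[of _ "{..degree L}"]) (auto simp: le_degree)

lemma emb_nth: "n \<ge> 1 \<Longrightarrow> fls_nth (emb n c) k = (if int n dvd k then fls_nth (mfls c) (k div int n) else 0)"
  unfolding emb_def by (rule fls_nth_compose_power) auto

lemma wt_le: "coeff L i \<noteq> 0 \<Longrightarrow> wt n d L \<le> int n * fls_subdegree (mfls (coeff L i)) - d * int i"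
  unfolding wt_def by (rule Min_le) (auto simp: finite_coeff_nonzero)

lemma wt_attained:
  assumes "L \<noteq> 0"
  obtains i where "coeff L i \<noteq> 0" "wt n d L = int n * fls_subdegree (mfls (coeff L i)) - d * int i"
proof -
  have "{i. coeff L i \<noteq> 0} \<noteq> {}" using assms by (metis (mono_tags) empty_iff leading_coeff_0_iff mem_Collect_eq)
  hence "wt n d L \<in> (\<lambda>i. int n * fls_subdegree (mfls (coeff L i)) - d * int i) ` {i. coeff L i \<noteq> 0}"
    unfolding wt_def by (intro Min_in) (auto simp: finite_coeff_nonzero)
  thus ?thesis using that by auto
qed

context
  fixes n :: nat and d :: int and p q :: "'a :: valued_field"
  assumes n: "n \<ge> 1" and pn: "p ^ n = q" and p0: "p \<noteq> 0"
begin

lemma emb_lower: "k < wt n d L + d * int i \<Longrightarrow> fls_nth (emb n (coeff L i)) k = 0"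
proof (cases "coeff L i = 0 \<or> \<not> int n dvd k")
  case False
  assume "k < wt n d L + d * int i"
  hence "k < int n * fls_subdegree (mfls (coeff L i))" using False wt_le[of L i n d] by simp
  moreover have "k = int n * (k div int n)" using False by simp
  ultimately have "k div int n < fls_subdegree (mfls (coeff L i))"
    using n by (metis mult_less_cancel_left_pos of_nat_0_less_iff zero_less_one less_le_trans)
  thus ?thesis using n by (simp add: emb_nth)
qed (use n in \<open>auto simp: emb_nth\<close>)

lemma emb_shift: "emb n (coeff L i) = fls_shift (- (wt n d L + d * int i)) (fps_to_fls (slope_coeff n d L i))"
  unfolding slope_coeff_def by (rule fls_lower_boundE) (rule emb_lower)

lemma slope_coeff_0: "fps_nth (slope_coeff n d L i) 0 = fls_nth (emb n (coeff L i)) (wt n d L + d * int i)"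
  by (simp add: slope_coeff_def add.commute)

lemma coeff_chi: "coeff (chi n d p L) i = fps_nth (slope_coeff n d L i) 0 * p powi (- d * tri i)"
proof (cases "i \<le> degree L")
  case False
  hence "coeff L i = 0" by (simp add: coeff_eq_0)
  hence "fps_nth (slope_coeff n d L i) 0 = 0" using n by (simp add: slope_coeff_0 emb_nth)
  thus ?thesis using False by (simp add: chi_def coeff_sum)
qed (simp add: chi_def coeff_sum)

text \<open>The support of \<open>chi\<close> consists of the points on the edge of slope d/n, which
  links it to the Newton polygon.\<close>

lemma coeff_chi_nonzero_iff:
  "coeff (chi n d p L) i \<noteq> 0 \<longleftrightarrow>
     coeff L i \<noteq> 0 \<and> int n * fls_subdegree (mfls (coeff L i)) - d * int i = wt n d L"
proof -
  have "coeff (chi n d p L) i \<noteq> 0 \<longleftrightarrow> fls_nth (emb n (coeff L i)) (wt n d L + d * int i) \<noteq> 0"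
    using p0 by (simp add: coeff_chi slope_coeff_0)
  also have "\<dots> \<longleftrightarrow> coeff L i \<noteq> 0 \<and> int n * fls_subdegree (mfls (coeff L i)) - d * int i = wt n d L"
  proof safe
    assume nz: "fls_nth (emb n (coeff L i)) (wt n d L + d * int i) \<noteq> 0"
    have dv: "int n dvd wt n d L + d * int i" and
      ge: "fls_subdegree (mfls (coeff L i)) \<le> (wt n d L + d * int i) div int n"
      using nz n by (auto simp: emb_nth fls_subdegree_leI split: if_splits)
    show False if "coeff L i = 0" using nz n that by (simp add: emb_nth split: if_splits)
    hence c: "coeff L i \<noteq> 0" by blast
    have "int n * fls_subdegree (mfls (coeff L i)) \<le> int n * ((wt n d L + d * int i) div int n)"
      using ge by (intro mult_left_mono) auto
    also have "\<dots> = wt n d L + d * int i" using dv by simp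
    finally show "int n * fls_subdegree (mfls (coeff L i)) - d * int i = wt n d L"
      using wt_le[OF c, of n d] by simp
  next
    assume c: "coeff L i \<noteq> 0" and e: "int n * fls_subdegree (mfls (coeff L i)) - d * int i = wt n d L"
      and z: "fls_nth (emb n (coeff L i)) (wt n d L + d * int i) = 0"
    have "wt n d L + d * int i = int n * fls_subdegree (mfls (coeff L i))" using e by simp
    hence "fls_nth (mfls (coeff L i)) (fls_subdegree (mfls (coeff L i))) = 0" using z n by (simp add: emb_nth)
    thus False using c by simp
  qed
  finally show ?thesis .
qed

lemma chi_nonzero: "L \<noteq> 0 \<Longrightarrow> chi n d p L \<noteq> 0"
proof -
  assume "L \<noteq> 0"
  then obtain i where "coeff L i \<noteq> 0" "wt n d L = int n * fls_subdegree (mfls (coeff L i)) - d * int i"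
    by (rule wt_attained)
  hence "coeff (chi n d p L) i \<noteq> 0" using coeff_chi_nonzero_iff by simp
  thus ?thesis by auto
qed

lemma emb_dilate: "fls_dil p (emb n c) = emb n (mero_dilate q c)"
proof (rule fls_eqI)
  fix k
  have q0: "q \<noteq> 0" using p0 pn by auto
  show "fls_nth (fls_dil p (emb n c)) k = fls_nth (emb n (mero_dilate q c)) k"
  proof (cases "int n dvd k")
    case True
    then obtain j where j: "k = int n * j" by (auto simp: dvd_def)
    have "p powi k = q powi j" using pn by (simp add: j power_int_mult)
    thus ?thesis using n p0 q0 by (simp add: emb_nth mfls_dilate j)
  qed (use n p0 in \<open>simp add: emb_nth\<close>)
qed

lemma semilinear_ssig: "semilinear (\<lambda>c y. emb n c * y) q UNIV (ssig p d \<eta>)"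
proof (intro semilinear.intro semilinear_axioms.intro)
  show vs: "vector_space (\<lambda>c y. emb n c * y)"
    by unfold_locales (use n in \<open>auto simp: emb_def algebra_simps\<close>)
  interpret vs: vector_space "\<lambda>c y. emb n c * y" by (rule vs)
  show "q \<noteq> 0" using p0 pn by auto
  show "vs.subspace UNIV" by (rule vs.subspace_UNIV)
  fix u v :: "'a fls" and c :: "'a mero"
  show "ssig p d \<eta> (u + v) = ssig p d \<eta> u + ssig p d \<eta> v"
    using p0 by (simp add: ssig_def fls_dil_add algebra_simps)
  show "ssig p d \<eta> (emb n c * v) = emb n (mero_dilate q c) * ssig p d \<eta> v"
  proof -
    have s: "fls_shift d (A * B) = A * fls_shift d B" for A B :: "'a fls"
      by (simp add: fls_shifted_times_simps)
    show ?thesis unfolding ssig_def fls_dil_mult[OF p0] emb_dilate s by (simp add: mult_ac)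
  qed
qed simp

abbreviation sact :: "'a \<Rightarrow> 'a mero poly \<Rightarrow> 'a fls \<Rightarrow> 'a fls" where
  "sact \<eta> \<equiv> act (\<lambda>c y. emb n c * y) (ssig p d \<eta>)"

lemma sact_conv:
  "sact \<eta> L y = fls_shift (- wt n d L) (\<Sum>i\<le>degree L. fps_to_fls (slope_coeff n d L i) *
     (fls_const (\<eta> ^ i * p powi (- d * tri i)) * fls_dil (p ^ i) y))"
proof -
  have pow: "(ssig p d \<eta> ^^ i) y = fls_shift (d * int i) (fls_const (\<eta> ^ i * p powi (- d * tri i)) * fls_dil (p ^ i) y)" for i
  proof (rule fls_eqI)
    fix k
    have "p powi (- d * tri i) * (p ^ i) powi (k + d * int i) = p powi (- d * tri i) * p powi (int i * (k + d * int i))"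
      by (simp only: power_int_mult power_int_of_nat)
    also have "\<dots> = p powi (- d * tri i + int i * (k + d * int i))"
      by (rule power_int_add[symmetric]) (use p0 in simp)
    finally have "p powi (int i * (k + d * int i) - d * tri i) = p powi (- d * tri i) * (p ^ i) powi (k + d * int i)"
      by simp
    thus "fls_nth ((ssig p d \<eta> ^^ i) y) k = fls_nth (fls_shift (d * int i) (fls_const (\<eta> ^ i * p powi (- d * tri i)) * fls_dil (p ^ i) y)) k"
      using p0 by (simp add: ssig_pow_nth mult_ac)
  qed
  have sh: "fls_shift m (sum f A) = (\<Sum>i\<in>A. fls_shift m (f i))" for m A and f :: "nat \<Rightarrow> 'a fls"
    by (induction A rule: infinite_finite_induct) auto
  show ?thesis
    unfolding act_def sh
    by (intro sum.cong refl) (simp add: emb_shift pow fls_shifted_times_simps)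
qed

text \<open>On a series starting with t^w, each a_i \<sigma>^i contributes to the lowest possible
  power according to the supporting line, and \<sigma>^i multiplies the leading term by (\<eta>
  p^w)^i. The sum of the contributions is a value of \<open>chi\<close>.\<close>

lemma sact_lead:
  assumes y: "\<And>k. k < w \<Longrightarrow> fls_nth y k = 0"
  shows "k < w + wt n d L \<Longrightarrow> fls_nth (sact \<eta> L y) k = 0"
    and "fls_nth (sact \<eta> L y) (w + wt n d L) = poly (chi n d p L) (\<eta> * p powi w) * fls_nth y w"
proof -
  have nth_sum: "fls_nth (sum f A) k = (\<Sum>i\<in>A. fls_nth (f i) k)" for k A and f :: "nat \<Rightarrow> 'a fls"
    by (induction A rule: infinite_finite_induct) auto
  define z where "z = (\<lambda>i. fls_const (\<eta> ^ i * p powi (- d * tri i)) * fls_dil (p ^ i) y)"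
  have zi: "fls_const (\<eta> ^ i * p powi (- d * tri i)) * fls_dil (p ^ i) y = z i" for i
    by (simp add: z_def)
  have z0: "k < w \<Longrightarrow> fls_nth (z i) k = 0" for i k using y p0 by (simp add: z_def)
  have s0: "k < 0 \<Longrightarrow> fls_nth (fps_to_fls (slope_coeff n d L i)) k = 0" for i k by simp
  note lb = fls_mult_lower_bound[OF s0 z0]
  show "k < w + wt n d L \<Longrightarrow> fls_nth (sact \<eta> L y) k = 0"
    unfolding sact_conv zi by (auto simp: nth_sum intro!: sum.neutral lb(1))
  have pc: "poly (chi n d p L) x = (\<Sum>i\<le>degree L. fps_nth (slope_coeff n d L i) 0 * p powi (- d * tri i) * x ^ i)" for x
    by (simp add: chi_def poly_sum poly_monom)
  have "fls_nth (sact \<eta> L y) (w + wt n d L) = (\<Sum>i\<le>degree L. fps_nth (slope_coeff n d L i) 0 * fls_nth (z i) w)"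
  proof -
    have "fls_nth (fps_to_fls (slope_coeff n d L i) * z i) w = fps_nth (slope_coeff n d L i) 0 * fls_nth (z i) w" for i
      using fls_mult_lower_bound(2)[of 0 "fps_to_fls (slope_coeff n d L i)" w "z i"] z0 by simp
    thus ?thesis unfolding sact_conv zi by (simp add: nth_sum)
  qed
  also have "\<dots> = (\<Sum>i\<le>degree L. fps_nth (slope_coeff n d L i) 0 * p powi (- d * tri i) * (\<eta> * p powi w) ^ i) * fls_nth y w"
    unfolding sum_distrib_right
  proof (intro sum.cong refl)
    fix i
    have "(p ^ i) powi w = (p powi w) ^ i"
      by (simp add: power_int_power power_int_power' mult.commute)
    thus "fps_nth (slope_coeff n d L i) 0 * fls_nth (z i) w =
       fps_nth (slope_coeff n d L i) 0 * p powi (- d * tri i) * (\<eta> * p powi w) ^ i * fls_nth y w"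
      using p0 by (simp add: z_def power_mult_distrib)
  qed
  finally show "fls_nth (sact \<eta> L y) (w + wt n d L) = poly (chi n d p L) (\<eta> * p powi w) * fls_nth y w"
    by (simp add: pc)
qed

lemma infinite_nonzero:
  assumes "non_root_of_unity p" shows "infinite (UNIV - {0 :: 'a})"
proof -
  have "inj (\<lambda>k :: int. p powi k)" using non_root_of_unityD(2)[OF assms] by (auto simp: inj_on_def)
  hence "infinite (range (\<lambda>k :: int. p powi k))" by (simp add: finite_image_iff)
  moreover have "range (\<lambda>k :: int. p powi k) \<subseteq> UNIV - {0}" using p0 by auto
  ultimately show ?thesis using finite_subset by blast
qed

lemma poly_eqI_nonzero:
  assumes "non_root_of_unity p" "\<And>x. x \<noteq> 0 \<Longrightarrow> poly f x = poly g (x :: 'a)" shows "f = g"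
proof (rule ccontr)
  assume "f \<noteq> g"
  hence "finite {x. poly (f - g) x = 0}" by (intro poly_roots_finite) auto
  moreover have "UNIV - {0} \<subseteq> {x. poly (f - g) x = 0}" using assms by auto
  ultimately show False using infinite_nonzero[OF assms(1)] finite_subset by blast
qed

text \<open>The operator acts on the series 1 for infinitely many \<eta>, and a polynomial is
  determined by its values there. So leading terms of the action determine both the weight and
  \<open>chi\<close>.\<close>

lemma chi_unique:
  assumes p: "non_root_of_unity p" and L: "L \<noteq> 0" and X: "X \<noteq> 0"
    and 1: "\<And>\<eta> k. \<eta> \<noteq> 0 \<Longrightarrow> k < W \<Longrightarrow> fls_nth (sact \<eta> L 1) k = 0"
    and 2: "\<And>\<eta>. \<eta> \<noteq> 0 \<Longrightarrow> fls_nth (sact \<eta> L 1) W = poly X \<eta>"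
  shows "W = wt n d L" "X = chi n d p L"
proof -
  have one: "k < 0 \<Longrightarrow> fls_nth 1 k = (0 :: 'a)" for k by simp
  have l: "k < wt n d L \<Longrightarrow> fls_nth (sact \<eta> L 1) k = 0"
    "fls_nth (sact \<eta> L 1) (wt n d L) = poly (chi n d p L) \<eta>" for \<eta> k
    using sact_lead[of 0 1, OF one] by auto
  have "\<not> W < wt n d L"
  proof
    assume "W < wt n d L"
    hence "\<eta> \<noteq> 0 \<Longrightarrow> poly X \<eta> = poly 0 \<eta>" for \<eta> using l(1) 2 by (metis poly_0)
    thus False using poly_eqI_nonzero[OF p] X by blast
  qed
  moreover have "\<not> wt n d L < W"
  proof
    assume "wt n d L < W"
    hence "\<eta> \<noteq> 0 \<Longrightarrow> poly (chi n d p L) \<eta> = poly 0 \<eta>" for \<eta> using l(2) 1 by (metis poly_0)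
    thus False using poly_eqI_nonzero[OF p] chi_nonzero[OF L] by blast
  qed
  ultimately show W: "W = wt n d L" by simp
  show "X = chi n d p L" by (rule poly_eqI_nonzero[OF p]) (use l 2 W in auto)
qed

text \<open>P R acts on 1 by R and then by P. After R the series starts with t to the weight of R,
  so by \<open>sact_lead\<close> the polynomial of P is evaluated at an argument shifted by that
  power of p.\<close>

lemma chi_skew_mult:
  assumes p: "non_root_of_unity p" and P: "P \<noteq> 0" and R: "R \<noteq> 0"
  shows "wt n d (skew_mult q P R) = wt n d P + wt n d R"
    "chi n d p (skew_mult q P R) = pcompose (chi n d p P) [:0, p powi wt n d R:] * chi n d p R"
proof -
  have q0: "q \<noteq> 0" using p0 pn by auto
  let ?X = "pcompose (chi n d p P) [:0, p powi wt n d R:] * chi n d p R"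
  have X: "?X \<noteq> 0" using chi_nonzero P R p0 by (simp add: pcompose_eq_0_iff)
  have one: "k < 0 \<Longrightarrow> fls_nth 1 k = (0 :: 'a)" for k by simp
  have S: "sact \<eta> (skew_mult q P R) 1 = sact \<eta> P (sact \<eta> R 1)" for \<eta>
  proof -
    interpret S: semilinear "\<lambda>c y. emb n c * y" q UNIV "ssig p d \<eta>" by (rule semilinear_ssig)
    show ?thesis by (simp add: S.act_skew_mult)
  qed
  have r: "k < wt n d R \<Longrightarrow> fls_nth (sact \<eta> R 1) k = 0"
    "fls_nth (sact \<eta> R 1) (wt n d R) = poly (chi n d p R) \<eta>" for \<eta> k
    using sact_lead[of 0 1, OF one] by auto
  note u = sact_lead[OF r(1), where L = P]
  have A: "fls_nth (sact \<eta> (skew_mult q P R) 1) k = 0" if "k < wt n d P + wt n d R" for \<eta> k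
    using u(1) that by (simp add: S add.commute)
  have B: "fls_nth (sact \<eta> (skew_mult q P R) 1) (wt n d P + wt n d R) = poly ?X \<eta>" for \<eta>
    using sact_lead(2)[where y = "sact \<eta> R 1" and w = "wt n d R" and L = P and \<eta> = \<eta>, OF r(1)] by (simp add: S r poly_pcompose add.commute[of "wt n d P"])
  have "wt n d P + wt n d R = wt n d (skew_mult q P R)" "?X = chi n d p (skew_mult q P R)"
    using chi_unique[OF p skew_mult_degree(2)[OF q0 P R] X, of "wt n d P + wt n d R"] A B by blast+
  thus "wt n d (skew_mult q P R) = wt n d P + wt n d R" "chi n d p (skew_mult q P R) = ?X" by simp_all
qed

end

subsection \<open>Geometric lower bounds for products\<close>

definition geometric :: "(nat \<Rightarrow> real) \<Rightarrow> bool" where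
  "geometric f \<longleftrightarrow> (\<forall>k. 0 < f k) \<and> (\<exists>c>0. \<forall>N. c ^ N \<le> (\<Prod>k<N. f k))"

lemma geometric_const: "c > 0 \<Longrightarrow> geometric (\<lambda>_. c)"
  by (auto simp: geometric_def)

lemma geometric_mult:
  assumes "geometric f" "geometric g" shows "geometric (\<lambda>k. f k * g k)"
proof -
  obtain b c where bc: "b > 0" "c > 0" "\<And>N. b ^ N \<le> (\<Prod>k<N. f k)" "\<And>N. c ^ N \<le> (\<Prod>k<N. g k)"
    using assms by (auto simp: geometric_def)
  have "(b * c) ^ N \<le> (\<Prod>k<N. f k * g k)" for N
    unfolding power_mult_distrib prod.distrib using bc by (intro mult_mono) (auto intro!: prod_nonneg assms simp: less_imp_le assms[unfolded geometric_def])
  thus ?thesis using assms bc unfolding geometric_def by (auto intro!: exI[of _ "b * c"])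
qed

lemma geometric_prod_mset:
  "(\<And>z. z \<in># A \<Longrightarrow> geometric (f z)) \<Longrightarrow> geometric (\<lambda>k. \<Prod>z\<in>#A. f z k)"
  by (induction A) (auto intro!: geometric_mult geometric_const)

lemma geometric_divisor: "tame q \<rho> \<Longrightarrow> geometric (divisor q \<rho>)"
  by (simp add: tame_def geometric_def)

lemma absv_prod_mset: "absv (\<Prod>z\<in>#A. f z :: 'a :: valued_field) = (\<Prod>z\<in>#A. absv (f z))"
  by (induction A) (auto simp: absv_mult)

text \<open>Over an algebraically closed field the polynomial splits, and |X(z p^k)| becomes a
  product of small divisors for the ratios z/w, one for each nonzero root w.\<close>

lemma geometric_poly:
  fixes X :: "'a :: base_field poly"
  assumes X: "X \<noteq> 0" and z: "z \<noteq> 0" and p: "absv p = 1"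
    and nz: "\<And>k. k \<ge> 1 \<Longrightarrow> poly X (z * p ^ k) \<noteq> 0"
    and tame: "\<And>w. w \<noteq> 0 \<Longrightarrow> poly X w = 0 \<Longrightarrow> tame p (z / w)"
  obtains \<delta> where "geometric \<delta>" "\<And>k. k \<ge> 1 \<Longrightarrow> \<delta> k = absv (poly X (z * p ^ k))"
proof -
  obtain A where A: "X = smult (lead_coeff X) (\<Prod>w\<in>#A. [:- w, 1:])"
    using alg_closed_imp_factorization[OF X] by blast
  have root: "poly X w = 0" if "w \<in># A" for w
    by (subst A) (use that in \<open>auto simp: poly_prod_mset prod_mset_zero_iff\<close>)
  \<comment> \<open>At k = 0 a root w = z contributes the conventional divisor 1, so \<delta> stays
    positive although z may itself be a root.\<close>
  define \<delta> where "\<delta> = (\<lambda>k. absv (lead_coeff X) *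
    (\<Prod>w\<in>#A. if w = 0 then absv z else absv w * divisor p (z / w) k))"
  have "geometric \<delta>"
    unfolding \<delta>_def
  proof (intro geometric_mult geometric_const geometric_prod_mset)
    fix w assume "w \<in># A"
    hence "poly X w = 0" by (rule root)
    thus "geometric (\<lambda>k. if w = 0 then absv z else absv w * divisor p (z / w) k)"
      using z tame[of w] by (cases "w = 0") (auto intro!: geometric_mult geometric_const geometric_divisor simp: absv_pos_iff)
  qed (use X in \<open>simp add: absv_pos_iff\<close>)
  moreover have "\<delta> k = absv (poly X (z * p ^ k))" if k: "k \<ge> 1" for k
  proof -
    have "absv (poly X (z * p ^ k)) = absv (poly (smult (lead_coeff X) (\<Prod>w\<in>#A. [:- w, 1:])) (z * p ^ k))"
      by (subst A) simp
    also have "\<dots> = absv (lead_coeff X) * (\<Prod>w\<in>#A. absv (z * p ^ k - w))"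
      by (simp add: absv_mult poly_prod_mset absv_prod_mset image_mset.compositionality o_def algebra_simps)
    also have "(\<Prod>w\<in>#A. absv (z * p ^ k - w)) =
      (\<Prod>w\<in>#A. if w = 0 then absv z else absv w * divisor p (z / w) k)"
    proof (intro arg_cong[of _ _ prod_mset] image_mset_cong)
      fix w assume "w \<in># A"
      hence w: "poly X w = 0" by (rule root)
      hence ne: "z * p ^ k \<noteq> w" using nz[OF k] by auto
      show "absv (z * p ^ k - w) = (if w = 0 then absv z else absv w * divisor p (z / w) k)"
      proof (cases "w = 0")
        case False
        have "z * p ^ k - w = - (w * (1 - p ^ k * (z / w)))" using False by (simp add: field_simps)
        hence "absv (z * p ^ k - w) = absv w * absv (1 - p ^ k * (z / w))" by (simp only: absv_uminus absv_mult)
        moreover have "p ^ k * (z / w) \<noteq> 1" using False ne by (auto simp: field_simps)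
        ultimately show ?thesis using False by (simp add: divisor_def)
      qed (use p in \<open>simp add: absv_mult absv_power\<close>)
    qed
    finally show ?thesis by (simp add: \<delta>_def)
  qed
  ultimately show ?thesis using that by blast
qed

lemma convergent_coeffs_uniform:
  assumes "finite I" "\<And>i. i \<in> I \<Longrightarrow> convergent_coeffs (f i)"
  obtains A B where "A > 0" "B \<ge> 1" "\<And>i k. i \<in> I \<Longrightarrow> absv (f i k) \<le> A * B ^ k"
  using assms
proof (induction I arbitrary: thesis rule: finite_induct)
  case empty
  thus ?case using empty(1)[of 1 1] by simp
next
  case (insert i I)
  obtain A B where 1: "A > 0" "B \<ge> 1" "\<And>j k. j \<in> I \<Longrightarrow> absv (f j k) \<le> A * B ^ k"
    using insert.IH insert.prems by blast
  obtain A' B' where 2: "A' > 0" "B' \<ge> 1" "\<And>k. absv (f i k) \<le> A' * B' ^ k"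
    using insert.prems(2)[of i] by (auto elim: convergent_coeffsE)
  show ?case
  proof (rule insert.prems(1)[of "max A A'" "max B B'"])
    fix j k assume "j \<in> insert i I"
    hence "absv (f j k) \<le> A * B ^ k \<or> absv (f j k) \<le> A' * B' ^ k" using 1(3) 2(3) by auto
    moreover have "A * B ^ k \<le> max A A' * max B B' ^ k" "A' * B' ^ k \<le> max A A' * max B B' ^ k"
      using 1 2 by (auto intro!: mult_mono power_mono)
    ultimately show "absv (f j k) \<le> max A A' * max B B' ^ k" by linarith
  qed (use 1 2 in auto)
qed

subsection \<open>Solutions attached to a slope\<close>

lemma conv_fls_compose_power: "conv_fls F \<Longrightarrow> n \<ge> 1 \<Longrightarrow> conv_fls (fls_compose_power F n)"
proof -
  assume "conv_fls F" and n: "n \<ge> 1"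
  then obtain A B where AB: "A > 0" "B \<ge> 1" "\<And>k. absv (fls_nth F (int k)) \<le> A * B ^ k"
    unfolding conv_fls_def by (elim convergent_coeffsE) blast
  show "conv_fls (fls_compose_power F n)"
  proof (rule conv_flsI[of B])
    fix k
    have "absv (fls_nth F (int (k div n))) \<le> A * B ^ (k div n)" by (rule AB)
    also have "\<dots> \<le> A * B ^ k" using AB by (intro mult_left_mono power_increasing) auto
    finally show "absv (fls_nth (fls_compose_power F n) (int k)) \<le> A * B ^ k"
      using n AB by (cases "n dvd k") auto
  qed (use AB in auto)
qed

lemma conv_fls_dil: "absv p = 1 \<Longrightarrow> conv_fls F \<Longrightarrow> conv_fls (fls_dil p F)"
proof -
  assume p: "absv p = 1" and "conv_fls F"
  then obtain A B where AB: "A > 0" "B \<ge> 1" "\<And>k. absv (fls_nth F (int k)) \<le> A * B ^ k"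
    unfolding conv_fls_def by (elim convergent_coeffsE) blast
  have "p \<noteq> 0" using p by auto
  thus ?thesis using AB p by (intro conv_flsI[of B _ A]) (auto simp: absv_mult absv_powi absv_power)
qed

lemma conv_fls_const: "conv_fls (fls_const c)"
  using conv_mfls[of "mconst c"] by simp

context
  fixes n :: nat and d :: int and p q :: "'a :: base_field"
  assumes n: "n \<ge> 1" and pn: "p ^ n = q" and p0: "p \<noteq> 0"
begin

abbreviation sact' :: "'a \<Rightarrow> 'a mero poly \<Rightarrow> 'a fls \<Rightarrow> 'a fls" where
  "sact' \<eta> \<equiv> act (\<lambda>c y. emb n c * y) (ssig p d \<eta>)"

text \<open>The factor with which the coefficient of index j of a series enters the coefficient of
  index j + m of its image, up to the overall shift by the weight.\<close>

definition kernel_coeff :: "'a \<Rightarrow> 'a mero poly \<Rightarrow> nat \<Rightarrow> nat \<Rightarrow> 'a" where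
  "kernel_coeff \<eta> L j m = (\<Sum>i\<le>degree L. fps_nth (slope_coeff n d L i) m * (\<eta> ^ i * p powi (- d * tri i) * p ^ (i * j)))"

lemma kernel_coeff_0: "kernel_coeff \<eta> L j 0 = poly (chi n d p L) (\<eta> * p ^ j)"
  by (simp add: kernel_coeff_def chi_def poly_sum poly_monom power_mult_distrib mult_ac power_mult[symmetric])

lemma sact_fps_zero_iff:
  "sact' \<eta> L (fps_to_fls Y) = 0 \<longleftrightarrow> (\<forall>k. (\<Sum>j\<le>k. kernel_coeff \<eta> L j (k - j) * fps_nth Y j) = 0)"
proof -
  define Z where "Z = (\<lambda>i. fps_const (\<eta> ^ i * p powi (- d * tri i)) * Abs_fps (\<lambda>k. p ^ (i * k) * fps_nth Y k))"
  define S where "S = (\<Sum>i\<le>degree L. slope_coeff n d L i * Z i)"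
  have Z: "fls_const (\<eta> ^ i * p powi (- d * tri i)) * fls_dil (p ^ i) (fps_to_fls Y) = fps_to_fls (Z i)" for i
    by (intro fls_eqI) (use p0 in \<open>auto simp: Z_def power_int_def mult_ac simp flip: power_mult\<close>)
  have fs: "fps_to_fls (sum f A) = (\<Sum>i\<in>A. fps_to_fls (f i))" for A and f :: "nat \<Rightarrow> 'a fps"
    by (induction A rule: infinite_finite_induct) auto
  have "sact' \<eta> L (fps_to_fls Y) = fls_shift (- wt n d L) (fps_to_fls S)"
    unfolding sact_conv[OF n pn p0] Z S_def fs by (simp add: fls_times_fps_to_fls)
  hence zero: "sact' \<eta> L (fps_to_fls Y) = 0 \<longleftrightarrow> (\<forall>k. fps_nth S k = 0)"
    by (simp add: fls_shift_eq0_iff fps_eq_iff)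
  have "fps_nth S k = (\<Sum>j\<le>k. kernel_coeff \<eta> L j (k - j) * fps_nth Y j)" for k
  proof -
    have "fps_nth S k = (\<Sum>i\<le>degree L. \<Sum>j\<le>k. fps_nth (Z i) j * fps_nth (slope_coeff n d L i) (k - j))"
      unfolding S_def fps_sum_nth by (intro sum.cong refl) (subst mult.commute, simp add: fps_mult_nth atLeast0AtMost)
    also have "\<dots> = (\<Sum>j\<le>k. \<Sum>i\<le>degree L. fps_nth (Z i) j * fps_nth (slope_coeff n d L i) (k - j))"
      by (rule sum.swap)
    also have "\<dots> = (\<Sum>j\<le>k. kernel_coeff \<eta> L j (k - j) * fps_nth Y j)"
      by (intro sum.cong refl) (simp add: kernel_coeff_def Z_def sum_distrib_left mult_ac)
    finally show ?thesis .
  qed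
  thus ?thesis by (simp add: zero)
qed

text \<open>The coefficient of index k has the factor chi(\<eta> p^k). It is zero for k = 0, which
  leaves the first coefficient free, and nonzero afterwards, so the rest is determined
  recursively.\<close>

lemma formal_solution:
  assumes root: "poly (chi n d p L) \<eta> = 0"
    and nroot: "\<And>k. k \<ge> 1 \<Longrightarrow> poly (chi n d p L) (\<eta> * p ^ k) \<noteq> 0"
  obtains Y where "fps_nth Y 0 = 1" "sact' \<eta> L (fps_to_fls Y) = 0"
proof -
  define H where "H = (\<lambda>k (u :: nat \<Rightarrow> 'a). if k = 0 then 1 else
    - (\<Sum>j<k. kernel_coeff \<eta> L j (k - j) * u j) / poly (chi n d p L) (\<eta> * p ^ k))"
  obtain u where u: "\<And>k. u k = H k (\<lambda>j. if j < k then u j else undefined)"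
    using wf_rec_exists[of H] by blast
  have u: "u k = (if k = 0 then 1 else
    - (\<Sum>j<k. kernel_coeff \<eta> L j (k - j) * u j) / poly (chi n d p L) (\<eta> * p ^ k))" for k
    by (subst u) (simp add: H_def)
  have "(\<Sum>j\<le>k. kernel_coeff \<eta> L j (k - j) * fps_nth (Abs_fps u) j) = 0" for k
  proof (cases "k = 0")
    case True
    thus ?thesis using root by (simp add: kernel_coeff_0)
  next
    case False
    have "{..k} = insert k {..<k}" by auto
    thus ?thesis using False nroot[of k] u[of k] by (simp add: kernel_coeff_0)
  qed
  hence "sact' \<eta> L (fps_to_fls (Abs_fps u)) = 0" by (simp add: sact_fps_zero_iff)
  thus ?thesis using that[of "Abs_fps u"] u[of 0] by simp
qed

text \<open>The recursion has the divisors |chi(\<eta> p^k)|, whose products are bounded below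
  geometrically by \<open>geometric_poly\<close>; \<open>geometric_majorant\<close>
  concludes.\<close>

lemma solution_convergent:
  assumes p1: "absv p = 1" and L: "L \<noteq> 0" and z: "\<eta> \<noteq> 0"
    and nroot: "\<And>k. k \<ge> 1 \<Longrightarrow> poly (chi n d p L) (\<eta> * p ^ k) \<noteq> 0"
    and tame: "\<And>w. w \<noteq> 0 \<Longrightarrow> poly (chi n d p L) w = 0 \<Longrightarrow> tame p (\<eta> / w)"
    and Y: "sact' \<eta> L (fps_to_fls Y) = 0"
  shows "conv_fls (fps_to_fls Y)"
proof -
  have X: "chi n d p L \<noteq> 0" using chi_nonzero[OF n pn p0 L] .
  obtain \<delta> where \<delta>: "geometric \<delta>" "\<And>k. k \<ge> 1 \<Longrightarrow> \<delta> k = absv (poly (chi n d p L) (\<eta> * p ^ k))"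
    using geometric_poly[OF X z p1 nroot tame] by blast
  obtain c where c: "c > 0" "\<And>N. c ^ N \<le> (\<Prod>k<N. \<delta> k)" and \<delta>0: "\<And>k. \<delta> k > 0"
    using \<delta>(1) by (auto simp: geometric_def)
  have cs: "convergent_coeffs (fps_nth (slope_coeff n d L i))" for i
  proof -
    have "conv_fls (fls_shift (- (wt n d L + d * int i)) (fps_to_fls (slope_coeff n d L i)))"
      unfolding emb_shift[OF n pn p0, symmetric] emb_def by (rule conv_fls_compose_power[OF _ n]) simp
    thus ?thesis by simp
  qed
  obtain A B where AB: "A > 0" "B \<ge> 1" "\<And>i k. i \<in> {..degree L} \<Longrightarrow> absv (fps_nth (slope_coeff n d L i) k) \<le> A * B ^ k"
    using convergent_coeffs_uniform[of "{..degree L}" "\<lambda>i. fps_nth (slope_coeff n d L i)"] cs by auto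
  define C where "C = (\<Sum>i\<le>degree L. absv \<eta> ^ i)"
  have C: "C \<ge> 0" unfolding C_def by (intro sum_nonneg) (simp add: absv_nonneg)
  have kb: "absv (kernel_coeff \<eta> L j m) \<le> (A * C) * B ^ m" for j m
  proof -
    have "absv (kernel_coeff \<eta> L j m) \<le> (\<Sum>i\<le>degree L. absv (fps_nth (slope_coeff n d L i) m) * absv \<eta> ^ i)"
      unfolding kernel_coeff_def
      by (rule order_trans[OF absv_sum_le]) (simp add: absv_mult absv_power absv_powi p1)
    also have "\<dots> \<le> (\<Sum>i\<le>degree L. (A * B ^ m) * absv \<eta> ^ i)"
      by (intro sum_mono mult_right_mono AB) (auto simp: absv_nonneg)
    also have "\<dots> = (A * C) * B ^ m" by (simp add: C_def sum_distrib_left mult_ac)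
    finally show ?thesis .
  qed
  define G where "G = max (\<delta> 0) (A * C)"
  have \<delta>G: "\<delta> k \<le> G" for k
  proof (cases "k = 0")
    case False
    thus ?thesis using kb[of k 0] \<delta>(2)[of k] by (simp add: kernel_coeff_0 G_def)
  qed (simp add: G_def)
  have rec: "absv (fps_nth Y k) * \<delta> k \<le> (absv (fps_nth Y 0) * \<delta> 0) * B ^ k + (\<Sum>j<k. (A * C) * B ^ (k - j) * absv (fps_nth Y j))" for k
  proof (cases "k = 0")
    case False
    have "{..k} = insert k {..<k}" by auto
    hence "fps_nth Y k * poly (chi n d p L) (\<eta> * p ^ k) = - (\<Sum>j<k. kernel_coeff \<eta> L j (k - j) * fps_nth Y j)"
      using Y[unfolded sact_fps_zero_iff] spec[OF Y[unfolded sact_fps_zero_iff], of k]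
      by (simp add: kernel_coeff_0 eq_neg_iff_add_eq_0 mult.commute)
    hence "absv (fps_nth Y k) * \<delta> k = absv (\<Sum>j<k. kernel_coeff \<eta> L j (k - j) * fps_nth Y j)"
      using \<delta>(2)[of k] False by (simp flip: absv_mult)
    also have "\<dots> \<le> (\<Sum>j<k. (A * C) * B ^ (k - j) * absv (fps_nth Y j))"
      by (intro order_trans[OF absv_sum_le] sum_mono) (simp add: absv_mult mult_right_mono kb absv_nonneg)
    also have "\<dots> \<le> (absv (fps_nth Y 0) * \<delta> 0) * B ^ k + \<dots>"
      using AB \<delta>0[of 0] by (simp add: absv_nonneg less_imp_le)
    finally show ?thesis .
  qed simp
  obtain A' B' where "A' \<ge> 0" "B' \<ge> 1" "\<And>k. absv (fps_nth Y k) \<le> A' * B' ^ k"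
    by (rule geometric_majorant[of "\<lambda>k. absv (fps_nth Y k)" \<delta> G c "A * C" B "absv (fps_nth Y 0) * \<delta> 0"])
       (use \<delta>0 \<delta>G c AB C rec in \<open>auto simp: absv_nonneg less_imp_le\<close>)
  thus ?thesis by (intro conv_flsI[of B' _ A']) auto
qed

end

lemma poly_nonzero_root:
  fixes f :: "'a :: alg_closed_field poly"
  assumes "coeff f i \<noteq> 0" "coeff f j \<noteq> 0" "i < j"
  obtains z where "z \<noteq> 0" "poly f z = 0"
proof -
  have f0: "f \<noteq> 0" using assms by auto
  obtain g where g: "f = [:- 0, 1:] ^ order 0 f * g" "\<not> [:- 0, 1:] dvd g"
    using order_decomp[OF f0] by blast
  have fm: "f = monom 1 (order 0 f) * g" using g(1) by (simp add: monom_altdef)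
  have g0: "g \<noteq> 0" "poly g 0 \<noteq> 0" using g f0 by (auto simp: poly_eq_0_iff_dvd)
  have "degree g > 0"
  proof (rule ccontr)
    assume "\<not> degree g > 0"
    hence "coeff g k = 0" if "k > 0" for k using that by (simp add: coeff_eq_0)
    moreover have "coeff f k = (if k < order 0 f then 0 else coeff g (k - order 0 f))" for k
      using arg_cong[OF fm, of "\<lambda>h. coeff h k"] by (simp add: coeff_monom_mult)
    ultimately have "coeff f k \<noteq> 0 \<Longrightarrow> k = order 0 f" for k
      by (metis diff_is_0_eq linorder_not_less order_antisym zero_less_iff_neq_zero)
    thus False using assms by (metis less_irrefl)
  qed
  then obtain z where z: "poly g z = 0" using alg_closed_imp_poly_has_root by blast
  have "poly f z = 0" using z by (subst fm) simp
  thus ?thesis using that z g0 by metis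
qed

text \<open>There are finitely many roots, and the orbit z p^k has no repetition, so some root is
  the last on its orbit. For such a root the recursion of \<open>formal_solution\<close> never
  divides by zero.\<close>

lemma maximal_root:
  fixes f :: "'a :: field poly"
  assumes f: "f \<noteq> 0" and p: "non_root_of_unity p" and z: "z \<noteq> 0" "poly f z = 0"
  obtains w where "w \<noteq> 0" "poly f w = 0" "\<And>k. k \<ge> 1 \<Longrightarrow> poly f (w * p ^ k) \<noteq> 0"
proof -
  have p0: "p \<noteq> 0" by (rule non_root_of_unityD[OF p])
  define K where "K = {k. poly f (z * p ^ k) = 0}"
  have "inj (\<lambda>k :: nat. z * p ^ k)"
    using non_root_of_unityD(2)[OF p, of "int _" "int _"] z by (auto simp: inj_on_def)
  hence "finite K" unfolding K_def using finite_vimageI[OF poly_roots_finite[OF f], of "\<lambda>k. z * p ^ k"]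
    by (simp add: vimage_def)
  moreover have "0 \<in> K" using z by (simp add: K_def)
  ultimately have m: "Max K \<in> K" "\<And>k. k \<in> K \<Longrightarrow> k \<le> Max K"
    using Max_in[of K] Max_ge[of K] by blast+
  show ?thesis
  proof (rule that[of "z * p ^ Max K"])
    show "poly f (z * p ^ Max K) = 0" using m(1) by (simp add: K_def)
    fix k :: nat assume "k \<ge> 1"
    hence "Max K + k \<notin> K" using m(2)[of "Max K + k"] by auto
    thus "poly f (z * p ^ Max K * p ^ k) \<noteq> 0" by (simp add: K_def power_add mult.assoc)
  qed (use z p0 in simp)
qed

text \<open>The first edge of the Newton polygon, from index 0 to an index i minimising the slope of
  the line through the two points, written in lowest terms.\<close>

lemma slope_exists:
  fixes L :: "'a :: valued_field mero poly"
  assumes L0: "coeff L 0 \<noteq> 0" and deg: "degree L \<ge> 1"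
  obtains n d i where "n \<ge> 1" "coprime (int n) d" "i \<ge> 1"
    "\<And>p :: 'a. p \<noteq> 0 \<Longrightarrow> coeff (chi n d p L) 0 \<noteq> 0 \<and> coeff (chi n d p L) i \<noteq> 0"
proof -
  define w where "w = (\<lambda>i. fls_subdegree (mfls (coeff L i)))"
  define I where "I = {i. coeff L i \<noteq> 0} - {0}"
  define f where "f = (\<lambda>i. real_of_int (w i - w 0) / real i)"
  have I: "finite I" unfolding I_def using finite_coeff_nonzero[of L] by simp
  have "degree L \<in> I" using deg unfolding I_def by auto
  hence "Min (f ` I) \<in> f ` I" using I by (intro Min_in) auto
  then obtain i where i: "i \<in> I" "f i = Min (f ` I)" by auto
  have le: "f i \<le> f j" if "j \<in> I" for j using i I that by simp
  have i1: "i \<ge> 1" using i by (auto simp: I_def)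
  define g where "g = gcd (int i) (w i - w 0)"
  define n where "n = nat (int i div g)"
  define d where "d = (w i - w 0) div g"
  have g: "g > 0" using i1 by (simp add: g_def)
  have ni: "int i = int n * g" and dw: "w i - w 0 = d * g"
    using g by (simp_all add: n_def d_def g_def pos_imp_zdiv_nonneg_iff)
  have n: "n \<ge> 1" using ni i1 g by (cases n) auto
  have cop: "coprime (int n) d"
  proof -
    have "coprime (int i div g) ((w i - w 0) div g)"
      unfolding g_def using i1 by (intro div_gcd_coprime) auto
    moreover have "int n = int i div g" using ni g by simp
    ultimately show ?thesis by (simp add: d_def)
  qed
  have ge: "int n * w 0 \<le> int n * w j - d * int j" if j: "coeff L j \<noteq> 0" for j
  proof (cases "j = 0")
    case False
    hence "f i \<le> f j" using le j by (auto simp: I_def)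
    moreover have "f i = real_of_int d / real n"
    proof -
      have "real i = real n * of_int g" using arg_cong[OF ni, of real_of_int] by simp
      thus ?thesis unfolding f_def dw using g n by simp
    qed
    ultimately have "of_int d / real n \<le> real_of_int (w j - w 0) / real j" by (simp add: f_def)
    hence "of_int d * real j \<le> real_of_int (w j - w 0) * real n"
      using False n by (simp add: field_simps)
    hence "real_of_int (d * int j) \<le> real_of_int ((w j - w 0) * int n)" by simp
    hence "d * int j \<le> (w j - w 0) * int n" by (simp only: of_int_le_iff)
    thus ?thesis by (simp add: algebra_simps)
  qed simp
  have eq: "int n * w i - d * int i = int n * w 0"
  proof -
    have "int n * (w i - w 0) = d * int i" by (simp add: ni dw)
    thus ?thesis by (simp add: algebra_simps)
  qed
  have wt: "wt n d L = int n * w 0"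
  proof (rule antisym)
    show "wt n d L \<le> int n * w 0" using wt_le[OF L0, of n d] by (simp add: w_def)
    have "L \<noteq> 0" using L0 by auto
    then obtain j where "coeff L j \<noteq> 0" "wt n d L = int n * w j - d * int j"
      unfolding w_def by (rule wt_attained)
    thus "int n * w 0 \<le> wt n d L" using ge by simp
  qed
  show ?thesis
  proof (rule that[OF n cop i1])
    fix p :: 'a assume p: "p \<noteq> 0"
    show "coeff (chi n d p L) 0 \<noteq> 0 \<and> coeff (chi n d p L) i \<noteq> 0"
      using L0 i eq by (auto simp: coeff_chi_nonzero_iff[OF n refl p] wt w_def I_def)
  qed
qed

subsection \<open>Eigenvectors of the slope operator on Laurent series\<close>

text \<open>The operator T attached to the slope d/n. If \<Sigma> e = x^(-d) e, then e is fixed by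
  x^d \<Sigma>, so T cancels the slope.\<close>

definition slope_op :: "('a :: valued_field mero \<Rightarrow> 'b \<Rightarrow> 'b) \<Rightarrow> ('b \<Rightarrow> 'b) \<Rightarrow> nat \<Rightarrow> int \<Rightarrow> 'b \<Rightarrow> 'b" where
  "slope_op smul \<Sigma> n d v = smul (mero_X powi d) ((\<Sigma> ^^ n) v)"

lemma emb_X: "n \<ge> 1 \<Longrightarrow> emb n (mero_X powi k) = fls_X_intpow (int n * k)"
  by (simp add: emb_def)

context
  fixes n :: nat and d :: int and p q :: "'a :: valued_field"
  assumes n: "n \<ge> 1" and pn: "p ^ n = q" and p0: "p \<noteq> 0"
begin

lemma slope_op_ssig_nth:
  "fls_nth (slope_op (\<lambda>c y. emb n c * y) (ssig p d \<eta>) n' d' y) k =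
     \<eta> ^ n' * p powi (int n' * (k - int n * d' + d * int n') - d * tri n') * fls_nth y (k - int n * d' + d * int n')"
  unfolding slope_op_def emb_X[OF n] by (simp add: fls_shifted_times_simps ssig_pow_nth[OF p0])

text \<open>The powers of t cancel, and T becomes a constant times the dilation t \<mapsto> qt. The
  constant is the eigenvalue that the root \<eta> contributes.\<close>

lemma slope_op_ssig_same:
  "slope_op (\<lambda>c y. emb n c * y) (ssig p d \<eta>) n d y = fls_const (\<eta> ^ n * p powi (- d * tri n)) * fls_dil q y"
proof (rule fls_eqI)
  fix k
  have q0: "q \<noteq> 0" using p0 pn by auto
  have "p powi (int n * k - d * tri n) = p powi (int n * k) * p powi (- d * tri n)"
    using power_int_add[of p "int n * k" "- d * tri n"] p0 by simp
  also have "p powi (int n * k) = q powi k" by (simp add: power_int_mult pn)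
  finally have "p powi (int n * k - d * tri n) = q powi k * p powi (- d * tri n)" .
  thus "fls_nth (slope_op (\<lambda>c y. emb n c * y) (ssig p d \<eta>) n d y) k =
      fls_nth (fls_const (\<eta> ^ n * p powi (- d * tri n)) * fls_dil q y) k"
    using q0 unfolding slope_op_ssig_nth by (simp add: mult_ac)
qed

text \<open>For another slope the operator changes the order of a nonzero series by a fixed nonzero
  amount, so it has no eigenvector with nonzero eigenvalue.\<close>

lemma slope_op_ssig_other:
  assumes s: "d * int n' \<noteq> int n * d'" and z: "\<eta> \<noteq> 0" and c: "c \<noteq> 0"
    and eq: "slope_op (\<lambda>c y. emb n c * y) (ssig p d \<eta>) n' d' y = fls_const c * y"
  shows "y = 0"
proof (rule ccontr)
  assume y: "y \<noteq> 0"
  define s where "s = d * int n' - int n * d'"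
  define w where "w = fls_subdegree y"
  have nth: "fls_nth (fls_const c * y) k =
     \<eta> ^ n' * p powi (int n' * (k + s) - d * tri n') * fls_nth y (k + s)" for k
    unfolding eq[symmetric] slope_op_ssig_nth s_def by (simp add: algebra_simps)
  have yw: "fls_nth y w \<noteq> 0" "\<And>k. k < w \<Longrightarrow> fls_nth y k = 0" using y by (auto simp: w_def)
  show False
  proof (cases "s > 0")
    case True
    thus False using nth[of "w - s"] yw z p0 by simp
  next
    case False
    hence "s < 0" using s by (simp add: s_def)
    thus False using nth[of w] yw c by simp
  qed
qed

end

text \<open>Elements of \<open>K\<close> are series in t^n, so multiplication by them acts
  separately on each residue class of exponents modulo n.\<close>

lemma emb_mult_component:
  fixes y :: "'a :: valued_field fls"
  assumes n: "n \<ge> 1" and j: "j < n" and g: "\<And>k. fls_nth G k = fls_nth y (int n * k + int j)"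
  shows "fls_nth (emb n c * y) (int n * k + int j) = fls_nth (mfls c * G) k"
proof -
  define y1 where "y1 = fls_X_intpow (int j) * fls_compose_power G n"
  define y2 where "y2 = y - y1"
  have y1: "fls_nth y1 m = (if int n dvd m - int j then fls_nth G ((m - int j) div int n) else 0)" for m
    using n unfolding y1_def by (simp add: fls_nth_compose_power fls_shifted_times_simps)
  have y2: "fls_nth y2 (int n * m + int j) = 0" for m
    using n g unfolding y2_def by (simp add: y1)
  have "fls_nth (emb n c * y2) (int n * k + int j) = 0"
  proof -
    have "fls_nth (emb n c * y2) (int n * k + int j) = (\<Sum>i\<in>{fls_subdegree (emb n c)..int n * k + int j - fls_subdegree y2}.
        fls_nth (emb n c) i * fls_nth y2 (int n * k + int j - i))"
      by (rule fls_times_nth(2))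
    also have "\<dots> = 0"
    proof (intro sum.neutral ballI)
      fix i
      show "fls_nth (emb n c) i * fls_nth y2 (int n * k + int j - i) = 0"
      proof (cases "int n dvd i")
        case True
        then obtain l where "i = int n * l" by blast
        thus ?thesis using y2[of "k - l"] by (simp add: algebra_simps)
      qed (use n in \<open>simp add: emb_nth\<close>)
    qed
    finally show ?thesis .
  qed
  moreover have "fls_nth (emb n c * y1) (int n * k + int j) = fls_nth (mfls c * G) k"
  proof -
    have "emb n c * y1 = fls_X_intpow (int j) * fls_compose_power (mfls c * G) n"
      by (simp add: y1_def emb_def mult_ac)
    thus ?thesis using n
      by (simp add: fls_nth_compose_power fls_shifted_times_simps del: fls_compose_power_mult)
  qed
  moreover have "emb n c * y = emb n c * y1 + emb n c * y2" by (simp add: y2_def algebra_simps)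
  ultimately show ?thesis by simp
qed

text \<open>
  A nonzero element of the subspace with the least number of residues modulo \<open>n\<close> in its support,
  divided by one of its components, is an eigenvector: the difference between its image and the
  appropriate multiple has a smaller support.
\<close>

lemma dilation_eigenvector:
  fixes I :: "'a :: valued_field fls set"
  assumes n: "n \<ge> 1" and q: "non_root_of_unity q"
    and conv: "\<And>y. y \<in> I \<Longrightarrow> conv_fls y"
    and diff: "\<And>y z. y \<in> I \<Longrightarrow> z \<in> I \<Longrightarrow> y - z \<in> I"
    and scale: "\<And>c y. y \<in> I \<Longrightarrow> emb n c * y \<in> I"
    and dil: "\<And>y. y \<in> I \<Longrightarrow> fls_dil q y \<in> I"
    and y: "y \<in> I" "y \<noteq> 0"
  obtains z j where "z \<in> I" "z \<noteq> 0" "fls_dil q z = fls_const (q ^ j) * z"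
proof -
  have q0: "q \<noteq> 0" by (rule non_root_of_unityD[OF q])
  define S where "S = (\<lambda>z :: 'a fls. {j. j < n \<and> (\<exists>k. fls_nth z (int n * k + int j) \<noteq> 0)})"
  have fin: "finite (S z)" for z by (rule finite_subset[of _ "{..<n}"]) (auto simp: S_def)
  have S0: "S z = {} \<Longrightarrow> z = 0" for z
  proof (rule fls_eqI)
    fix k assume "S z = {}"
    have k: "k = int n * (k div int n) + int (nat (k mod int n))" "nat (k mod int n) < n"
      using n by (auto simp: nat_less_iff)
    have "nat (k mod int n) \<notin> S z" using \<open>S z = {}\<close> by simp
    hence "fls_nth z (int n * (k div int n) + int (nat (k mod int n))) = 0"
      using k(2) by (simp only: S_def mem_Collect_eq) blast
    thus "fls_nth z k = fls_nth 0 k" using k(1) by simp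
  qed
  obtain z where z: "z \<in> I" "z \<noteq> 0" "\<And>w. w \<in> I \<Longrightarrow> w \<noteq> 0 \<Longrightarrow> card (S z) \<le> card (S w)"
    using ex_has_least_nat[of "\<lambda>z. z \<in> I \<and> z \<noteq> 0" y "\<lambda>z. card (S z)"] y by blast
  then obtain j where j: "j \<in> S z" using S0 by blast
  hence jn: "j < n" by (simp add: S_def)
  define G where "G = Abs_fls (\<lambda>k. fls_nth z (int n * k + int j))"
  have G: "fls_nth G k = fls_nth z (int n * k + int j)" for k
    unfolding G_def
  proof (rule nth_Abs_fls_lower_bound[of "min 0 (fls_subdegree z) - int j"], safe)
    fix k assume k: "k < min 0 (fls_subdegree z) - int j"
    have "int n * k \<le> 1 * k" using n k by (intro mult_right_mono_neg) auto
    thus "fls_nth z (int n * k + int j) = 0" using k by simp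
  qed
  have "conv_fls G"
  proof -
    obtain A B where AB: "A > 0" "B \<ge> 1" "\<And>k. absv (fls_nth z (int k)) \<le> A * B ^ k"
      using conv[OF z(1)] unfolding conv_fls_def by (elim convergent_coeffsE) blast
    have "absv (fls_nth G (int k)) \<le> (A * B ^ j) * (B ^ n) ^ k" for k
      using AB(3)[of "n * k + j"] by (simp add: G power_add mult_ac flip: power_mult)
    thus ?thesis using AB by (intro conv_flsI[of "B ^ n"]) auto
  qed
  then obtain g where g: "mfls g = G" using mfls_range by metis
  have "G \<noteq> 0" using j G by (auto simp: S_def)
  hence g0: "g \<noteq> 0" using g by auto
  define z' where "z' = emb n (inverse g) * z"
  have z': "z' \<in> I" using z scale by (simp add: z'_def)
  have z'0: "z' \<noteq> 0"
  proof -
    have "emb n g * emb n (inverse g) = 1"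
      using g0 n by (simp add: emb_def flip: fls_compose_power_mult mfls_mult)
    hence "emb n (inverse g) \<noteq> 0" by auto
    thus ?thesis using z by (simp add: z'_def)
  qed
  have z'j: "fls_nth z' (int n * k + int j) = (if k = 0 then 1 else 0)" for k
    using emb_mult_component[OF n jn G, of "inverse g" k] g0 g \<open>G \<noteq> 0\<close> by (simp add: z'_def)
  have Sz': "S z' \<subseteq> S z"
  proof
    fix i assume i: "i \<in> S z'"
    show "i \<in> S z"
    proof (rule ccontr)
      assume "i \<notin> S z"
      hence "fls_nth 0 k = fls_nth z (int n * k + int i)" for k using i by (simp add: S_def)
      from emb_mult_component[OF n _ this, of "inverse g"] i show False by (auto simp: S_def z'_def)
    qed
  qed
  define w where "w = fls_dil q z' - fls_const (q ^ j) * z'"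
  have c: "fls_const (q ^ j) = emb n (mconst (q ^ j))" using n by (simp add: emb_def)
  have "w \<in> I" unfolding w_def c using z' diff scale dil by blast
  have wn: "fls_nth w k = (q powi k - q ^ j) * fls_nth z' k" for k
    using q0 by (simp add: w_def algebra_simps)
  have "S w \<subseteq> S z - {j}"
    using Sz' by (auto simp: S_def wn z'j split: if_splits)
  hence "card (S w) < card (S z)" using j fin by (intro psubset_card_mono) auto
  hence "w = 0" using z(3)[OF \<open>w \<in> I\<close>] by force
  thus ?thesis using that[OF z' z'0, of j] by (simp add: w_def)
qed

section \<open>Generalised eigenvectors of T, and solving T - \<eta> on their span\<close>

section \<open>Generalised eigenvectors\<close>

locale qdm = q_difference_module smul q M \<Sigma>
  for smul :: "'a :: base_field mero \<Rightarrow> 'b :: ab_group_add \<Rightarrow> 'b" and q :: 'a and M \<Sigma> +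
  assumes q1: "absv q = 1" and qn: "non_root_of_unity q"

sublocale qdm \<subseteq> semilinear smul q M \<Sigma>
  using subspace_carrier bij_sigma sigma_add sigma_smul non_root_of_unityD(1)[OF qn]
  by unfold_locales (auto simp: bij_betw_def)

text \<open>The slope d/n in lowest terms, with the denominator first; every rational number is
  represented exactly once (\<open>slopes_unique\<close>).\<close>

definition slopes :: "(nat \<times> int) set" where
  "slopes = {(n, d). n \<ge> 1 \<and> coprime (int n) d}"

context semilinear
begin

abbreviation sop :: "nat \<Rightarrow> int \<Rightarrow> 'b \<Rightarrow> 'b" where "sop \<equiv> slope_op smul \<Sigma>"

definition shop :: "nat \<Rightarrow> int \<Rightarrow> 'a \<Rightarrow> 'b \<Rightarrow> 'b" where
  "shop n d \<eta> v = sop n d v - smul (mconst \<eta>) v"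

lemma sop_semilinear: "semilinear smul (q ^ n) M (sop n d)"
proof (intro semilinear.intro semilinear_axioms.intro)
  show "vector_space smul" by unfold_locales
  fix u v f
  show "u \<in> M \<Longrightarrow> v \<in> M \<Longrightarrow> sop n d (u + v) = sop n d u + sop n d v"
    by (simp add: slope_op_def pow_add scale_right_distrib)
  show "v \<in> M \<Longrightarrow> sop n d (smul f v) = smul (mero_dilate (q ^ n) f) (sop n d v)"
    by (simp add: slope_op_def pow_scale mult.commute)
qed (use q0 subspace_M in \<open>auto simp: slope_op_def\<close>)

lemma sop_closed [simp]: "v \<in> M \<Longrightarrow> sop n d v \<in> M"
  by (simp add: slope_op_def)

lemma sop_add: "u \<in> M \<Longrightarrow> v \<in> M \<Longrightarrow> sop n d (u + v) = sop n d u + sop n d v"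
  and sop_scale: "v \<in> M \<Longrightarrow> sop n d (smul f v) = smul (mero_dilate (q ^ n) f) (sop n d v)"
  and sop_0 [simp]: "sop n d 0 = 0"
  and sop_diff: "u \<in> M \<Longrightarrow> v \<in> M \<Longrightarrow> sop n d (u - v) = sop n d u - sop n d v"
proof -
  interpret s: semilinear smul "q ^ n" M "sop n d" by (rule sop_semilinear)
  show "u \<in> M \<Longrightarrow> v \<in> M \<Longrightarrow> sop n d (u + v) = sop n d u + sop n d v"
    "v \<in> M \<Longrightarrow> sop n d (smul f v) = smul (mero_dilate (q ^ n) f) (sop n d v)"
    "sop n d 0 = 0"
    "u \<in> M \<Longrightarrow> v \<in> M \<Longrightarrow> sop n d (u - v) = sop n d u - sop n d v"
    using s.add s.scale s.sigma_0 s.sigma_diff by blast+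
qed

lemma stable_subset: "stable N \<Longrightarrow> v \<in> N \<Longrightarrow> v \<in> M"
  and stable_0: "stable N \<Longrightarrow> 0 \<in> N"
  and stable_add: "stable N \<Longrightarrow> u \<in> N \<Longrightarrow> v \<in> N \<Longrightarrow> u + v \<in> N"
  and stable_diff: "stable N \<Longrightarrow> u \<in> N \<Longrightarrow> v \<in> N \<Longrightarrow> u - v \<in> N"
  and stable_scale: "stable N \<Longrightarrow> v \<in> N \<Longrightarrow> smul c v \<in> N"
  and stable_sigma: "stable N \<Longrightarrow> v \<in> N \<Longrightarrow> \<Sigma> v \<in> N"
  by (auto simp: stable_def subspace_0 subspace_add subspace_diff subspace_scale)

lemma stable_M: "stable M"
  using subspace_M closed by (auto simp: stable_def)

lemma stable_pow: "stable N \<Longrightarrow> v \<in> N \<Longrightarrow> (\<Sigma> ^^ i) v \<in> N"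
  by (induction i) (auto simp: stable_sigma)

lemma stable_sop: "stable N \<Longrightarrow> v \<in> N \<Longrightarrow> sop n d v \<in> N"
  by (simp add: slope_op_def stable_scale stable_pow)

lemma stable_shop: "stable N \<Longrightarrow> v \<in> N \<Longrightarrow> shop n d \<eta> v \<in> N"
  by (simp add: shop_def stable_scale stable_diff stable_sop)

lemma stable_shop_pow: "stable N \<Longrightarrow> v \<in> N \<Longrightarrow> (shop n d \<eta> ^^ h) v \<in> N"
  by (induction h) (auto simp: stable_shop)

lemma shop_pow_closed [simp]: "v \<in> M \<Longrightarrow> (shop n d \<eta> ^^ h) v \<in> M"
  by (rule stable_shop_pow[OF stable_M])

lemma shop_closed [simp]: "v \<in> M \<Longrightarrow> shop n d \<eta> v \<in> M"
  by (rule stable_shop[OF stable_M])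

lemma shop_0 [simp]: "shop n d \<eta> 0 = 0"
  by (simp add: shop_def)

lemma shop_pow_0 [simp]: "(shop n d \<eta> ^^ h) 0 = 0"
  by (induction h) auto

lemma shop_add: "u \<in> M \<Longrightarrow> v \<in> M \<Longrightarrow> shop n d \<eta> (u + v) = shop n d \<eta> u + shop n d \<eta> v"
  by (simp add: shop_def sop_add scale_right_distrib)

lemma shop_diff: "u \<in> M \<Longrightarrow> v \<in> M \<Longrightarrow> shop n d \<eta> (u - v) = shop n d \<eta> u - shop n d \<eta> v"
  by (simp add: shop_def sop_diff scale_right_diff_distrib)

lemma shop_const: "v \<in> M \<Longrightarrow> shop n d \<eta> (smul (mconst c) v) = smul (mconst c) (shop n d \<eta> v)"
  by (simp add: shop_def sop_scale scale_right_diff_distrib mult.commute q0)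

lemma shop_pow_add: "u \<in> M \<Longrightarrow> v \<in> M \<Longrightarrow> (shop n d \<eta> ^^ h) (u + v) = (shop n d \<eta> ^^ h) u + (shop n d \<eta> ^^ h) v"
  by (induction h) (auto simp: shop_add)

lemma shop_pow_diff: "u \<in> M \<Longrightarrow> v \<in> M \<Longrightarrow> (shop n d \<eta> ^^ h) (u - v) = (shop n d \<eta> ^^ h) u - (shop n d \<eta> ^^ h) v"
  by (induction h) (auto simp: shop_diff)

lemma shop_pow_const: "v \<in> M \<Longrightarrow> (shop n d \<eta> ^^ h) (smul (mconst c) v) = smul (mconst c) ((shop n d \<eta> ^^ h) v)"
  by (induction h) (auto simp: shop_const)

lemma shop_pow_mono: "(shop n d \<eta> ^^ h) v = 0 \<Longrightarrow> h \<le> m \<Longrightarrow> (shop n d \<eta> ^^ m) v = 0"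
  by (metis comp_apply funpow_add le_add_diff_inverse2 shop_pow_0)

text \<open>A subspace over the constants only: multiplication by x changes the eigenvalue
  (\<open>gen_eig_X\<close>).\<close>

definition gen_eig :: "nat \<Rightarrow> int \<Rightarrow> 'a \<Rightarrow> 'b set" where
  "gen_eig n d \<eta> = {v \<in> M. \<exists>h. (shop n d \<eta> ^^ h) v = 0}"

lemma gen_eig_0: "0 \<in> gen_eig n d \<eta>"
  by (auto simp: gen_eig_def)

lemma gen_eig_add: "u \<in> gen_eig n d \<eta> \<Longrightarrow> v \<in> gen_eig n d \<eta> \<Longrightarrow> u + v \<in> gen_eig n d \<eta>"
proof -
  assume "u \<in> gen_eig n d \<eta>" "v \<in> gen_eig n d \<eta>"
  then obtain h k where "u \<in> M" "v \<in> M" "(shop n d \<eta> ^^ h) u = 0" "(shop n d \<eta> ^^ k) v = 0"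
    by (auto simp: gen_eig_def)
  hence "(shop n d \<eta> ^^ max h k) (u + v) = 0"
    using shop_pow_mono[of _ n d \<eta> _ "max h k"] by (simp add: shop_pow_add)
  thus ?thesis using \<open>u \<in> M\<close> \<open>v \<in> M\<close> by (auto simp: gen_eig_def)
qed

lemma gen_eig_const: "v \<in> gen_eig n d \<eta> \<Longrightarrow> smul (mconst c) v \<in> gen_eig n d \<eta>"
  by (auto simp: gen_eig_def shop_pow_const intro!: exI)

lemma gen_eig_shop: "v \<in> gen_eig n d \<eta> \<Longrightarrow> shop n d \<eta> v \<in> gen_eig n d \<eta>"
proof -
  assume "v \<in> gen_eig n d \<eta>"
  then obtain h where h: "v \<in> M" "(shop n d \<eta> ^^ h) v = 0" by (auto simp: gen_eig_def)
  have "(shop n d \<eta> ^^ h) (shop n d \<eta> v) = shop n d \<eta> ((shop n d \<eta> ^^ h) v)"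
    by (simp add: funpow_swap1)
  thus ?thesis using h by (auto simp: gen_eig_def)
qed

lemma gen_eigI: "v \<in> M \<Longrightarrow> shop n d \<eta> v \<in> gen_eig n d \<eta> \<Longrightarrow> v \<in> gen_eig n d \<eta>"
proof -
  assume v: "v \<in> M" "shop n d \<eta> v \<in> gen_eig n d \<eta>"
  then obtain h where "(shop n d \<eta> ^^ h) (shop n d \<eta> v) = 0" by (auto simp: gen_eig_def)
  hence "(shop n d \<eta> ^^ Suc h) v = 0" by (simp add: funpow_swap1)
  thus ?thesis using v by (auto simp del: funpow.simps simp: gen_eig_def)
qed

lemma sop_sigma: "v \<in> M \<Longrightarrow> sop n d (\<Sigma> v) = smul (mconst (q powi (- d))) (\<Sigma> (sop n d v))"
proof -
  assume v: "v \<in> M"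
  have "\<Sigma> (sop n d v) = smul (mconst (q powi d) * mero_X powi d) (\<Sigma> ((\<Sigma> ^^ n) v))"
    using v by (simp add: slope_op_def scale mero_dilate_powi mero_dilate_X q0 power_int_mult_distrib mconst_powi)
  moreover have "q powi (- d) * q powi d = 1" using q0 by (simp flip: power_int_add)
  hence "mconst (q powi (- d)) * mconst (q powi d) = 1" by (metis mconst_mult mconst_1)
  ultimately show ?thesis
    by (simp add: slope_op_def funpow_swap1 mult.assoc[symmetric] del: power_int_minus)
qed

lemma shop_sigma: "v \<in> M \<Longrightarrow> shop n d (q powi (- d) * \<eta>) (\<Sigma> v) = smul (mconst (q powi (- d))) (\<Sigma> (shop n d \<eta> v))"
  by (simp add: shop_def sop_sigma sigma_diff scale scale_right_diff_distrib mconst_mult q0)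

text \<open>\<Sigma> and T commute up to the constant q^(-d) that arises when \<Sigma> passes x^d.
  Hence the \<open>K\<close>-span of the eigenvectors is stable under \<Sigma> once the set of
  eigenvalues is closed under powers of q.\<close>

lemma gen_eig_sigma:
  assumes "v \<in> gen_eig n d \<eta>" shows "\<Sigma> v \<in> gen_eig n d (q powi (- d) * \<eta>)"
proof -
  have "\<Sigma> v \<in> gen_eig n d (q powi (- d) * \<eta>)" if "v \<in> M" "(shop n d \<eta> ^^ h) v = 0" for h v
    using that
  proof (induction h arbitrary: v)
    case (Suc h)
    have "(shop n d \<eta> ^^ h) (shop n d \<eta> v) = 0" using Suc by (simp add: funpow_swap1)
    hence "\<Sigma> (shop n d \<eta> v) \<in> gen_eig n d (q powi (- d) * \<eta>)" using Suc by simp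
    hence "shop n d (q powi (- d) * \<eta>) (\<Sigma> v) \<in> gen_eig n d (q powi (- d) * \<eta>)"
      unfolding shop_sigma[OF Suc.prems(1)] by (rule gen_eig_const)
    from gen_eigI[OF _ this] show ?case using Suc.prems(1) by (simp add: closed)
  qed (simp add: gen_eig_0)
  moreover obtain h where "v \<in> M" "(shop n d \<eta> ^^ h) v = 0" using assms unfolding gen_eig_def by blast
  ultimately show ?thesis by blast
qed

lemma sop_X:
  "v \<in> M \<Longrightarrow> sop n d (smul (mero_X powi k) v) = smul (mconst (q powi (int n * k)) * mero_X powi k) (sop n d v)"
proof -
  have "(q ^ n) powi k = q powi (int n * k)" by (simp add: power_int_mult)
  thus "v \<in> M \<Longrightarrow> ?thesis"
    using q0 by (simp add: sop_scale mero_dilate_powi mero_dilate_X power_int_mult_distrib flip: mconst_powi)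
qed

lemma shop_X:
  assumes "v \<in> M"
  shows "shop n d (q powi (int n * k) * \<eta>) (smul (mero_X powi k) v) =
    smul (mconst (q powi (int n * k))) (smul (mero_X powi k) (shop n d \<eta> v))"
  using assms by (simp add: shop_def sop_X scale_right_diff_distrib mconst_mult mult_ac)

text \<open>T passes x^k at the cost of the constant q^(nk). Together with
  \<open>gen_eig_sigma\<close> and the coprimality of n and d, only the class of an eigenvalue
  modulo powers of q matters.\<close>

lemma gen_eig_X:
  assumes "v \<in> gen_eig n d \<eta>" shows "smul (mero_X powi k) v \<in> gen_eig n d (q powi (int n * k) * \<eta>)"
proof -
  have "smul (mero_X powi k) v \<in> gen_eig n d (q powi (int n * k) * \<eta>)" if "v \<in> M" "(shop n d \<eta> ^^ h) v = 0" for h v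
    using that
  proof (induction h arbitrary: v)
    case (Suc h)
    have "(shop n d \<eta> ^^ h) (shop n d \<eta> v) = 0" using Suc by (simp add: funpow_swap1)
    hence "smul (mero_X powi k) (shop n d \<eta> v) \<in> gen_eig n d (q powi (int n * k) * \<eta>)" using Suc by simp
    hence "shop n d (q powi (int n * k) * \<eta>) (smul (mero_X powi k) v) \<in> gen_eig n d (q powi (int n * k) * \<eta>)"
      unfolding shop_X[OF Suc.prems(1)] by (rule gen_eig_const)
    from gen_eigI[OF _ this] show ?case using Suc.prems(1) by simp
  qed (simp add: gen_eig_0)
  moreover obtain h where "v \<in> M" "(shop n d \<eta> ^^ h) v = 0" using assms unfolding gen_eig_def by blast
  ultimately show ?thesis by blast
qed

definition eig_gens :: "(nat \<Rightarrow> int \<Rightarrow> 'a set) \<Rightarrow> (nat \<times> int) set \<Rightarrow> 'b set \<Rightarrow> 'b set" where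
  "eig_gens A S N = {v \<in> N. \<exists>n d \<eta>. (n, d) \<in> S \<and> \<eta> \<in> A n d \<and> v \<in> gen_eig n d \<eta>}"

definition eig_span :: "(nat \<Rightarrow> int \<Rightarrow> 'a set) \<Rightarrow> (nat \<times> int) set \<Rightarrow> 'b set \<Rightarrow> 'b set" where
  "eig_span A S N = span (eig_gens A S N)"

lemma stable_span:
  assumes "B \<subseteq> M" "\<And>v. v \<in> B \<Longrightarrow> \<Sigma> v \<in> span B" shows "stable (span B)"
proof -
  have sub: "span B \<subseteq> M" using assms subspace_M by (intro span_minimal)
  have "v \<in> M \<and> \<Sigma> v \<in> span B" if "v \<in> span B" for v
    using that
  proof (induction rule: span_induct_alt)
    case (step c x y)
    hence "x \<in> M" using assms by auto
    thus ?case using step assms by (simp add: add scale span_add span_scale)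
  qed (simp add: span_zero)
  thus ?thesis using sub by (auto simp: stable_def)
qed

end

text \<open>\<open>A n d\<close> is the set of the eigenvalues of \<open>x\<^sup>d \<Sigma>\<^sup>n\<close> that are taken into account for the slope \<open>d/n\<close>.\<close>

locale exponent_system =
  fixes q :: "'a :: base_field" and A :: "nat \<Rightarrow> int \<Rightarrow> 'a set"
  assumes A_nonzero: "\<eta> \<in> A n d \<Longrightarrow> \<eta> \<noteq> 0"
    and A_shift: "\<eta> \<in> A n d \<Longrightarrow> q powi k * \<eta> \<in> A n d"
    and A_tame: "\<eta> \<in> A n d \<Longrightarrow> \<xi> \<in> A n d \<Longrightarrow> tame q (\<eta> / \<xi>)"

locale qdm_exponents = qdm smul q M \<Sigma> + exponent_system q A
  for smul :: "'a :: base_field mero \<Rightarrow> 'b :: ab_group_add \<Rightarrow> 'b" and q :: 'a and M \<Sigma> A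
begin

lemma eig_span_stable:
  assumes "stable N" shows "stable (eig_span A S N)" "eig_span A S N \<subseteq> N"
proof -
  have sub: "eig_gens A S N \<subseteq> M" using assms by (auto simp: eig_gens_def stable_subset)
  show "stable (eig_span A S N)"
    unfolding eig_span_def
  proof (rule stable_span[OF sub])
    fix v assume "v \<in> eig_gens A S N"
    hence "\<Sigma> v \<in> eig_gens A S N"
      using assms gen_eig_sigma A_shift unfolding eig_gens_def by (blast intro: stable_sigma)
    thus "\<Sigma> v \<in> span (eig_gens A S N)" by (rule span_base)
  qed
  show "eig_span A S N \<subseteq> N"
    unfolding eig_span_def using assms by (intro span_minimal) (auto simp: eig_gens_def stable_def)
qed

lemma eig_span_mono: "N \<subseteq> N' \<Longrightarrow> S \<subseteq> S' \<Longrightarrow> eig_span A S N \<subseteq> eig_span A S' N'"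
  unfolding eig_span_def by (rule span_mono) (auto simp: eig_gens_def)

lemma eig_span_base: "(n, d) \<in> S \<Longrightarrow> \<eta> \<in> A n d \<Longrightarrow> v \<in> N \<Longrightarrow> v \<in> gen_eig n d \<eta> \<Longrightarrow> v \<in> eig_span A S N"
  unfolding eig_span_def by (rule span_base) (auto simp: eig_gens_def)

text \<open>Looking for w of the form g v leads to \<open>resonant_equation\<close> for the
  coefficients. Its resonant term c x^k v is a generalised eigenvector for \<eta> itself and may
  stay in the remainder. The nilpotent part of T on v produces a term with a vector of smaller
  height, removed by induction.\<close>

lemma solve_same_slope:
  assumes N: "stable N" and n: "n \<ge> 1" and z: "\<eta> \<in> A n d" and x: "\<xi> \<in> A n d"
    and v: "v \<in> N" "(shop n d \<xi> ^^ h) v = 0" and S: "(n, d) \<in> S"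
  shows "\<exists>w\<in>eig_span A S N. smul f v - shop n d \<eta> w \<in> gen_eig n d \<eta>"
  using v
proof (induction h arbitrary: f v)
  case 0
  thus ?case using stable_0[OF eig_span_stable(1)[OF N]] by (intro bexI[of _ 0]) (auto simp: gen_eig_0)
next
  case (Suc h)
  let ?W = "eig_span A S N"
  have W: "stable ?W" "?W \<subseteq> N" using eig_span_stable[OF N] by auto
  define v' where "v' = shop n d \<xi> v"
  have v': "v' \<in> N" "(shop n d \<xi> ^^ h) v' = 0"
    using Suc.prems N by (auto simp: v'_def stable_shop funpow_swap1)
  have vM: "v \<in> M" "v' \<in> M" using Suc.prems v' N stable_subset by auto
  have vg: "v \<in> gen_eig n d \<xi>" using vM Suc.prems unfolding gen_eig_def by blast
  have t: "tame (q ^ n) (\<xi> / \<eta>)" using tame_subsequence[OF q1 A_tame[OF x z] n] .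
  obtain g c k where g: "f = mconst \<xi> * mero_dilate (q ^ n) g - mconst \<eta> * g + mconst c * mero_X powi k"
    and ck: "c \<noteq> 0 \<Longrightarrow> \<xi> * (q ^ n) powi k = \<eta>"
    using resonant_equation[of "q ^ n" \<xi> \<eta> f] t q1 qn n A_nonzero z x
    by (metis absv_power power_one non_root_of_unity_power)
  define G where "G = mero_dilate (q ^ n) g"
  \<comment> \<open>With g v as a first approximation the error is c x^k v - G v', and the induction
    takes care of the second term.\<close>
  from Suc.IH[OF v', of "- G"] obtain w where w: "w \<in> ?W" "smul (- G) v' - shop n d \<eta> w \<in> gen_eig n d \<eta>" by blast
  have vW: "v \<in> ?W" using eig_span_base[OF S x _ vg] Suc.prems by simp
  have Tv: "sop n d v = smul (mconst \<xi>) v + v'" by (simp add: v'_def shop_def)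
  have "shop n d \<eta> (smul g v) = smul G (smul (mconst \<xi>) v + v') - smul (mconst \<eta>) (smul g v)"
    using vM by (simp add: shop_def sop_scale Tv G_def)
  also have "\<dots> = smul (mconst \<xi> * G - mconst \<eta> * g) v + smul G v'"
    by (simp add: scale_right_distrib scale_left_diff_distrib mult.commute)
  also have "mconst \<xi> * G - mconst \<eta> * g = f - mconst c * mero_X powi k"
    by (simp add: g G_def)
  finally have sg: "shop n d \<eta> (smul g v) = smul f v - smul (mconst c * mero_X powi k) v + smul G v'"
    by (simp add: scale_left_diff_distrib)
  have wM: "w \<in> M" using w W N stable_subset by blast
  have "smul f v - shop n d \<eta> (smul g v + w) = smul (mconst c * mero_X powi k) v + (smul (- G) v' - shop n d \<eta> w)"
    using vM wM by (simp add: shop_add sg)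
  also have "\<dots> \<in> gen_eig n d \<eta>"
  proof (rule gen_eig_add[OF _ w(2)])
    show "smul (mconst c * mero_X powi k) v \<in> gen_eig n d \<eta>"
    proof (cases "c = 0")
      case False
      have "q powi (int n * k) = (q ^ n) powi k" by (simp add: power_int_mult)
      hence "q powi (int n * k) * \<xi> = \<eta>" using ck[OF False] by (simp add: mult.commute)
      hence "smul (mero_X powi k) v \<in> gen_eig n d \<eta>" using gen_eig_X[OF vg, of k] by simp
      from gen_eig_const[OF this, of c] show ?thesis by simp
    qed (simp add: gen_eig_0)
  qed
  finally show ?case
    using w W vW by (intro bexI[of _ "smul g v + w"]) (auto intro: stable_add stable_scale)
qed

lemma sop_pow:
  obtains a where "a \<noteq> 0" "\<And>v. v \<in> M \<Longrightarrow> (sop n d ^^ j) v = smul (mconst a * mero_X powi (d * int j)) ((\<Sigma> ^^ (n * j)) v)"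
proof (induction j arbitrary: thesis)
  case 0
  show ?case by (rule 0[of 1]) auto
next
  case (Suc j)
  then obtain a where a: "a \<noteq> 0" "\<And>v. v \<in> M \<Longrightarrow> (sop n d ^^ j) v = smul (mconst a * mero_X powi (d * int j)) ((\<Sigma> ^^ (n * j)) v)"
    by blast
  let ?c = "(q ^ n) powi (d * int j)"
  show ?case
  proof (rule Suc.prems[of "a * ?c"])
    show "a * ?c \<noteq> 0" using a q0 by simp
    fix v assume v: "v \<in> M"
    have qn0: "q ^ n \<noteq> 0" using q0 by simp
    have "(sop n d ^^ Suc j) v = smul (mconst a * mconst ?c * mero_X powi (d * int j)) (sop n d ((\<Sigma> ^^ (n * j)) v))"
      using v by (simp add: a sop_scale mero_dilate_mult[OF qn0] mero_dilate_powi[OF qn0] mero_dilate_X[OF qn0] mero_dilate_const[OF qn0] q0 power_int_mult_distrib mult.assoc mconst_powi)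
    also have "\<dots> = smul (mconst a * mconst ?c * (mero_X powi (d * int j) * mero_X powi d)) ((\<Sigma> ^^ (n * Suc j)) v)"
      by (simp add: slope_op_def funpow_add mult.assoc)
    also have "mero_X powi (d * int j) * mero_X powi d = mero_X powi (d * int (Suc j))"
      by (simp add: algebra_simps flip: power_int_add)
    finally show "(sop n d ^^ Suc j) v = smul (mconst (a * ?c) * mero_X powi (d * int (Suc j))) ((\<Sigma> ^^ (n * Suc j)) v)"
      by (simp add: mconst_mult)
  qed
qed

text \<open>Both powers are a constant times a power of x times \<Sigma>^(n n'). The two operators
  thus differ by a power of x whose exponent vanishes only if the slopes agree.\<close>

lemma sop_pow_other:
  obtains a where "a \<noteq> 0"
    "\<And>v. v \<in> M \<Longrightarrow> (sop n d ^^ n') v = smul (mconst a * mero_X powi (d * int n' - d' * int n)) ((sop n' d' ^^ n) v)"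
proof -
  obtain a where a: "a \<noteq> 0" "\<And>v. v \<in> M \<Longrightarrow> (sop n d ^^ n') v = smul (mconst a * mero_X powi (d * int n')) ((\<Sigma> ^^ (n * n')) v)"
    using sop_pow[where n = n and d = d and j = n'] by blast
  obtain b where b: "b \<noteq> 0" "\<And>v. v \<in> M \<Longrightarrow> (sop n' d' ^^ n) v = smul (mconst b * mero_X powi (d' * int n)) ((\<Sigma> ^^ (n' * n)) v)"
    using sop_pow[where n = n' and d = d' and j = n] by blast
  have 1: "mconst (a * inverse b) * mero_X powi (d * int n' - d' * int n) * (mconst b * mero_X powi (d' * int n)) = mconst a * mero_X powi (d * int n')"
  proof -
    have "mconst (a * inverse b) * mconst b = mconst a" using b by (simp flip: mconst_mult)
    moreover have "(mero_X :: 'a mero) powi (d * int n' - d' * int n) * mero_X powi (d' * int n) = mero_X powi (d * int n')"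
      by (simp flip: power_int_add)
    moreover have "mconst (a * inverse b) * mero_X powi (d * int n' - d' * int n) * (mconst b * mero_X powi (d' * int n)) =
        (mconst (a * inverse b) * mconst b) * (mero_X powi (d * int n' - d' * int n) * mero_X powi (d' * int n))"
      by (simp only: mult_ac)
    ultimately show ?thesis by simp
  qed
  show ?thesis
  proof (rule that[of "a * inverse b"])
    fix v assume v: "v \<in> M"
    show "(sop n d ^^ n') v = smul (mconst (a * inverse b) * mero_X powi (d * int n' - d' * int n)) ((sop n' d' ^^ n) v)"
      unfolding a(2)[OF v] b(2)[OF v] scale_scale 1 by (simp add: mult.commute)
  qed (use a b in auto)
qed

lemma sop_pow_scale: "v \<in> M \<Longrightarrow> (sop n d ^^ j) (smul f v) = smul (mero_dilate (q ^ (n * j)) f) ((sop n d ^^ j) v)"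
proof -
  interpret s: semilinear smul "q ^ n" M "sop n d" by (rule sop_semilinear)
  show "v \<in> M \<Longrightarrow> ?thesis" using s.pow_scale[of v j f] by (simp add: power_mult)
qed

text \<open>The factorisation of T^j - \<eta>^j as in a commutative ring, valid because T is linear
  over the constants.\<close>

lemma geometric_shop:
  "v \<in> M \<Longrightarrow> (sop n d ^^ j) v - smul (mconst (\<eta> ^ j)) v =
     shop n d \<eta> (\<Sum>i<j. smul (mconst (\<eta> ^ (j - Suc i))) ((sop n d ^^ i) v))"
proof (induction j)
  case (Suc j)
  interpret s: semilinear smul "q ^ n" M "sop n d" by (rule sop_semilinear)
  let ?u = "\<lambda>j. \<Sum>i<j. smul (mconst (\<eta> ^ (j - Suc i))) ((sop n d ^^ i) v)"
  have uM: "?u j \<in> M" for j using Suc.prems by (intro M_sum M_scale s.pow_closed)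
  have "?u (Suc j) = (\<Sum>i<j. smul (mconst \<eta>) (smul (mconst (\<eta> ^ (j - Suc i))) ((sop n d ^^ i) v))) + (sop n d ^^ j) v"
  proof -
    have "(\<Sum>i<j. smul (mconst (\<eta> ^ (Suc j - Suc i))) ((sop n d ^^ i) v)) =
       (\<Sum>i<j. smul (mconst \<eta>) (smul (mconst (\<eta> ^ (j - Suc i))) ((sop n d ^^ i) v)))"
    proof (intro sum.cong refl)
      fix i assume "i \<in> {..<j}"
      hence "Suc j - Suc i = Suc (j - Suc i)" by auto
      thus "smul (mconst (\<eta> ^ (Suc j - Suc i))) ((sop n d ^^ i) v) =
        smul (mconst \<eta>) (smul (mconst (\<eta> ^ (j - Suc i))) ((sop n d ^^ i) v))"
        by (simp add: mconst_mult)
    qed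
    thus ?thesis by simp
  qed
  also have "\<dots> = smul (mconst \<eta>) (?u j) + (sop n d ^^ j) v" by (simp add: scale_sum_right)
  finally have u: "?u (Suc j) = smul (mconst \<eta>) (?u j) + (sop n d ^^ j) v" .
  have "shop n d \<eta> (?u (Suc j)) = smul (mconst \<eta>) (shop n d \<eta> (?u j)) + shop n d \<eta> ((sop n d ^^ j) v)"
    unfolding u using uM[of j] Suc.prems by (subst shop_add) (auto simp: shop_const)
  also have "shop n d \<eta> (?u j) = (sop n d ^^ j) v - smul (mconst (\<eta> ^ j)) v" using Suc by simp
  also have "smul (mconst \<eta>) \<dots> + shop n d \<eta> ((sop n d ^^ j) v) = (sop n d ^^ Suc j) v - smul (mconst (\<eta> ^ Suc j)) v"
    by (simp add: shop_def scale_right_diff_distrib mconst_mult)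
  finally show ?case by simp
qed simp

text \<open>For two different slopes T is replaced by T^n' and the second operator by its n-th
  power, so that both involve the same power of \<Sigma>. On coefficients this is
  \<open>contracting_equation\<close>, which has an exact solution. \<open>geometric_shop\<close>
  then turns a solution for T^n' - \<eta>^n' into one for T - \<eta>.\<close>

lemma solve_other_slope:
  assumes N: "stable N" and n: "n \<ge> 1" "n' \<ge> 1" and s: "d * int n' \<noteq> d' * int n" and z: "\<eta> \<noteq> 0" and x: "\<xi> \<in> A n' d'"
    and v: "v \<in> N" "(shop n' d' \<xi> ^^ h) v = 0" and S: "(n', d') \<in> S"
  shows "\<exists>w\<in>eig_span A S N. smul f v = shop n d \<eta> w"
proof -
  let ?W = "eig_span A S N"
  have W: "stable ?W" "?W \<subseteq> N" using eig_span_stable[OF N] by auto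
  obtain a where a: "a \<noteq> 0" "\<And>v. v \<in> M \<Longrightarrow> (sop n d ^^ n') v = smul (mconst a * mero_X powi (d * int n' - d' * int n)) ((sop n' d' ^^ n) v)"
    using sop_pow_other[where n = n and d = d and n' = n' and d' = d'] by blast
  interpret s: semilinear smul "q ^ n" M "sop n d" by (rule sop_semilinear)
  interpret s': semilinear smul "q ^ n'" M "sop n' d'" by (rule sop_semilinear)
  have x0: "\<xi> \<noteq> 0" using A_nonzero x by blast
  \<comment> \<open>The n-th power of the second operator minus \<xi>^n has the factor that measures
    the height, so it lowers the height by one and the induction on h can proceed.\<close>
  have level: "v' \<in> N \<and> (shop n' d' \<xi> ^^ h) v' = 0"
    if "v \<in> N" "(shop n' d' \<xi> ^^ Suc h) v = 0" "v' = (sop n' d' ^^ j) v - smul (mconst (\<xi> ^ j)) v" for v v' j h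
  proof -
    have vM: "v \<in> M" using that N stable_subset by blast
    have sp: "(sop n' d' ^^ i) v \<in> N" for i using that(1) N by (induction i) (auto simp: stable_sop)
    have comm: "shop n' d' \<xi> (sop n' d' u) = sop n' d' (shop n' d' \<xi> u)" if "u \<in> M" for u
      using that by (simp add: shop_def s'.sigma_diff sop_scale q0)
    have comm_pow: "(shop n' d' \<xi>) ((sop n' d' ^^ i) u) = (sop n' d' ^^ i) (shop n' d' \<xi> u)" if "u \<in> M" for u i
      using that by (induction i) (auto simp: comm)
    have comm2: "(shop n' d' \<xi> ^^ h) ((sop n' d' ^^ i) u) = (sop n' d' ^^ i) ((shop n' d' \<xi> ^^ h) u)" if "u \<in> M" for u i h
      using that by (induction h) (auto simp: comm_pow)
    define u where "u = (\<Sum>i<j. smul (mconst (\<xi> ^ (j - Suc i))) ((sop n' d' ^^ i) v))"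
    have v': "v' = shop n' d' \<xi> u" unfolding that(3) u_def by (rule geometric_shop[OF vM])
    have uM: "u \<in> M" unfolding u_def using vM by (intro M_sum) auto
    have "(shop n' d' \<xi> ^^ Suc h) u = 0"
    proof -
      have sum: "(shop n' d' \<xi> ^^ Suc h) (sum g I) = (\<Sum>i\<in>I. (shop n' d' \<xi> ^^ Suc h) (g i))" if "\<And>i. g i \<in> M" for g and I :: "nat set"
        using that by (induction I rule: infinite_finite_induct) (auto simp del: funpow.simps simp: shop_pow_add M_sum)
      show ?thesis unfolding u_def using vM that(2)
        by (subst sum) (auto simp del: funpow.simps simp: shop_pow_const comm2 s'.pow_0)
    qed
    hence "(shop n' d' \<xi> ^^ h) v' = 0" by (simp add: v' funpow_swap1)
    moreover have "v' \<in> N" unfolding that(3) using sp that(1) N by (auto intro: stable_diff stable_scale)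
    ultimately show ?thesis by simp
  qed
  have "\<exists>w\<in>?W. smul f v = (sop n d ^^ n') w - smul (mconst (\<eta> ^ n')) w"
    using v
  proof (induction h arbitrary: f v)
    case 0
    thus ?case using stable_0[OF W(1)] by (intro bexI[of _ 0]) (auto simp: s.pow_0)
  next
    case (Suc h)
    have vM: "v \<in> M" using Suc.prems N stable_subset by blast
    have vW: "v \<in> ?W"
      using eig_span_base[OF S x Suc.prems(1)] vM Suc.prems(2) unfolding gen_eig_def by blast
    define v' where "v' = (sop n' d' ^^ n) v - smul (mconst (\<xi> ^ n)) v"
    have v': "v' \<in> N" "(shop n' d' \<xi> ^^ h) v' = 0" using level[OF Suc.prems v'_def] by auto
    let ?s = "d * int n' - d' * int n"
    have "absv (q ^ (n * n')) = 1" "a * \<xi> ^ n \<noteq> 0" "\<eta> ^ n' \<noteq> 0" "?s \<noteq> 0"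
      using q1 a x0 z s by (auto simp: absv_power)
    from contracting_equation[OF this, of f] obtain g where
      g: "f = mconst (a * \<xi> ^ n) * mero_X powi ?s * mero_dilate (q ^ (n * n')) g - mconst (\<eta> ^ n') * g" by blast
    define G where "G = mero_dilate (q ^ (n * n')) g"
    from Suc.IH[OF v', of "- (mconst a * mero_X powi ?s * G)"] obtain w where
      w: "w \<in> ?W" "smul (- (mconst a * mero_X powi ?s * G)) v' = (sop n d ^^ n') w - smul (mconst (\<eta> ^ n')) w" by blast
    have wM: "w \<in> M" using w W N stable_subset by blast
    have Tn: "(sop n' d' ^^ n) v = smul (mconst (\<xi> ^ n)) v + v'" by (simp add: v'_def)
    have "(sop n d ^^ n') (smul g v) = smul (G * (mconst a * mero_X powi ?s)) (smul (mconst (\<xi> ^ n)) v + v')"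
      using vM by (simp add: sop_pow_scale a(2) Tn G_def)
    also have "\<dots> = smul (mconst (a * \<xi> ^ n) * mero_X powi ?s * G) v + smul (mconst a * mero_X powi ?s * G) v'"
      by (simp add: scale_right_distrib mconst_mult mult_ac)
    finally have "(sop n d ^^ n') (smul g v + w) - smul (mconst (\<eta> ^ n')) (smul g v + w) =
      (smul (mconst (a * \<xi> ^ n) * mero_X powi ?s * G) v - smul (mconst (\<eta> ^ n') * g) v)"
      using vM wM w(2) by (simp add: s.pow_add scale_right_distrib algebra_simps)
    also have "\<dots> = smul f v" by (simp add: g G_def scale_left_diff_distrib)
    finally show ?case
      using w W vW by (intro bexI[of _ "smul g v + w"]) (auto intro: stable_add stable_scale)
  qed
  then obtain w where w: "w \<in> ?W" "smul f v = (sop n d ^^ n') w - smul (mconst (\<eta> ^ n')) w" by blast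
  have wM: "w \<in> M" using w W N stable_subset by blast
  have wp: "(sop n d ^^ i) w \<in> ?W" for i using w W by (induction i) (auto simp: stable_sop)
  have "(\<Sum>i<n'. smul (mconst (\<eta> ^ (n' - Suc i))) ((sop n d ^^ i) w)) \<in> ?W"
    using W wp by (auto simp: stable_def intro!: subspace_sum subspace_scale)
  thus ?thesis unfolding w(2) geometric_shop[OF wM] by blast
qed

end

section \<open>The module is spanned by generalised eigenvectors\<close>

section \<open>Generation by generalised eigenvectors\<close>

text \<open>By multiplicativity, roots of a factor are roots of the product after multiplication by
  a fixed power of p. Conditions on ratios of roots are therefore inherited by factors.\<close>

lemma chi_root_transfer:
  fixes P R :: "'a :: base_field mero poly"
  assumes n: "n \<ge> 1" and p: "p ^ n = q" "p \<noteq> 0" "non_root_of_unity p" and P: "P \<noteq> 0" and R: "R \<noteq> 0" and X: "X = P \<or> X = R"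
  obtains m where "\<And>z. poly (chi n d p X) z = 0 \<Longrightarrow> poly (chi n d p (skew_mult q P R)) (z * p powi (- m)) = 0"
proof (cases "X = R")
  case True
  thus ?thesis using that[of 0] by (simp add: chi_skew_mult(2)[OF n p P R])
next
  case False
  have eq: "z * p powi (- wt n d R) * p powi wt n d R = z" for z using p by (simp add: power_int_minus)
  have "poly (chi n d p P) (z * p powi (- wt n d R) * p powi wt n d R) = 0" if "poly (chi n d p X) z = 0" for z
    unfolding eq using False that X by simp
  thus ?thesis using that[of "wt n d R"] by (simp add: chi_skew_mult(2)[OF n p P R] poly_pcompose)
qed

context exponent_system
begin

definition controls :: "'a mero poly \<Rightarrow> bool" where
  "controls L \<longleftrightarrow> (\<forall>n d. n \<ge> 1 \<longrightarrow> coprime (int n) d \<longrightarrow> (\<exists>p. p ^ n = q \<and>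
     (\<forall>z. z \<noteq> 0 \<longrightarrow> poly (chi n d p L) z = 0 \<longrightarrow> z ^ n * p powi (- d * tri n) \<in> A n d) \<and>
     (\<forall>z w. z \<noteq> 0 \<longrightarrow> w \<noteq> 0 \<longrightarrow> poly (chi n d p L) z = 0 \<longrightarrow> poly (chi n d p L) w = 0 \<longrightarrow> tame p (z / w))))"

text \<open>A shift of roots by a power of p multiplies the eigenvalues by a power of q, which the
  exponent system allows, and cancels in the ratios.\<close>

lemma controls_skew_mult:
  assumes q: "non_root_of_unity q" and c: "controls (skew_mult q P R)" and P: "P \<noteq> 0" and R: "R \<noteq> 0"
  shows "controls P" "controls R"
proof -
  have q0: "q \<noteq> 0" using non_root_of_unityD[OF q] by blast
  have *: "\<exists>p. p ^ n = q \<and>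
     (\<forall>z. z \<noteq> 0 \<longrightarrow> poly (chi n d p X) z = 0 \<longrightarrow> z ^ n * p powi (- d * tri n) \<in> A n d) \<and>
     (\<forall>z w. z \<noteq> 0 \<longrightarrow> w \<noteq> 0 \<longrightarrow> poly (chi n d p X) z = 0 \<longrightarrow> poly (chi n d p X) w = 0 \<longrightarrow> tame p (z / w))"
    if n: "n \<ge> 1" "coprime (int n) d" and X: "X = P \<or> X = R" for n d X
  proof -
    obtain p where p: "p ^ n = q"
      and r: "\<And>z. z \<noteq> 0 \<Longrightarrow> poly (chi n d p (skew_mult q P R)) z = 0 \<Longrightarrow> z ^ n * p powi (- d * tri n) \<in> A n d"
      and t: "\<And>z w. z \<noteq> 0 \<Longrightarrow> w \<noteq> 0 \<Longrightarrow> poly (chi n d p (skew_mult q P R)) z = 0 \<Longrightarrow>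
        poly (chi n d p (skew_mult q P R)) w = 0 \<Longrightarrow> tame p (z / w)"
      using c n unfolding controls_def by metis
    have p0: "p \<noteq> 0" using p q0 n by (auto simp: power_0_left split: if_splits)
    have pn: "non_root_of_unity p" using non_root_of_unity_root[of p n] p q n by simp
    obtain m where root: "\<And>z. poly (chi n d p X) z = 0 \<Longrightarrow> poly (chi n d p (skew_mult q P R)) (z * p powi (- m)) = 0"
      using chi_root_transfer[OF n(1) p p0 pn P R X] by blast
    have ps: "z * p powi (- m) \<noteq> 0" if "z \<noteq> 0" for z using that p0 by simp
    show ?thesis
    proof (intro exI[of _ p] conjI allI impI)
      fix z assume z: "z \<noteq> 0" "poly (chi n d p X) z = 0"
      have "q powi m * ((z * p powi (- m)) ^ n * p powi (- d * tri n)) \<in> A n d"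
        using r[OF ps root] z by (intro A_shift) auto
      moreover have "(p powi (- m)) ^ n = q powi (- m)"
        unfolding p[symmetric] using power_int_mult[of p "- m" "int n"] power_int_mult[of p "int n" "- m"]
        by (simp add: mult.commute)
      hence "q powi m * ((z * p powi (- m)) ^ n * p powi (- d * tri n)) = z ^ n * p powi (- d * tri n)"
        using q0 by (simp add: power_mult_distrib power_int_minus)
      ultimately show "z ^ n * p powi (- d * tri n) \<in> A n d" by (simp only:)
    next
      fix z w assume zw: "z \<noteq> 0" "w \<noteq> 0" "poly (chi n d p X) z = 0" "poly (chi n d p X) w = 0"
      have "tame p (z * p powi (- m) / (w * p powi (- m)))"
        using zw by (intro t ps root)
      thus "tame p (z / w)" using p0 by simp
    qed (rule p)
  qed
  show "controls P" "controls R" unfolding controls_def using * by blast+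
qed

end

lemma slopes_unique:
  assumes "n \<ge> 1" "n' \<ge> 1" "coprime (int n) d" "coprime (int n') d'" "d * int n' = d' * int n"
  shows "n = n'" "d = d'"
proof -
  have "int n dvd d * int n'" "int n' dvd d' * int n" using assms(5) by (metis dvd_triv_right)+
  hence "int n dvd int n'" "int n' dvd int n"
    using assms(3,4) by (simp_all add: coprime_dvd_mult_right_iff coprime_dvd_mult_left_iff)
  thus n: "n = n'" by (simp add: dvd_antisym)
  show "d = d'" using assms n by simp
qed

lemma hom_slope_op:
  assumes S: "semilinear smul q M \<Sigma>" and N: "semilinear.stable smul M \<Sigma> N"
    and sc: "\<And>a v. v \<in> N \<Longrightarrow> \<phi> (smul a v) = smul' a (\<phi> v)"
    and sg: "\<And>v. v \<in> N \<Longrightarrow> \<phi> (\<Sigma> v) = \<Sigma>' (\<phi> v)" and v: "v \<in> N"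
  shows "\<phi> (slope_op smul \<Sigma> n d v) = slope_op smul' \<Sigma>' n d (\<phi> v)"
proof -
  interpret S: semilinear smul q M \<Sigma> by fact
  have "\<phi> ((\<Sigma> ^^ i) v) = (\<Sigma>' ^^ i) (\<phi> v)" for i
    by (induction i) (simp_all add: sg S.stable_pow[OF N v])
  thus ?thesis by (simp add: slope_op_def sc S.stable_pow[OF N v])
qed

context qdm_exponents
begin

lemma solve:
  assumes N: "stable N" and S: "S \<subseteq> slopes" "(n, d) \<in> S" and z: "\<eta> \<in> A n d"
    and u: "u \<in> eig_span A S N"
  shows "\<exists>w\<in>eig_span A S N. u - shop n d \<eta> w \<in> gen_eig n d \<eta>"
proof -
  let ?W = "eig_span A S N"
  have W: "stable ?W" "?W \<subseteq> N" using eig_span_stable[OF N] by auto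
  have gen: "\<exists>w\<in>?W. smul c x - shop n d \<eta> w \<in> gen_eig n d \<eta>" if x: "x \<in> eig_gens A S N" for c x
  proof -
    obtain n' d' \<xi> h where x: "x \<in> N" "(n', d') \<in> S" "\<xi> \<in> A n' d'" "(shop n' d' \<xi> ^^ h) x = 0"
      using x unfolding eig_gens_def gen_eig_def by blast
    show ?thesis
    proof (cases "n = n' \<and> d = d'")
      case True
      thus ?thesis using solve_same_slope[OF N _ z _ x(1), of \<xi> h S c] x S by (auto simp: slopes_def)
    next
      case False
      have nd: "n \<ge> 1" "n' \<ge> 1" "coprime (int n) d" "coprime (int n') d'" using S x by (auto simp: slopes_def)
      hence "d * int n' \<noteq> d' * int n" using slopes_unique False by metis
      from solve_other_slope[OF N nd(1,2) this A_nonzero[OF z] x(3,1,4,2), of c]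
      obtain w where "w \<in> ?W" "smul c x = shop n d \<eta> w" by blast
      thus ?thesis by (intro bexI[of _ w]) (simp_all add: gen_eig_0)
    qed
  qed
  show ?thesis
    using u unfolding eig_span_def[of A S N]
  proof (induction rule: span_induct_alt)
    case base
    show ?case by (intro bexI[of _ 0]) (auto simp: gen_eig_0 span_zero)
  next
    case (step c x y)
    then obtain w where w: "w \<in> ?W" "y - shop n d \<eta> w \<in> gen_eig n d \<eta>" by (auto simp: eig_span_def)
    obtain w' where w': "w' \<in> ?W" "smul c x - shop n d \<eta> w' \<in> gen_eig n d \<eta>" using gen[OF step(1)] by blast
    have "w \<in> M" "w' \<in> M" using w w' W N stable_subset by blast+
    hence eq: "smul c x + y - shop n d \<eta> (w' + w) = (smul c x - shop n d \<eta> w') + (y - shop n d \<eta> w)"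
      by (simp add: shop_add)
    have "smul c x + y - shop n d \<eta> (w' + w) \<in> gen_eig n d \<eta>"
      unfolding eq by (rule gen_eig_add[OF w'(2) w(2)])
    thus ?case using stable_add[OF W(1) w'(1) w(1)] by (auto simp: eig_span_def)
  qed
qed

text \<open>If the span N1 is proper, a convergent solution of the operator of the quotient gives a
  nonzero homomorphism \<phi> that kills N1. By induction the kernel is N1, the image contains an
  eigenvector of T, and its lift can be corrected inside N1 to a generalised eigenvector, which
  already lies in N1.\<close>

theorem generated:
  assumes "controls L" "cyc smul q \<Sigma> e L N" "N \<subseteq> M"
  shows "eig_span A slopes N = N"
  using assms
proof (induction "degree L" arbitrary: L e N rule: less_induct)
  case (less L e N)
  note cL = less.prems(1) and cyc = less.prems(2) and NM = less.prems(3)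
  have N: "stable N" using cyc_stable[OF cyc NM] .
  have eN: "e \<in> N" "e \<in> M" using cyc NM by (auto simp: cyc_def)
  have L0: "L \<noteq> 0" using cyc by (rule cyc_nonzero)
  define N1 where "N1 = eig_span A slopes N"
  have N1: "stable N1" "N1 \<subseteq> N" unfolding N1_def using eig_span_stable[OF N] by auto
  have "N1 = N"
  proof (rule ccontr)
    assume ne: "N1 \<noteq> N"
    \<comment> \<open>P is the operator of the quotient of N by N1, R that of N1.\<close>
    obtain R P where RP: "L = skew_mult q R P" "cyc smul q \<Sigma> (app P e) R N1" "coeff P 0 \<noteq> 0" "degree P = 0 \<Longrightarrow> N1 = N"
      using cyc_factor[OF cyc NM N1] by blast
    have P0: "P \<noteq> 0" and R0: "R \<noteq> 0" using RP cyc_nonzero by auto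
    have cP: "controls P" using controls_skew_mult[OF qn _ R0 P0] cL RP(1) by simp
    have "degree P \<ge> 1" using RP(4) ne by (cases "degree P") auto
    from slope_exists[OF RP(3) this] obtain n d i where
      n: "n \<ge> 1" "coprime (int n) d" and i: "i \<ge> 1"
      "\<And>p :: 'a. p \<noteq> 0 \<Longrightarrow> coeff (chi n d p P) 0 \<noteq> 0 \<and> coeff (chi n d p P) i \<noteq> 0" by blast
    obtain p where p: "p ^ n = q"
      and r: "\<And>z. z \<noteq> 0 \<Longrightarrow> poly (chi n d p P) z = 0 \<Longrightarrow> z ^ n * p powi (- d * tri n) \<in> A n d"
      and t: "\<And>z w. z \<noteq> 0 \<Longrightarrow> w \<noteq> 0 \<Longrightarrow> poly (chi n d p P) z = 0 \<Longrightarrow> poly (chi n d p P) w = 0 \<Longrightarrow> tame p (z / w)"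
      using cP n unfolding controls_def by metis
    have p0: "p \<noteq> 0" using p q0 n by (auto simp: power_0_left split: if_splits)
    have pn: "non_root_of_unity p" using non_root_of_unity_root[of p n] p qn n by simp
    have p1: "absv p = 1"
    proof -
      have "absv p ^ n = 1" using p q1 by (metis absv_power)
      thus ?thesis using n absv_nonneg[of p] power_eq_imp_eq_base[of "absv p" n 1] by simp
    qed
    obtain z0 where z0: "z0 \<noteq> 0" "poly (chi n d p P) z0 = 0"
      using poly_nonzero_root[of "chi n d p P" 0 i] i p0 by auto
    \<comment> \<open>The last root on its orbit is taken, so that the recursion for the solution
      has nonzero divisors.\<close>
    obtain \<eta> where \<eta>: "\<eta> \<noteq> 0" "poly (chi n d p P) \<eta> = 0" "\<And>k. k \<ge> 1 \<Longrightarrow> poly (chi n d p P) (\<eta> * p ^ k) \<noteq> 0"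
      using maximal_root[OF chi_nonzero[OF n(1) p p0 P0] pn z0] by blast
    obtain Y where Y: "fps_nth Y 0 = 1" "act (\<lambda>c y. emb n c * y) (ssig p d \<eta>) P (fps_to_fls Y) = 0"
      using formal_solution[OF n(1) p p0 \<eta>(2,3)] by blast
    define y where "y = fps_to_fls Y"
    have y0: "y \<noteq> 0" using Y(1) by (auto simp: y_def)
    have yc: "conv_fls y"
      unfolding y_def using solution_convergent[OF n(1) p p0 p1 P0 \<eta>(1,3) t Y(2)] \<eta> by blast
    let ?smul = "\<lambda>c y. emb n c * y" and ?\<Sigma> = "ssig p d \<eta>"
    interpret s: semilinear ?smul q UNIV ?\<Sigma> by (rule semilinear_ssig[OF n(1) p p0])
    have Ly: "s.app L y = 0" using Y(2) by (simp add: RP(1) s.act_skew_mult y_def)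
    obtain \<phi> where \<phi>: "\<And>P. \<phi> (app P e) = s.app P y" "\<And>u v. u \<in> N \<Longrightarrow> v \<in> N \<Longrightarrow> \<phi> (u + v) = \<phi> u + \<phi> v"
      "\<And>a v. v \<in> N \<Longrightarrow> \<phi> (smul a v) = emb n a * \<phi> v" "\<And>v. v \<in> N \<Longrightarrow> \<phi> (\<Sigma> v) = ?\<Sigma> (\<phi> v)"
      using cyc_hom[OF semilinear_axioms s.semilinear_axioms cyc NM Ly] by blast
    have \<phi>diff: "\<phi> (u - v) = \<phi> u - \<phi> v" if "u \<in> N" "v \<in> N" for u v
      using \<phi>(2)[of "u - v" v] that N by (simp add: stable_diff)
    define K where "K = {v \<in> N. \<phi> v = 0}"
    have K: "stable K" "K \<subseteq> N"
    proof -
      have "subspace K"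
      proof (rule subspaceI)
        show "0 \<in> K" using stable_0[OF N] \<phi>(1)[of 0] by (simp add: K_def)
      qed (use N in \<open>auto simp: K_def stable_add stable_scale \<phi>\<close>)
      thus "stable K" using N NM by (auto simp: stable_def K_def \<phi>(4))
    qed (auto simp: K_def)
    have eK: "e \<notin> K" using \<phi>(1)[of 1] y0 by (simp add: K_def)
    have N1K: "N1 \<subseteq> K"
    proof
      fix v assume v: "v \<in> N1"
      then obtain S where S: "v = app S (app P e)" using cyc_elem[OF RP(2)] by blast
      have "\<phi> v = s.app (skew_mult q S P) y" using S \<phi>(1)[of "skew_mult q S P"] eN by (simp add: act_skew_mult)
      also have "\<dots> = 0" using Y(2) by (simp add: s.act_skew_mult y_def)
      finally show "v \<in> K" using v N1 by (auto simp: K_def)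
    qed
    \<comment> \<open>The kernel is a proper submodule because e is not in it, so the induction
      hypothesis applies to it.\<close>
    have "K = N1"
    proof -
      obtain R2 P2 where RP2: "L = skew_mult q R2 P2" "cyc smul q \<Sigma> (app P2 e) R2 K" "coeff P2 0 \<noteq> 0" "degree P2 = 0 \<Longrightarrow> K = N"
        using cyc_factor[OF cyc NM K] by blast
      have 0: "P2 \<noteq> 0" "R2 \<noteq> 0" using RP2 cyc_nonzero by auto
      have "degree P2 \<noteq> 0" using RP2(4) eN eK by auto
      hence lt: "degree R2 < degree L" using skew_mult_degree(1)[OF q0 0(2,1)] RP2(1) by simp
      have "controls R2" using controls_skew_mult[OF qn _ 0(2,1)] cL RP2(1) by simp
      from less.hyps[OF lt this RP2(2)] K NM have "eig_span A slopes K = K" by auto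
      moreover have "eig_span A slopes K \<subseteq> N1" unfolding N1_def by (rule eig_span_mono[OF K(2)]) simp
      ultimately show ?thesis using N1K by auto
    qed
    have convI: "conv_fls z" if zI: "z \<in> \<phi> ` N" for z
    proof -
      obtain S where S: "z = s.app S y" using zI cyc_elem[OF cyc] \<phi>(1) by blast
      have e: "conv_fls (emb n c)" for c unfolding emb_def by (rule conv_fls_compose_power) (use n in auto)
      have "conv_fls (?\<Sigma> u)" if "conv_fls u" for u
        unfolding ssig_def using that p1 by (intro conv_fls_mult conv_fls_const) (auto intro: conv_fls_dil)
      hence "conv_fls ((?\<Sigma> ^^ j) y)" for j by (induction j) (auto simp: yc)
      hence "conv_fls (emb n (coeff S j) * (?\<Sigma> ^^ j) y)" for j by (intro conv_fls_mult e)
      note terms = this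
      have sum: "conv_fls (sum f I)" if "\<And>i. conv_fls (f i)" for f :: "nat \<Rightarrow> 'a fls" and I
        using that by (induction I rule: infinite_finite_induct) (auto intro: conv_fls_add conv_fls_const[of 0, simplified])
      show ?thesis unfolding S act_def by (rule sum) (rule terms)
    qed
    \<comment> \<open>The constant by which T differs from the dilation by q on the image of
      \<phi>.\<close>
    define c0 where "c0 = \<eta> ^ n * p powi (- d * tri n)"
    have c0: "c0 \<noteq> 0" using \<eta> p0 by (simp add: c0_def)
    have T: "\<phi> (sop n d v) = fls_const c0 * fls_dil q (\<phi> v)" if "v \<in> N" for v
      using hom_slope_op[OF semilinear_axioms N \<phi>(3,4) that] slope_op_ssig_same[OF n(1) p p0]
      by (simp add: c0_def)
    obtain z j where z: "z \<in> \<phi> ` N" "z \<noteq> 0" "fls_dil q z = fls_const (q ^ j) * z"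
    proof (rule dilation_eigenvector[OF n(1) qn, of "\<phi> ` N" y])
      show "u - v \<in> \<phi> ` N" if "u \<in> \<phi> ` N" "v \<in> \<phi> ` N" for u v
        using that N by (auto simp flip: \<phi>diff intro!: imageI stable_diff)
      show "emb n c * u \<in> \<phi> ` N" if "u \<in> \<phi> ` N" for u c
        using that N by (auto simp flip: \<phi>(3) intro!: imageI stable_scale)
      show "fls_dil q u \<in> \<phi> ` N" if u: "u \<in> \<phi> ` N" for u
      proof -
        obtain v where v: "v \<in> N" "u = \<phi> v" using u by blast
        have "\<phi> (smul (mconst (inverse c0)) (sop n d v)) = emb n (mconst (inverse c0)) * (fls_const c0 * fls_dil q u)"
          using v N by (simp add: \<phi>(3) stable_sop T)
        also have "\<dots> = fls_dil q u" using n c0 by (simp add: emb_def mult.assoc[symmetric])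
        finally show ?thesis using v N by (metis imageI stable_scale stable_sop)
      qed
      show "y \<in> \<phi> ` N" using \<phi>(1)[of 1] eN by force
    qed (use convI y0 in auto)
    then obtain m where m: "m \<in> N" "z = \<phi> m" by blast
    \<comment> \<open>The eigenvector z of the dilation has eigenvalue q^j, so T has eigenvalue q^j
      c0 on it. This stays in the exponent system.\<close>
    define \<nu> where "\<nu> = q powi (int j) * c0"
    have \<nu>: "\<nu> \<in> A n d" unfolding \<nu>_def c0_def using r[OF \<eta>(1,2)] by (rule A_shift)
    have "\<phi> (shop n d \<nu> m) = 0"
    proof -
      have "\<phi> (shop n d \<nu> m) = \<phi> (sop n d m) - emb n (mconst \<nu>) * \<phi> m"
        using m N by (simp add: shop_def \<phi>diff \<phi>(3) stable_sop stable_scale)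
      also have "\<dots> = (fls_const c0 * fls_const (q ^ j)) * z - fls_const \<nu> * z"
        using m z n by (simp add: T emb_def mult.assoc)
      finally show ?thesis by (simp add: \<nu>_def mult.commute)
    qed
    hence "shop n d \<nu> m \<in> K" using stable_shop[OF N m(1)] unfolding K_def by blast
    hence "shop n d \<nu> m \<in> eig_span A slopes N" unfolding \<open>K = N1\<close> N1_def .
    \<comment> \<open>The lift m is an eigenvector only modulo N1; subtracting w makes it a
      generalised eigenvector of the module itself.\<close>
    from solve[OF N order_refl _ \<nu> this] n obtain w where
      w: "w \<in> N1" "shop n d \<nu> m - shop n d \<nu> w \<in> gen_eig n d \<nu>" by (auto simp: slopes_def N1_def)
    have wm: "w \<in> M" "m \<in> M" "w \<in> N" using w(1) m N1 NM by auto
    have "shop n d \<nu> (m - w) \<in> gen_eig n d \<nu>" using w(2) wm by (simp add: shop_diff)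
    hence "m - w \<in> gen_eig n d \<nu>" using wm by (intro gen_eigI[OF M_diff])
    hence "m - w \<in> N1" unfolding N1_def
      using n m wm N \<nu> by (intro eig_span_base[of n d]) (auto simp: slopes_def stable_diff)
    hence "m \<in> N1" using stable_add[OF N1(1) \<open>m - w \<in> N1\<close> w(1)] by simp
    hence "z = 0" using \<open>K = N1\<close> m by (auto simp: K_def)
    thus False using z by simp
  qed
  thus ?case by (simp add: N1_def)
qed

end

section \<open>The length of a slope is the dimension of its span\<close>

section \<open>Slopes and dimensions\<close>

text \<open>The number of nonzero roots over an algebraically closed field; for \<open>chi\<close>
  it is the horizontal length of the edge.\<close>

definition width :: "'a :: idom poly \<Rightarrow> nat" where
  "width f = degree f - order 0 f"

lemma coeff_order_0:
  fixes f :: "'a :: idom poly"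
  assumes "f \<noteq> 0"
  shows "coeff f (order 0 f) \<noteq> 0" "i < order 0 f \<Longrightarrow> coeff f i = 0" "order 0 f \<le> degree f"
proof -
  obtain g where g: "f = [:- 0, 1:] ^ order 0 f * g" "\<not> [:- 0, 1:] dvd g"
    using order_decomp[OF assms] by blast
  have fm: "f = monom 1 (order 0 f) * g" using g(1) by (simp add: monom_altdef)
  have g0: "coeff g 0 \<noteq> 0" using g(2) poly_eq_0_iff_dvd[of g 0] by (simp add: poly_0_coeff_0)
  have "coeff f k = (if k < order 0 f then 0 else coeff g (k - order 0 f))" for k
    using arg_cong[OF fm, of "\<lambda>h. coeff h k"] by (simp add: coeff_monom_mult)
  thus c: "coeff f (order 0 f) \<noteq> 0" "i < order 0 f \<Longrightarrow> coeff f i = 0" using g0 by auto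
  show "order 0 f \<le> degree f" using c(1) by (rule le_degree)
qed

lemma order_0_eqI:
  fixes f :: "'a :: idom poly"
  assumes "coeff f k \<noteq> 0" "\<And>i. i < k \<Longrightarrow> coeff f i = 0" shows "order 0 f = k"
proof -
  have "f \<noteq> 0" using assms by auto
  thus ?thesis using coeff_order_0[of f] assms by (metis linorder_neqE_nat)
qed

lemma width_eqI:
  fixes f :: "'a :: idom poly"
  assumes "coeff f i \<noteq> 0" "coeff f j \<noteq> 0" "\<And>k. coeff f k \<noteq> 0 \<Longrightarrow> i \<le> k \<and> k \<le> j"
  shows "width f = j - i"
proof -
  have "coeff f k = 0" if "k < i" for k using assms(3)[of k] that by (meson leD)
  hence "order 0 f = i" using assms(1) by (intro order_0_eqI)
  moreover have "degree f = j"
    using assms by (intro antisym degree_le le_degree) (auto simp: not_le[symmetric])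
  ultimately show ?thesis by (simp add: width_def)
qed

lemma width_mult:
  fixes f g :: "'a :: idom poly"
  assumes "f \<noteq> 0" "g \<noteq> 0" shows "width (f * g) = width f + width g"
proof -
  have "order 0 (f * g) = order 0 f + order 0 g" by (rule order_mult) (use assms in simp)
  thus ?thesis using coeff_order_0(3)[OF assms(1)] coeff_order_0(3)[OF assms(2)] assms
    by (simp add: width_def degree_mult_eq)
qed

lemma width_pcompose:
  fixes f :: "'a :: idom poly"
  assumes f: "f \<noteq> 0" and c: "c \<noteq> 0" shows "width (pcompose f [:0, c:]) = width f"
proof -
  have cf: "coeff (pcompose f [:0, c:]) i = c ^ i * coeff f i" for i
    by (simp add: coeff_pcompose_linear)
  have "order 0 (pcompose f [:0, c:]) = order 0 f"
    using coeff_order_0[OF f] c by (intro order_0_eqI) (auto simp: cf)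
  thus ?thesis using c by (simp add: width_def degree_pcompose)
qed

lemma width_no_root:
  fixes f :: "'a :: alg_closed_field poly"
  assumes "f \<noteq> 0" "\<And>z. z \<noteq> 0 \<Longrightarrow> poly f z \<noteq> 0" shows "width f = 0"
proof -
  have "\<not> order 0 f < degree f"
    using poly_nonzero_root[of f "order 0 f" "degree f"] coeff_order_0(1)[OF assms(1)] assms by force
  thus ?thesis by (simp add: width_def)
qed

lemma chi_coeff_iff_min:
  fixes p :: "'a :: valued_field" and d :: int
  assumes n: "n \<ge> 1" and p0: "p \<noteq> 0"
  defines "w \<equiv> \<lambda>L i. int n * fls_subdegree (mfls (coeff L i)) - d * int i"
  shows "coeff (chi n d p L) i \<noteq> 0 \<longleftrightarrow> coeff L i \<noteq> 0 \<and> (\<forall>j. coeff L j \<noteq> 0 \<longrightarrow> w L i \<le> w L j)"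
proof (cases "L = 0")
  case False
  then obtain j where j: "coeff L j \<noteq> 0" "wt n d L = w L j" unfolding w_def by (rule wt_attained)
  show ?thesis
    unfolding coeff_chi_nonzero_iff[OF n refl p0] using j wt_le[of L _ n d] unfolding w_def
    by (metis antisym)
qed (use coeff_chi_nonzero_iff[OF n refl p0, of d 0 i] in simp)

text \<open>Integral points on a line of slope d/n in lowest terms, after scaling, have horizontal
  distances divisible by n.\<close>

lemma chi_support_dvd:
  assumes nd: "n \<ge> 1" "coprime (int n) d" and p: "p \<noteq> 0" and c: "coeff (chi n d p L) i \<noteq> 0" "coeff (chi n d p L) j \<noteq> 0"
  shows "int n dvd int i - int j"
proof -
  have "d * (int i - int j) = int n * (fls_subdegree (mfls (coeff L i)) - fls_subdegree (mfls (coeff L j)))"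
    using c unfolding coeff_chi_nonzero_iff[OF nd(1) refl p] by (simp add: algebra_simps)
  hence "int n dvd d * (int i - int j)" by simp
  thus ?thesis using nd(2) by (simp add: coprime_dvd_mult_right_iff)
qed

text \<open>The last edge of the Newton polygon, obtained by reading the coefficients backwards,
  which changes the sign of slopes.\<close>

lemma slope_exists_top:
  fixes L :: "'a :: valued_field mero poly"
  assumes L0: "coeff L 0 \<noteq> 0" and deg: "degree L \<ge> 1"
  obtains n d i where "n \<ge> 1" "coprime (int n) d" "i < degree L"
    "\<And>p :: 'a. p \<noteq> 0 \<Longrightarrow> coeff (chi n d p L) (degree L) \<noteq> 0 \<and> coeff (chi n d p L) i \<noteq> 0"
proof -
  define R where "R = reflect_poly L"
  have cR: "coeff R i = (if i > degree L then 0 else coeff L (degree L - i))" for i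
    unfolding R_def by (rule coeff_reflect_poly)
  have dR: "degree R = degree L" unfolding R_def using L0 by (rule degree_reflect_poly_eq)
  have "coeff R 0 \<noteq> 0" "degree R \<ge> 1" using L0 deg dR by (auto simp: cR)
  from slope_exists[OF this] obtain n d i where *: "n \<ge> 1" "coprime (int n) d" "i \<ge> 1"
    "\<And>p :: 'a. p \<noteq> 0 \<Longrightarrow> coeff (chi n d p R) 0 \<noteq> 0 \<and> coeff (chi n d p R) i \<noteq> 0" by blast
  have tr: "coeff (chi n (- d) p L) (degree L - j) \<noteq> 0" if p: "p \<noteq> 0" and j: "coeff (chi n d p R) j \<noteq> 0" for p :: 'a and j
  proof -
    note iff = chi_coeff_iff_min[OF *(1) p]
    have jL: "j \<le> degree L" "coeff L (degree L - j) \<noteq> 0" using j by (auto simp: iff cR split: if_splits)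
    have "int n * fls_subdegree (mfls (coeff L (degree L - j))) - (- d) * int (degree L - j)
      \<le> int n * fls_subdegree (mfls (coeff L k)) - (- d) * int k" if k: "coeff L k \<noteq> 0" for k
    proof -
      have kL: "k \<le> degree L" using k by (rule le_degree)
      hence ck: "coeff R (degree L - k) = coeff L k" by (simp add: cR)
      hence "coeff R (degree L - k) \<noteq> 0" using k by simp
      hence "int n * fls_subdegree (mfls (coeff R j)) - d * int j
        \<le> int n * fls_subdegree (mfls (coeff R (degree L - k))) - d * int (degree L - k)"
        using j unfolding iff by blast
      thus ?thesis unfolding ck using jL kL by (simp add: cR of_nat_diff algebra_simps)
    qed
    thus ?thesis using jL unfolding iff by blast
  qed
  have i: "i \<le> degree L" using *(4)[of 1] chi_coeff_iff_min[OF *(1), of 1 d R i] by (auto simp: cR split: if_splits)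
  show ?thesis
  proof (rule that[of n "- d" "degree L - i"])
    fix p :: 'a assume p: "p \<noteq> 0"
    show "coeff (chi n (- d) p L) (degree L) \<noteq> 0 \<and> coeff (chi n (- d) p L) (degree L - i) \<noteq> 0"
      using *(4)[OF p] tr[OF p, of 0] tr[OF p, of i] by simp
  qed (use * i in auto)
qed

lemma root_exists:
  fixes q :: "'a :: alg_closed_field"
  assumes "n \<ge> 1" obtains p where "p ^ n = q"
proof -
  have "degree (monom 1 n - [:q:]) = n"
    using assms by (subst diff_conv_add_uminus, subst degree_add_eq_left) (auto simp: degree_monom_eq)
  then obtain p where "poly (monom 1 n - [:q:]) p = 0"
    using alg_closed_imp_poly_has_root[of "monom 1 n - [:q:]"] assms by auto
  thus ?thesis using that by (simp add: poly_monom)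
qed

context qdm_exponents
begin

lemma root_nonzero: "p ^ n = q \<Longrightarrow> n \<ge> 1 \<Longrightarrow> p \<noteq> 0"
  using q0 by (auto simp: power_0_left)

text \<open>A nonzero root of the polynomial of P gives a formal solution and so a nonzero
  homomorphism into Laurent series of slope d/n. It kills the multiples of P e, and by
  \<open>slope_op_ssig_other\<close> every generalised eigenvector of another slope. If these span
  N, it is zero.\<close>

lemma no_homomorphism:
  assumes cyc: "cyc smul q \<Sigma> e L N" and NM: "N \<subseteq> M" and L: "L = skew_mult q R P" "P \<noteq> 0"
    and n: "n \<ge> 1" and p: "p ^ n = q" and z: "z \<noteq> 0" "poly (chi n d p P) z = 0"
    and gen: "N = span B"
    and B: "\<And>v. v \<in> B \<Longrightarrow> (\<exists>n' d' \<nu>. v \<in> gen_eig n' d' \<nu> \<and> \<nu> \<noteq> 0 \<and> d' * int n \<noteq> d * int n') \<or>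
       (\<exists>S. v = app S (app P e))"
  shows False
proof -
  have N: "stable N" using cyc_stable[OF cyc NM] .
  have eN: "e \<in> N" "e \<in> M" using cyc NM by (auto simp: cyc_def)
  have p0: "p \<noteq> 0" using root_nonzero[OF p n] .
  have pn: "non_root_of_unity p" using non_root_of_unity_root[of p n] p qn n by simp
  obtain \<eta> where \<eta>: "\<eta> \<noteq> 0" "poly (chi n d p P) \<eta> = 0" "\<And>k. k \<ge> 1 \<Longrightarrow> poly (chi n d p P) (\<eta> * p ^ k) \<noteq> 0"
    using maximal_root[OF chi_nonzero[OF n p p0 L(2)] pn z] by blast
  obtain Y where Y: "fps_nth Y 0 = 1" "act (\<lambda>c y. emb n c * y) (ssig p d \<eta>) P (fps_to_fls Y) = 0"
    using formal_solution[OF n p p0 \<eta>(2,3)] by blast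
  define y where "y = fps_to_fls Y"
  have y0: "y \<noteq> 0" using Y(1) by (auto simp: y_def)
  let ?smul = "\<lambda>c y. emb n c * y" and ?\<Sigma> = "ssig p d \<eta>"
  interpret s: semilinear ?smul q UNIV ?\<Sigma> by (rule semilinear_ssig[OF n p p0])
  have Ly: "s.app L y = 0" using Y(2) by (simp add: L(1) s.act_skew_mult y_def)
  obtain \<phi> where \<phi>: "\<And>P. \<phi> (app P e) = s.app P y" "\<And>u v. u \<in> N \<Longrightarrow> v \<in> N \<Longrightarrow> \<phi> (u + v) = \<phi> u + \<phi> v"
    "\<And>a v. v \<in> N \<Longrightarrow> \<phi> (smul a v) = emb n a * \<phi> v" "\<And>v. v \<in> N \<Longrightarrow> \<phi> (\<Sigma> v) = ?\<Sigma> (\<phi> v)"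
    using cyc_hom[OF semilinear_axioms s.semilinear_axioms cyc NM Ly] by blast
  have \<phi>diff: "\<phi> (u - v) = \<phi> u - \<phi> v" if "u \<in> N" "v \<in> N" for u v
    using \<phi>(2)[of "u - v" v] that N by (simp add: stable_diff)
  have \<phi>0: "\<phi> 0 = 0" using \<phi>(1)[of 0] by simp
  have eig: "\<phi> v = 0" if v: "v \<in> N" "(shop n' d' \<nu> ^^ h) v = 0" "\<nu> \<noteq> 0" "d' * int n \<noteq> d * int n'" for v n' d' \<nu> h
    using v(1,2)
  proof (induction h arbitrary: v)
    case (Suc h)
    have "shop n' d' \<nu> v \<in> N" using Suc.prems N by (simp add: stable_shop)
    moreover have "(shop n' d' \<nu> ^^ h) (shop n' d' \<nu> v) = 0" using Suc.prems by (simp add: funpow_swap1)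
    ultimately have "\<phi> (shop n' d' \<nu> v) = 0" by (rule Suc.IH)
    moreover have "\<phi> (shop n' d' \<nu> v) = slope_op ?smul ?\<Sigma> n' d' (\<phi> v) - fls_const \<nu> * \<phi> v"
      using Suc.prems N hom_slope_op[OF semilinear_axioms N \<phi>(3,4)] n
      by (simp add: shop_def \<phi>diff \<phi>(3) stable_sop stable_scale emb_def)
    ultimately show ?case
      using slope_op_ssig_other[OF n p p0 _ \<eta>(1) v(3), of d n' d' "\<phi> v"] v(4) by (simp add: mult.commute)
  qed (simp add: \<phi>0)
  have BN: "B \<subseteq> N" unfolding gen by (rule span_superset)
  have "\<phi> v = 0 \<and> v \<in> N" if "v \<in> span B" for v
    using that
  proof (induction rule: span_induct_alt)
    case (step c x u)
    have x: "x \<in> N" using step BN by blast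
    have "\<phi> x = 0"
      using B[OF step(1)]
    proof (elim disjE exE conjE)
      fix n' d' \<nu> assume "x \<in> gen_eig n' d' \<nu>" "\<nu> \<noteq> 0" "d' * int n \<noteq> d * int n'"
      thus ?thesis using eig[OF x] by (auto simp: gen_eig_def)
    next
      fix S assume S: "x = app S (app P e)"
      have "\<phi> x = s.app (skew_mult q S P) y" using S \<phi>(1)[of "skew_mult q S P"] eN by (simp add: act_skew_mult)
      thus ?thesis using Y(2) by (simp add: s.act_skew_mult y_def)
    qed
    thus ?case using x step N by (simp add: \<phi> stable_add stable_scale)
  qed (simp add: \<phi>0 stable_0[OF N])
  hence "\<phi> e = 0" using eN gen by blast
  thus False using \<phi>(1)[of 1] y0 by simp
qed

lemma eig_span_idem:
  assumes "stable N" shows "eig_span A S (eig_span A S N) = eig_span A S N"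
proof
  show "eig_span A S (eig_span A S N) \<subseteq> eig_span A S N"
    using eig_span_stable[OF assms] eig_span_mono by blast
  have "eig_gens A S N \<subseteq> eig_gens A S (eig_span A S N)"
    by (auto simp: eig_gens_def intro: eig_span_base)
  thus "eig_span A S N \<subseteq> eig_span A S (eig_span A S N)"
    unfolding eig_span_def[of A S N] unfolding eig_span_def by (rule span_mono)
qed

text \<open>The case P = L of \<open>no_homomorphism\<close>: the slopes occurring among generators
  already include all slopes of the operator.\<close>

lemma slope_in:
  assumes cyc: "cyc smul q \<Sigma> e L N" and NM: "N \<subseteq> M" and S: "S \<subseteq> slopes" "eig_span A S N = N"
    and n: "(n, d) \<in> slopes" and p: "p ^ n = q" and z: "z \<noteq> 0" "poly (chi n d p L) z = 0"
  shows "(n, d) \<in> S"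
proof (rule ccontr)
  assume ne: "(n, d) \<notin> S"
  have n1: "n \<ge> 1" "coprime (int n) d" using n by (auto simp: slopes_def)
  show False
  proof (rule no_homomorphism[OF cyc NM _ cyc_nonzero[OF cyc] n1(1) p z])
    show "L = skew_mult q 1 L" by (simp add: q0)
    show "N = span (eig_gens A S N)" using S(2) by (simp add: eig_span_def)
    fix v assume "v \<in> eig_gens A S N"
    then obtain n' d' \<nu> where v: "(n', d') \<in> S" "\<nu> \<in> A n' d'" "v \<in> gen_eig n' d' \<nu>" by (auto simp: eig_gens_def)
    have "n' \<ge> 1" "coprime (int n') d'" using v S by (auto simp: slopes_def)
    hence "d' * int n \<noteq> d * int n'" using slopes_unique[of n' n d' d] n1 v ne by metis
    thus "(\<exists>n' d' \<nu>. v \<in> gen_eig n' d' \<nu> \<and> \<nu> \<noteq> 0 \<and> d' * int n \<noteq> d * int n') \<or> (\<exists>S. v = app S (app L e))"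
      using v A_nonzero by blast
  qed
qed

lemma cyc_one:
  assumes "cyc smul q \<Sigma> e L N" "N \<subseteq> M" "degree L = 0" shows "N = {0}"
  using cyc_basis(3)[OF assms(1,2)] assms(3) by simp

text \<open>Both the first and the last edge of the polygon must have the only slope available, so a
  single edge runs from 0 to the degree.\<close>

lemma pure_coeffs:
  assumes cyc: "cyc smul q \<Sigma> e L N" and NM: "N \<subseteq> M" and S: "(n, d) \<in> slopes" "eig_span A {(n, d)} N = N"
    and p: "p ^ n = q" and L: "degree L \<ge> 1"
  shows "coeff (chi n d p L) 0 \<noteq> 0" "coeff (chi n d p L) (degree L) \<noteq> 0"
proof -
  have n1: "n \<ge> 1" using S by (auto simp: slopes_def)
  have p0: "p \<noteq> 0" using root_nonzero[OF p n1] .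
  have L0: "coeff L 0 \<noteq> 0" using cyc by (simp add: cyc_def)
  have nd: "n' = n \<and> d' = d" if n': "n' \<ge> 1" "coprime (int n') d'" and ij: "i < j"
    "\<And>p :: 'a. p \<noteq> 0 \<Longrightarrow> coeff (chi n' d' p L) i \<noteq> 0 \<and> coeff (chi n' d' p L) j \<noteq> 0" for n' d' i j
  proof -
    obtain p' where p': "p' ^ n' = q" using root_exists[OF n'(1)] by blast
    have "p' \<noteq> 0" using root_nonzero[OF p' n'(1)] .
    then obtain z where "z \<noteq> 0" "poly (chi n' d' p' L) z = 0"
      using poly_nonzero_root[of "chi n' d' p' L" i j] ij by blast
    from slope_in[OF cyc NM _ S(2) _ p' this] S n' show ?thesis by (auto simp: slopes_def)
  qed
  obtain n' d' i where 1: "n' \<ge> 1" "coprime (int n') d'" "i \<ge> 1"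
    "\<And>p :: 'a. p \<noteq> 0 \<Longrightarrow> coeff (chi n' d' p L) 0 \<noteq> 0 \<and> coeff (chi n' d' p L) i \<noteq> 0"
    using slope_exists[OF L0 L] by blast
  thus "coeff (chi n d p L) 0 \<noteq> 0" using nd[of n' d' 0 i] p0 by auto
  obtain n' d' i where 2: "n' \<ge> 1" "coprime (int n') d'" "i < degree L"
    "\<And>p :: 'a. p \<noteq> 0 \<Longrightarrow> coeff (chi n' d' p L) (degree L) \<noteq> 0 \<and> coeff (chi n' d' p L) i \<noteq> 0"
    using slope_exists_top[OF L0 L] by blast
  thus "coeff (chi n d p L) (degree L) \<noteq> 0" using nd[of n' d' i "degree L"] p0 by auto
qed

lemma coeff_chi_bound: "n \<ge> 1 \<Longrightarrow> p \<noteq> 0 \<Longrightarrow> coeff (chi n d p L) k \<noteq> 0 \<Longrightarrow> k \<le> degree L"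
  using chi_coeff_iff_min[of n p d L k] le_degree[of L k] by blast

text \<open>Let R belong to the span of slope d/n and P to the quotient. P has no nonzero root for
  this slope by \<open>no_homomorphism\<close>, so its width is 0. R is pure, so its width is its
  degree, which is the dimension of the span. Widths add up by multiplicativity.\<close>

lemma slope_width:
  assumes cyc: "cyc smul q \<Sigma> e L N" and NM: "N \<subseteq> M" and gen: "eig_span A slopes N = N"
    and n: "(n, d) \<in> slopes" and p: "p ^ n = q"
  shows "width (chi n d p L) = dim (eig_span A {(n, d)} N)"
proof -
  have n1: "n \<ge> 1" "coprime (int n) d" using n by (auto simp: slopes_def)
  have p0: "p \<noteq> 0" using root_nonzero[OF p n1(1)] .
  have pn: "non_root_of_unity p" using non_root_of_unity_root[of p n] p qn n1 by simp
  have N: "stable N" using cyc_stable[OF cyc NM] .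
  define N0 where "N0 = eig_span A {(n, d)} N"
  have N0: "stable N0" "N0 \<subseteq> N" unfolding N0_def using eig_span_stable[OF N] by auto
  obtain R P where RP: "L = skew_mult q R P" "cyc smul q \<Sigma> (app P e) R N0" "coeff P 0 \<noteq> 0"
    using cyc_factor[OF cyc NM N0] by blast
  have 0: "P \<noteq> 0" "R \<noteq> 0" using RP cyc_nonzero by auto
  have "poly (chi n d p P) z \<noteq> 0" if z: "z \<noteq> 0" for z
  proof
    assume r: "poly (chi n d p P) z = 0"
    show False
    proof (rule no_homomorphism[OF cyc NM RP(1) 0(1) n1(1) p z r])
      show "N = span (eig_gens A slopes N)" using gen by (simp add: eig_span_def)
      fix v assume "v \<in> eig_gens A slopes N"
      then obtain n' d' \<nu> where v: "(n', d') \<in> slopes" "\<nu> \<in> A n' d'" "v \<in> gen_eig n' d' \<nu>" "v \<in> N" by (auto simp: eig_gens_def)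
      show "(\<exists>n' d' \<nu>. v \<in> gen_eig n' d' \<nu> \<and> \<nu> \<noteq> 0 \<and> d' * int n \<noteq> d * int n') \<or> (\<exists>S. v = app S (app P e))"
      proof (cases "d' * int n = d * int n'")
        case True
        hence "n' = n" "d' = d" using slopes_unique[of n' n d' d] v n1 by (auto simp: slopes_def)
        hence "v \<in> N0" unfolding N0_def using v by (intro eig_span_base[of n d]) auto
        thus ?thesis using cyc_elem[OF RP(2)] by blast
      qed (use v A_nonzero in blast)
    qed
  qed
  hence wP: "width (chi n d p P) = 0" by (intro width_no_root chi_nonzero[OF n1(1) p p0 0(1)])
  have N0M: "N0 \<subseteq> M" using N0 NM by simp
  have wR: "width (chi n d p R) = degree R"
  proof (cases "degree R \<ge> 1")
    case True
    have "eig_span A {(n, d)} N0 = N0" unfolding N0_def by (rule eig_span_idem[OF N])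
    from pure_coeffs[OF RP(2) N0M n this p True] coeff_chi_bound[OF n1(1) p0] show ?thesis
      using width_eqI[of "chi n d p R" 0 "degree R"] by auto
  next
    case False
    have "degree (chi n d p R) \<le> 0"
      by (rule degree_le) (use coeff_chi_bound[OF n1(1) p0] False in \<open>fastforce simp: not_le\<close>)
    thus ?thesis using False by (simp add: width_def)
  qed
  have "width (chi n d p L) = width (chi n d p R) + width (chi n d p P)"
    unfolding RP(1) chi_skew_mult(2)[OF n1(1) p p0 pn 0(2,1)]
    using chi_nonzero[OF n1(1) p p0] 0 p0 by (subst width_mult) (auto simp: width_pcompose pcompose_eq_0_iff)
  thus ?thesis using wP wR cyc_basis(4)[OF RP(2) N0M] by (simp add: N0_def)
qed

text \<open>Such a vector makes the span of slope d/n inside the given span nonzero. Its dimension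
  is a width, so \<open>chi\<close> has a nonzero root and \<open>slope_in\<close> applies.\<close>

lemma eigenvector_slope:
  assumes cyc: "cyc smul q \<Sigma> e L N" and NM: "N \<subseteq> M" and X: "X \<subseteq> slopes"
    and n: "(n, d) \<in> slopes" and v: "\<nu> \<in> A n d" "v \<in> gen_eig n d \<nu>" "v \<in> eig_span A X N" "v \<noteq> 0"
  shows "(n, d) \<in> X"
proof -
  have N: "stable N" using cyc_stable[OF cyc NM] .
  define N1 where "N1 = eig_span A X N"
  have N1: "stable N1" "N1 \<subseteq> N" unfolding N1_def using eig_span_stable[OF N] by auto
  have N1M: "N1 \<subseteq> M" using N1 NM by simp
  obtain R P where R: "cyc smul q \<Sigma> (app P e) R N1" using cyc_factor[OF cyc NM N1] by blast
  have gen: "eig_span A X N1 = N1" unfolding N1_def by (rule eig_span_idem[OF N])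
  have gen': "eig_span A slopes N1 = N1"
    using eig_span_mono[OF order_refl X, of N1] eig_span_stable(2)[OF N1(1)] gen by blast
  have n1: "n \<ge> 1" using n by (auto simp: slopes_def)
  obtain p where p: "p ^ n = q" using root_exists[OF n1] by blast
  have "v \<in> eig_span A {(n, d)} N1" using v by (intro eig_span_base[of n d]) (auto simp: N1_def)
  hence "eig_span A {(n, d)} N1 \<noteq> {0}" using v by auto
  moreover have "dim (eig_span A {(n, d)} N1) = 0 \<Longrightarrow> eig_span A {(n, d)} N1 = {0}"
  proof -
    assume 0: "dim (eig_span A {(n, d)} N1) = 0"
    have st: "stable (eig_span A {(n, d)} N1)" "eig_span A {(n, d)} N1 \<subseteq> N1" using eig_span_stable[OF N1(1)] by auto
    obtain R' P' where R': "cyc smul q \<Sigma> (app P' (app P e)) R' (eig_span A {(n, d)} N1)"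
      using cyc_factor[OF R N1M st] by blast
    have sM: "eig_span A {(n, d)} N1 \<subseteq> M" using st N1M by simp
    show "eig_span A {(n, d)} N1 = {0}" using cyc_one[OF R' sM] cyc_basis(4)[OF R' sM] 0 by simp
  qed
  ultimately have "dim (eig_span A {(n, d)} N1) > 0" by auto
  hence "width (chi n d p R) > 0" using slope_width[OF R N1M gen' n p] by simp
  moreover have "chi n d p R \<noteq> 0" using chi_nonzero[OF n1 p root_nonzero[OF p n1] cyc_nonzero[OF R]] .
  ultimately obtain z where "z \<noteq> 0" "poly (chi n d p R) z = 0"
    using width_no_root by (metis less_irrefl)
  from slope_in[OF R N1M X gen n p this] show ?thesis .
qed

text \<open>The intersection is itself a stable submodule, hence spanned by its generalised
  eigenvectors (\<open>generated\<close>). A nonzero one would have its slope in both sets.\<close>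

lemma eig_span_disjoint:
  assumes L: "controls L" and cyc: "cyc smul q \<Sigma> e L N" and NM: "N \<subseteq> M"
    and S: "S \<subseteq> slopes" "S' \<subseteq> slopes" "S \<inter> S' = {}"
  shows "eig_span A S N \<inter> eig_span A S' N = {0}"
proof -
  have N: "stable N" using cyc_stable[OF cyc NM] .
  define Z where "Z = eig_span A S N \<inter> eig_span A S' N"
  have st: "stable (eig_span A S N)" "stable (eig_span A S' N)" "eig_span A S N \<subseteq> N" "eig_span A S' N \<subseteq> N"
    using eig_span_stable[OF N] by auto
  have Z: "stable Z" "Z \<subseteq> N" using st by (auto simp: Z_def stable_def subspace_inter)
  have ZM: "Z \<subseteq> M" using Z NM by simp
  obtain R P where RP: "L = skew_mult q R P" "cyc smul q \<Sigma> (app P e) R Z" "coeff P 0 \<noteq> 0"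
    using cyc_factor[OF cyc NM Z] by blast
  have "P \<noteq> 0" "R \<noteq> 0" using RP cyc_nonzero by auto
  hence "controls R" using controls_skew_mult[OF qn, of R P] L RP(1) by simp
  hence gen: "Z = span (eig_gens A slopes Z)" using generated[OF _ RP(2) ZM] by (simp add: eig_span_def)
  have "eig_gens A slopes Z \<subseteq> {0}"
  proof
    fix v assume "v \<in> eig_gens A slopes Z"
    then obtain n d \<nu> where v: "(n, d) \<in> slopes" "\<nu> \<in> A n d" "v \<in> gen_eig n d \<nu>" "v \<in> Z" by (auto simp: eig_gens_def)
    have "(n, d) \<in> S \<and> (n, d) \<in> S'" if "v \<noteq> 0"
      using eigenvector_slope[OF cyc NM S(1) v(1,2,3) _ that] eigenvector_slope[OF cyc NM S(2) v(1,2,3) _ that] v(4)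
      by (simp add: Z_def)
    thus "v \<in> {0}" using S(3) by blast
  qed
  hence "Z \<subseteq> span {0}" unfolding gen[symmetric] using gen span_mono by metis
  thus ?thesis using stable_0[OF Z(1)] by (auto simp: Z_def)
qed

end

section \<open>Eigenvectors inside \<open>K\<close>-spans of generalised eigenvectors\<close>

section \<open>Independence of generalised eigenvectors\<close>

lemma dilation_eq_const:
  fixes f :: "'a :: valued_field mero"
  assumes q: "q \<noteq> 0" and eq: "mconst a * mero_dilate q f - mconst b * f = mconst c"
    and nr: "\<And>k. k \<noteq> 0 \<Longrightarrow> a * q powi k \<noteq> b"
  shows "\<exists>s. f = mconst s \<and> a * s - b * s = c"
proof -
  have nth: "(a * q powi k - b) * fls_nth (mfls f) k = (if k = 0 then c else 0)" for k
    using arg_cong[OF eq, of "\<lambda>z. fls_nth (mfls z) k"] q by (simp add: mfls_dilate algebra_simps)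
  have "fls_nth (mfls f) k = 0" if "k \<noteq> 0" for k
    using nth[of k] nr[OF that] that by simp
  hence "mfls f = fls_const (fls_nth (mfls f) 0)" by (intro fls_eqI) simp
  hence "f = mconst (fls_nth (mfls f) 0)" by (simp flip: mfls_eq_iff)
  moreover have "a * fls_nth (mfls f) 0 - b * fls_nth (mfls f) 0 = c" using nth[of 0] by (simp add: algebra_simps)
  ultimately show ?thesis by blast
qed

lemma dilation_eq_zero:
  fixes f :: "'a :: valued_field mero"
  assumes q: "q \<noteq> 0" and eq: "mconst a * mero_dilate q f - mconst b * f = 0"
    and nr: "\<And>k. a * q powi k \<noteq> b"
  shows "f = 0"
proof -
  have "(a * q powi k - b) * fls_nth (mfls f) k = 0" for k
    using arg_cong[OF eq, of "\<lambda>z. fls_nth (mfls z) k"] q by (simp add: mfls_dilate algebra_simps)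
  hence "mfls f = 0" using nr by (intro fls_eqI) simp
  thus ?thesis by simp
qed

context semilinear
begin

lemma scale_in_subspace: "subspace U \<Longrightarrow> smul c v \<in> U \<Longrightarrow> v \<notin> U \<Longrightarrow> c = 0"
  using subspace_scale[of U "smul c v" "inverse c"] by (cases "c = 0") auto

definition const_subspace :: "'b set \<Rightarrow> bool" where
  "const_subspace V \<longleftrightarrow> 0 \<in> V \<and> (\<forall>u\<in>V. \<forall>v\<in>V. u + v \<in> V) \<and> (\<forall>c. \<forall>v\<in>V. smul (mconst c) v \<in> V)"

lemma const_subspace_diff: "const_subspace V \<Longrightarrow> u \<in> V \<Longrightarrow> v \<in> V \<Longrightarrow> u - v \<in> V"
  unfolding const_subspace_def
  by (metis (no_types, lifting) mconst_1 mconst_uminus scale_minus_left scale_one uminus_add_conv_diff add.commute)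

text \<open>The last clause says that V, a space over the constants, absorbs all generalised
  eigenvectors for \<nu> that lie in the \<open>K\<close>-space U (\<open>good_descend\<close>).
  Such pairs are built up by adjoining one vector at a time.\<close>

definition good :: "nat \<Rightarrow> int \<Rightarrow> 'a \<Rightarrow> 'b set \<Rightarrow> 'b set \<Rightarrow> bool" where
  "good n d \<nu> U V \<longleftrightarrow> subspace U \<and> U \<subseteq> M \<and> (\<forall>u\<in>U. sop n d u \<in> U) \<and> V \<subseteq> U \<and> const_subspace V \<and>
     (\<forall>z\<in>U. shop n d \<nu> z \<in> V \<longrightarrow> z \<in> V)"

lemma good_zero: "good n d \<nu> {0} {0}"
  by (auto simp: good_def const_subspace_def)

lemma extend_by_vector:
  assumes U: "subspace U" "U \<subseteq> M" "\<forall>u\<in>U. sop n d u \<in> U" and v: "v \<in> M" "shop n d \<xi> v \<in> U"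
  defines "U' \<equiv> {u + smul f v | u f. u \<in> U}"
  shows "subspace U'" "U' \<subseteq> M" "\<And>u. u \<in> U' \<Longrightarrow> sop n d u \<in> U'" "U \<subseteq> U'" "v \<in> U'"
    "\<And>u f. u \<in> U \<Longrightarrow> shop n d \<nu> (u + smul f v) =
       (shop n d \<nu> u + smul (mero_dilate (q ^ n) f) (shop n d \<xi> v)) +
       smul (mconst \<xi> * mero_dilate (q ^ n) f - mconst \<nu> * f) v"
    "\<And>u. u \<in> U \<Longrightarrow> shop n d \<nu> u \<in> U"
proof -
  have Tv: "sop n d v = smul (mconst \<xi>) v + shop n d \<xi> v" by (simp add: shop_def)
  have Tuf: "sop n d (u + smul f v) = (sop n d u + smul (mero_dilate (q ^ n) f) (shop n d \<xi> v)) +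
       smul (mconst \<xi> * mero_dilate (q ^ n) f) v" if "u \<in> U" for u f
  proof -
    have "u \<in> M" using that U by blast
    thus ?thesis using v by (simp add: sop_add sop_scale Tv scale_right_distrib mult.commute add_ac)
  qed
  show "subspace U'"
  proof (rule subspaceI)
    show "0 \<in> U'" unfolding U'_def using U subspace_0 by (intro CollectI exI[of _ 0]) auto
    fix x y assume "x \<in> U'" "y \<in> U'"
    then obtain a f b g where xy: "x = a + smul f v" "y = b + smul g v" "a \<in> U" "b \<in> U" by (auto simp: U'_def)
    have "x + y = (a + b) + smul (f + g) v" by (simp add: xy scale_left_distrib add_ac)
    moreover have "a + b \<in> U" using xy U subspace_add by blast
    ultimately show "x + y \<in> U'" unfolding U'_def by blast
  next
    fix c x assume "x \<in> U'"
    then obtain a f where x: "x = a + smul f v" "a \<in> U" by (auto simp: U'_def)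
    have "smul c x = smul c a + smul (c * f) v" by (simp add: x scale_right_distrib)
    moreover have "smul c a \<in> U" using x U subspace_scale by blast
    ultimately show "smul c x \<in> U'" unfolding U'_def by blast
  qed
  show "U' \<subseteq> M" using U v by (auto simp: U'_def)
  show "sop n d x \<in> U'" if x: "x \<in> U'" for x
  proof -
    obtain u f where u: "x = u + smul f v" "u \<in> U" using x by (auto simp: U'_def)
    have "sop n d u + smul (mero_dilate (q ^ n) f) (shop n d \<xi> v) \<in> U"
      using u U v subspace_add subspace_scale by blast
    thus ?thesis unfolding u(1) Tuf[OF u(2)] U'_def by blast
  qed
  show "U \<subseteq> U'"
  proof
    fix u assume "u \<in> U"
    thus "u \<in> U'" unfolding U'_def by (intro CollectI exI[of _ u] exI[of _ 0]) auto
  qed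
  have "v = 0 + smul 1 v" by simp
  thus "v \<in> U'" unfolding U'_def using U subspace_0 by blast
  show "shop n d \<nu> (u + smul f v) =
       (shop n d \<nu> u + smul (mero_dilate (q ^ n) f) (shop n d \<xi> v)) +
       smul (mconst \<xi> * mero_dilate (q ^ n) f - mconst \<nu> * f) v" if "u \<in> U" for u f
    using Tuf[OF that, of f] by (simp add: shop_def[of n d \<nu>] scale_right_distrib scale_left_diff_distrib)
  show "shop n d \<nu> u \<in> U" if "u \<in> U" for u
    unfolding shop_def using that U subspace_diff subspace_scale by blast
qed

text \<open>If u + f v is sent into V by T - \<nu>, then f satisfies \<xi> \<sigma>^n f = \<nu> f.
  This forces f = 0, as \<nu>/\<xi> is not a power of q^n. So nothing new enters V.\<close>

lemma good_add_foreign: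
  assumes g: "good n d \<nu> U V" and v: "v \<in> M" "shop n d \<xi> v \<in> U"
    and nr: "\<And>k. \<xi> * (q ^ n) powi k \<noteq> \<nu>"
  shows "\<exists>U'. good n d \<nu> U' V \<and> U \<subseteq> U' \<and> v \<in> U'"
proof (cases "v \<in> U")
  case False
  have U: "subspace U" "U \<subseteq> M" "\<forall>u\<in>U. sop n d u \<in> U" using g by (auto simp: good_def)
  note e = extend_by_vector[OF U v]
  define U' where "U' = {u + smul f v | u f. u \<in> U}"
  have "z \<in> V" if z: "z \<in> U'" "shop n d \<nu> z \<in> V" for z
  proof -
    obtain u f where u: "z = u + smul f v" "u \<in> U" using z by (auto simp: U'_def)
    let ?f = "mconst \<xi> * mero_dilate (q ^ n) f - mconst \<nu> * f"
    have "shop n d \<nu> z \<in> U" using z g by (auto simp: good_def)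
    moreover have "shop n d \<nu> u + smul (mero_dilate (q ^ n) f) (shop n d \<xi> v) \<in> U"
      using e(7)[OF u(2)] v U subspace_add subspace_scale by blast
    ultimately have "smul ?f v \<in> U" using e(6)[OF u(2), of \<nu> f] U subspace_diff[of U] unfolding u(1)
      by (metis add_diff_cancel_left')
    hence "?f = 0" by (rule scale_in_subspace[OF U(1) _ False])
    hence "f = 0" using dilation_eq_zero[of "q ^ n" \<xi> f \<nu>] nr q0 by simp
    thus "z \<in> V" using u z g by (auto simp: good_def)
  qed
  hence "good n d \<nu> U' V" using e(1-4) g unfolding good_def U'_def by blast
  thus ?thesis using e(4,5) unfolding U'_def by blast
qed (use g in blast)

text \<open>Here the coefficient f satisfies \<nu> \<sigma>^n f - \<nu> f = c with c constant.
  Comparing coefficients, f is constant and c = 0, so V grows only by constant multiples of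
  v.\<close>

lemma good_add_same:
  assumes g: "good n d \<nu> U V" and v: "v \<in> M" "shop n d \<nu> v \<in> V"
    and \<nu>: "\<nu> \<noteq> 0" and nr: "\<And>k. k \<noteq> 0 \<Longrightarrow> (q ^ n) powi k \<noteq> 1"
  shows "\<exists>U' V'. good n d \<nu> U' V' \<and> U \<subseteq> U' \<and> v \<in> U' \<and> V' \<subseteq> {w + smul (mconst c) v | w c. w \<in> V}"
proof (cases "v \<in> U")
  case True
  hence "V \<subseteq> {w + smul (mconst c) v | w c. w \<in> V}"
    by (auto intro!: exI[of _ "0 :: 'a"])
  thus ?thesis using True g by blast
next
  case False
  have U: "subspace U" "U \<subseteq> M" "\<forall>u\<in>U. sop n d u \<in> U" and VU: "V \<subseteq> U" and V: "const_subspace V"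
    using g by (auto simp: good_def)
  have vU: "shop n d \<nu> v \<in> U" using v VU by blast
  note e = extend_by_vector[OF U v(1) vU]
  define U' where "U' = {u + smul f v | u f. u \<in> U}"
  define V' where "V' = {w + smul (mconst c) v | w c. w \<in> V}"
  have V': "const_subspace V'"
    unfolding const_subspace_def
  proof safe
    show "0 \<in> V'" using V unfolding V'_def const_subspace_def by (intro CollectI exI[of _ 0]) auto
    fix x y assume "x \<in> V'" "y \<in> V'"
    then obtain a b c s where xy: "x = a + smul (mconst c) v" "y = b + smul (mconst s) v" "a \<in> V" "b \<in> V"
      by (auto simp: V'_def)
    have "x + y = (a + b) + smul (mconst (c + s)) v" by (simp add: xy mconst_add scale_left_distrib add_ac)
    moreover have "a + b \<in> V" using V xy by (auto simp: const_subspace_def)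
    ultimately show "x + y \<in> V'" unfolding V'_def by blast
  next
    fix c x assume "x \<in> V'"
    then obtain a s where x: "x = a + smul (mconst s) v" "a \<in> V" by (auto simp: V'_def)
    have "smul (mconst c) x = smul (mconst c) a + smul (mconst (c * s)) v"
      by (simp add: x mconst_mult scale_right_distrib)
    moreover have "smul (mconst c) a \<in> V" using V x by (auto simp: const_subspace_def)
    ultimately show "smul (mconst c) x \<in> V'" unfolding V'_def by blast
  qed
  have V'U': "V' \<subseteq> U'" using VU by (auto simp: V'_def U'_def)
  have "z \<in> V'" if z: "z \<in> U'" "shop n d \<nu> z \<in> V'" for z
  proof -
    obtain u f where u: "z = u + smul f v" "u \<in> U" using z by (auto simp: U'_def)
    obtain w c where w: "shop n d \<nu> z = w + smul (mconst c) v" "w \<in> V" using z by (auto simp: V'_def)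
    let ?f = "mconst \<nu> * mero_dilate (q ^ n) f - mconst \<nu> * f"
    define u' where "u' = shop n d \<nu> u + smul (mero_dilate (q ^ n) f) (shop n d \<nu> v)"
    have u': "u' \<in> U" unfolding u'_def using e(7)[OF u(2)] vU U subspace_add subspace_scale by blast
    have eq: "u' + smul ?f v = w + smul (mconst c) v"
      using e(6)[OF u(2), of \<nu> f] w(1) unfolding u(1) u'_def by simp
    hence "smul (?f - mconst c) v = w - u'" by (simp add: scale_left_diff_distrib algebra_simps)
    hence "smul (?f - mconst c) v \<in> U" using u' w VU U subspace_diff by auto
    hence fc: "?f = mconst c" using scale_in_subspace[OF U(1) _ False] by force
    have "\<nu> * (q ^ n) powi k \<noteq> \<nu>" if "k \<noteq> 0" for k using nr[OF that] \<nu> by simp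
    then obtain s where s: "f = mconst s" "\<nu> * s - \<nu> * s = c"
      using dilation_eq_const[OF _ fc] q0 by auto
    hence "c = 0" by simp
    hence "u' = w" using eq fc by simp
    hence "shop n d \<nu> u = w - smul (mconst s) (shop n d \<nu> v)"
      unfolding u'_def using s q0 by simp (metis add_diff_cancel_right')
    also have "\<dots> \<in> V" using w v V by (intro const_subspace_diff[OF V]) (auto simp: const_subspace_def)
    finally have "u \<in> V" using g u by (auto simp: good_def)
    thus "z \<in> V'" unfolding u(1) s(1) V'_def by blast
  qed
  hence "good n d \<nu> U' V'" using e(1-3) V' V'U' unfolding good_def U'_def by blast
  thus ?thesis using e(4,5) unfolding U'_def V'_def by blast
qed

lemma good_descend: "good n d \<nu> U V \<Longrightarrow> z \<in> U \<Longrightarrow> (shop n d \<nu> ^^ h) z = 0 \<Longrightarrow> z \<in> V"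
proof (induction h arbitrary: z)
  case 0
  thus ?case by (auto simp: good_def const_subspace_def)
next
  case (Suc h)
  have "shop n d \<nu> z \<in> U" using Suc.prems unfolding good_def shop_def by (metis subspace_diff subspace_scale)
  moreover have "(shop n d \<nu> ^^ h) (shop n d \<nu> z) = 0" using Suc.prems by (simp add: funpow_swap1)
  ultimately have "shop n d \<nu> z \<in> V" using Suc by blast
  thus ?case using Suc.prems by (auto simp: good_def)
qed

lemma good_chain_foreign:
  assumes "good n d \<nu> U V" "v \<in> M" "(shop n d \<xi> ^^ h) v = 0" and nr: "\<And>k. \<xi> * (q ^ n) powi k \<noteq> \<nu>"
  shows "\<exists>U'. good n d \<nu> U' V \<and> U \<subseteq> U' \<and> v \<in> U'"
  using assms(2,3)
proof (induction h arbitrary: v)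
  case 0
  thus ?case using assms(1) by (auto simp: good_def intro: subspace_0)
next
  case (Suc h)
  have "(shop n d \<xi> ^^ h) (shop n d \<xi> v) = 0" using Suc.prems by (simp add: funpow_swap1)
  then obtain U' where U': "good n d \<nu> U' V" "U \<subseteq> U'" "shop n d \<xi> v \<in> U'"
    using Suc.IH[OF shop_closed[OF Suc.prems(1)]] by blast
  from good_add_foreign[OF U'(1) Suc.prems(1) U'(3) nr] U'(2) show ?case by blast
qed

lemma good_chain_same:
  assumes g: "good n d \<nu> U V" "V \<subseteq> V1" and V1: "const_subspace V1" "V1 \<subseteq> M" "\<And>v. v \<in> V1 \<Longrightarrow> shop n d \<nu> v \<in> V1"
    and v: "v \<in> V1" "(shop n d \<nu> ^^ h) v = 0"
    and \<nu>: "\<nu> \<noteq> 0" and nr: "\<And>k. k \<noteq> 0 \<Longrightarrow> (q ^ n) powi k \<noteq> 1"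
  shows "\<exists>U' V'. good n d \<nu> U' V' \<and> V' \<subseteq> V1 \<and> U \<subseteq> U' \<and> v \<in> U'"
  using v
proof (induction h arbitrary: v)
  case 0
  thus ?case using g by (auto simp: good_def intro: subspace_0)
next
  case (Suc h)
  have sh: "(shop n d \<nu> ^^ h) (shop n d \<nu> v) = 0" using Suc.prems by (simp add: funpow_swap1)
  then obtain U' V' where U': "good n d \<nu> U' V'" "V' \<subseteq> V1" "U \<subseteq> U'" "shop n d \<nu> v \<in> U'"
    using Suc V1 by blast
  have "shop n d \<nu> v \<in> V'" using good_descend[OF U'(1,4) sh] .
  moreover have "v \<in> M" using Suc.prems V1 by blast
  ultimately obtain U'' V'' where U'': "good n d \<nu> U'' V''" "U' \<subseteq> U''" "v \<in> U''" "V'' \<subseteq> {w + smul (mconst c) v | w c. w \<in> V'}"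
    using good_add_same[OF U'(1) _ _ \<nu> nr] by blast
  have "V'' \<subseteq> V1" using U''(4) U'(2) V1(1) Suc.prems(1) unfolding const_subspace_def by blast
  thus ?case using U'' U' by blast
qed

lemma good_finite:
  assumes V1: "const_subspace V1" "V1 \<subseteq> M" "\<And>v. v \<in> V1 \<Longrightarrow> shop n d \<nu> v \<in> V1"
    and \<nu>: "\<nu> \<noteq> 0" and nr: "\<And>k. k \<noteq> 0 \<Longrightarrow> (q ^ n) powi k \<noteq> 1"
    and F: "finite F" "\<And>v. v \<in> F \<Longrightarrow> (v \<in> V1 \<and> (\<exists>h. (shop n d \<nu> ^^ h) v = 0)) \<or>
      (\<exists>\<xi>. v \<in> gen_eig n d \<xi> \<and> (\<forall>k. \<xi> * (q ^ n) powi k \<noteq> \<nu>))"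
  shows "\<exists>U V. good n d \<nu> U V \<and> V \<subseteq> V1 \<and> F \<subseteq> U"
  using F
proof (induction F rule: finite_induct)
  case empty
  thus ?case using good_zero V1(1) by (auto simp: const_subspace_def intro!: exI[of _ "{0}"])
next
  case (insert v F)
  then obtain U V where UV: "good n d \<nu> U V" "V \<subseteq> V1" "F \<subseteq> U" by auto
  have "\<exists>U' V'. good n d \<nu> U' V' \<and> V' \<subseteq> V1 \<and> U \<subseteq> U' \<and> v \<in> U'"
  proof -
    consider (same) h where "v \<in> V1" "(shop n d \<nu> ^^ h) v = 0"
      | (foreign) \<xi> h where "v \<in> M" "(shop n d \<xi> ^^ h) v = 0" "\<And>k. \<xi> * (q ^ n) powi k \<noteq> \<nu>"
      using insert.prems[OF insertI1] unfolding gen_eig_def by blast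
    thus ?thesis
    proof cases
      case same
      thus ?thesis using good_chain_same[OF UV(1,2) V1 _ _ \<nu> nr] by blast
    next
      case foreign
      thus ?thesis using good_chain_foreign[OF UV(1)] UV(2) by blast
    qed
  qed
  thus ?case using UV by blast
qed

text \<open>A substitute for linear independence: a generalised eigenvector for \<nu> in a
  \<open>K\<close>-span is controlled, over the constants, by the generators for \<nu>. Only
  finitely many generators are involved, and a good pair is built for these.\<close>

lemma gen_eig_in_span:
  assumes V1: "const_subspace V1" "V1 \<subseteq> M" "\<And>v. v \<in> V1 \<Longrightarrow> shop n d \<nu> v \<in> V1"
    and \<nu>: "\<nu> \<noteq> 0" and nr: "\<And>k. k \<noteq> 0 \<Longrightarrow> (q ^ n) powi k \<noteq> 1"
    and B: "\<And>v. v \<in> B \<Longrightarrow> (v \<in> V1 \<and> (\<exists>h. (shop n d \<nu> ^^ h) v = 0)) \<or>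
      (\<exists>\<xi>. v \<in> gen_eig n d \<xi> \<and> (\<forall>k. \<xi> * (q ^ n) powi k \<noteq> \<nu>))"
    and z: "z \<in> span B" "(shop n d \<nu> ^^ h) z = 0"
  shows "z \<in> V1"
proof -
  obtain F where F: "finite F" "F \<subseteq> B" "z \<in> span F" using z(1) by (auto simp: span_explicit intro: span_sum span_scale span_base)
  have "\<exists>U V. good n d \<nu> U V \<and> V \<subseteq> V1 \<and> F \<subseteq> U"
    by (rule good_finite[OF V1 \<nu> nr F(1)]) (use B F in blast)+
  then obtain U V where U: "good n d \<nu> U V" "V \<subseteq> V1" "F \<subseteq> U" by blast
  have "z \<in> U" using F(3) U span_minimal[OF U(3)] by (auto simp: good_def)
  thus ?thesis using good_descend[OF U(1) _ z(2)] U by blast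
qed

end

section \<open>Stable subspaces as submodules, and decompositions into indecomposables\<close>

section \<open>Decompositions\<close>

context qdm
begin

lemma sigma_pow_inj: "u \<in> M \<Longrightarrow> v \<in> M \<Longrightarrow> (\<Sigma> ^^ k) u = (\<Sigma> ^^ k) v \<Longrightarrow> u = v"
proof (induction k)
  case (Suc k)
  hence "(\<Sigma> ^^ k) u = (\<Sigma> ^^ k) v" using bij_sigma by (auto simp: bij_betw_def inj_on_def)
  thus ?case using Suc by blast
qed simp

text \<open>As R has a nonzero constant coefficient, the relation R f = 0 expresses f by the vectors
  \<Sigma>^i f with i > 0, which lie in the image of \<Sigma>.\<close>

lemma cyc_image:
  assumes R: "cyc smul q \<Sigma> f R Z" and ZM: "Z \<subseteq> M" shows "\<Sigma> ` Z = Z"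
proof
  have Z: "stable Z" by (rule cyc_stable[OF R ZM])
  show "\<Sigma> ` Z \<subseteq> Z" using Z by (auto simp: stable_def)
  have f: "f \<in> Z" "f \<in> M" using R ZM by (auto simp: cyc_def)
  have sub: "subspace (\<Sigma> ` Z)"
  proof (rule subspaceI)
    show "0 \<in> \<Sigma> ` Z" using stable_0[OF Z] sigma_0 by (metis imageI)
    show "x + y \<in> \<Sigma> ` Z" if xy: "x \<in> \<Sigma> ` Z" "y \<in> \<Sigma> ` Z" for x y
    proof -
      obtain u v where uv: "x = \<Sigma> u" "y = \<Sigma> v" "u \<in> Z" "v \<in> Z" using xy by blast
      hence "x + y = \<Sigma> (u + v)" using ZM by (simp add: add subset_iff)
      thus ?thesis using uv Z stable_add by blast
    qed
    show "smul c x \<in> \<Sigma> ` Z" if x: "x \<in> \<Sigma> ` Z" for c x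
    proof -
      obtain u where u: "x = \<Sigma> u" "u \<in> Z" using x by blast
      hence "smul c x = \<Sigma> (smul (mero_dilate (inverse q) c) u)"
        using ZM q0 by (auto simp: scale mero_dilate_inverse_dilate)
      thus ?thesis using u Z stable_scale by blast
    qed
  qed
  have pos: "(\<Sigma> ^^ i) f \<in> \<Sigma> ` Z" if "i > 0" for i
    using that stable_pow[OF Z f(1), of "i - 1"] by (cases i) auto
  have "f \<in> \<Sigma> ` Z"
  proof -
    have "app R f = 0" by (rule cyc_annihilates[OF R])
    also have "app R f = (\<Sum>i\<in>{..degree R}. smul (coeff R i) ((\<Sigma> ^^ i) f))" by (simp add: act_def)
    also have "\<dots> = smul (coeff R 0) f + (\<Sum>i\<in>{..degree R} - {0}. smul (coeff R i) ((\<Sigma> ^^ i) f))"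
      by (subst sum.remove[of _ 0]) auto
    finally have "smul (coeff R 0) f = - (\<Sum>i\<in>{..degree R} - {0}. smul (coeff R i) ((\<Sigma> ^^ i) f))"
      by (simp add: eq_neg_iff_add_eq_0)
    moreover have "\<dots> \<in> \<Sigma> ` Z"
      by (intro subspace_neg[OF sub] subspace_sum[OF sub] subspace_scale[OF sub] pos) auto
    ultimately have "smul (coeff R 0) f \<in> \<Sigma> ` Z" by simp
    moreover have "coeff R 0 \<noteq> 0" using R by (simp add: cyc_def)
    ultimately show ?thesis using scale_in_subspace[OF sub] by blast
  qed
  hence "(\<Sigma> ^^ i) f \<in> \<Sigma> ` Z" for i using pos[of i] by (cases "i = 0") auto
  hence "span ((\<lambda>i. (\<Sigma> ^^ i) f) ` {..<degree R}) \<subseteq> \<Sigma> ` Z" by (intro span_minimal[OF _ sub]) auto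
  thus "Z \<subseteq> \<Sigma> ` Z" using cyc_basis(3)[OF R ZM] by simp
qed

end

locale controlled = qdm_exponents smul q M \<Sigma> A
  for smul :: "'a :: base_field mero \<Rightarrow> 'b :: ab_group_add \<Rightarrow> 'b" and q :: 'a and M \<Sigma> A +
  fixes e :: 'b and L :: "'a mero poly"
  assumes ctrl: "controls L" and cyclic: "cyc smul q \<Sigma> e L M"
begin

lemma stable_cyc:
  assumes "stable Z"
  obtains R P where "L = skew_mult q R P" "cyc smul q \<Sigma> (app P e) R Z" "R \<noteq> 0" "P \<noteq> 0" "controls R"
proof -
  have ZM: "Z \<subseteq> M" using assms by (auto simp: stable_def)
  obtain R P where RP: "L = skew_mult q R P" "cyc smul q \<Sigma> (app P e) R Z" "coeff P 0 \<noteq> 0"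
    using cyc_factor[OF cyclic order_refl assms ZM] by blast
  have 0: "P \<noteq> 0" "R \<noteq> 0" using RP cyc_nonzero by auto
  thus ?thesis using that RP controls_skew_mult[OF qn, of R P] ctrl by auto
qed

lemma stable_generated: "stable Z \<Longrightarrow> eig_span A slopes Z = Z"
  using stable_cyc generated by (metis stable_def)

lemma stable_dim_less:
  assumes "stable Z" "stable Z'" "Z \<subseteq> Z'" "Z \<noteq> Z'" shows "dim Z < dim Z'"
proof -
  have M: "Z' \<subseteq> M" "Z \<subseteq> M" using assms by (auto simp: stable_def)
  obtain R P where R: "cyc smul q \<Sigma> (app P e) R Z'" using stable_cyc[OF assms(2)] by metis
  obtain R2 P2 where R2: "R = skew_mult q R2 P2" "cyc smul q \<Sigma> (app P2 (app P e)) R2 Z" "coeff P2 0 \<noteq> 0" "degree P2 = 0 \<Longrightarrow> Z = Z'"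
    using cyc_factor[OF R M(1) assms(1,3)] by blast
  have "P2 \<noteq> 0" "R2 \<noteq> 0" using R2 cyc_nonzero by auto
  hence "degree R = degree R2 + degree P2" using skew_mult_degree(1)[OF q0] R2(1) by simp
  moreover have "degree P2 \<noteq> 0" using R2(4) assms(4) by blast
  ultimately show ?thesis using cyc_basis(4)[OF R M(1)] cyc_basis(4)[OF R2(2) M(2)] by simp
qed

lemma stable_dim_0: "stable Z \<Longrightarrow> dim Z = 0 \<longleftrightarrow> Z = {0}"
proof -
  assume Z: "stable Z"
  then obtain R P where R: "cyc smul q \<Sigma> (app P e) R Z" using stable_cyc by metis
  have ZM: "Z \<subseteq> M" using Z by (auto simp: stable_def)
  have "dim {0} = dim (span {})" by simp
  also have "\<dots> = 0" unfolding dim_span using dim_eq_card_independent[OF independent_empty] by simp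
  finally show ?thesis using cyc_one[OF R ZM] cyc_basis(4)[OF R ZM] by auto
qed

lemma stable_image:
  assumes Z: "stable Z" shows "\<Sigma> ` Z = Z"
  using cyc_image stable_cyc[OF Z] Z by (metis stable_def)

lemma stable_q_submodule:
  assumes Z: "stable Z" and ZN: "Z \<subseteq> N" shows "q_submodule smul q \<Sigma> Z N"
proof -
  have ZM: "Z \<subseteq> M" using Z by (auto simp: stable_def)
  obtain R P where R: "cyc smul q \<Sigma> (app P e) R Z" using stable_cyc[OF Z] by metis
  have "finite ((\<lambda>i. (\<Sigma> ^^ i) (app P e)) ` {..<degree R})" by simp
  hence "\<exists>B. finite B \<and> span B = Z" using cyc_basis(3)[OF R ZM] by blast
  moreover have "bij_betw \<Sigma> Z Z"
    using stable_image[OF Z] bij_sigma ZM by (auto simp: bij_betw_def intro: inj_on_subset)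
  ultimately have "q_difference_module smul q Z \<Sigma>"
    using Z ZM by unfold_locales (auto simp: stable_def add scale subset_iff)
  thus ?thesis using ZN by (simp add: q_submodule_def)
qed

lemma q_submodule_stable: "q_submodule smul q \<Sigma> Z N \<Longrightarrow> N \<subseteq> M \<Longrightarrow> stable Z"
proof -
  assume "q_submodule smul q \<Sigma> Z N" "N \<subseteq> M"
  then interpret Z: q_difference_module smul q Z \<Sigma> by (simp add: q_submodule_def)
  show ?thesis
    using Z.subspace_carrier Z.bij_sigma \<open>q_submodule smul q \<Sigma> Z N\<close> \<open>N \<subseteq> M\<close>
    by (auto simp: stable_def q_submodule_def bij_betw_def)
qed

definition set_sum :: "'b set \<Rightarrow> 'b set \<Rightarrow> 'b set" where
  "set_sum U V = {u + v | u v. u \<in> U \<and> v \<in> V}"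

lemma stable_set_sum:
  assumes "stable U" "stable V" shows "stable (set_sum U V)"
proof -
  have UV: "U \<subseteq> M" "V \<subseteq> M" using assms by (auto simp: stable_def)
  have "subspace (set_sum U V)"
    unfolding set_sum_def using assms by (intro subspace_sums) (auto simp: stable_def)
  moreover have "\<Sigma> x \<in> set_sum U V" if x: "x \<in> set_sum U V" for x
  proof -
    obtain u v where uv: "x = u + v" "u \<in> U" "v \<in> V" using x by (auto simp: set_sum_def)
    hence "\<Sigma> x = \<Sigma> u + \<Sigma> v" using UV by (simp add: add subset_iff)
    thus ?thesis using uv assms unfolding set_sum_def by (blast intro: stable_sigma)
  qed
  moreover have "set_sum U V \<subseteq> M" using UV by (auto simp: set_sum_def subset_iff)
  ultimately show ?thesis by (auto simp: stable_def)
qed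

lemma set_sum_superset:
  assumes "stable U" "stable V" shows "U \<subseteq> set_sum U V" "V \<subseteq> set_sum U V"
proof -
  have "u = u + 0" "u = 0 + u" for u :: 'b by auto
  thus "U \<subseteq> set_sum U V" "V \<subseteq> set_sum U V"
    unfolding set_sum_def using stable_0[OF assms(1)] stable_0[OF assms(2)] by blast+
qed

text \<open>A direct sum given as a list of summands, convenient for concatenating decompositions by
  induction; \<open>dsum_internal\<close> converts it to the indexed form.\<close>

fun dsum :: "'b set list \<Rightarrow> 'b set \<Rightarrow> bool" where
  "dsum [] Z \<longleftrightarrow> Z = {0}"
| "dsum (P # Ps) Z \<longleftrightarrow> stable P \<and> (\<exists>Z'. dsum Ps Z' \<and> P \<inter> Z' = {0} \<and> Z = set_sum P Z')"

lemma stable_zero: "stable {0}"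
  by (auto simp: stable_def)

lemma dsum_stable: "dsum Ps Z \<Longrightarrow> stable Z"
  by (induction Ps arbitrary: Z) (auto simp: stable_zero stable_set_sum)

lemma dsum_subset: "dsum Ps Z \<Longrightarrow> P \<in> set Ps \<Longrightarrow> P \<subseteq> Z"
proof (induction Ps arbitrary: Z)
  case (Cons Q Ps)
  then obtain Z' where Z': "dsum Ps Z'" "Z = set_sum Q Z'" "stable Q" by auto
  have "Q \<subseteq> Z" "Z' \<subseteq> Z" unfolding Z'(2) using Z' dsum_stable set_sum_superset by blast+
  thus ?case using Cons Z' by auto
qed auto

lemma dsum_append:
  "dsum Ps U \<Longrightarrow> dsum Qs V \<Longrightarrow> U \<inter> V = {0} \<Longrightarrow> dsum (Ps @ Qs) (set_sum U V)"
proof (induction Ps arbitrary: U)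
  case Nil
  thus ?case by (auto simp: set_sum_def)
next
  case (Cons P Ps)
  then obtain U' where U': "dsum Ps U'" "P \<inter> U' = {0}" "U = set_sum P U'" "stable P" by auto
  have st: "stable U'" "stable V" using U' Cons.prems dsum_stable by auto
  have U'U: "U' \<subseteq> U" "P \<subseteq> U"
    unfolding U'(3) using set_sum_superset[OF U'(4) st(1)] by auto
  have "U' \<inter> V = {0}" using U'U Cons.prems(3) stable_0[OF st(1)] by blast
  hence 1: "dsum (Ps @ Qs) (set_sum U' V)" by (rule Cons.IH[OF U'(1) Cons.prems(2)])
  have "P \<inter> set_sum U' V \<subseteq> {0}"
  proof
    fix x assume "x \<in> P \<inter> set_sum U' V"
    hence x: "x \<in> P" "x \<in> set_sum U' V" by auto
    then obtain u v where uv: "x = u + v" "u \<in> U'" "v \<in> V" by (auto simp: set_sum_def)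
    have "stable U" using dsum_stable[OF Cons.prems(1)] .
    hence "v \<in> U" using uv x U'U stable_diff[of U x u] by auto
    hence "v = 0" using uv Cons.prems(3) by auto
    hence "x \<in> P \<inter> U'" using uv x by simp
    thus "x \<in> {0}" using U'(2) by simp
  qed
  moreover have "0 \<in> P \<inter> set_sum U' V" using stable_0[OF U'(4)] stable_0[OF stable_set_sum[OF st]] by simp
  ultimately have "P \<inter> set_sum U' V = {0}" by blast
  moreover have "set_sum U V = set_sum P (set_sum U' V)"
  proof
    show "set_sum U V \<subseteq> set_sum P (set_sum U' V)"
    proof
      fix x assume "x \<in> set_sum U V"
      then obtain a b c where "x = (a + b) + c" "a \<in> P" "b \<in> U'" "c \<in> V" unfolding U'(3) set_sum_def by blast
      hence "x = a + (b + c)" "a \<in> P" "b + c \<in> set_sum U' V" by (auto simp: set_sum_def add.assoc)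
      thus "x \<in> set_sum P (set_sum U' V)" unfolding set_sum_def[of P] by blast
    qed
    show "set_sum P (set_sum U' V) \<subseteq> set_sum U V"
    proof
      fix x assume "x \<in> set_sum P (set_sum U' V)"
      then obtain a b c where "x = a + (b + c)" "a \<in> P" "b \<in> U'" "c \<in> V" unfolding set_sum_def by blast
      hence "x = (a + b) + c" "a + b \<in> U" "c \<in> V" unfolding U'(3) set_sum_def by (auto simp: add.assoc)
      thus "x \<in> set_sum U V" unfolding set_sum_def by blast
    qed
  qed
  ultimately show ?case using 1 U' by auto
qed

lemma internal_direct_sum_insert:
  assumes I: "finite I" "i \<notin> I" and ids: "internal_direct_sum I N Z" and st: "stable (N i)" "stable Z"
    and dis: "N i \<inter> Z = {0}"
  shows "internal_direct_sum (insert i I) N (set_sum (N i) Z)"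
proof -
  have bij: "bij_betw (\<lambda>u. \<Sum>j\<in>I. u j) (Pi\<^sub>E I N) Z" using ids by (simp add: internal_direct_sum_def)
  have split: "(\<Sum>j\<in>insert i I. u j) = u i + (\<Sum>j\<in>I. u j)" for u :: "_ \<Rightarrow> 'b" using I by simp
  have restr: "restrict u I \<in> Pi\<^sub>E I N" "(\<Sum>j\<in>I. restrict u I j) = (\<Sum>j\<in>I. u j)" if "u \<in> Pi\<^sub>E (insert i I) N" for u
    using that by (auto simp: PiE_def)
  have sumZ: "(\<Sum>j\<in>I. u j) \<in> Z" if "u \<in> Pi\<^sub>E (insert i I) N" for u
    using bij_betwE[OF bij] restr[OF that] by fastforce
  show ?thesis
    unfolding internal_direct_sum_def
  proof (rule bij_betw_imageI)
    show "inj_on (\<lambda>u. \<Sum>j\<in>insert i I. u j) (Pi\<^sub>E (insert i I) N)"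
    proof (rule inj_onI)
      fix u v assume u: "u \<in> Pi\<^sub>E (insert i I) N" and v: "v \<in> Pi\<^sub>E (insert i I) N"
        and eq: "(\<Sum>j\<in>insert i I. u j) = (\<Sum>j\<in>insert i I. v j)"
      have ui: "u i \<in> N i" "v i \<in> N i" using u v by (auto simp: PiE_def)
      have "u i - v i = (\<Sum>j\<in>I. v j) - (\<Sum>j\<in>I. u j)" using eq unfolding split by (simp add: algebra_simps)
      moreover have "u i - v i \<in> N i" using ui st stable_diff by blast
      moreover have "(\<Sum>j\<in>I. v j) - (\<Sum>j\<in>I. u j) \<in> Z" using sumZ[OF u] sumZ[OF v] st stable_diff by blast
      ultimately have "u i - v i \<in> N i \<inter> Z" by (simp only: Int_iff)
      hence "u i - v i = 0" using dis by blast
      hence i: "u i = v i" by simp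
      hence "(\<Sum>j\<in>I. restrict u I j) = (\<Sum>j\<in>I. restrict v I j)" using eq restr(2)[OF u] restr(2)[OF v] unfolding split by simp
      hence "restrict u I = restrict v I" using bij restr(1)[OF u] restr(1)[OF v] by (auto simp: bij_betw_def inj_on_def)
      hence "u j = v j" if "j \<in> insert i I" for j using that i by (metis insertE restrict_apply')
      thus "u = v" using u v by (intro PiE_ext) auto
    qed
    show "(\<lambda>u. \<Sum>j\<in>insert i I. u j) ` Pi\<^sub>E (insert i I) N = set_sum (N i) Z"
    proof
      show "(\<lambda>u. \<Sum>j\<in>insert i I. u j) ` Pi\<^sub>E (insert i I) N \<subseteq> set_sum (N i) Z"
        unfolding split set_sum_def using sumZ by (fastforce simp: PiE_def)
      show "set_sum (N i) Z \<subseteq> (\<lambda>u. \<Sum>j\<in>insert i I. u j) ` Pi\<^sub>E (insert i I) N"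
      proof
        fix x assume "x \<in> set_sum (N i) Z"
        then obtain a z where a: "x = a + z" "a \<in> N i" "z \<in> Z" by (auto simp: set_sum_def)
        then obtain u where u: "u \<in> Pi\<^sub>E I N" "z = (\<Sum>j\<in>I. u j)" using bij by (auto simp: bij_betw_def)
        have "u(i := a) \<in> Pi\<^sub>E (insert i I) N" using u a by (auto simp: PiE_def extensional_def)
        moreover have "(\<Sum>j\<in>insert i I. (u(i := a)) j) = x"
          unfolding split using I a u by (auto intro!: sum.cong)
        ultimately show "x \<in> (\<lambda>u. \<Sum>j\<in>insert i I. u j) ` Pi\<^sub>E (insert i I) N" by blast
      qed
    qed
  qed
qed

lemma internal_direct_sum_cong:
  "(\<And>i. i \<in> I \<Longrightarrow> N i = N' i) \<Longrightarrow> internal_direct_sum I N Z \<longleftrightarrow> internal_direct_sum I N' Z"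
  unfolding internal_direct_sum_def by (metis PiE_cong)

text \<open>The offset a is general for the sake of the induction, where the tail of the list is
  indexed from the next number on.\<close>

lemma dsum_internal:
  "dsum Ps Z \<Longrightarrow> internal_direct_sum {Suc a..a + length Ps} (\<lambda>j. Ps ! (j - Suc a)) Z"
proof (induction Ps arbitrary: Z a)
  case Nil
  thus ?case by (auto simp: internal_direct_sum_def bij_betw_def inj_on_def)
next
  case (Cons P Ps)
  then obtain Z' where Z': "dsum Ps Z'" "P \<inter> Z' = {0}" "Z = set_sum P Z'" "stable P" by auto
  let ?N = "\<lambda>j. (P # Ps) ! (j - Suc a)"
  have "internal_direct_sum {Suc (Suc a)..Suc a + length Ps} (\<lambda>j. Ps ! (j - Suc (Suc a))) Z'" using Cons.IH[OF Z'(1)] .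
  also have "?this \<longleftrightarrow> internal_direct_sum {Suc (Suc a)..Suc a + length Ps} ?N Z'"
  proof (rule internal_direct_sum_cong)
    fix j assume "j \<in> {Suc (Suc a)..Suc a + length Ps}"
    hence "j - Suc a = Suc (j - Suc (Suc a))" by auto
    thus "Ps ! (j - Suc (Suc a)) = ?N j" by simp
  qed
  finally have "internal_direct_sum (insert (Suc a) {Suc (Suc a)..Suc a + length Ps}) ?N (set_sum (?N (Suc a)) Z')"
    using Z' dsum_stable by (intro internal_direct_sum_insert) auto
  moreover have "insert (Suc a) {Suc (Suc a)..Suc a + length Ps} = {Suc a..a + length (P # Ps)}" by auto
  ultimately show ?case using Z'(3) by simp
qed

lemma two_summands:
  assumes "stable U" "stable V" "U \<inter> V = {0}"
  shows "internal_direct_sum (UNIV :: bool set) (\<lambda>b. if b then U else V) (set_sum U V)"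
proof -
  have f: "internal_direct_sum {} N {0 :: 'b}" for N :: "bool \<Rightarrow> 'b set"
    by (auto simp: internal_direct_sum_def bij_betw_def)
  let ?N = "\<lambda>b. if b then U else V"
  have "internal_direct_sum (insert False {}) ?N (set_sum (?N False) {0})"
    by (rule internal_direct_sum_insert) (use assms f stable_0 in \<open>auto simp: stable_zero\<close>)
  moreover have "set_sum V {0} = V" by (auto simp: set_sum_def)
  ultimately have "internal_direct_sum {False} ?N V" by simp
  hence "internal_direct_sum (insert True {False}) ?N (set_sum (?N True) V)"
    by (intro internal_direct_sum_insert) (use assms in auto)
  thus ?thesis by (simp add: UNIV_bool insert_commute)
qed

lemma indecomposable_split:
  assumes ind: "indecomposable_module smul q \<Sigma> Z" and UV: "stable U" "stable V" "U \<inter> V = {0}" "Z = set_sum U V"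
  shows "U = {0} \<or> V = {0}"
proof (rule ccontr)
  assume n: "\<not> ?thesis"
  have "U \<subseteq> Z" "V \<subseteq> Z" unfolding UV(4) using set_sum_superset[OF UV(1,2)] by auto
  hence "\<forall>b. q_submodule smul q \<Sigma> (if b then U else V) Z \<and> (if b then U else V) \<noteq> {0}"
    using stable_q_submodule UV(1,2) n by simp
  moreover have "internal_direct_sum UNIV (\<lambda>b. if b then U else V) Z"
    unfolding UV(4) by (rule two_summands[OF UV(1,2,3)])
  ultimately have "\<exists>N :: bool \<Rightarrow> 'b set. (\<forall>i. q_submodule smul q \<Sigma> (N i) Z \<and> N i \<noteq> {0}) \<and> internal_direct_sum UNIV N Z"
    by (intro exI[of _ "\<lambda>b. if b then U else V"]) blast
  thus False using ind unfolding indecomposable_module_def by blast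
qed

text \<open>A module that splits has two proper summands, both of smaller dimension
  (\<open>stable_dim_less\<close>), so splitting ends.\<close>

lemma indecomposable_decomposition:
  assumes "stable Z" shows "\<exists>Ps. dsum Ps Z \<and> (\<forall>P\<in>set Ps. indecomposable_module smul q \<Sigma> P)"
  using assms
proof (induction "dim Z" arbitrary: Z rule: less_induct)
  case less
  have ZM: "Z \<subseteq> M" using less.prems by (auto simp: stable_def)
  show ?case
  proof (cases "Z = {0} \<or> indecomposable_module smul q \<Sigma> Z")
    case True
    thus ?thesis
    proof
      assume "Z = {0}"
      thus ?thesis by (intro exI[of _ "[]"]) auto
    next
      assume "indecomposable_module smul q \<Sigma> Z"
      moreover have "set_sum Z {0} = Z" by (auto simp: set_sum_def)
      ultimately show ?thesis using less.prems stable_0 by (intro exI[of _ "[Z]"]) auto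
    qed
  next
    case False
    have "q_difference_module smul q Z \<Sigma>"
      using stable_q_submodule[OF less.prems order_refl] by (simp add: q_submodule_def)
    hence "\<exists>N :: bool \<Rightarrow> 'b set. (\<forall>i. q_submodule smul q \<Sigma> (N i) Z \<and> N i \<noteq> {0}) \<and> internal_direct_sum UNIV N Z"
      using False by (cases "Z = {0}") (simp_all add: indecomposable_module_def)
    then obtain N :: "bool \<Rightarrow> 'b set" where
      "(\<forall>i. q_submodule smul q \<Sigma> (N i) Z \<and> N i \<noteq> {0}) \<and> internal_direct_sum UNIV N Z" ..
    hence N: "\<And>i. q_submodule smul q \<Sigma> (N i) Z" "\<And>i. N i \<noteq> {0}" "internal_direct_sum UNIV N Z"
      by simp_all
    define U V where "U = N True" and "V = N False"
    have st: "stable U" "stable V" "U \<noteq> {0}" "V \<noteq> {0}" "U \<subseteq> Z" "V \<subseteq> Z"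
      using N(1,2) q_submodule_stable[OF _ ZM] by (auto simp: U_def V_def q_submodule_def)
    have bij: "bij_betw (\<lambda>u. u True + u False) (Pi\<^sub>E UNIV N) Z"
      using N(3) by (simp add: internal_direct_sum_def UNIV_bool add.commute)
    have dis: "U \<inter> V = {0}"
    proof safe
      fix x assume x: "x \<in> U" "x \<in> V"
      define u where "u = (\<lambda>b. if b then x else 0)"
      define v where "v = (\<lambda>b. if b then 0 else x)"
      have "u \<in> Pi\<^sub>E UNIV N" "v \<in> Pi\<^sub>E UNIV N"
        using x stable_0[OF st(1)] stable_0[OF st(2)]
        by (simp_all add: PiE_UNIV_domain all_bool_eq u_def v_def U_def V_def)
      moreover have "u True + u False = v True + v False" by (simp add: u_def v_def)
      ultimately have "u = v" using bij by (auto simp: bij_betw_def inj_on_def)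
      hence "u True = v True" by simp
      thus "x = 0" by (simp add: u_def v_def)
    qed (use st stable_0 in auto)
    have Z: "Z = set_sum U V"
    proof
      show "Z \<subseteq> set_sum U V"
      proof
        fix z assume "z \<in> Z"
        then obtain u where "u \<in> Pi\<^sub>E UNIV N" "z = u True + u False" using bij by (auto simp: bij_betw_def)
        thus "z \<in> set_sum U V" unfolding set_sum_def U_def V_def by (auto simp: PiE_UNIV_domain)
      qed
      show "set_sum U V \<subseteq> Z" using st less.prems by (auto simp: set_sum_def intro: stable_add)
    qed
    have "U \<noteq> Z" "V \<noteq> Z" using dis st by auto
    hence "dim U < dim Z" "dim V < dim Z" using stable_dim_less st less.prems by auto
    then obtain Ps Qs where PQ: "dsum Ps U" "dsum Qs V" "\<forall>P\<in>set Ps. indecomposable_module smul q \<Sigma> P"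
      "\<forall>P\<in>set Qs. indecomposable_module smul q \<Sigma> P" using less.hyps st by metis
    have "dsum (Ps @ Qs) Z" unfolding Z by (rule dsum_append[OF PQ(1,2) dis])
    thus ?thesis using PQ by (intro exI[of _ "Ps @ Qs"]) auto
  qed
qed

end

section \<open>Indecomposable modules: one slope, one class of eigenvalues, one Jordan block\<close>

section \<open>Indecomposable modules\<close>

context semilinear
begin

lemma gen_eig_sigma_pow: "v \<in> gen_eig n d \<eta> \<Longrightarrow> (\<Sigma> ^^ b) v \<in> gen_eig n d (q powi (- d * int b) * \<eta>)"
proof (induction b)
  case (Suc b)
  have "q powi (- d) * (q powi (- d * int b) * \<eta>) = q powi (- d + - d * int b) * \<eta>"
    using q0 by (subst power_int_add) auto
  also have "- d + - d * int b = - d * int (Suc b)" by (simp add: algebra_simps)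
  finally have e: "q powi (- d) * (q powi (- d * int b) * \<eta>) = q powi (- d * int (Suc b)) * \<eta>" .
  show ?case using gen_eig_sigma[OF Suc.IH[OF Suc.prems]] unfolding e by (simp only: funpow.simps comp_apply)
qed simp

end

context qdm_exponents
begin

lemma gen_eig_sigma_inverse:
  assumes u: "u \<in> M" and g: "\<Sigma> u \<in> gen_eig n d (q powi (- d) * \<eta>)" shows "u \<in> gen_eig n d \<eta>"
proof -
  have "(shop n d \<eta> ^^ h) u = 0" if "u \<in> M" "(shop n d (q powi (- d) * \<eta>) ^^ h) (\<Sigma> u) = 0" for h u
    using that
  proof (induction h arbitrary: u)
    case 0
    thus ?case using sigma_pow_inj[of u 0 1] by simp
  next
    case (Suc h)
    let ?s = "shop n d (q powi (- d) * \<eta>)"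
    have "(?s ^^ h) (?s (\<Sigma> u)) = 0" using Suc.prems by (simp add: funpow_swap1)
    hence "smul (mconst (q powi (- d))) ((?s ^^ h) (\<Sigma> (shop n d \<eta> u))) = 0"
      using Suc.prems(1) by (simp add: shop_sigma shop_pow_const closed)
    hence "(?s ^^ h) (\<Sigma> (shop n d \<eta> u)) = 0" using q0 by simp
    hence "(shop n d \<eta> ^^ h) (shop n d \<eta> u) = 0" using Suc by simp
    thus ?case by (simp add: funpow_swap1)
  qed
  thus ?thesis using u g unfolding gen_eig_def by blast
qed

lemma gen_eig_sigma_pow_inverse:
  "u \<in> M \<Longrightarrow> (\<Sigma> ^^ b) u \<in> gen_eig n d (q powi (- d * int b) * \<eta>) \<Longrightarrow> u \<in> gen_eig n d \<eta>"
proof (induction b arbitrary: u)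
  case (Suc b)
  have e: "q powi (- d * int (Suc b)) * \<eta> = q powi (- d) * (q powi (- d * int b) * \<eta>)"
  proof -
    have "- d * int (Suc b) = - d + - d * int b" by (simp add: algebra_simps)
    moreover have "q powi (- d + - d * int b) = q powi (- d) * q powi (- d * int b)"
      by (rule power_int_add) (use q0 in simp)
    ultimately show ?thesis by (simp only: mult.assoc)
  qed
  have "\<Sigma> ((\<Sigma> ^^ b) u) \<in> gen_eig n d (q powi (- d) * (q powi (- d * int b) * \<eta>))"
    using Suc.prems(2) unfolding e by simp
  from gen_eig_sigma_inverse[OF _ this] have "(\<Sigma> ^^ b) u \<in> gen_eig n d (q powi (- d * int b) * \<eta>)"
    using Suc.prems(1) by simp
  thus ?case by (rule Suc.IH[OF Suc.prems(1)])
qed simp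

lemma eig_span_Un: "eig_span A (S \<union> S') N = {u + v | u v. u \<in> eig_span A S N \<and> v \<in> eig_span A S' N}"
proof -
  have "eig_gens A (S \<union> S') N = eig_gens A S N \<union> eig_gens A S' N" by (auto simp: eig_gens_def)
  thus ?thesis by (simp add: eig_span_def span_Un)
qed

end

text \<open>By \<open>gen_eig_X\<close> and \<open>gen_eig_sigma\<close> the operator x^a \<Sigma>^b
  multiplies eigenvalues by q^(na - db). By Bezout all powers of q are reached, even with b
  nonnegative after reduction modulo n.\<close>

lemma bezout_shift:
  assumes "coprime (int n) d" "n \<ge> 1"
  obtains a :: int and b :: nat where "int n * a - d * int b = m"
proof -
  obtain x y where xy: "x * int n + y * d = 1" using bezout_int[of "int n" d] assms by auto
  define b where "b = nat ((- y * m) mod int n)"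
  have b: "int b = (- y * m) mod int n" using assms by (simp add: b_def)
  define c where "c = (- y * m) div int n"
  have "int b = - y * m - int n * c" unfolding b c_def by (simp add: minus_mult_div_eq_mod[symmetric])
  hence "d * int b + m = d * (- y * m - int n * c) + m" by simp
  also have "\<dots> = m - (y * d) * m - int n * (d * c)" by (simp add: algebra_simps)
  also have "y * d = 1 - x * int n" using xy by simp
  finally have "int n * (x * m - d * c) - d * int b = m" by (simp add: algebra_simps)
  thus ?thesis using that by blast
qed

context controlled
begin

lemma nilpotent_last:
  assumes "v \<noteq> 0" "(shop n d \<nu> ^^ h) v = 0"
  obtains k where "k < h" "(shop n d \<nu> ^^ k) v \<noteq> 0" "(shop n d \<nu> ^^ Suc k) v = 0"
proof -
  define k where "k = (LEAST k. (shop n d \<nu> ^^ k) v = 0)"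
  have k: "(shop n d \<nu> ^^ k) v = 0" "k \<le> h" unfolding k_def using assms(2) by (auto intro: LeastI Least_le)
  have "k \<noteq> 0" using k assms by (cases k) auto
  then obtain j where j: "k = Suc j" by (cases k) auto
  have "(shop n d \<nu> ^^ j) v \<noteq> 0" using not_less_Least[of j "\<lambda>k. (shop n d \<nu> ^^ k) v = 0"] j by (simp add: k_def)
  thus ?thesis using that[of j] k j by auto
qed

lemma eigenvector_exists:
  assumes Z: "stable Z" "Z \<noteq> {0}"
  obtains n d \<nu> y where "(n, d) \<in> slopes" "\<nu> \<in> A n d" "y \<in> Z" "y \<noteq> 0" "shop n d \<nu> y = 0"
proof -
  have "\<not> eig_gens A slopes Z \<subseteq> {0}"
  proof
    assume "eig_gens A slopes Z \<subseteq> {0}"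
    hence "eig_span A slopes Z \<subseteq> {0}" unfolding eig_span_def by (intro span_minimal) auto
    thus False using stable_generated[OF Z(1)] Z stable_0 by blast
  qed
  then obtain v n d \<nu> h where v: "v \<in> Z" "v \<noteq> 0" "(n, d) \<in> slopes" "\<nu> \<in> A n d" "(shop n d \<nu> ^^ h) v = 0"
    unfolding eig_gens_def gen_eig_def by blast
  then obtain k where k: "(shop n d \<nu> ^^ k) v \<noteq> 0" "(shop n d \<nu> ^^ Suc k) v = 0" using nilpotent_last by metis
  have "(shop n d \<nu> ^^ k) v \<in> Z" by (rule stable_shop_pow[OF Z(1) v(1)])
  thus ?thesis using that v k by simp
qed

text \<open>The slope of one eigenvector and all the other slopes give two complementary summands,
  and the first one is not zero.\<close>

lemma indecomposable_single_slope:
  assumes P: "stable P" and ind: "indecomposable_module smul q \<Sigma> P"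
  obtains n d \<nu> y where "(n, d) \<in> slopes" "eig_span A {(n, d)} P = P" "\<nu> \<in> A n d" "y \<in> P" "y \<noteq> 0" "shop n d \<nu> y = 0"
proof -
  have P0: "P \<noteq> {0}" using ind by (simp add: indecomposable_module_def)
  have PM: "P \<subseteq> M" using P by (simp add: stable_def)
  obtain n d \<nu> y where y: "(n, d) \<in> slopes" "\<nu> \<in> A n d" "y \<in> P" "y \<noteq> 0" "shop n d \<nu> y = 0"
    using eigenvector_exists[OF P P0] by blast
  define U V where "U = eig_span A {(n, d)} P" and "V = eig_span A (slopes - {(n, d)}) P"
  have UV: "stable U" "stable V" unfolding U_def V_def using eig_span_stable[OF P] by auto
  have "(shop n d \<nu> ^^ 1) y = 0" using y by simp
  hence yg: "y \<in> gen_eig n d \<nu>" using y PM unfolding gen_eig_def by blast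
  have yU: "y \<in> U" unfolding U_def using eig_span_base[of n d, OF _ y(2,3) yg] by simp
  obtain R Q where R: "cyc smul q \<Sigma> (app Q e) R P" "controls R" using stable_cyc[OF P] by metis
  have dis: "U \<inter> V = {0}" unfolding U_def V_def
    by (rule eig_span_disjoint[OF R(2,1) PM]) (use y in auto)
  have "slopes = {(n, d)} \<union> (slopes - {(n, d)})" using y by auto
  hence "eig_span A slopes P = set_sum U V"
    using eig_span_Un[of "{(n, d)}" "slopes - {(n, d)}" P] unfolding U_def V_def set_sum_def by simp
  hence sum: "P = set_sum U V" using stable_generated[OF P] by simp
  have "V = {0}" using indecomposable_split[OF ind UV dis sum] yU y by auto
  hence "P = U" using sum by (auto simp: set_sum_def)
  thus ?thesis using that y by (simp add: U_def)
qed

definition eig_class :: "nat \<Rightarrow> int \<Rightarrow> 'a \<Rightarrow> 'b set \<Rightarrow> 'b set" where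
  "eig_class n d \<nu> P = {v \<in> P. \<exists>k. v \<in> gen_eig n d (q powi k * \<nu>)}"

lemma q_class: "q powi k * (q powi l * \<nu>) = q powi (k + l) * \<nu>"
  using q0 by (simp add: power_int_add)

lemma qn_powi: "(q ^ n) powi k = q powi (int n * k)"
  by (simp add: power_int_mult)

lemma foreign_class:
  assumes "\<And>k. \<xi> \<noteq> q powi k * \<nu>" shows "\<And>k. \<xi> * (q ^ n) powi k \<noteq> \<nu>"
proof
  fix k assume "\<xi> * (q ^ n) powi k = \<nu>"
  hence a: "\<xi> * q powi (int n * k) = \<nu>" by (simp add: qn_powi)
  have "\<xi> = q powi (- (int n * k)) * \<nu>" unfolding a[symmetric] using q0 by (simp add: power_int_minus)
  thus False using assms by blast
qed

lemma nonresonant: "n \<ge> 1 \<Longrightarrow> k \<noteq> 0 \<Longrightarrow> (q ^ n) powi k \<noteq> 1"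
  using non_root_of_unityD(2)[OF non_root_of_unity_power[OF qn], of n k 0] by simp

lemma zero_of_foreign_span:
  assumes n: "n \<ge> 1" and \<nu>: "\<nu> \<noteq> 0"
    and B: "\<And>v. v \<in> B \<Longrightarrow> \<exists>\<xi>. v \<in> gen_eig n d \<xi> \<and> (\<forall>k. \<xi> * (q ^ n) powi k \<noteq> \<nu>)"
    and z: "z \<in> span B" "shop n d \<nu> z = 0"
  shows "z = 0"
proof -
  have "z \<in> {0}"
    by (rule gen_eig_in_span[where n = n and d = d and \<nu> = \<nu> and B = B and h = 1])
       (use assms nonresonant in \<open>auto simp: const_subspace_def\<close>)
  thus ?thesis by simp
qed

text \<open>Within one slope, the eigenvalues in the class of \<nu> modulo powers of q and those in
  other classes span two stable summands. An eigenvector in the intersection would be foreign to the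
  generators of one of them, hence zero.\<close>

lemma indecomposable_single_class:
  assumes P: "stable P" and ind: "indecomposable_module smul q \<Sigma> P" and n: "(n, d) \<in> slopes"
    and gen: "eig_span A {(n, d)} P = P" and y: "\<nu> \<in> A n d" "y \<in> P" "y \<noteq> 0" "shop n d \<nu> y = 0"
  shows "P = span (eig_class n d \<nu> P)"
proof -
  have n1: "n \<ge> 1" using n by (simp add: slopes_def)
  have PM: "P \<subseteq> M" using P by (simp add: stable_def)
  define B where "B = {v \<in> P. \<exists>\<xi>\<in>A n d. v \<in> gen_eig n d \<xi> \<and> (\<forall>k. \<xi> \<noteq> q powi k * \<nu>)}"
  let ?C = "eig_class n d \<nu> P"
  have subP: "span ?C \<subseteq> P" "span B \<subseteq> P"
    by (rule span_minimal; use P in \<open>auto simp: stable_def eig_class_def B_def\<close>)+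
  have CM: "?C \<subseteq> M" "B \<subseteq> M" using PM by (auto simp: eig_class_def B_def)
  have stC: "stable (span ?C)"
  proof (rule stable_span[OF CM(1)])
    fix v assume "v \<in> ?C"
    then obtain k where k: "v \<in> P" "v \<in> gen_eig n d (q powi k * \<nu>)" by (auto simp: eig_class_def)
    have "\<Sigma> v \<in> gen_eig n d (q powi (- d + k) * \<nu>)" using gen_eig_sigma[OF k(2)] unfolding q_class .
    hence "\<Sigma> v \<in> ?C" using k P unfolding eig_class_def by (blast intro: stable_sigma)
    thus "\<Sigma> v \<in> span ?C" by (rule span_base)
  qed
  have stB: "stable (span B)"
  proof (rule stable_span[OF CM(2)])
    fix v assume "v \<in> B"
    then obtain \<xi> where x: "v \<in> P" "\<xi> \<in> A n d" "v \<in> gen_eig n d \<xi>" "\<And>k. \<xi> \<noteq> q powi k * \<nu>" by (auto simp: B_def)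
    have "q powi (- d) * \<xi> \<noteq> q powi k * \<nu>" for k
    proof
      assume "q powi (- d) * \<xi> = q powi k * \<nu>"
      hence "q powi d * (q powi (- d) * \<xi>) = q powi d * (q powi k * \<nu>)" by simp
      hence "\<xi> = q powi (d + k) * \<nu>" unfolding q_class by simp
      thus False using x by blast
    qed
    hence "\<Sigma> v \<in> B" using gen_eig_sigma[OF x(3)] A_shift[OF x(2)] x(1) P unfolding B_def by (blast intro: stable_sigma)
    thus "\<Sigma> v \<in> span B" by (rule span_base)
  qed
  have fB: "\<exists>\<xi>. v \<in> gen_eig n d \<xi> \<and> (\<forall>k. \<xi> * (q ^ n) powi k \<noteq> \<nu>')"
    if vB: "v \<in> B" "\<nu>' = q powi m * \<nu>" for v \<nu>' m
  proof -
    obtain \<xi> where x: "v \<in> gen_eig n d \<xi>" "\<And>k. \<xi> \<noteq> q powi k * \<nu>" using vB(1) by (auto simp: B_def)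
    have "\<xi> \<noteq> q powi k * \<nu>'" for k unfolding vB(2) q_class by (rule x)
    thus ?thesis using foreign_class x(1) by blast
  qed
  have fC: "\<exists>\<xi>. v \<in> gen_eig n d \<xi> \<and> (\<forall>k. \<xi> * (q ^ n) powi k \<noteq> \<nu>')"
    if v: "v \<in> ?C" and k': "\<And>m. \<nu>' \<noteq> q powi m * \<nu>" for v \<nu>'
  proof -
    obtain k where k: "v \<in> gen_eig n d (q powi k * \<nu>)" using v by (auto simp: eig_class_def)
    have "q powi k * \<nu> \<noteq> q powi m * \<nu>'" for m
    proof
      assume "q powi k * \<nu> = q powi m * \<nu>'"
      hence "q powi (- m) * (q powi k * \<nu>) = q powi (- m) * (q powi m * \<nu>')" by simp
      hence "\<nu>' = q powi (- m + k) * \<nu>" unfolding q_class by simp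
      thus False using k' by blast
    qed
    thus ?thesis using foreign_class k by blast
  qed
  have dis: "span ?C \<inter> span B = {0}"
  proof (rule ccontr)
    assume ne: "span ?C \<inter> span B \<noteq> {0}"
    have st: "stable (span ?C \<inter> span B)" using stB stC by (auto simp: stable_def subspace_inter)
    obtain n' d' \<nu>' z where z: "(n', d') \<in> slopes" "\<nu>' \<in> A n' d'" "z \<in> span ?C \<inter> span B" "z \<noteq> 0" "shop n' d' \<nu>' z = 0"
      using eigenvector_exists[OF st ne] by blast
    have zP: "z \<in> P" using z subP by auto
    have "(shop n' d' \<nu>' ^^ 1) z = 0" using z by simp
    hence zg: "z \<in> gen_eig n' d' \<nu>'" using zP PM unfolding gen_eig_def by blast
    have "z \<in> eig_span A {(n, d)} M" using zP gen eig_span_mono[OF PM order_refl, of "{(n, d)}"] by auto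
    moreover have "{(n, d)} \<subseteq> slopes" using n by simp
    ultimately have "(n', d') \<in> {(n, d)}"
      using eigenvector_slope[OF cyclic order_refl _ z(1,2) zg _ z(4)] by blast
    hence [simp]: "n' = n" "d' = d" by simp_all
    have zz: "shop n d \<nu>' z = 0" using z by simp
    have k0: "\<nu>' \<noteq> 0" using A_nonzero z by blast
    have "z = 0"
    proof (cases "\<exists>m. \<nu>' = q powi m * \<nu>")
      case True
      then obtain m where m: "\<nu>' = q powi m * \<nu>" by blast
      show ?thesis
        by (rule zero_of_foreign_span[where B = B, OF n1 k0 fB[OF _ m] _ zz]) (use z in auto)
    next
      case False
      show ?thesis
        by (rule zero_of_foreign_span[where B = ?C, OF n1 k0 fC _ zz]) (use z False in auto)
    qed
    thus False using z by simp
  qed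
  have "eig_gens A {(n, d)} P \<subseteq> ?C \<union> B" by (auto simp: eig_gens_def eig_class_def B_def)
  hence "P \<subseteq> span (?C \<union> B)" using gen unfolding eig_span_def by (metis span_mono)
  also have "\<dots> = set_sum (span ?C) (span B)" by (simp add: span_Un set_sum_def)
  finally have "P \<subseteq> set_sum (span ?C) (span B)" .
  moreover have "set_sum (span ?C) (span B) \<subseteq> P" using subP P by (auto simp: set_sum_def intro: stable_add)
  ultimately have sum: "P = set_sum (span ?C) (span B)" by simp
  have "(shop n d \<nu> ^^ 1) y = 0" using y by simp
  hence "y \<in> gen_eig n d \<nu>" using y(2) PM unfolding gen_eig_def by blast
  hence "y \<in> gen_eig n d (q powi 0 * \<nu>)" by simp
  hence "y \<in> ?C" using y unfolding eig_class_def by blast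
  hence "y \<in> span ?C" by (rule span_base)
  hence "span B = {0}" using indecomposable_split[OF ind stC stB dis sum] y by auto
  thus ?thesis using sum by (auto simp: set_sum_def)
qed

end

text \<open>The setting reached for an indecomposable P: all eigenvalues are in the class of one
  \<nu>. The structure of P can then be read off from \<open>V0\<close>.\<close>

locale class_module = controlled smul q M \<Sigma> A e L
  for smul :: "'a :: base_field mero \<Rightarrow> 'b :: ab_group_add \<Rightarrow> 'b" and q :: 'a and M \<Sigma> A e L +
  fixes P :: "'b set" and n :: nat and d :: int and \<nu> :: 'a
  assumes P: "stable P" and nd: "(n, d) \<in> slopes" and \<nu>A: "\<nu> \<in> A n d" and Pgen: "P = span (eig_class n d \<nu> P)"
begin

lemma n1: "n \<ge> 1" and cop: "coprime (int n) d"
  using nd by (auto simp: slopes_def)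

lemma \<nu>0: "\<nu> \<noteq> 0"
  using A_nonzero \<nu>A by blast

lemma PM: "P \<subseteq> M"
  using P by (simp add: stable_def)

abbreviation nil :: "'b \<Rightarrow> 'b" where "nil \<equiv> shop n d \<nu>"

definition V0 :: "'b set" where "V0 = gen_eig n d \<nu> \<inter> P"

definition nil_stable :: "'b set \<Rightarrow> bool" where
  "nil_stable V \<longleftrightarrow> V \<subseteq> V0 \<and> const_subspace V \<and> (\<forall>v\<in>V. nil v \<in> V)"

text \<open>The exponents b < n are enough, because \<Sigma>^n v = x^(-d) (\<nu> v +
  \<open>nil\<close> v) leads back into V when V is stable under \<open>nil\<close>.\<close>

definition dhull :: "'b set \<Rightarrow> 'b set" where
  "dhull V = span {(\<Sigma> ^^ b) v | b v. b < n \<and> v \<in> V}"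

lemma V0P: "V0 \<subseteq> P" and V0M: "V0 \<subseteq> M"
  using PM by (auto simp: V0_def)

lemma V0_nil_stable: "nil_stable V0"
  unfolding nil_stable_def V0_def const_subspace_def
  using P by (auto simp: gen_eig_0 gen_eig_add gen_eig_const gen_eig_shop stable_0 stable_add stable_scale stable_shop)

lemma sigma_n: "v \<in> M \<Longrightarrow> (\<Sigma> ^^ n) v = smul (mero_X powi (- d)) (smul (mconst \<nu>) v + nil v)"
proof -
  assume v: "v \<in> M"
  have "smul (mconst \<nu>) v + nil v = smul (mero_X powi d) ((\<Sigma> ^^ n) v)"
    by (simp add: shop_def slope_op_def)
  moreover have "mero_X powi (- d) * mero_X powi d = (1 :: 'a mero)" by (simp add: power_int_minus)
  ultimately show ?thesis by simp
qed

lemma dhull_stable: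
  assumes V: "nil_stable V" shows "stable (dhull V)" "dhull V \<subseteq> P" "V \<subseteq> dhull V"
proof -
  have VP: "V \<subseteq> P" "V \<subseteq> M" using V V0P V0M by (auto simp: nil_stable_def)
  let ?B = "{(\<Sigma> ^^ b) v | b v. b < n \<and> v \<in> V}"
  show sub: "V \<subseteq> dhull V"
    unfolding dhull_def using n1 by (auto intro!: span_base exI[of _ "0 :: nat"])
  have BM: "?B \<subseteq> M" using VP by auto
  show "stable (dhull V)"
    unfolding dhull_def
  proof (rule stable_span[OF BM])
    fix x assume "x \<in> ?B"
    then obtain b v where b: "x = (\<Sigma> ^^ b) v" "b < n" "v \<in> V" by blast
    show "\<Sigma> x \<in> span ?B"
    proof (cases "Suc b < n")
      case True
      have "\<Sigma> x = (\<Sigma> ^^ Suc b) v" by (simp add: b)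
      thus ?thesis using True b by (intro span_base) blast
    next
      case False
      hence "Suc b = n" using b by simp
      hence "\<Sigma> x = (\<Sigma> ^^ n) v" using b by auto
      also have "\<dots> = smul (mero_X powi (- d)) (smul (mconst \<nu>) v + nil v)" using b VP by (intro sigma_n) auto
      also have "\<dots> \<in> span ?B"
      proof (intro span_scale span_add)
        show "v \<in> span ?B" "nil v \<in> span ?B" using sub b V unfolding dhull_def nil_stable_def by blast+
      qed
      finally show ?thesis .
    qed
  qed
  show "dhull V \<subseteq> P"
    unfolding dhull_def using VP P by (intro span_minimal) (auto simp: stable_pow stable_def[of P])
qed

lemma dhull_mono: "V \<subseteq> V' \<Longrightarrow> dhull V \<subseteq> dhull V'"
  unfolding dhull_def by (rule span_mono) blast

text \<open>The vectors \<Sigma>^b v with 0 < b < n have eigenvalue q^(-db) \<nu>. Since n does not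
  divide db, this is not a q^(nk) multiple of \<nu>, so \<open>gen_eig_in_span\<close> leaves only
  V. Hence V is recovered from its hull.\<close>

lemma dhull_inter:
  assumes V: "nil_stable V" shows "dhull V \<inter> V0 \<subseteq> V"
proof
  fix z assume z: "z \<in> dhull V \<inter> V0"
  then obtain h where h: "(nil ^^ h) z = 0" by (auto simp: V0_def gen_eig_def)
  have VM: "V \<subseteq> M" "V \<subseteq> V0" using V V0M by (auto simp: nil_stable_def)
  show "z \<in> V"
  proof (rule gen_eig_in_span[OF _ VM(1) _ \<nu>0 nonresonant[OF n1] _ _ h])
    show "const_subspace V" "\<And>v. v \<in> V \<Longrightarrow> nil v \<in> V" using V by (auto simp: nil_stable_def)
    show "z \<in> span {(\<Sigma> ^^ b) v | b v. b < n \<and> v \<in> V}" using z by (simp add: dhull_def)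
    fix x assume "x \<in> {(\<Sigma> ^^ b) v | b v. b < n \<and> v \<in> V}"
    then obtain b v where b: "x = (\<Sigma> ^^ b) v" "b < n" "v \<in> V" by blast
    have vg: "v \<in> gen_eig n d \<nu>" using b VM by (auto simp: V0_def)
    show "(x \<in> V \<and> (\<exists>h. (nil ^^ h) x = 0)) \<or> (\<exists>\<xi>. x \<in> gen_eig n d \<xi> \<and> (\<forall>k. \<xi> * (q ^ n) powi k \<noteq> \<nu>))"
    proof (cases "b = 0")
      case True
      thus ?thesis using b vg by (auto simp: gen_eig_def)
    next
      case False
      have "q powi (- d * int b) * \<nu> * (q ^ n) powi k \<noteq> \<nu>" for k
      proof
        assume "q powi (- d * int b) * \<nu> * (q ^ n) powi k = \<nu>"
        hence "q powi (- d * int b) * q powi (int n * k) = 1" using \<nu>0 by (simp add: qn_powi)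
        hence "q powi (- d * int b + int n * k) = q powi 0" using q0 by (subst power_int_add) auto
        hence "- d * int b + int n * k = 0" using non_root_of_unityD(2)[OF qn] by blast
        hence "int n dvd d * int b" by (metis add.commute add_uminus_conv_diff dvd_triv_left eq_iff_diff_eq_0 mult_minus_left)
        hence "int n dvd int b" using cop by (simp add: coprime_dvd_mult_right_iff)
        thus False using False b(2) by (auto dest: dvd_imp_le)
      qed
      thus ?thesis using gen_eig_sigma_pow[OF vg, of b] b(1) by blast
    qed
  qed
qed

lemma stable_pow_image:
  assumes "v \<in> P" shows "\<exists>u\<in>P. v = (\<Sigma> ^^ b) u"
  using assms
proof (induction b arbitrary: v)
  case (Suc b)
  obtain w where w: "w \<in> P" "v = \<Sigma> w" using stable_image[OF P] Suc.prems by blast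
  then obtain u where "u \<in> P" "w = (\<Sigma> ^^ b) u" using Suc.IH by blast
  thus ?case using w by (auto intro!: bexI[of _ u])
qed auto

text \<open>A vector with eigenvalue q^m \<nu> is x^a \<Sigma>^b applied to one with eigenvalue
  \<nu>, for a and b from \<open>bezout_shift\<close>, using that \<Sigma> is invertible on
  P.\<close>

lemma dhull_V0: "dhull V0 = P"
proof
  note st = dhull_stable[OF V0_nil_stable]
  show "dhull V0 \<subseteq> P" by (rule st)
  have "eig_class n d \<nu> P \<subseteq> dhull V0"
  proof
    fix v assume "v \<in> eig_class n d \<nu> P"
    then obtain m where m: "v \<in> P" "v \<in> gen_eig n d (q powi m * \<nu>)" by (auto simp: eig_class_def)
    obtain a b where ab: "int n * a - d * int b = m" using bezout_shift[OF cop n1] by blast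
    have "smul (mero_X powi (- a)) v \<in> gen_eig n d (q powi (int n * (- a)) * (q powi m * \<nu>))" by (rule gen_eig_X[OF m(2)])
    also have "q powi (int n * (- a)) * (q powi m * \<nu>) = q powi (- d * int b) * \<nu>"
      unfolding q_class by (simp flip: ab)
    finally have g: "smul (mero_X powi (- a)) v \<in> gen_eig n d (q powi (- d * int b) * \<nu>)" .
    have "smul (mero_X powi (- a)) v \<in> P" using m P stable_scale by blast
    then obtain u where u: "u \<in> P" "smul (mero_X powi (- a)) v = (\<Sigma> ^^ b) u" using stable_pow_image by blast
    have "u \<in> V0" using gen_eig_sigma_pow_inverse[of u b n d \<nu>] u g PM by (auto simp: V0_def)
    hence "smul (mero_X powi (- a)) v \<in> dhull V0" unfolding u(2) using st stable_pow by blast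
    hence "smul (mero_X powi a) (smul (mero_X powi (- a)) v) \<in> dhull V0" using st stable_scale by blast
    moreover have "mero_X powi a * mero_X powi (- a) = (1 :: 'a mero)" by (simp add: power_int_minus)
    ultimately show "v \<in> dhull V0" by simp
  qed
  hence "span (eig_class n d \<nu> P) \<subseteq> dhull V0" using st by (intro span_minimal) (auto simp: stable_def)
  thus "P \<subseteq> dhull V0" using Pgen by simp
qed

lemma class_in_slope: "P \<subseteq> eig_span A {(n, d)} M"
proof -
  have "eig_class n d \<nu> P \<subseteq> eig_gens A {(n, d)} M"
    using PM A_shift[OF \<nu>A] by (auto simp: eig_class_def eig_gens_def)
  thus ?thesis unfolding eig_span_def using Pgen span_mono by metis
qed

text \<open>A nonzero submodule has some eigenvector. Its slope and class are those of P, and a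
  suitable x^a \<Sigma>^b moves its eigenvalue to \<nu> exactly.\<close>

lemma stable_meets_V0:
  assumes Z: "stable Z" "Z \<subseteq> P" "Z \<noteq> {0}"
  obtains y where "y \<in> Z" "y \<in> V0" "y \<noteq> 0" "nil y = 0"
proof -
  obtain n' d' \<nu>' z where z: "(n', d') \<in> slopes" "\<nu>' \<in> A n' d'" "z \<in> Z" "z \<noteq> 0" "shop n' d' \<nu>' z = 0"
    using eigenvector_exists[OF Z(1,3)] by blast
  have zP: "z \<in> P" "z \<in> M" using z Z PM by auto
  have "(shop n' d' \<nu>' ^^ 1) z = 0" using z by simp
  hence zg: "z \<in> gen_eig n' d' \<nu>'" using zP unfolding gen_eig_def by blast
  have "{(n, d)} \<subseteq> slopes" "z \<in> eig_span A {(n, d)} M" using nd class_in_slope zP by auto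
  hence "(n', d') \<in> {(n, d)}" using eigenvector_slope[OF cyclic order_refl _ z(1,2) zg _ z(4)] by blast
  hence [simp]: "n' = n" "d' = d" by simp_all
  have "\<exists>m. \<nu>' = q powi m * \<nu>"
  proof (rule ccontr)
    assume no: "\<nexists>m. \<nu>' = q powi m * \<nu>"
    have "z = 0"
    proof (rule zero_of_foreign_span[where n = n and d = d and \<nu> = \<nu>' and B = "eig_class n d \<nu> P"])
      show "n \<ge> 1" by (rule n1)
      show "\<nu>' \<noteq> 0" using A_nonzero z by blast
      show "z \<in> span (eig_class n d \<nu> P)" using zP Pgen by simp
      show "shop n d \<nu>' z = 0" using z by simp
      fix v assume "v \<in> eig_class n d \<nu> P"
      then obtain k where k: "v \<in> gen_eig n d (q powi k * \<nu>)" by (auto simp: eig_class_def)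
      have "q powi k * \<nu> \<noteq> q powi m * \<nu>'" for m
      proof
        assume "q powi k * \<nu> = q powi m * \<nu>'"
        hence "q powi (- m) * (q powi k * \<nu>) = q powi (- m) * (q powi m * \<nu>')" by simp
        hence "\<nu>' = q powi (- m + k) * \<nu>" unfolding q_class by simp
        thus False using no by blast
      qed
      thus "\<exists>\<xi>. v \<in> gen_eig n d \<xi> \<and> (\<forall>k. \<xi> * (q ^ n) powi k \<noteq> \<nu>')" using foreign_class k by blast
    qed
    thus False using z by simp
  qed
  then obtain m where m: "\<nu>' = q powi m * \<nu>" by blast
  obtain a b where ab: "int n * a - d * int b = - m" using bezout_shift[OF cop n1] by blast
  define y where "y = smul (mero_X powi a) ((\<Sigma> ^^ b) z)"
  have "y \<in> gen_eig n d (q powi (int n * a) * (q powi (- d * int b) * \<nu>'))"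
    unfolding y_def using gen_eig_X[OF gen_eig_sigma_pow[of z n d \<nu>' b]] zg by simp
  also have "q powi (int n * a) * (q powi (- d * int b) * \<nu>') = \<nu>"
  proof -
    have "int n * a + (- d * int b + m) = 0" using ab by simp
    thus ?thesis unfolding m q_class by simp
  qed
  finally have yg: "y \<in> gen_eig n d \<nu>" .
  have yZ: "y \<in> Z" unfolding y_def using Z z by (auto intro: stable_scale stable_pow)
  have "(\<Sigma> ^^ b) z \<noteq> 0"
  proof (induction b)
    case (Suc b)
    thus ?case using sigma_pow_inj[of "(\<Sigma> ^^ b) z" 0 1] zP by auto
  qed (use z in auto)
  hence y0: "y \<noteq> 0" by (simp add: y_def)
  obtain h where "(nil ^^ h) y = 0" using yg by (auto simp: gen_eig_def)
  then obtain k where k: "(nil ^^ k) y \<noteq> 0" "(nil ^^ Suc k) y = 0" using nilpotent_last[OF y0] by metis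
  have yV: "y \<in> V0" using yg yZ Z by (auto simp: V0_def)
  have "(nil ^^ k) y \<in> V0" using yV V0_nil_stable by (induction k) (auto simp: nil_stable_def)
  thus ?thesis using that[of "(nil ^^ k) y"] k stable_shop_pow[OF Z(1) yZ] by simp
qed

text \<open>A submodule is pure of slope d/n, so the edge of its operator runs from 0 to the degree,
  and by \<open>chi_support_dvd\<close> that degree is a multiple of n.\<close>

lemma dim_dvd:
  assumes Z: "stable Z" "Z \<subseteq> P" shows "n dvd dim Z"
proof -
  have ZM: "Z \<subseteq> M" using Z PM by simp
  obtain R Q where R: "cyc smul q \<Sigma> (app Q e) R Z" using stable_cyc[OF Z(1)] by metis
  show ?thesis
  proof (cases "degree R \<ge> 1")
    case True
    have "eig_gens A slopes Z \<subseteq> eig_span A {(n, d)} Z"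
    proof
      fix v assume "v \<in> eig_gens A slopes Z"
      then obtain n' d' \<xi> where v: "v \<in> Z" "(n', d') \<in> slopes" "\<xi> \<in> A n' d'" "v \<in> gen_eig n' d' \<xi>" by (auto simp: eig_gens_def)
      show "v \<in> eig_span A {(n, d)} Z"
      proof (cases "v = 0")
        case False
        have "(n', d') \<in> {(n, d)}" using eigenvector_slope[OF cyclic order_refl _ v(2,3,4) _ False] nd class_in_slope Z v by auto
        thus ?thesis using v by (intro eig_span_base[of n' d']) auto
      qed (use stable_0 eig_span_stable(1)[OF Z(1)] in auto)
    qed
    hence "eig_span A slopes Z \<subseteq> eig_span A {(n, d)} Z"
      unfolding eig_span_def[of A slopes] using eig_span_stable(1)[OF Z(1)] by (intro span_minimal) (auto simp: stable_def)
    hence gen: "eig_span A {(n, d)} Z = Z" using stable_generated[OF Z(1)] eig_span_stable(2)[OF Z(1)] by blast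
    obtain p where p: "p ^ n = q" using root_exists[OF n1] by blast
    have p0: "p \<noteq> 0" using root_nonzero[OF p n1] .
    have "coeff (chi n d p R) 0 \<noteq> 0" "coeff (chi n d p R) (degree R) \<noteq> 0"
      using pure_coeffs[OF R ZM nd gen p True] by auto
    hence "int n dvd int (degree R) - int 0" by (intro chi_support_dvd[OF n1 cop p0])
    thus ?thesis using cyc_basis(4)[OF R ZM] by simp
  next
    case False
    hence "degree R = 0" by simp
    thus ?thesis using cyc_basis(4)[OF R ZM] by simp
  qed
qed

lemma dim_step:
  assumes "stable Z" "stable Z'" "Z \<subseteq> Z'" "Z \<noteq> Z'" "Z' \<subseteq> P" shows "dim Z + n \<le> dim Z'"
proof -
  have "dim Z < dim Z'" using stable_dim_less assms by blast
  moreover have "n dvd dim Z' - dim Z" using dim_dvd assms by (intro dvd_diff_nat) auto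
  ultimately show ?thesis using dvd_imp_le[of n "dim Z' - dim Z"] by simp
qed

text \<open>The kernels of the powers of \<open>nil\<close> give a strictly increasing sequence of
  submodules through their hulls, and each step has rank at least n. This bounds the heights before
  anything is known about the dimension of \<open>V0\<close> over the constants.\<close>

lemma height_bound:
  assumes v: "v \<in> V0" "(nil ^^ h) v \<noteq> 0" "(nil ^^ Suc h) v = 0" shows "n * Suc h \<le> dim P"
proof -
  define K where "K = (\<lambda>i. {w \<in> V0. (nil ^^ i) w = 0})"
  have K: "nil_stable (K i)" for i
    using V0_nil_stable V0M unfolding nil_stable_def const_subspace_def K_def
    by (auto simp: shop_pow_add shop_pow_const subset_iff funpow_swap1[symmetric])
  have mono: "K i \<subseteq> K (Suc i)" for i by (auto simp: K_def)
  have pow: "(nil ^^ i) v \<in> V0" for i using v(1) V0_nil_stable by (induction i) (auto simp: nil_stable_def)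
  \<comment> \<open>The vector nil^(h-i) v is killed by the power i + 1 of \<open>nil\<close> but
    not by the power i.\<close>
  have ne: "dhull (K i) \<noteq> dhull (K (Suc i))" if "i \<le> h" for i
  proof
    assume eq: "dhull (K i) = dhull (K (Suc i))"
    define w where "w = (nil ^^ (h - i)) v"
    have wi: "(nil ^^ i) w = (nil ^^ h) v" "(nil ^^ Suc i) w = (nil ^^ Suc h) v"
      using that by (simp_all add: w_def funpow_add[symmetric, THEN fun_cong, unfolded comp_def] del: funpow.simps)
    have "w \<in> K (Suc i)" using wi v pow by (simp add: K_def w_def del: funpow.simps)
    hence "w \<in> dhull (K i) \<inter> V0" using dhull_stable(3)[OF K] eq pow by (auto simp: w_def)
    hence "w \<in> K i" using dhull_inter[OF K] by blast
    thus False using wi v by (simp add: K_def)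
  qed
  have "n * i \<le> dim (dhull (K i))" if "i \<le> Suc h" for i
    using that
  proof (induction i)
    case (Suc i)
    have "dim (dhull (K i)) + n \<le> dim (dhull (K (Suc i)))"
      using Suc.prems dhull_stable[OF K] dhull_mono[OF mono] ne by (intro dim_step) auto
    thus ?case using Suc by simp
  qed simp
  hence "n * Suc h \<le> dim (dhull (K (Suc h)))" by blast
  also have "\<dots> \<le> dim P"
    using stable_dim_less[OF dhull_stable(1)[OF K] P dhull_stable(2)[OF K]] by (metis order_refl less_imp_le)
  finally show ?thesis .
qed

end

section \<open>The Jordan block of an indecomposable module\<close>

locale indecomposable_class = class_module +
  assumes ind: "indecomposable_module smul q \<Sigma> P"
begin

lemma const_vector_space: "vector_space (\<lambda>c. smul (mconst c))"
  by unfold_locales (auto simp: scale_right_distrib scale_left_distrib mconst_add mconst_mult)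

lemma P_nonzero: "P \<noteq> {0}"
  using ind by (simp add: indecomposable_module_def)

lemma V0_nil_pow: "v \<in> V0 \<Longrightarrow> (nil ^^ i) v \<in> V0"
  using V0_nil_stable by (induction i) (auto simp: nil_stable_def)

lemma maximal_height:
  obtains h v where "v \<in> V0" "(nil ^^ h) v \<noteq> 0" "\<And>w. w \<in> V0 \<Longrightarrow> (nil ^^ Suc h) w = 0" "n * Suc h \<le> dim P"
proof -
  define H where "H = {h. \<exists>v\<in>V0. (nil ^^ h) v \<noteq> 0 \<and> (nil ^^ Suc h) v = 0}"
  obtain y where "y \<in> V0" "y \<noteq> 0" "nil y = 0" by (rule stable_meets_V0[OF P order_refl P_nonzero])
  hence H0: "0 \<in> H" by (auto simp: H_def)
  have "h \<le> dim P" if "h \<in> H" for h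
  proof -
    have "n * Suc h \<le> dim P" using that height_bound by (auto simp: H_def simp del: funpow.simps)
    moreover have "1 * Suc h \<le> n * Suc h" using n1 by (intro mult_right_mono) auto
    ultimately show ?thesis by simp
  qed
  hence fin: "finite H" by (auto intro: finite_subset[of _ "{..dim P}"])
  have "Max H \<in> H" using fin H0 by (intro Max_in) auto
  then obtain v where v: "v \<in> V0" "(nil ^^ Max H) v \<noteq> 0" "(nil ^^ Suc (Max H)) v = 0" by (auto simp: H_def)
  have "(nil ^^ Suc (Max H)) w = 0" if w: "w \<in> V0" for w
  proof (cases "w = 0")
    case False
    obtain h where "(nil ^^ h) w = 0" using w by (auto simp: V0_def gen_eig_def)
    then obtain k where k: "(nil ^^ k) w \<noteq> 0" "(nil ^^ Suc k) w = 0" using nilpotent_last[OF False] by metis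
    hence "k \<in> H" using w by (auto simp: H_def)
    hence "Suc k \<le> Suc (Max H)" using Max_ge[OF fin] by simp
    thus ?thesis using shop_pow_mono[OF k(2)] by blast
  qed simp
  thus ?thesis using that[OF v(1,2)] height_bound[OF v] by blast
qed

definition chain :: "'b \<Rightarrow> nat \<Rightarrow> 'b set" where
  "chain v h = {\<Sum>j\<le>h. smul (mconst (c j)) ((nil ^^ j) v) | c. True}"

lemma chain_nil_stable:
  assumes v: "v \<in> V0" "(nil ^^ Suc h) v = 0" shows "nil_stable (chain v h)"
proof -
  have VM: "(nil ^^ j) v \<in> M" for j using V0_nil_pow[OF v(1)] V0M by blast
  have c0: "const_subspace V0" using V0_nil_stable by (simp add: nil_stable_def)
  have sumV: "(\<Sum>j\<in>J. smul (mconst (c j)) ((nil ^^ j) v)) \<in> V0" for c and J :: "nat set"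
    using c0 V0_nil_pow[OF v(1)] unfolding const_subspace_def
    by (induction J rule: infinite_finite_induct) auto
  have shift: "nil (\<Sum>j\<in>J. smul (mconst (c j)) ((nil ^^ j) v)) = (\<Sum>j\<in>J. smul (mconst (c j)) ((nil ^^ Suc j) v))"
    for c and J :: "nat set"
  proof (induction J rule: infinite_finite_induct)
    case (insert x F)
    have "(\<Sum>j\<in>F. smul (mconst (c j)) ((nil ^^ j) v)) \<in> M" using sumV V0M by blast
    thus ?case using insert VM[of x] by (simp add: shop_add shop_const)
  qed auto
  show ?thesis
    unfolding nil_stable_def const_subspace_def
  proof (intro conjI ballI allI)
    show "chain v h \<subseteq> V0" using sumV by (auto simp: chain_def)
    show "0 \<in> chain v h" unfolding chain_def by (intro CollectI exI[of _ "\<lambda>_. 0"]) simp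
    fix x assume "x \<in> chain v h"
    then obtain c where c: "x = (\<Sum>j\<le>h. smul (mconst (c j)) ((nil ^^ j) v))" by (auto simp: chain_def)
    have "nil x = (\<Sum>j\<le>h. smul (mconst (c j)) ((nil ^^ Suc j) v))" unfolding c by (rule shift)
    also have "\<dots> = (\<Sum>j<Suc h. smul (mconst (c j)) ((nil ^^ Suc j) v))" by (simp only: lessThan_Suc_atMost)
    also have "\<dots> = (\<Sum>j<h. smul (mconst (c j)) ((nil ^^ Suc j) v))" using v(2) by (simp del: funpow.simps)
    also have "\<dots> = (\<Sum>j<Suc h. smul (mconst (case j of 0 \<Rightarrow> 0 | Suc i \<Rightarrow> c i)) ((nil ^^ j) v))"
      by (subst sum.lessThan_Suc_shift) (simp del: funpow.simps)
    finally show "nil x \<in> chain v h" unfolding chain_def lessThan_Suc_atMost by blast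
    fix s
    have "smul (mconst s) x = (\<Sum>j\<le>h. smul (mconst (s * c j)) ((nil ^^ j) v))"
      by (simp add: c scale_sum_right mconst_mult)
    thus "smul (mconst s) x \<in> chain v h" unfolding chain_def
      by (intro CollectI exI[of _ "\<lambda>j. s * c j"]) simp
    fix y assume "y \<in> chain v h"
    then obtain b where b: "y = (\<Sum>j\<le>h. smul (mconst (b j)) ((nil ^^ j) v))" by (auto simp: chain_def)
    have "x + y = (\<Sum>j\<le>h. smul (mconst (c j + b j)) ((nil ^^ j) v))"
      by (simp add: c b mconst_add scale_left_distrib sum.distrib)
    thus "x + y \<in> chain v h" unfolding chain_def
      by (intro CollectI exI[of _ "\<lambda>j. c j + b j"]) simp
  qed
qed

text \<open>Applying nil^(h-i) sends the terms after index i beyond the end of the chain, so the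
  first possibly nonzero coefficient can be read off.\<close>

lemma chain_pow:
  assumes v: "v \<in> V0" "(nil ^^ Suc h) v = 0" and i: "i \<le> h" and c: "\<And>j. j < i \<Longrightarrow> c j = 0"
  shows "(nil ^^ (h - i)) (\<Sum>j\<le>h. smul (mconst (c j)) ((nil ^^ j) v)) = smul (mconst (c i)) ((nil ^^ h) v)"
proof -
  have VM: "(nil ^^ j) v \<in> M" for j using V0_nil_pow[OF v(1)] V0M by blast
  have shift: "(nil ^^ k) (\<Sum>j\<in>J. smul (mconst (c j)) ((nil ^^ j) v)) = (\<Sum>j\<in>J. smul (mconst (c j)) ((nil ^^ (k + j)) v))"
    for k and J :: "nat set"
  proof (induction J rule: infinite_finite_induct)
    case (insert x F)
    have "(\<Sum>j\<in>F. smul (mconst (c j)) ((nil ^^ j) v)) \<in> M" using VM by (intro M_sum M_scale)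
    thus ?case using insert VM[of x] by (simp add: shop_pow_add shop_pow_const funpow_add)
  qed auto
  have "(\<Sum>j\<le>h. smul (mconst (c j)) ((nil ^^ (h - i + j)) v)) = (\<Sum>j\<in>{i}. smul (mconst (c j)) ((nil ^^ (h - i + j)) v))"
  proof (rule sum.mono_neutral_right)
    show "\<forall>j\<in>{..h} - {i}. smul (mconst (c j)) ((nil ^^ (h - i + j)) v) = 0"
    proof
      fix j assume j: "j \<in> {..h} - {i}"
      show "smul (mconst (c j)) ((nil ^^ (h - i + j)) v) = 0"
      proof (cases "j < i")
        case False
        hence "Suc h \<le> h - i + j" using j i by auto
        thus ?thesis using shop_pow_mono[OF v(2)] by simp
      qed (use c in simp)
    qed
  qed (use i in auto)
  thus ?thesis unfolding shift using i by simp
qed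

text \<open>The splitting step for Jordan blocks: a chain of maximal length has a complement stable
  under \<open>nil\<close>. The hulls of chain and complement are complementary submodules of P, so
  by indecomposability the complement is zero.\<close>

lemma chain_all:
  assumes v: "v \<in> V0" "(nil ^^ h) v \<noteq> 0" and top: "\<And>w. w \<in> V0 \<Longrightarrow> (nil ^^ Suc h) w = 0"
  shows "V0 \<subseteq> chain v h"
proof -
  interpret C: vector_space "\<lambda>c. smul (mconst c)" by (rule const_vector_space)
  define w0 where "w0 = (nil ^^ h) v"
  have ind0: "C.independent {w0}" using v by (simp add: w0_def)
  define E where "E = C.extend_basis {w0}"
  have E: "C.independent E" "C.span E = UNIV" "w0 \<in> E"
    using C.independent_extend_basis[OF ind0] C.span_extend_basis[OF ind0] C.extend_basis_superset[OF ind0]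
    by (auto simp: E_def)
  \<comment> \<open>A coordinate with respect to a basis over the constants: a linear form with
    value 1 at the end nil^h v of the chain.\<close>
  define f where "f = (\<lambda>u. C.representation E u w0)"
  have f_add: "f (a + b) = f a + f b" for a b unfolding f_def using E by (simp add: C.representation_add)
  have f_scale: "f (smul (mconst c) a) = c * f a" for a c unfolding f_def using E by (simp add: C.representation_scale)
  have f_diff: "f (a - b) = f a - f b" for a b using f_add[of "a - b" b] by simp
  have fw: "f w0 = 1" unfolding f_def using E by (simp add: C.representation_basis)
  have f0: "f 0 = 0" using f_scale[of 0 0] by simp
  \<comment> \<open>The largest subspace of V0 stable under \<open>nil\<close> on which f vanishes;
    it meets the chain in zero because f detects the first nonzero coefficient of a
    combination.\<close>
  define V2 where "V2 = {u \<in> V0. \<forall>i. f ((nil ^^ i) u) = 0}"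
  note vtop = top[OF v(1)]
  have N1: "nil_stable (chain v h)" by (rule chain_nil_stable[OF v(1) vtop])
  have c0: "const_subspace V0" using V0_nil_stable by (simp add: nil_stable_def)
  have N2: "nil_stable V2"
    unfolding nil_stable_def const_subspace_def
  proof (intro conjI ballI allI)
    show "V2 \<subseteq> V0" "0 \<in> V2" using c0 by (auto simp: V2_def f0 const_subspace_def)
    fix x c assume x: "x \<in> V2"
    hence xM: "x \<in> V0" "x \<in> M" "\<And>i. f ((nil ^^ i) x) = 0" using V0M by (auto simp: V2_def)
    show "smul (mconst c) x \<in> V2"
      using c0 xM by (simp add: V2_def const_subspace_def shop_pow_const f_scale)
    have "f ((nil ^^ i) (nil x)) = 0" for i using xM(3)[of "Suc i"] by (simp add: funpow_swap1)
    moreover have "nil x \<in> V0" using V0_nil_stable xM(1) by (simp add: nil_stable_def)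
    ultimately show "nil x \<in> V2" by (simp add: V2_def)
    fix y assume "y \<in> V2"
    hence yM: "y \<in> V0" "y \<in> M" "\<And>i. f ((nil ^^ i) y) = 0" using V0M by (auto simp: V2_def)
    show "x + y \<in> V2"
      using c0 xM yM by (simp add: V2_def const_subspace_def shop_pow_add f_add)
  qed
  have powM: "(nil ^^ i) u \<in> M" if "u \<in> V0" for u i using V0_nil_pow[OF that] V0M by blast
  \<comment> \<open>Coefficients are found one by one: a multiple of nil^s v corrects f(nil^(h-s)
    u), and the corrections already made at higher powers are kept because nil^(h+1) v = 0.\<close>
  have red: "\<exists>c. \<forall>j. s \<ge> Suc h - j \<longrightarrow> f ((nil ^^ j) (u - (\<Sum>i<s. smul (mconst (c i)) ((nil ^^ i) v)))) = 0"
    if "u \<in> V0" "s \<le> Suc h" for u s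
    using that(2)
  proof (induction s)
    case 0
    have "f ((nil ^^ j) u) = 0" if "Suc h \<le> j" for j using shop_pow_mono[OF top[OF \<open>u \<in> V0\<close>] that] f0 by simp
    thus ?case by auto
  next
    case (Suc s)
    then obtain c where c: "\<And>j. s \<ge> Suc h - j \<Longrightarrow> f ((nil ^^ j) (u - (\<Sum>i<s. smul (mconst (c i)) ((nil ^^ i) v)))) = 0" by auto
    define w where "w = u - (\<Sum>i<s. smul (mconst (c i)) ((nil ^^ i) v))"
    have wM: "w \<in> M" unfolding w_def using powM[OF v(1)] powM[OF that(1), of 0] by (intro M_diff M_sum M_scale) auto
    define a where "a = f ((nil ^^ (h - s)) w)"
    define c' where "c' = c(s := a)"
    have w': "u - (\<Sum>i<Suc s. smul (mconst (c' i)) ((nil ^^ i) v)) = w - smul (mconst a) ((nil ^^ s) v)"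
      by (simp add: w_def c'_def algebra_simps)
    have "f ((nil ^^ j) (w - smul (mconst a) ((nil ^^ s) v))) = 0" if j: "Suc s \<ge> Suc h - j" for j
    proof -
      have 1: "(nil ^^ j) (w - smul (mconst a) ((nil ^^ s) v)) = (nil ^^ j) w - smul (mconst a) ((nil ^^ (j + s)) v)"
        using wM powM[OF v(1), of s] by (simp add: shop_pow_diff shop_pow_const funpow_add)
      show ?thesis
      proof (cases "s \<ge> Suc h - j")
        case True
        hence "Suc h \<le> j + s" by simp
        hence "(nil ^^ (j + s)) v = 0" using shop_pow_mono[OF vtop] by blast
        thus ?thesis unfolding 1 using c[OF True] by (simp add: w_def)
      next
        case False
        hence "j = h - s" "j + s = h" using j Suc.prems by auto
        thus ?thesis unfolding 1 using fw by (simp add: f_diff f_scale a_def w0_def)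
      qed
    qed
    thus ?case unfolding w'[symmetric] by blast
  qed
  have split: "\<exists>x\<in>chain v h. u - x \<in> V2" if u: "u \<in> V0" for u
  proof -
    obtain c where c: "\<And>j. f ((nil ^^ j) (u - (\<Sum>i<Suc h. smul (mconst (c i)) ((nil ^^ i) v)))) = 0"
      using red[OF u order_refl] by auto
    define x where "x = (\<Sum>i\<le>h. smul (mconst (c i)) ((nil ^^ i) v))"
    have x: "x \<in> chain v h" by (auto simp: x_def chain_def)
    hence "x \<in> V0" using N1 by (auto simp: nil_stable_def)
    hence "u - x \<in> V0" using const_subspace_diff[OF c0 u] by blast
    thus ?thesis using c x unfolding V2_def x_def lessThan_Suc_atMost by blast
  qed
  have int: "chain v h \<inter> V2 \<subseteq> {0}"
  proof
    fix x assume x: "x \<in> chain v h \<inter> V2"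
    then obtain c where c: "x = (\<Sum>j\<le>h. smul (mconst (c j)) ((nil ^^ j) v))" by (auto simp: chain_def)
    have "\<forall>i\<le>h. c i = 0"
    proof (rule ccontr)
      assume nz: "\<not> (\<forall>i\<le>h. c i = 0)"
      define i where "i = (LEAST i. c i \<noteq> 0)"
      obtain i' where i': "i' \<le> h" "c i' \<noteq> 0" using nz by blast
      have ci: "c i \<noteq> 0" unfolding i_def by (rule LeastI[of "\<lambda>i. c i \<noteq> 0", OF i'(2)])
      moreover have "i \<le> h" using Least_le[of "\<lambda>i. c i \<noteq> 0", OF i'(2)] i'(1) by (simp add: i_def)
      moreover have "c j = 0" if "j < i" for j using that not_less_Least[of j "\<lambda>i. c i \<noteq> 0"] by (auto simp: i_def)
      ultimately have "(nil ^^ (h - i)) x = smul (mconst (c i)) w0"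
        unfolding c w0_def by (intro chain_pow[OF v(1) vtop])
      hence "f ((nil ^^ (h - i)) x) = c i" using fw by (simp add: f_scale)
      thus False using x ci by (auto simp: V2_def)
    qed
    thus "x \<in> {0}" by (simp add: c)
  qed
  note H1 = dhull_stable[OF N1] and H2 = dhull_stable[OF N2]
  have dis: "dhull (chain v h) \<inter> dhull V2 = {0}"
  proof (rule ccontr)
    assume ne: "dhull (chain v h) \<inter> dhull V2 \<noteq> {0}"
    have "stable (dhull (chain v h) \<inter> dhull V2)" using H1 H2 by (auto simp: stable_def subspace_inter)
    then obtain y where y: "y \<in> dhull (chain v h) \<inter> dhull V2" "y \<in> V0" "y \<noteq> 0"
      by (rule stable_meets_V0[OF _ _ ne]) (use H1(2) in auto)
    hence "y \<in> chain v h \<inter> V2" using dhull_inter[OF N1] dhull_inter[OF N2] by blast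
    thus False using int y by blast
  qed
  have sum: "P = set_sum (dhull (chain v h)) (dhull V2)"
  proof
    have st: "stable (set_sum (dhull (chain v h)) (dhull V2))" by (rule stable_set_sum[OF H1(1) H2(1)])
    have "V0 \<subseteq> set_sum (dhull (chain v h)) (dhull V2)"
    proof
      fix u assume "u \<in> V0"
      then obtain x where "x \<in> chain v h" "u - x \<in> V2" using split by blast
      moreover have "u = x + (u - x)" by simp
      ultimately show "u \<in> set_sum (dhull (chain v h)) (dhull V2)"
        unfolding set_sum_def using H1(3) H2(3) by blast
    qed
    hence "dhull V0 \<subseteq> set_sum (dhull (chain v h)) (dhull V2)"
      unfolding dhull_def[of V0] using st by (intro span_minimal) (auto simp: stable_pow stable_def[of "set_sum _ _"])
    thus "P \<subseteq> set_sum (dhull (chain v h)) (dhull V2)" using dhull_V0 by simp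
    show "set_sum (dhull (chain v h)) (dhull V2) \<subseteq> P" using H1 H2 P by (auto simp: set_sum_def intro: stable_add)
  qed
  have "v \<in> chain v h"
    unfolding chain_def by (rule CollectI, rule exI[of _ "\<lambda>j. if j = 0 then 1 else 0"])
      (simp add: if_distrib[of mconst] if_distrib[of "\<lambda>c. smul c _"] cong: if_cong)
  moreover have "v \<noteq> 0" using v(2) by auto
  ultimately have "dhull (chain v h) \<noteq> {0}" using H1(3) by blast
  hence "dhull V2 = {0}" using indecomposable_split[OF ind H1(1) H2(1) dis sum] by blast
  hence "V2 \<subseteq> {0}" using H2(3) by blast
  show ?thesis
  proof
    fix u assume "u \<in> V0"
    then obtain x where "x \<in> chain v h" "u - x \<in> V2" using split by blast
    thus "u \<in> chain v h" using \<open>V2 \<subseteq> {0}\<close> by auto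
  qed
qed

end

context vector_space
begin

lemma spanning_family_independent:
  assumes fin: "finite I" and sp: "span (b ` I) = Z" and card: "card I \<le> dim Z"
  shows "inj_on b I" "independent (b ` I)"
proof -
  obtain B where B: "B \<subseteq> b ` I" "independent B" "b ` I \<subseteq> span B"
    using maximal_independent_subset by blast
  have finb: "finite (b ` I)" using fin by simp
  have "span B = Z" using B sp span_mono[OF B(1)] span_minimal[OF B(3)] by (auto simp: subspace_span)
  hence "dim Z = card B" using dim_span[of B] dim_eq_card_independent[OF B(2)] by simp
  hence "card (b ` I) \<le> card B" using card card_image_le[OF fin, of b] by linarith
  hence eq: "B = b ` I" using card_seteq[OF finb B(1)] by blast
  thus "independent (b ` I)" using B by simp
  have "card (b ` I) = card I"
    using card card_image_le[OF fin, of b] \<open>dim Z = card B\<close> eq by simp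
  thus "inj_on b I" using eq_card_imp_inj_on[OF fin] by blast
qed

lemma independent_family_zero:
  assumes "independent B" "finite J" "inj_on b J" "b ` J \<subseteq> B"
    "(\<Sum>j\<in>J. scale (c j) (b j)) = 0" "j \<in> J"
  shows "c j = 0"
proof -
  define u where "u = (\<lambda>x. c (inv_into J b x))"
  have "(\<Sum>x\<in>b ` J. scale (u x) x) = (\<Sum>j\<in>J. scale (c j) (b j))"
    by (subst sum.reindex[OF assms(3)]) (auto simp: u_def assms(3) intro!: sum.cong)
  hence "u (b j) = 0"
    using independentD[OF assms(1), of "b ` J" u "b j"] assms by auto
  thus ?thesis using assms by (simp add: u_def)
qed

end

context indecomposable_class
begin

text \<open>With v the start of the Jordan chain, the vectors \<Sigma>^b nil^j v with b < n and j
  \<le> h form a basis of P: they span it, and there are no more of them than its rank. The ends of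
  the chain span the members Q i of a filtration, Q 1 is simple, and shifting along the chain
  identifies Q (i+1) modulo Q i with Q 1. A splitting would produce an eigenvector outside the end
  of the chain.\<close>

theorem indecomposable_structure:
  obtains S where "stable S" "S \<subseteq> P" "simple_module smul q \<Sigma> S" "iterated_self_extension smul q \<Sigma> S P"
proof -
  obtain h v where v: "v \<in> V0" "(nil ^^ h) v \<noteq> 0" and top: "\<And>w. w \<in> V0 \<Longrightarrow> (nil ^^ Suc h) w = 0"
    and dimP: "n * Suc h \<le> dim P" by (rule maximal_height) blast
  note vtop = top[OF v(1)]
  have V0c: "V0 \<subseteq> chain v h" by (rule chain_all[OF v top])
  have powV: "(nil ^^ j) v \<in> V0" for j by (rule V0_nil_pow[OF v(1)])
  have powM: "(nil ^^ j) v \<in> M" "(nil ^^ j) v \<in> P" for j using powV V0M V0P by blast+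
  define bas where "bas = (\<lambda>(b, j). (\<Sigma> ^^ b) ((nil ^^ j) v))"
  have basP: "bas x \<in> P" for x using powM P by (cases x) (auto simp: bas_def stable_pow)
  have basM: "bas x \<in> M" for x using basP PM by blast
  have bas0: "bas (b, j) = 0" if "j > h" for b j
    using shop_pow_mono[OF vtop, of j] that by (simp add: bas_def)
  have basS: "\<Sigma> (bas (b, j)) = bas (Suc b, j)" for b j by (simp add: bas_def)
  have basn: "bas (n, j) = smul (mero_X powi (- d)) (smul (mconst \<nu>) (bas (0, j)) + bas (0, Suc j))" for j
    using sigma_n[OF powM(1)[of j]] by (simp add: bas_def)
  \<comment> \<open>The submodule spanned by the last i steps of the chain; it is zero for i = 0 and
    equal to P for i = h + 1.\<close>
  define Q where "Q = (\<lambda>i. span (bas ` ({..<n} \<times> {Suc h - i..h})))"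
  have n0: "0 < n" using n1 by simp
  have mem0: "bas (0, j) \<in> Q i" if "Suc h - i \<le> j" for i j
  proof (cases "j \<le> h")
    case True
    thus ?thesis unfolding Q_def using that n0 by (intro span_base) auto
  qed (simp add: bas0 Q_def span_zero)
  have Qst: "stable (Q i)" for i
    unfolding Q_def
  proof (rule stable_span)
    show "bas ` ({..<n} \<times> {Suc h - i..h}) \<subseteq> M" using basM by auto
    fix x assume "x \<in> bas ` ({..<n} \<times> {Suc h - i..h})"
    then obtain b j where x: "x = bas (b, j)" "b < n" "Suc h - i \<le> j" "j \<le> h" by auto
    show "\<Sigma> x \<in> span (bas ` ({..<n} \<times> {Suc h - i..h}))"
    proof (cases "Suc b < n")
      case True
      thus ?thesis unfolding x(1) basS using x by (intro span_base) auto
    next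
      case False
      hence "Suc b = n" using x by simp
      hence "\<Sigma> x = bas (n, j)" unfolding x(1) basS by simp
      also have "\<dots> \<in> Q i" unfolding basn using mem0[of i j] mem0[of i "Suc j"] x
        unfolding Q_def by (intro span_scale span_add) auto
      finally show ?thesis by (simp add: Q_def)
    qed
  qed
  have QP: "Q i \<subseteq> P" for i
    unfolding Q_def using basP P by (intro span_minimal) (auto simp: stable_def)
  have QM: "Q i \<subseteq> M" for i using QP PM by blast
  have Qmono: "i \<le> j \<Longrightarrow> Q i \<subseteq> Q j" for i j
    unfolding Q_def by (intro span_mono image_mono) auto
  define I where "I = {..<n} \<times> {..h}"
  have QI: "Q (Suc h) = span (bas ` I)" by (simp add: Q_def I_def atLeast0AtMost)
  have Qtop: "Q (Suc h) = P"
  proof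
    show "P \<subseteq> Q (Suc h)"
    proof -
      have "V0 \<subseteq> Q (Suc h)"
      proof
        fix w assume "w \<in> V0"
        then obtain c where "w = (\<Sum>j\<le>h. smul (mconst (c j)) ((nil ^^ j) v))" using V0c by (auto simp: chain_def)
        also have "\<dots> = (\<Sum>j\<le>h. smul (mconst (c j)) (bas (0, j)))" by (simp add: bas_def)
        also have "\<dots> \<in> Q (Suc h)" using mem0[of "Suc h"] unfolding Q_def by (intro span_sum span_scale) auto
        finally show "w \<in> Q (Suc h)" .
      qed
      hence "dhull V0 \<subseteq> Q (Suc h)"
        unfolding dhull_def using Qst[of "Suc h"] by (intro span_minimal) (auto simp: stable_pow stable_def[of "Q _"])
      thus ?thesis using dhull_V0 by simp
    qed
  qed (rule QP)
  have finI: "finite I" by (simp add: I_def)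
  have "card I \<le> dim P" using dimP by (simp add: I_def)
  from spanning_family_independent[OF finI _ this, of bas] have
    inj: "inj_on bas I" and indep: "independent (bas ` I)" using QI Qtop by auto
  have zero: "c x = 0" if "(\<Sum>x\<in>J. smul (c x) (bas x)) = 0" "x \<in> J" "J \<subseteq> I" for c J x
    by (rule independent_family_zero[OF indep _ _ _ that(1,2)])
       (use that(3) finI inj in \<open>auto intro: finite_subset inj_on_subset\<close>)
  interpret vp: vector_space_pair smul smul by unfold_locales
  \<comment> \<open>Shift by i steps along the chain, with values 0 beyond the end. It commutes with
    \<Sigma>, as the relation for \<Sigma>^n has the same form for every j.\<close>
  define \<pi> where "\<pi> = (\<lambda>i. vp.construct (bas ` I) (\<lambda>x. bas (case inv_into I bas x of (b, j) \<Rightarrow> (b, j + i))))"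
  have lin: "Vector_Spaces.linear smul smul (\<pi> i)" for i unfolding \<pi>_def by (rule vp.linear_construct[OF indep])
  have \<pi>_add: "\<pi> i (x + y) = \<pi> i x + \<pi> i y" for i x y using vp.linear_add[OF lin] .
  have \<pi>_scale: "\<pi> i (smul c x) = smul c (\<pi> i x)" for i c x using vp.linear_scale[OF lin] .
  have \<pi>_0: "\<pi> i 0 = 0" for i using \<pi>_scale[of i 0 0] by simp
  have \<pi>_bas: "\<pi> i (bas (b, j)) = bas (b, j + i)" if "b < n" for i b j
  proof (cases "j \<le> h")
    case True
    have "(b, j) \<in> I" using True that by (simp add: I_def)
    thus ?thesis unfolding \<pi>_def using inj by (subst vp.construct_basis[OF indep]) auto
  next
    case False
    thus ?thesis using bas0 \<pi>_0 by simp
  qed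
  have \<pi>_P: "\<pi> i x \<in> P \<and> \<pi> i (\<Sigma> x) = \<Sigma> (\<pi> i x) \<and> x \<in> P" if "x \<in> P" for i x
  proof -
    have "x \<in> span (bas ` I)" using that Qtop QI by simp
    thus ?thesis
    proof (induction rule: span_induct_alt)
      case base
      thus ?case using stable_0[OF P] by (simp add: \<pi>_0)
    next
      case (step c x y)
      obtain b j where x: "x = bas (b, j)" "b < n" "j \<le> h" using step(1) by (auto simp: I_def)
      have \<pi>x: "\<pi> i x = bas (b, j + i)" using \<pi>_bas x by simp
      have "\<pi> i (\<Sigma> x) = \<Sigma> (\<pi> i x)"
      proof (cases "Suc b < n")
        case True
        thus ?thesis unfolding \<pi>x unfolding x(1) basS using \<pi>_bas by simp
      next
        case False
        hence "Suc b = n" using x by simp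
        thus ?thesis unfolding \<pi>x unfolding x(1) basS using \<pi>_bas[OF n0]
          by (simp add: basn \<pi>_add \<pi>_scale)
      qed
      moreover have "x \<in> M" "y \<in> M" "\<pi> i x \<in> M" "\<pi> i y \<in> M" "x \<in> P" "\<pi> i x \<in> P"
        using x basP basM step PM \<pi>x by auto
      ultimately show ?case using step P
        by (simp add: \<pi>_add \<pi>_scale add scale stable_add stable_scale)
    qed
  qed
  \<comment> \<open>The basis vectors of Q (i+1) outside Q i have j = h - i, and the shift sends
    them to the independent vectors with j = h.\<close>
  have ker: "x \<in> Q i \<longleftrightarrow> \<pi> i x = 0" if x: "x \<in> Q (Suc i)" and i: "1 \<le> i" "i \<le> h" for x i
  proof
    have "\<pi> i y = 0" if "y \<in> Q i" for y
      using that unfolding Q_def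
    proof (induction rule: span_induct_alt)
      case (step c x y)
      thus ?case using \<pi>_bas bas0 by (auto simp: \<pi>_add \<pi>_scale)
    qed (rule \<pi>_0)
    thus "x \<in> Q i \<Longrightarrow> \<pi> i x = 0" .
    assume x0: "\<pi> i x = 0"
    let ?J = "{..<n} \<times> {Suc h - Suc i..h}"
    have JI: "?J \<subseteq> I" by (auto simp: I_def)
    have injJ: "inj_on bas ?J" using inj JI by (rule inj_on_subset)
    have "x \<in> span (bas ` ?J)" using x by (simp add: Q_def)
    then obtain u where u: "x = (\<Sum>y\<in>bas ` ?J. smul (u y) y)" by (auto simp: span_finite)
    define c where "c = (\<lambda>x. u (bas x))"
    have xc: "x = (\<Sum>y\<in>?J. smul (c y) (bas y))" unfolding u c_def by (subst sum.reindex[OF injJ]) simp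
    let ?K = "{..<n} \<times> {h - i}"
    have J: "?J = ?K \<union> {..<n} \<times> {Suc h - i..h}" using i by auto
    have disj: "?K \<inter> {..<n} \<times> {Suc h - i..h} = {}" using i by auto
    define x1 x2 where "x1 = (\<Sum>y\<in>?K. smul (c y) (bas y))" and "x2 = (\<Sum>y\<in>{..<n} \<times> {Suc h - i..h}. smul (c y) (bas y))"
    have x12: "x = x1 + x2" unfolding xc J x1_def x2_def by (rule sum.union_disjoint) (use disj in auto)
    have x2: "x2 \<in> Q i" unfolding x2_def Q_def by (intro span_sum span_scale span_base) auto
    have "\<pi> i x1 = 0" using x0 \<open>\<And>y. y \<in> Q i \<Longrightarrow> \<pi> i y = 0\<close>[OF x2] unfolding x12 \<pi>_add by simp
    moreover have "\<pi> i x1 = (\<Sum>y\<in>?K. smul (c y) (bas (fst y, h)))"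
    proof -
      have "\<pi> i x1 = (\<Sum>y\<in>?K. \<pi> i (smul (c y) (bas y)))" unfolding x1_def by (rule vp.linear_sum[OF lin])
      also have "\<dots> = (\<Sum>y\<in>?K. smul (c y) (bas (fst y, h)))"
        using i \<pi>_bas by (intro sum.cong refl) (auto simp: \<pi>_scale)
      finally show ?thesis .
    qed
    also have "\<dots> = (\<Sum>y\<in>{..<n} \<times> {h}. smul (c (fst y, h - i)) (bas y))"
      by (rule sum.reindex_bij_witness[of _ "\<lambda>y. (fst y, h - i)" "\<lambda>y. (fst y, h)"]) auto
    ultimately have z: "(\<Sum>y\<in>{..<n} \<times> {h}. smul (c (fst y, h - i)) (bas y)) = 0" by simp
    have "c (b, h - i) = 0" if "b < n" for b
      using zero[OF z, of "(b, h)"] that by (auto simp: I_def)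
    hence "x1 = 0" unfolding x1_def by (intro sum.neutral) auto
    thus "x \<in> Q i" using x12 x2 by simp
  qed
  have \<pi>_surj: "\<pi> i ` Q (Suc i) = Q 1" if i: "1 \<le> i" "i \<le> h" for i
  proof -
    let ?S = "\<pi> i ` bas ` ({..<n} \<times> {Suc h - Suc i..h})" and ?T = "bas ` ({..<n} \<times> {Suc h - 1..h})"
    have "?S \<subseteq> insert 0 ?T"
    proof
      fix x assume "x \<in> ?S"
      then obtain b j where x: "x = bas (b, j + i)" "b < n" "h \<le> j + i" using \<pi>_bas by auto
      thus "x \<in> insert 0 ?T" using bas0[of "j + i" b] by (cases "j + i = h") auto
    qed
    moreover have "?T \<subseteq> ?S"
    proof
      fix x assume "x \<in> ?T"
      then obtain b where x: "x = bas (b, h)" "b < n" by auto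
      hence "x = \<pi> i (bas (b, h - i))" using \<pi>_bas[of b i "h - i"] i by simp
      thus "x \<in> ?S" using x(2) by auto
    qed
    ultimately have "span ?S = span ?T" by (metis span_insert_0 span_mono subset_antisym)
    thus ?thesis unfolding Q_def using vp.linear_span_image[OF lin] by metis
  qed
  have qd: "q_difference_module smul q (Q i) \<Sigma>" for i
    using stable_q_submodule[OF Qst order_refl] by (simp add: q_submodule_def)
  \<comment> \<open>A section would map the eigenvector s at the end of the chain to an eigenvector
    in V0. The only such vectors are constant multiples of s, which the shift kills, whereas a
    section requires s itself as the image under the shift.\<close>
  have nonsplit: "\<not> (\<exists>\<tau>. q_morphism smul \<Sigma> (Q 1) (Q (Suc i)) \<tau> \<and> (\<forall>y\<in>Q 1. \<pi> i (\<tau> y) = y))" if i: "1 \<le> i" "i \<le> h" for i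
  proof
    assume "\<exists>\<tau>. q_morphism smul \<Sigma> (Q 1) (Q (Suc i)) \<tau> \<and> (\<forall>y\<in>Q 1. \<pi> i (\<tau> y) = y)"
    then obtain \<tau> where \<tau>: "q_morphism smul \<Sigma> (Q 1) (Q (Suc i)) \<tau>" and inv: "\<And>y. y \<in> Q 1 \<Longrightarrow> \<pi> i (\<tau> y) = y" by blast
    define s where "s = bas (0, h)"
    have s: "s \<in> Q 1" unfolding s_def by (rule mem0) simp
    have s0: "s \<noteq> 0" using v(2) by (simp add: s_def bas_def)
    have nils: "nil s = 0" using vtop by (simp add: s_def bas_def)
    define w where "w = \<tau> s"
    have wQ: "w \<in> Q (Suc i)" using \<tau> s by (auto simp: q_morphism_def w_def)
    have wP: "w \<in> P" "w \<in> M" using wQ QP PM by blast+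
    have tsc: "\<tau> (smul c y) = smul c (\<tau> y)" if "y \<in> Q 1" for c y using \<tau> that by (simp add: q_morphism_def)
    have tsg: "\<tau> (\<Sigma> y) = \<Sigma> (\<tau> y)" if "y \<in> Q 1" for y using \<tau> that by (simp add: q_morphism_def)
    have "sop n d w = \<tau> (sop n d s)"
      unfolding w_def by (rule hom_slope_op[OF semilinear_axioms Qst tsc tsg s, symmetric])
    also have "sop n d s = smul (mconst \<nu>) s" using nils by (simp add: shop_def)
    also have "\<tau> \<dots> = smul (mconst \<nu>) w" using tsc[OF s] by (simp add: w_def)
    finally have nw: "nil w = 0" by (simp add: shop_def)
    hence nw1: "(nil ^^ 1) w = 0" by simp
    hence "w \<in> gen_eig n d \<nu>" using wP unfolding gen_eig_def by blast
    hence "w \<in> V0" using wP by (simp add: V0_def)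
    then obtain c where c: "w = (\<Sum>j\<le>h. smul (mconst (c j)) ((nil ^^ j) v))" using V0c by (auto simp: chain_def)
    have "c j = 0" if "j < h" for j
      using that
    proof (induction j rule: less_induct)
      case (less j)
      have "(nil ^^ (h - j)) w = smul (mconst (c j)) ((nil ^^ h) v)"
        unfolding c by (rule chain_pow[OF v(1) vtop]) (use less in auto)
      moreover have "(nil ^^ (h - j)) w = 0" by (rule shop_pow_mono[OF nw1]) (use less.prems in simp)
      ultimately show ?case using v(2) by simp
    qed
    hence "w = (\<Sum>j\<in>{h}. smul (mconst (c j)) ((nil ^^ j) v))"
      unfolding c by (intro sum.mono_neutral_right) auto
    hence "w = smul (mconst (c h)) s" by (simp add: s_def bas_def)
    hence "\<pi> i w = smul (mconst (c h)) (bas (0, h + i))" by (simp add: \<pi>_scale s_def \<pi>_bas n0)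
    hence "\<pi> i w = 0" using bas0 i by simp
    thus False using inv[OF s] s0 by (simp add: w_def)
  qed
  have iter: "iterated_self_extension smul q \<Sigma> (Q 1) (Q (Suc i))" if "i \<le> h" for i
    using that
  proof (induction i)
    case 0
    have "q_morphism smul \<Sigma> (Q 1) (Q 1) (\<lambda>x. x)" by (simp add: q_morphism_def)
    thus ?case using iterated_self_extension.base[OF qd[of 1], of _ "\<lambda>x. x"] by (simp add: bij_betw_def inj_on_def)
  next
    case (Suc i)
    let ?i = "Suc i"
    have "nontrivial_extension smul \<Sigma> (Q ?i) (Q (Suc ?i)) (Q 1)"
      unfolding nontrivial_extension_def
    proof (rule exI[of _ "\<lambda>x. x"], rule exI[of _ "\<pi> ?i"], intro conjI)
      show "q_morphism smul \<Sigma> (Q ?i) (Q (Suc ?i)) (\<lambda>x. x)" using Qmono[of ?i "Suc ?i"] by (simp add: q_morphism_def)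
      have sur: "\<pi> ?i ` Q (Suc ?i) = Q 1" using \<pi>_surj[of ?i] Suc.prems by simp
      show "q_morphism smul \<Sigma> (Q (Suc ?i)) (Q 1) (\<pi> ?i)"
        using sur \<pi>_P QP[of "Suc ?i"] by (auto simp: q_morphism_def \<pi>_add \<pi>_scale)
      show "\<pi> ?i ` Q (Suc ?i) = Q 1" by (rule sur)
      show "(\<lambda>x. x) ` Q ?i = {m \<in> Q (Suc ?i). \<pi> ?i m = 0}"
        using ker[of _ ?i] Qmono[of ?i "Suc ?i"] Suc.prems by auto
      show "\<not> (\<exists>\<tau>. q_morphism smul \<Sigma> (Q 1) (Q (Suc ?i)) \<tau> \<and> (\<forall>y\<in>Q 1. \<pi> ?i (\<tau> y) = y))"
        using nonsplit[of ?i] Suc.prems by simp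
    qed (simp add: inj_on_def)
    thus ?case using Suc iterated_self_extension.extend[OF qd] by simp
  qed
  \<comment> \<open>Ranks of submodules of P are multiples of n, and so are the differences, while Q
    1 has rank at most n.\<close>
  have simple: "simple_module smul q \<Sigma> (Q 1)"
    unfolding simple_module_def
  proof (intro conjI allI impI)
    show "Q 1 \<noteq> {0}" using mem0[of 1 h] v(2) by (auto simp: bas_def)
    fix Z assume "q_submodule smul q \<Sigma> Z (Q 1)"
    hence Z: "stable Z" "Z \<subseteq> Q 1" using q_submodule_stable[OF _ QM] by (auto simp: q_submodule_def)
    have ZP: "Z \<subseteq> P" using Z QP by blast
    show "Z = {0} \<or> Z = Q 1"
    proof (rule ccontr)
      assume "\<not> ?thesis"
      hence ne: "Z \<noteq> {0}" "Z \<noteq> Q 1" by auto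
      have "dim Z \<noteq> 0" using stable_dim_0[OF Z(1)] ne by simp
      hence "n \<le> dim Z" using dim_dvd[OF Z(1) ZP] by (simp add: dvd_imp_le)
      moreover have "dim Z + n \<le> dim (Q 1)" by (rule dim_step[OF Z(1) Qst Z(2) ne(2) QP])
      moreover have "dim (Q 1) \<le> n"
      proof -
        have "dim (Q 1) \<le> card (bas ` ({..<n} \<times> {Suc h - 1..h}))"
          unfolding Q_def by (rule dim_le_card) (auto intro: span_superset)
        also have "\<dots> \<le> card ({..<n} \<times> {Suc h - 1..h})" by (rule card_image_le) simp
        finally show ?thesis by simp
      qed
      ultimately show False using n0 by simp
    qed
  qed (rule qd)
  show ?thesis using that[OF Qst QP simple] iter[of h] Qtop by simp
qed

end

section \<open>Edges of the Newton polygon against the support of \<open>chi\<close>\<close>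

section \<open>The Newton polygon\<close>

definition to_mero :: "'a :: valued_field qop \<Rightarrow> 'a mero poly" where
  "to_mero L = map_poly to_fract L"

lemma coeff_to_mero [simp]: "coeff (to_mero L) i = to_fract (coeff L i)"
  by (simp add: to_mero_def coeff_map_poly)

lemma to_mero_eq_0_iff [simp]: "to_mero L = 0 \<longleftrightarrow> L = 0"
  by (auto simp: poly_eq_iff)

lemma degree_to_mero [simp]: "degree (to_mero L) = degree L"
  unfolding to_mero_def by (rule degree_map_poly) auto

text \<open>The choice p = 1 is harmless, since p affects only nonzero factors of the coefficients
  and not the support (\<open>width_chi\<close>).\<close>

definition nwidth :: "nat \<Rightarrow> int \<Rightarrow> 'a :: valued_field mero poly \<Rightarrow> nat" where
  "nwidth n d L = width (chi n d 1 L)"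

lemma width_cong:
  fixes f g :: "'a :: idom poly"
  assumes "\<And>i. coeff f i = 0 \<longleftrightarrow> coeff g i = 0" shows "width f = width g"
proof (cases "f = 0")
  case True
  hence "g = 0" using assms by (simp add: poly_eq_iff)
  thus ?thesis using True by simp
next
  case False
  hence g: "g \<noteq> 0" using assms by (auto simp: poly_eq_iff)
  have "order 0 f = order 0 g" using coeff_order_0[OF g] assms by (intro order_0_eqI) auto
  moreover have "degree f = degree g"
  proof (rule antisym)
    show "degree f \<le> degree g" using assms[of "degree f"] False by (intro le_degree) simp
    show "degree g \<le> degree f" using assms[of "degree g"] g by (intro le_degree) simp
  qed
  ultimately show ?thesis by (simp add: width_def)
qed

lemma width_chi:
  assumes "n \<ge> 1" "p \<noteq> 0" shows "width (chi n d p L) = nwidth n d L"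
  unfolding nwidth_def
proof (rule width_cong)
  fix i
  have "coeff (chi n d p L) i \<noteq> 0 \<longleftrightarrow> coeff (chi n d 1 L) i \<noteq> 0"
    unfolding chi_coeff_iff_min[OF assms] chi_coeff_iff_min[OF assms(1) one_neq_zero] by (rule refl)
  thus "coeff (chi n d p L) i = 0 \<longleftrightarrow> coeff (chi n d 1 L) i = 0" by simp
qed

text \<open>An open half-plane together with a convex part of its boundary line is convex. As a hull
  containing the Newton polygon it shows that the polygon touches a supporting line in the expected
  segment only.\<close>

lemma convex_halfspace_union:
  fixes v \<mu> :: real and S :: "(real \<times> real) set"
  assumes S: "convex S" "\<And>x y. (x, y) \<in> S \<Longrightarrow> y - \<mu> * x = v"
  shows "convex ({(x, y). y - \<mu> * x > v} \<union> S)"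
proof (rule convexI)
  fix P Q :: "real \<times> real" and s t :: real
  assume P: "P \<in> {(x, y). y - \<mu> * x > v} \<union> S" and Q: "Q \<in> {(x, y). y - \<mu> * x > v} \<union> S"
    and st: "0 \<le> s" "0 \<le> t" "s + t = 1"
  obtain a b c d where ab: "P = (a, b)" "Q = (c, d)" by (cases P; cases Q) auto
  have ge: "b - \<mu> * a \<ge> v" "d - \<mu> * c \<ge> v" using P Q S(2) by (auto simp: ab less_imp_le)
  have eq: "(s * b + t * d) - \<mu> * (s * a + t * c) = s * (b - \<mu> * a) + t * (d - \<mu> * c)"
    by (simp add: algebra_simps)
  show "s *\<^sub>R P + t *\<^sub>R Q \<in> {(x, y). y - \<mu> * x > v} \<union> S"
  proof (cases "(s = 0 \<or> P \<in> S) \<and> (t = 0 \<or> Q \<in> S)")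
    case True
    show ?thesis
    proof (cases "s = 0 \<or> t = 0")
      case True
      moreover have "s = 0 \<Longrightarrow> t = 1" "t = 0 \<Longrightarrow> s = 1" using st by auto
      ultimately have "s *\<^sub>R P + t *\<^sub>R Q = P \<or> s *\<^sub>R P + t *\<^sub>R Q = Q" by auto
      thus ?thesis
      proof
        assume "s *\<^sub>R P + t *\<^sub>R Q = P" thus ?thesis using P by (rule ssubst)
      next
        assume "s *\<^sub>R P + t *\<^sub>R Q = Q" thus ?thesis using Q by (rule ssubst)
      qed
    next
      case False
      hence "P \<in> S" "Q \<in> S" using True by auto
      thus ?thesis using S(1) st convexD by blast
    qed
  next
    case False
    have v: "v = s * v + t * v" using st by (metis distrib_right mult_1)
    have "s * (b - \<mu> * a) + t * (d - \<mu> * c) > v"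
    proof (cases "s = 0 \<or> P \<in> S")
      case True
      hence "t > 0" "d - \<mu> * c > v" using False st Q by (auto simp: ab)
      hence "t * (d - \<mu> * c) > t * v" by simp
      moreover have "s * (b - \<mu> * a) \<ge> s * v" using ge st by (intro mult_left_mono)
      ultimately show ?thesis using v by linarith
    next
      case False
      hence "s > 0" "b - \<mu> * a > v" using st P by (auto simp: ab)
      hence "s * (b - \<mu> * a) > s * v" by simp
      moreover have "t * (d - \<mu> * c) \<ge> t * v" using ge st by (intro mult_left_mono)
      ultimately show ?thesis using v by linarith
    qed
    thus ?thesis using eq by (simp add: ab)
  qed
qed

lemma newton_polygon_point:
  "coeff L i \<noteq> 0 \<Longrightarrow> real (germ_ord (coeff L i)) \<le> k \<Longrightarrow> (real i, k) \<in> newton_polygon L"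
  unfolding newton_polygon_def by (rule hull_inc) (auto intro: le_degree)

lemma newton_polygon_up:
  assumes "(x, y) \<in> newton_polygon L" "y \<le> y'" shows "(x, y') \<in> newton_polygon L"
proof -
  let ?G = "{(real i, k) | i k. i \<le> degree L \<and> coeff L i \<noteq> 0 \<and> real (germ_ord (coeff L i)) \<le> k}"
  have "convex hull ?G \<subseteq> (\<lambda>p. (0, - (y' - y)) + p) ` (convex hull ?G)"
  proof (rule hull_minimal)
    show "?G \<subseteq> (\<lambda>p. (0, - (y' - y)) + p) ` (convex hull ?G)"
    proof
      fix p assume "p \<in> ?G"
      then obtain i k where p: "p = (real i, k)" "i \<le> degree L" "coeff L i \<noteq> 0" "real (germ_ord (coeff L i)) \<le> k" by auto
      have "(real i, k + (y' - y)) \<in> ?G" using p assms by auto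
      hence "(real i, k + (y' - y)) \<in> convex hull ?G" by (rule hull_inc)
      moreover have "p = (0, - (y' - y)) + (real i, k + (y' - y))" by (simp add: p)
      ultimately show "p \<in> (\<lambda>p. (0, - (y' - y)) + p) ` (convex hull ?G)" by blast
    qed
    show "convex ((\<lambda>p. (0, - (y' - y)) + p) ` (convex hull ?G))"
      by (rule convex_translation) simp
  qed
  then obtain p where p: "p \<in> convex hull ?G" "(x, y) = (0, - (y' - y)) + p"
    using assms(1) unfolding newton_polygon_def by blast
  hence "p = (x, y')" by (cases p) auto
  thus ?thesis using p by (simp add: newton_polygon_def)
qed

lemma segment_on_line:
  fixes a b :: real
  assumes "a < c"
  shows "(x, y) \<in> closed_segment (a, b) (c, b + \<mu> * (c - a)) \<longleftrightarrow> a \<le> x \<and> x \<le> c \<and> y = b + \<mu> * (x - a)"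
proof
  assume "(x, y) \<in> closed_segment (a, b) (c, b + \<mu> * (c - a))"
  then obtain u where u: "0 \<le> u" "u \<le> 1" "x = (1 - u) * a + u * c" "y = (1 - u) * b + u * (b + \<mu> * (c - a))"
    by (auto simp: closed_segment_def)
  have x: "x = a + u * (c - a)" using u(3) by (simp add: algebra_simps)
  have "u * (c - a) \<le> 1 * (c - a)" using u assms by (intro mult_right_mono) auto
  moreover have "0 \<le> u * (c - a)" using u assms by simp
  ultimately have "x \<le> c" "a \<le> x" unfolding x by simp_all
  moreover have "y = b + \<mu> * (x - a)" unfolding x u(4) by (simp add: algebra_simps)
  ultimately show "a \<le> x \<and> x \<le> c \<and> y = b + \<mu> * (x - a)" by simp
next
  assume h: "a \<le> x \<and> x \<le> c \<and> y = b + \<mu> * (x - a)"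
  define u where "u = (x - a) / (c - a)"
  have uc: "u * (c - a) = x - a" using assms by (simp add: u_def)
  have "0 \<le> u" "u \<le> 1" using h assms by (auto simp: u_def)
  moreover have "x = (1 - u) * a + u * c" using uc by (simp add: algebra_simps)
  moreover have "y = (1 - u) * b + u * (b + \<mu> * (c - a))"
  proof -
    have "(1 - u) * b + u * (b + \<mu> * (c - a)) = b + \<mu> * (u * (c - a))" by (simp add: algebra_simps)
    thus ?thesis using h uc by simp
  qed
  ultimately show "(x, y) \<in> closed_segment (a, b) (c, b + \<mu> * (c - a))"
    by (auto simp: closed_segment_def)
qed

lemma newton_polygon_face:
  fixes L :: "'a :: valued_field qop" and \<mu> v :: real
  assumes min: "\<And>i. coeff L i \<noteq> 0 \<Longrightarrow> v \<le> real (germ_ord (coeff L i)) - \<mu> * real i"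
    and i0: "coeff L i0 \<noteq> 0" "real (germ_ord (coeff L i0)) - \<mu> * real i0 = v"
    and i1: "coeff L i1 \<noteq> 0" "real (germ_ord (coeff L i1)) - \<mu> * real i1 = v"
    and ext: "\<And>i. coeff L i \<noteq> 0 \<Longrightarrow> real (germ_ord (coeff L i)) - \<mu> * real i = v \<Longrightarrow> i0 \<le> i \<and> i \<le> i1"
    and lt: "i0 < i1"
  defines "S \<equiv> closed_segment (real i0, v + \<mu> * real i0) (real i1, v + \<mu> * real i0 + \<mu> * (real i1 - real i0))"
  shows "newton_polygon L \<subseteq> {(x, y). y - \<mu> * x > v} \<union> S" "S \<subseteq> newton_polygon L" "S face_of newton_polygon L"
    "S edge_of newton_polygon L"
proof -
  have mem: "(x, y) \<in> S \<longleftrightarrow> real i0 \<le> x \<and> x \<le> real i1 \<and> y = v + \<mu> * real i0 + \<mu> * (x - real i0)" for x y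
    unfolding S_def using lt by (intro segment_on_line) simp
  have on: "y - \<mu> * x = v" if "(x, y) \<in> S" for x y using that unfolding mem by (simp add: algebra_simps)
  have conv: "convex S" by (simp add: S_def)
  show sub: "newton_polygon L \<subseteq> {(x, y). y - \<mu> * x > v} \<union> S"
    unfolding newton_polygon_def
  proof (rule hull_minimal)
    show "convex ({(x, y). y - \<mu> * x > v} \<union> S)" by (rule convex_halfspace_union) (use conv on in blast)+
  next
    have "k - \<mu> * real i > v" if i: "coeff L i \<noteq> 0" "real (germ_ord (coeff L i)) \<le> k" "(real i, k) \<notin> S" for i k
    proof -
    have ge: "v \<le> k - \<mu> * real i" using min[OF i(1)] i(2) by simp
    have "k - \<mu> * real i \<noteq> v"
    proof
      assume e: "k - \<mu> * real i = v"
      hence "real (germ_ord (coeff L i)) - \<mu> * real i = v" using min[OF i(1)] i(2) by simp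
      hence "i0 \<le> i \<and> i \<le> i1" by (rule ext[OF i(1)])
      hence "(real i, k) \<in> S" unfolding mem using e by (auto simp: algebra_simps)
      thus False using i by simp
    qed
    thus "k - \<mu> * real i > v" using ge by simp
    qed
    thus "{(real i, k) |i k. i \<le> degree L \<and> coeff L i \<noteq> 0 \<and> real (germ_ord (coeff L i)) \<le> k} \<subseteq> {(x, y). y - \<mu> * x > v} \<union> S"
      by blast
  qed
  have cN: "convex (newton_polygon L)" by (simp add: newton_polygon_def)
  have e0: "v + \<mu> * real i0 = real (germ_ord (coeff L i0))" using i0 by simp
  have e1: "v + \<mu> * real i0 + \<mu> * (real i1 - real i0) = real (germ_ord (coeff L i1))" using i1 by (simp add: algebra_simps)
  have P0: "(real i0, v + \<mu> * real i0) \<in> newton_polygon L" unfolding e0 by (rule newton_polygon_point[OF i0(1)]) simp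
  have P1: "(real i1, v + \<mu> * real i0 + \<mu> * (real i1 - real i0)) \<in> newton_polygon L"
    unfolding e1 by (rule newton_polygon_point[OF i1(1)]) simp
  show SN: "S \<subseteq> newton_polygon L"
    unfolding S_def using P0 P1 by (intro closed_segment_subset[OF _ _ cN])
  have "newton_polygon L \<inter> {p. (- \<mu>, 1) \<bullet> p = v} face_of newton_polygon L"
  proof (rule face_of_Int_supporting_hyperplane_ge[OF cN])
    fix p assume "p \<in> newton_polygon L"
    thus "v \<le> (- \<mu>, 1) \<bullet> p" using sub on by (cases p) force
  qed
  moreover have "newton_polygon L \<inter> {p. (- \<mu>, 1) \<bullet> p = v} = S"
    using sub SN on by (auto; force)
  ultimately show face: "S face_of newton_polygon L" by simp
  have "aff_dim S = 1"
    unfolding S_def segment_convex_hull aff_dim_convex_hull aff_dim_2 using lt by simp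
  thus "S edge_of newton_polygon L" using face by (simp add: edge_of_def)
qed

text \<open>From right to left this is \<open>newton_polygon_face\<close>. Conversely, the line
  through a bounded edge must support the polygon from below, because the polygon is closed upwards,
  and the ends of the edge are extreme points and so come from coefficients.\<close>

lemma newton_slopes_char:
  fixes L :: "'a :: valued_field qop"
  shows "(\<mu>, r) \<in> newton_slopes L \<longleftrightarrow> (\<exists>i0 i1 v. i0 < i1 \<and> r = real i1 - real i0 \<and>
     (\<forall>i. coeff L i \<noteq> 0 \<longrightarrow> v \<le> real (germ_ord (coeff L i)) - \<mu> * real i) \<and>
     coeff L i0 \<noteq> 0 \<and> real (germ_ord (coeff L i0)) - \<mu> * real i0 = v \<and>
     coeff L i1 \<noteq> 0 \<and> real (germ_ord (coeff L i1)) - \<mu> * real i1 = v \<and>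
     (\<forall>i. coeff L i \<noteq> 0 \<longrightarrow> real (germ_ord (coeff L i)) - \<mu> * real i = v \<longrightarrow> i0 \<le> i \<and> i \<le> i1))"
    (is "_ \<longleftrightarrow> ?R")
proof
  assume ?R
  then obtain i0 i1 v where *: "i0 < i1" "r = real i1 - real i0"
     "\<And>i. coeff L i \<noteq> 0 \<Longrightarrow> v \<le> real (germ_ord (coeff L i)) - \<mu> * real i"
     "coeff L i0 \<noteq> 0" "real (germ_ord (coeff L i0)) - \<mu> * real i0 = v"
     "coeff L i1 \<noteq> 0" "real (germ_ord (coeff L i1)) - \<mu> * real i1 = v"
     "\<And>i. coeff L i \<noteq> 0 \<Longrightarrow> real (germ_ord (coeff L i)) - \<mu> * real i = v \<Longrightarrow> i0 \<le> i \<and> i \<le> i1" by blast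
  have "closed_segment (real i0, v + \<mu> * real i0) (real i1, v + \<mu> * real i0 + \<mu> * (real i1 - real i0)) edge_of newton_polygon L"
    by (rule newton_polygon_face(4)) (use * in auto)
  hence "closed_segment (real i0, v + \<mu> * real i0) (real i0 + r, v + \<mu> * real i0 + \<mu> * r) edge_of newton_polygon L"
    by (simp add: *(2))
  moreover have "r > 0" using *(1,2) by simp
  ultimately show "(\<mu>, r) \<in> newton_slopes L" unfolding newton_slopes_def by blast
next
  assume "(\<mu>, r) \<in> newton_slopes L"
  then obtain a b where r: "r > 0" and edge: "closed_segment (a, b) (a + r, b + \<mu> * r) edge_of newton_polygon L"
    by (auto simp: newton_slopes_def)
  define S where "S = closed_segment (a, b) (a + r, b + \<mu> * r)"
  have face: "S face_of newton_polygon L" using edge by (simp add: S_def edge_of_def)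
  hence SN: "S \<subseteq> newton_polygon L" by (rule face_of_imp_subset)
  have mem: "(x, y) \<in> S \<longleftrightarrow> a \<le> x \<and> x \<le> a + r \<and> y = b + \<mu> * (x - a)" for x y
    using segment_on_line[of a "a + r" x y b \<mu>] r by (simp add: S_def)
  define v where "v = b - \<mu> * a"
  \<comment> \<open>A polygon point below the line, joined through the middle of the edge to a
    polygon point beyond it, would have to lie on the edge by the definition of a face.\<close>
  have low: "v \<le> y - \<mu> * x" if p: "(x, y) \<in> newton_polygon L" for x y
  proof (rule ccontr)
    assume "\<not> ?thesis"
    hence lt: "y < b + \<mu> * (x - a)" by (simp add: v_def algebra_simps)
    define sx where "sx = a + r / 2"
    define sy where "sy = b + \<mu> * (sx - a)"
    \<comment> \<open>So small that the point beyond the middle still lies above the edge, hence in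
      the polygon.\<close>
    define \<epsilon> where "\<epsilon> = (r / 2) / (\<bar>sx - x\<bar> + 1)"
    have \<epsilon>: "\<epsilon> > 0" unfolding \<epsilon>_def using r by (intro divide_pos_pos) auto
    have "\<epsilon> * \<bar>sx - x\<bar> \<le> r / 2"
    proof -
      have "\<bar>sx - x\<bar> / (\<bar>sx - x\<bar> + 1) \<le> 1" by simp
      hence "(r / 2) * (\<bar>sx - x\<bar> / (\<bar>sx - x\<bar> + 1)) \<le> (r / 2) * 1" using r by (intro mult_left_mono) auto
      thus ?thesis by (simp add: \<epsilon>_def)
    qed
    moreover have "\<bar>\<epsilon> * (sx - x)\<bar> = \<epsilon> * \<bar>sx - x\<bar>" using \<epsilon> by (simp add: abs_mult)
    ultimately have bnd: "\<bar>\<epsilon> * (sx - x)\<bar> \<le> r / 2" by simp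
    define tx where "tx = sx + \<epsilon> * (sx - x)"
    define ty where "ty = sy + \<epsilon> * (sy - y)"
    have tx: "a \<le> tx" "tx \<le> a + r" using bnd by (auto simp: tx_def sx_def)
    have "(tx, b + \<mu> * (tx - a)) \<in> newton_polygon L" using SN mem tx by auto
    moreover have "b + \<mu> * (tx - a) \<le> ty"
    proof -
      have "ty - (b + \<mu> * (tx - a)) = \<epsilon> * ((b + \<mu> * (x - a)) - y)"
        by (simp add: ty_def tx_def sy_def algebra_simps)
      thus ?thesis using \<epsilon> lt by (smt (verit) mult_pos_pos)
    qed
    ultimately have tN: "(tx, ty) \<in> newton_polygon L" by (rule newton_polygon_up)
    define u where "u = 1 / (1 + \<epsilon>)"
    have u: "0 < u" "u < 1" "u * (1 + \<epsilon>) = 1" using \<epsilon> by (auto simp: u_def)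
    have ue: "u * \<epsilon> = 1 - u" using u(3) by (simp add: algebra_simps)
    have cx: "(1 - u) * x + u * tx = sx" and cy: "(1 - u) * y + u * ty = sy"
    proof -
      have "(1 - u) * x + u * tx = (1 - u) * x + u * sx + (u * \<epsilon>) * (sx - x)" by (simp add: tx_def algebra_simps)
      thus "(1 - u) * x + u * tx = sx" unfolding ue by (simp add: algebra_simps)
      have "(1 - u) * y + u * ty = (1 - u) * y + u * sy + (u * \<epsilon>) * (sy - y)" by (simp add: ty_def algebra_simps)
      thus "(1 - u) * y + u * ty = sy" unfolding ue by (simp add: algebra_simps)
    qed
    have sS: "(sx, sy) \<in> S" using mem r by (auto simp: sx_def sy_def)
    have ne: "(x, y) \<noteq> (tx, ty)"
    proof
      assume e: "(x, y) = (tx, ty)"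
      hence "x = sx" "y = sy" using cx cy by (auto simp: algebra_simps)
      thus False using lt by (simp add: sy_def)
    qed
    have "(sx, sy) \<in> open_segment (x, y) (tx, ty)"
      unfolding in_segment using ne u cx cy by (auto intro!: exI[of _ u])
    hence "(x, y) \<in> S" using face p tN sS unfolding face_of_def by blast
    thus False using mem lt by simp
  qed
  have minI: "v \<le> real (germ_ord (coeff L i)) - \<mu> * real i" if "coeff L i \<noteq> 0" for i
    using low[OF newton_polygon_point[OF that order_refl]] .
  have vertex: "\<exists>i. coeff L i \<noteq> 0 \<and> x = real i \<and> real (germ_ord (coeff L i)) - \<mu> * real i = v"
    if ex: "(x, y) extreme_point_of newton_polygon L" and on: "y - \<mu> * x = v" for x y
  proof -
    obtain i where i: "x = real i" "coeff L i \<noteq> 0" "real (germ_ord (coeff L i)) \<le> y"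
      using extreme_point_of_convex_hull[OF ex[unfolded newton_polygon_def]] by auto
    thus ?thesis using minI[OF i(2)] on by (intro exI[of _ i]) auto
  qed
  have ext: "(a, b) extreme_point_of newton_polygon L" "(a + r, b + \<mu> * r) extreme_point_of newton_polygon L"
    using extreme_point_of_face[OF face] extreme_point_of_segment[of _ "(a, b)" "(a + r, b + \<mu> * r)"] by (auto simp: S_def)
  obtain i0 where i0: "coeff L i0 \<noteq> 0" "a = real i0" "real (germ_ord (coeff L i0)) - \<mu> * real i0 = v"
    using vertex[OF ext(1)] by (auto simp: v_def)
  obtain i1 where i1: "coeff L i1 \<noteq> 0" "a + r = real i1" "real (germ_ord (coeff L i1)) - \<mu> * real i1 = v"
    using vertex[OF ext(2)] by (auto simp: v_def algebra_simps)
  have ab: "(a, b) = (a, v + \<mu> * a)" "(a + r, b + \<mu> * r) = (a + r, v + \<mu> * (a + r))" by (simp_all add: v_def algebra_simps)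
  have line: "(y, v + \<mu> * y) \<in> open_segment (x, v + \<mu> * x) (z, v + \<mu> * z)" if "x < y" "y < z" for x y z
  proof -
    define u where "u = (y - x) / (z - x)"
    have u: "0 < u" "u < 1" "u * (z - x) = y - x" using that by (auto simp: u_def)
    have y: "y = (1 - u) * x + u * z" using u(3) by (simp add: algebra_simps)
    have "v + \<mu> * y = (1 - u) * (v + \<mu> * x) + u * (v + \<mu> * z)" unfolding y by (simp add: algebra_simps)
    thus ?thesis unfolding in_segment by (intro conjI exI[of _ u]) (use u(1,2) that y in simp_all)
  qed
  have "i0 \<le> i \<and> i \<le> i1" if i: "coeff L i \<noteq> 0" "real (germ_ord (coeff L i)) - \<mu> * real i = v" for i
  proof (rule ccontr)
    have P: "(real i, v + \<mu> * real i) \<in> newton_polygon L" using newton_polygon_point[OF i(1), of "v + \<mu> * real i"] i(2) by simp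
    assume "\<not> ?thesis"
    hence "real i < a \<or> a + r < real i" unfolding i0(2) i1(2)[unfolded i0(2)] by auto
    thus False using line[of "real i" a "a + r"] line[of a "a + r" "real i"] r P ext unfolding ab extreme_point_of_def by auto
  qed
  with minI i0 i1 r show ?R by - (rule exI[of _ i0], rule exI[of _ i1], rule exI[of _ v], auto)
qed

text \<open>The points minimising n ord(a_i) - d i are the support of \<open>chi\<close>, so the
  edge of slope d/n reaches from its lowest to its highest index.\<close>

lemma newton_slopes_iff:
  fixes L :: "'a :: valued_field qop"
  assumes nd: "(n, d) \<in> slopes"
  shows "(real_of_int d / real n, r) \<in> newton_slopes L \<longleftrightarrow> r = real (nwidth n d (to_mero L)) \<and> r > 0"
proof -
  have n1: "n \<ge> 1" using nd by (simp add: slopes_def)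
  define w where "w = (\<lambda>i. int n * int (germ_ord (coeff L i)) - d * int i)"
  define X where "X = chi n d 1 (to_mero L)"
  have cmp: "w i \<le> w j \<longleftrightarrow> real (germ_ord (coeff L i)) - real_of_int d / real n * real i \<le>
      real (germ_ord (coeff L j)) - real_of_int d / real n * real j" for i j
  proof -
    have wr: "real_of_int (w k) = real n * (real (germ_ord (coeff L k)) - real_of_int d / real n * real k)" for k
      using n1 by (simp add: w_def algebra_simps)
    have "w i \<le> w j \<longleftrightarrow> real_of_int (w i) \<le> real_of_int (w j)" by simp
    also have "\<dots> \<longleftrightarrow> real (germ_ord (coeff L i)) - real_of_int d / real n * real i \<le>
      real (germ_ord (coeff L j)) - real_of_int d / real n * real j"
      unfolding wr using n1 by (intro mult_le_cancel_left_pos) auto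
    finally show ?thesis .
  qed
  have Xiff: "coeff X i \<noteq> 0 \<longleftrightarrow> coeff L i \<noteq> 0 \<and> (\<forall>j. coeff L j \<noteq> 0 \<longrightarrow> w i \<le> w j)" for i
    unfolding X_def using chi_coeff_iff_min[OF n1, of 1 d "to_mero L" i] by (simp add: w_def germ_fls_subdegree)
  have wX: "nwidth n d (to_mero L) = width X" by (simp add: nwidth_def X_def)
  show ?thesis
  proof
    assume "(real_of_int d / real n, r) \<in> newton_slopes L"
    then obtain i0 i1 v where *: "i0 < i1" "r = real i1 - real i0"
     "\<And>i. coeff L i \<noteq> 0 \<Longrightarrow> v \<le> real (germ_ord (coeff L i)) - real_of_int d / real n * real i"
     "coeff L i0 \<noteq> 0" "real (germ_ord (coeff L i0)) - real_of_int d / real n * real i0 = v"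
     "coeff L i1 \<noteq> 0" "real (germ_ord (coeff L i1)) - real_of_int d / real n * real i1 = v"
     "\<And>i. coeff L i \<noteq> 0 \<Longrightarrow> real (germ_ord (coeff L i)) - real_of_int d / real n * real i = v \<Longrightarrow> i0 \<le> i \<and> i \<le> i1"
      unfolding newton_slopes_char by blast
    have "width X = i1 - i0"
    proof (rule width_eqI)
      show "coeff X i0 \<noteq> 0" "coeff X i1 \<noteq> 0" unfolding Xiff cmp using * by auto
      fix k assume k: "coeff X k \<noteq> 0"
      hence "coeff L k \<noteq> 0" "w k \<le> w i0" unfolding Xiff using * by auto
      hence "real (germ_ord (coeff L k)) - real_of_int d / real n * real k = v" unfolding cmp using *(3)[of k] *(5) by simp
      thus "i0 \<le> k \<and> k \<le> i1" using *(8) \<open>coeff L k \<noteq> 0\<close> by blast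
    qed
    thus "r = real (nwidth n d (to_mero L)) \<and> r > 0" using * wX by auto
  next
    assume r: "r = real (nwidth n d (to_mero L)) \<and> r > 0"
    hence X0: "X \<noteq> 0" using wX by (auto simp: width_def)
    define i0 i1 where "i0 = order 0 X" and "i1 = degree X"
    define v where "v = real (germ_ord (coeff L i0)) - real_of_int d / real n * real i0"
    have ri: "r = real i1 - real i0" "i0 < i1" using r wX coeff_order_0(3)[OF X0] by (auto simp: width_def i0_def i1_def)
    have c: "coeff X i0 \<noteq> 0" "coeff X i1 \<noteq> 0" using coeff_order_0(1)[OF X0] X0 by (auto simp: i0_def i1_def)
    show "(real_of_int d / real n, r) \<in> newton_slopes L"
      unfolding newton_slopes_char
    proof (rule exI[of _ i0], rule exI[of _ i1], rule exI[of _ v], intro conjI allI impI)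
      show "coeff L i0 \<noteq> 0" "coeff L i1 \<noteq> 0" using c by (auto simp: Xiff)
      show "v \<le> real (germ_ord (coeff L i)) - real_of_int d / real n * real i" if "coeff L i \<noteq> 0" for i
        unfolding v_def cmp[symmetric] using c(1) that by (simp add: Xiff)
      have "w i1 \<le> w i0" "w i0 \<le> w i1" using c by (auto simp: Xiff)
      thus "real (germ_ord (coeff L i1)) - real_of_int d / real n * real i1 = v" unfolding v_def cmp by simp
      fix i assume i: "coeff L i \<noteq> 0" "real (germ_ord (coeff L i)) - real_of_int d / real n * real i = v"
      have "w i \<le> w i0" unfolding cmp using i by (simp add: v_def)
      hence "coeff X i \<noteq> 0" using i c(1) unfolding Xiff by force
      thus "i0 \<le> i" "i \<le> i1" using coeff_order_0(2)[OF X0, of i] le_degree[of X i] by (auto simp: i0_def i1_def not_less[symmetric])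
    qed (use ri v_def in auto)
  qed
qed

lemma newton_slopes_rational:
  fixes L :: "'a :: valued_field qop"
  assumes "(\<mu>, r) \<in> newton_slopes L"
  obtains n d where "(n, d) \<in> slopes" "\<mu> = real_of_int d / real n"
proof -
  obtain i0 i1 v where *: "i0 < i1"
     "real (germ_ord (coeff L i0)) - \<mu> * real i0 = v" "real (germ_ord (coeff L i1)) - \<mu> * real i1 = v"
    using assms unfolding newton_slopes_char by blast
  define D where "D = int (germ_ord (coeff L i1)) - int (germ_ord (coeff L i0))"
  define I where "I = int i1 - int i0"
  have I: "I > 0" using * by (simp add: I_def)
  have "\<mu> * real_of_int I = real_of_int D" using * by (simp add: I_def D_def algebra_simps)
  hence \<mu>: "\<mu> = real_of_int D / real_of_int I" using I by (simp add: field_simps)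
  define g where "g = gcd I D"
  have g: "g > 0" using I by (simp add: g_def)
  define n where "n = nat (I div g)"
  define d where "d = D div g"
  have "I div g > 0" using I g by (simp add: g_def pos_imp_zdiv_pos_iff zdvd_imp_le)
  hence n: "int n = I div g" "n \<ge> 1" by (auto simp: n_def)
  have "coprime (int n) d" unfolding n(1) d_def g_def using I by (intro div_gcd_coprime) auto
  moreover have "\<mu> = real_of_int d / real n"
  proof -
    have "I = int n * g" "D = d * g" using n(1) by (simp_all add: d_def g_def)
    hence "real_of_int I = real n * real_of_int g" "real_of_int D = real_of_int d * real_of_int g" by simp_all
    thus ?thesis using \<mu> g by simp
  qed
  ultimately show ?thesis using that[of n d] n(2) by (simp add: slopes_def)
qed

section \<open>Laurent skew polynomials reduced to skew polynomials\<close>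

section \<open>Laurent skew polynomials\<close>

abbreviation "lookup \<equiv> Poly_Mapping.lookup"
abbreviation "keys \<equiv> Poly_Mapping.keys"
abbreviation "single \<equiv> Poly_Mapping.single"

lemma lookup_ore_mult:
  assumes "finite I" "keys P \<subseteq> I"
  shows "lookup (ore_mult q P R) k =
    (\<Sum>i\<in>I. lookup P i * (if k - i \<in> keys R then mero_dilate (q powi i) (lookup R (k - i)) else 0))"
proof -
  have 1: "(\<Sum>j\<in>keys R. if i + j = k then lookup P i * mero_dilate (q powi i) (lookup R j) else 0) =
      lookup P i * (if k - i \<in> keys R then mero_dilate (q powi i) (lookup R (k - i)) else 0)" for i
  proof -
    have "(\<Sum>j\<in>keys R. if i + j = k then lookup P i * mero_dilate (q powi i) (lookup R j) else 0) =
      (\<Sum>j\<in>keys R. if j = k - i then lookup P i * mero_dilate (q powi i) (lookup R j) else 0)"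
      by (intro sum.cong) auto
    thus ?thesis by simp
  qed
  have "lookup (ore_mult q P R) k = (\<Sum>i\<in>keys P.
      lookup P i * (if k - i \<in> keys R then mero_dilate (q powi i) (lookup R (k - i)) else 0))"
    unfolding ore_mult_def lookup_sum lookup_single when_def 1 by simp
  also have "\<dots> = (\<Sum>i\<in>I. lookup P i * (if k - i \<in> keys R then mero_dilate (q powi i) (lookup R (k - i)) else 0))"
    using assms by (intro sum.mono_neutral_left) (auto simp: in_keys_iff)
  finally show ?thesis .
qed

context
  fixes q :: "'a :: valued_field" assumes q0: "q \<noteq> 0"
begin

lemma ore_mult_lookup:
  assumes "finite I" "keys P \<subseteq> I"
  shows "lookup (ore_mult q P R) k =
    (\<Sum>i\<in>I. lookup P i * mero_dilate (q powi i) (lookup R (k - i)))"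
  unfolding lookup_ore_mult[OF assms] using q0 by (intro sum.cong) (auto simp: in_keys_iff)

lemma single_ore_mult_lookup:
  "lookup (ore_mult q (single i f) R) k = f * mero_dilate (q powi i) (lookup R (k - i))"
  by (subst ore_mult_lookup[of "{i}"]) (auto split: if_splits)

lemma const_ore_mult_lookup [simp]: "lookup (ore_mult q (ore_const f) R) k = f * lookup R k"
  unfolding ore_const_def single_ore_mult_lookup by simp

lemma sigma_ore_mult_lookup [simp]: "lookup (ore_mult q ore_sigma R) k = mero_dilate q (lookup R (k - 1))"
  unfolding ore_sigma_def single_ore_mult_lookup by simp

lemma ore_mult_single:
  "ore_mult q (single i f) (single j g) = single (i + j) (f * mero_dilate (q powi i) g)"
  by (rule poly_mapping_eqI) (auto simp: single_ore_mult_lookup lookup_single when_def q0)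

lemma ore_mult_diff: "ore_mult q (P - R) S = ore_mult q P S - ore_mult q R S"
proof (rule poly_mapping_eqI)
  fix k
  let ?I = "keys P \<union> keys R"
  have "keys (P - R) \<subseteq> ?I" by (auto simp: in_keys_iff lookup_minus)
  thus "lookup (ore_mult q (P - R) S) k = lookup (ore_mult q P S - ore_mult q R S) k"
    by (simp add: lookup_minus ore_mult_lookup[of ?I] algebra_simps sum_subtractf)
qed

lemma single_ore_mult_assoc:
  "ore_mult q (single k f) (ore_mult q Q R) = ore_mult q (ore_mult q (single k f) Q) R"
proof (rule poly_mapping_eqI)
  fix m
  let ?K = "keys Q"
  have K: "keys (ore_mult q (single k f) Q) \<subseteq> (\<lambda>j. k + j) ` ?K"
  proof
    fix i assume "i \<in> keys (ore_mult q (single k f) Q)"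
    hence "i - k \<in> ?K" using q0 by (auto simp: in_keys_iff single_ore_mult_lookup)
    thus "i \<in> (\<lambda>j. k + j) ` ?K" by (rule rev_image_eqI) simp
  qed
  have qk: "q powi k \<noteq> 0" using q0 by simp
  have "lookup (ore_mult q (ore_mult q (single k f) Q) R) m =
     (\<Sum>j\<in>?K. f * mero_dilate (q powi k) (lookup Q j) * mero_dilate (q powi (k + j)) (lookup R (m - (k + j))))"
    by (subst ore_mult_lookup[OF _ K], simp, subst sum.reindex) (auto simp: inj_on_def single_ore_mult_lookup)
  also have "\<dots> = f * mero_dilate (q powi k) (\<Sum>j\<in>?K. lookup Q j * mero_dilate (q powi j) (lookup R (m - k - j)))"
    using q0 by (simp add: mero_dilate_sum[OF qk] mero_dilate_mult[OF qk] mero_dilate_dilate sum_distrib_left power_int_add mult.assoc diff_diff_eq)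
  also have "\<dots> = lookup (ore_mult q (single k f) (ore_mult q Q R)) m"
    by (simp add: single_ore_mult_lookup ore_mult_lookup[of ?K])
  finally show "lookup (ore_mult q (single k f) (ore_mult q Q R)) m =
    lookup (ore_mult q (ore_mult q (single k f) Q) R) m" ..
qed

end

text \<open>This is P \<sigma>^l, for l of any sign; every Laurent skew polynomial has this form for
  l small enough (\<open>ore_of_surj\<close>).\<close>

definition ore_of :: "int \<Rightarrow> 'a :: valued_field mero poly \<Rightarrow> 'a ore" where
  "ore_of l P = (\<Sum>i\<le>degree P. single (int i + l) (coeff P i))"

lemma lookup_ore_of [simp]: "lookup (ore_of l P) k = (if l \<le> k then coeff P (nat (k - l)) else 0)"
proof -
  have "lookup (ore_of l P) k = (\<Sum>i\<le>degree P. if int i + l = k then coeff P i else 0)"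
    by (simp add: ore_of_def lookup_sum lookup_single when_def)
  also have "\<dots> = (\<Sum>i\<le>degree P. if i = nat (k - l) then (if l \<le> k then coeff P i else 0) else 0)"
    by (intro sum.cong) auto
  also have "\<dots> = (if l \<le> k then coeff P (nat (k - l)) else 0)" by (auto simp: coeff_eq_0)
  finally show ?thesis .
qed

lemma ore_of_surj:
  assumes "\<And>k. k \<in> keys Q \<Longrightarrow> l \<le> k" obtains P where "Q = ore_of l P"
proof -
  define m where "m = nat (Max (insert l (keys Q)) - l)"
  define P where "P = poly_of_list (map (\<lambda>i. lookup Q (int i + l)) [0..<Suc m])"
  have "coeff P i = lookup Q (int i + l)" for i
  proof (cases "i \<le> m")
    case True
    thus ?thesis by (simp add: P_def nth_default_nth del: upt_Suc)
  next
    case False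
    have "int i + l \<notin> keys Q"
    proof
      assume "int i + l \<in> keys Q"
      hence "int i + l \<le> Max (insert l (keys Q))" by (intro Max_ge) auto
      thus False using False by (simp add: m_def)
    qed
    thus ?thesis using False by (simp add: P_def nth_default_beyond in_keys_iff del: upt_Suc)
  qed
  moreover have "lookup Q k = 0" if "\<not> l \<le> k" for k using assms that by (auto simp: in_keys_iff)
  ultimately have "Q = ore_of l P" by (intro poly_mapping_eqI) auto
  thus ?thesis by (rule that)
qed

lemma ore_of_inj: "ore_of l P = ore_of l R \<longleftrightarrow> P = R"
proof
  assume "ore_of l P = ore_of l R"
  from arg_cong[OF this, of "\<lambda>X. lookup X (int i + l)" for i] show "P = R"
    by (intro poly_eqI) (metis lookup_ore_of le_add_same_cancel2 of_nat_0_le_iff add_diff_cancel_right' nat_int)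
qed simp

lemma to_ore_conv: "to_ore L = ore_of 0 (to_mero L)"
  by (simp add: to_ore_def ore_of_def)

lemma ore_mult_ore_of:
  fixes q :: "'a :: valued_field"
  assumes q0: "q \<noteq> 0"
  shows "ore_mult q (ore_of 0 S) (ore_of l R) = ore_of l (skew_mult q S R)"
proof (rule poly_mapping_eqI)
  fix k
  have K: "keys (ore_of 0 S) \<subseteq> int ` {..degree S}"
  proof
    fix i assume "i \<in> keys (ore_of 0 S)"
    hence "0 \<le> i" "coeff S (nat i) \<noteq> 0" by (auto simp: in_keys_iff split: if_splits)
    thus "i \<in> int ` {..degree S}" by (intro image_eqI[of _ _ "nat i"]) (auto simp: le_degree)
  qed
  have "lookup (ore_mult q (ore_of 0 S) (ore_of l R)) k =
      (\<Sum>i\<le>degree S. coeff S i * mero_dilate (q ^ i) (if l \<le> k - int i then coeff R (nat (k - int i - l)) else 0))"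
    by (subst ore_mult_lookup[OF q0 _ K], simp, subst sum.reindex) auto
  also have "\<dots> = lookup (ore_of l (skew_mult q S R)) k"
  proof (cases "l \<le> k")
    case True
    have "nat (k - int i - l) = nat (k - l) - i" "l \<le> k - int i \<longleftrightarrow> i \<le> nat (k - l)" for i using True by auto
    thus ?thesis using True q0 by (auto simp: coeff_skew_mult intro!: sum.cong)
  qed (use q0 in auto)
  finally show "lookup (ore_mult q (ore_of 0 S) (ore_of l R)) k = lookup (ore_of l (skew_mult q S R)) k" .
qed

text \<open>If L has a nonzero constant coefficient, the lowest term of a multiplier R survives in
  the product. So a product without powers below \<sigma>^l has a multiplier without negative
  powers, and the two notions of ideal agree.\<close>

lemma left_ideal_ore_of:
  fixes q :: "'a :: valued_field"
  assumes q0: "q \<noteq> 0" and L: "coeff L 0 \<noteq> 0"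
  shows "(\<exists>R. ore_of l P = ore_mult q R (ore_of l L)) \<longleftrightarrow> (\<exists>S. P = skew_mult q S L)"
proof
  assume "\<exists>R. ore_of l P = ore_mult q R (ore_of l L)"
  then obtain R where R: "ore_of l P = ore_mult q R (ore_of l L)" ..
  have "0 \<le> i" if i: "i \<in> keys R" for i
  proof -
    define k where "k = Min (keys R)"
    have k: "k \<in> keys R" "\<And>j. j \<in> keys R \<Longrightarrow> k \<le> j" using i by (auto simp: k_def intro!: Min_in)
    have "lookup (ore_mult q R (ore_of l L)) (k + l) =
        (\<Sum>j\<in>keys R. if j = k then lookup R k * mero_dilate (q powi k) (coeff L 0) else 0)"
      unfolding ore_mult_lookup[OF q0 finite_keys order_refl] using k q0 by (intro sum.cong) force+
    also have "\<dots> \<noteq> 0" using k q0 L by (simp add: in_keys_iff)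
    finally have "0 \<le> k" unfolding R[symmetric] by (auto split: if_splits)
    thus ?thesis using k(2)[OF i] by simp
  qed
  then obtain S where "R = ore_of 0 S" using ore_of_surj[of R 0] by blast
  thus "\<exists>S. P = skew_mult q S L" using R by (auto simp: ore_mult_ore_of[OF q0] ore_of_inj)
next
  assume "\<exists>S. P = skew_mult q S L"
  thus "\<exists>R. ore_of l P = ore_mult q R (ore_of l L)" by (metis ore_mult_ore_of[OF q0])
qed

section \<open>Exponents, ramification and admissibility in terms of small divisors\<close>

section \<open>Exponents\<close>

lemma mfls_X_powi: "fls_nth (mfls (f * mero_X powi m)) k = fls_nth (mfls f) (k - m)"
  by (simp add: fls_X_intpow_times_conv_shift mult.commute)

lemma germ_of_mero:
  assumes "\<And>k. k < 0 \<Longrightarrow> fls_nth (mfls f) k = 0" obtains g where "f = to_fract g"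
proof -
  define h where "h = fls_regpart (mfls f)"
  have e: "mfls f = fps_to_fls h" unfolding h_def using fls_lower_boundE[of 0 "mfls f"] assms by simp
  have "conv_fls (mfls f)" using mfls_range by blast
  hence "convergent_coeffs (fps_nth h)" unfolding e by simp
  hence "f = to_fract (Abs_germ h)" by (simp flip: mfls_eq_iff add: e germ_fls_def Abs_germ_inverse)
  thus ?thesis by (rule that)
qed

lemma cleared_iff:
  fixes L :: "'a :: valued_field qop"
  shows "cleared L \<longleftrightarrow> (\<exists>i. coeff L i \<noteq> 0 \<and> germ_ord (coeff L i) = 0)"
proof
  assume "cleared L"
  then obtain u where u: "(u, 0) \<in> newton_polygon L" by (auto simp: cleared_def)
  show "\<exists>i. coeff L i \<noteq> 0 \<and> germ_ord (coeff L i) = 0"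
  proof (rule ccontr)
    assume n: "\<not> ?thesis"
    have "newton_polygon L \<subseteq> {p. (0, 1) \<bullet> p \<ge> (1 :: real)}"
      unfolding newton_polygon_def
    proof (rule hull_minimal)
      have "1 \<le> k" if "coeff L i \<noteq> 0" "real (germ_ord (coeff L i)) \<le> k" for i k
        using that n by (metis One_nat_def Suc_leI gr0I of_nat_1 of_nat_le_iff order_trans)
      thus "{(real i, k) |i k. i \<le> degree L \<and> coeff L i \<noteq> 0 \<and> real (germ_ord (coeff L i)) \<le> k} \<subseteq> {p. (0, 1) \<bullet> p \<ge> (1 :: real)}"
        by auto
    qed (rule convex_halfspace_ge)
    thus False using u by auto
  qed
next
  assume "\<exists>i. coeff L i \<noteq> 0 \<and> germ_ord (coeff L i) = 0"
  thus "cleared L" unfolding cleared_def by (metis newton_polygon_point of_nat_0 order_refl)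
qed

text \<open>Follows from (x^(-m) \<sigma>)^i = q^(-m tri(i)) x^(-mi) \<sigma>^i, the origin of the
  powers in \<open>chi\<close>.\<close>

lemma slope_transform_lookup:
  fixes q :: "'a :: valued_field"
  assumes q0: "q \<noteq> 0"
  shows "lookup (slope_transform q m C L) k = (if 0 \<le> k then
     to_fract (coeff L (nat k)) * mconst (q powi (- m * tri (nat k))) * mero_X powi (C - m * k) else 0)"
proof -
  have p: "ore_power q (ore_mult q (ore_const (mero_X powi (- m))) ore_sigma) i =
     single (int i) (mconst (q powi (- m * tri i)) * mero_X powi (- m * int i))" for i
  proof (induction i)
    case (Suc i)
    have "ore_power q (ore_mult q (ore_const (mero_X powi (- m))) ore_sigma) (Suc i) =
       ore_mult q (single 1 (mero_X powi (- m))) (single (int i) (mconst (q powi (- m * tri i)) * mero_X powi (- m * int i)))"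
      using Suc q0 by (simp add: ore_power_def ore_const_def ore_sigma_def ore_mult_single)
    also have "\<dots> = single (int (Suc i)) (mero_X powi (- m) *
        (mconst (q powi (- m * tri i)) * (mconst q powi (- m * int i) * mero_X powi (- m * int i))))"
      using q0 by (simp add: ore_mult_single mero_dilate_mult mero_dilate_powi mero_dilate_X power_int_mult_distrib add.commute)
    also have "mero_X powi (- m) * (mconst (q powi (- m * tri i)) * (mconst q powi (- m * int i) * mero_X powi (- m * int i))) =
       mconst (q powi (- m * tri (Suc i))) * mero_X powi (- m * int (Suc i))"
    proof -
      have "- m * tri (Suc i) = - m * tri i + - m * int i" "- m * int (Suc i) = - m + - m * int i" by (simp_all add: algebra_simps)
      hence "q powi (- m * tri (Suc i)) = q powi (- m * tri i) * q powi (- m * int i)"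
        "(mero_X :: 'a mero) powi (- m * int (Suc i)) = mero_X powi (- m) * mero_X powi (- m * int i)"
        using q0 by (simp_all only: power_int_add mero_X_nonzero simp_thms)
      thus ?thesis by (simp only: mconst_mult mconst_powi mult_ac)
    qed
    finally show ?case .
  qed (simp add: ore_power_def ore_const_def)
  have "lookup (slope_transform q m C L) k = mero_X powi C * (\<Sum>i\<le>degree L. if int i = k then
     to_fract (coeff L i) * (mconst (q powi (- m * tri i)) * mero_X powi (- m * int i)) else 0)"
    using q0 by (simp add: slope_transform_def p lookup_sum lookup_single when_def) (auto intro!: sum.cong)
  also have "\<dots> = mero_X powi C * (\<Sum>i\<le>degree L. if i = nat k then (if 0 \<le> k then
     to_fract (coeff L i) * (mconst (q powi (- m * tri i)) * mero_X powi (- m * int i)) else 0) else 0)"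
    by (intro arg_cong2[of _ _ _ _ "(*)"] refl sum.cong) auto
  also have "\<dots> = (if 0 \<le> k then
     to_fract (coeff L (nat k)) * mconst (q powi (- m * tri (nat k))) * mero_X powi (C - m * k) else 0)"
    by (auto simp: coeff_eq_0 power_int_diff power_int_minus field_simps)
  finally show ?thesis .
qed

text \<open>After the transformation the supporting line of slope m is horizontal, and clearing
  moves it to height 0. The constant terms are then the coefficients on the edge, with the powers of
  q that \<open>chi\<close> contains.\<close>

lemma char_poly_chi:
  fixes q :: "'a :: valued_field"
  assumes q0: "q \<noteq> 0" and L: "L \<noteq> 0"
  shows "char_poly q m L = chi 1 m q (to_mero L)"
proof -
  define W where "W = wt 1 m (to_mero L)"
  have nth: "fls_nth (germ_fls (coeff L' i)) k = fls_nth (germ_fls (coeff L i)) (k - C + m * int i) * q powi (- m * tri i)"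
    if "to_ore L' = slope_transform q m C L" for L' C i k
  proof -
    have "to_fract (coeff L' i) = lookup (to_ore L') (int i)" by (simp add: to_ore_conv)
    also have "\<dots> = to_fract (coeff L i) * mconst (q powi (- m * tri i)) * mero_X powi (C - m * int i)"
      unfolding that slope_transform_lookup[OF q0] by simp
    finally have "fls_nth (mfls (to_fract (coeff L' i))) k = fls_nth (mfls (to_fract (coeff L i) * mconst (q powi (- m * tri i)))) (k - (C - m * int i))"
      by (simp only: mfls_X_powi)
    thus ?thesis by (simp add: algebra_simps)
  qed
  have low: "fls_nth (germ_fls (coeff L i)) k = 0" if "k < W + m * int i" for i k
    using emb_lower[where n = 1 and p = 1 and d = m and L = "to_mero L" and i = i and k = k] that by (simp add: W_def emb_nth)
  obtain j where j: "coeff L j \<noteq> 0" "W = int (germ_ord (coeff L j)) - m * int j"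
    using wt_attained[of "to_mero L" 1 m] L by (auto simp: W_def germ_fls_subdegree)
  have jn: "fls_nth (germ_fls (coeff L j)) (W + m * int j) \<noteq> 0"
    using j by (simp add: germ_fls_subdegree[symmetric])
  have X: "coeff (chi 1 m q (to_mero L)) i = fls_nth (germ_fls (coeff L i)) (W + m * int i) * q powi (- m * tri i)" for i
    unfolding coeff_chi[OF order_refl power_one_right q0] slope_coeff_0[OF order_refl power_one_right q0] by (simp add: emb_nth W_def)
  show ?thesis
    unfolding char_poly_def
  proof (rule the_equality)
    fix p assume "\<exists>C L'. to_ore L' = slope_transform q m C L \<and> cleared L' \<and> p = map_poly (\<lambda>a. germ_nth a 0) L'"
    then obtain C L' where *: "to_ore L' = slope_transform q m C L" "cleared L'" "p = map_poly (\<lambda>a. germ_nth a 0) L'" by blast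
    note n = nth[OF *(1)]
    obtain i where i: "coeff L' i \<noteq> 0" "germ_ord (coeff L' i) = 0" using *(2) cleared_iff by blast
    have "fls_nth (germ_fls (coeff L' i)) 0 \<noteq> 0" using i nth_fls_subdegree_nonzero[of "germ_fls (coeff L' i)"] by (simp add: germ_fls_subdegree)
    hence "\<not> - C < W" using low[of "- C + m * int i" i] by (auto simp: n)
    moreover have "\<not> W < - C"
    proof
      assume "W < - C"
      hence "fls_nth (germ_fls (coeff L' j)) (W + C) = 0" by (simp add: germ_fls_def)
      thus False using jn q0 by (simp add: n)
    qed
    \<comment> \<open>C is forced from both sides: L' has no negative powers of x, and being cleared
      it has a coefficient with nonzero constant term.\<close>
    ultimately have C: "C = - W" by simp
    show "p = chi 1 m q (to_mero L)"
    proof (rule poly_eqI)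
      fix i
      have "coeff p i = fls_nth (germ_fls (coeff L' i)) (int 0)"
        unfolding *(3) germ_fls_nth by (simp add: coeff_map_poly germ_nth.rep_eq zero_germ.rep_eq)
      thus "coeff p i = coeff (chi 1 m q (to_mero L)) i"
        unfolding X by (simp add: n C)
    qed
  next
    have "\<exists>g. to_fract (coeff L i) * mconst (q powi (- m * tri i)) * mero_X powi (- W - m * int i) = to_fract g" for i
    proof -
      have "fls_nth (mfls (to_fract (coeff L i) * mconst (q powi (- m * tri i)) * mero_X powi (- W - m * int i))) k = 0" if "k < 0" for k
        unfolding mfls_X_powi using that low[of "k + W + m * int i" i] by (simp add: algebra_simps)
      thus ?thesis using germ_of_mero by metis
    qed
    then obtain g where g: "\<And>i. to_fract (coeff L i) * mconst (q powi (- m * tri i)) * mero_X powi (- W - m * int i) = to_fract (g i)" by metis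
    define L' where "L' = poly_of_list (map g [0..<Suc (degree L)])"
    have g0: "g i = 0" if "\<not> i \<le> degree L" for i using g[of i] that by (simp add: coeff_eq_0)
    have cL: "coeff L' i = g i" for i
      by (cases "i \<le> degree L") (simp_all add: L'_def nth_default_nth nth_default_beyond g0 del: upt_Suc)
    have s: "to_ore L' = slope_transform q m (- W) L"
      by (rule poly_mapping_eqI) (auto simp: to_ore_conv slope_transform_lookup[OF q0] cL g[symmetric])
    note n = nth[OF s]
    have "fls_nth (germ_fls (coeff L' j)) (int 0) \<noteq> 0" using jn q0 by (simp add: n add.commute)
    hence "germ_nth (coeff L' j) 0 \<noteq> 0" unfolding germ_fls_nth .
    hence "coeff L' j \<noteq> 0 \<and> germ_ord (coeff L' j) = 0" by transfer (auto simp: subdegree_eq_0_iff)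
    hence "cleared L'" unfolding cleared_iff by blast
    moreover have "chi 1 m q (to_mero L) = map_poly (\<lambda>a. germ_nth a 0) L'"
    proof (rule poly_eqI)
      fix i
      have "coeff (map_poly (\<lambda>a. germ_nth a 0) L') i = fls_nth (germ_fls (coeff L' i)) (int 0)"
        unfolding germ_fls_nth by (simp add: coeff_map_poly germ_nth.rep_eq zero_germ.rep_eq)
      thus "coeff (chi 1 m q (to_mero L)) i = coeff (map_poly (\<lambda>a. germ_nth a 0) L') i"
        unfolding X by (simp add: n)
    qed
    ultimately show "\<exists>C L'. to_ore L' = slope_transform q m C L \<and> cleared L' \<and> chi 1 m q (to_mero L) = map_poly (\<lambda>a. germ_nth a 0) L'"
      using s by blast
  qed
qed

lemma fls_nth_germ: "fls_nth (germ_fls c) k = (if k < 0 then 0 else fps_nth (Rep_germ c) (nat k))"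
  by (simp add: germ_fls_def)

lemma mfls_ramify:
  assumes "N \<ge> 1" shows "mfls (to_fract (germ_ramify N c)) = emb N (to_fract c)"
proof (rule fls_eqI)
  fix k
  show "fls_nth (mfls (to_fract (germ_ramify N c))) k = fls_nth (emb N (to_fract c)) k"
  proof (cases "k < 0")
    case True
    have "k div int N < 0" by (rule div_neg_pos_less0[OF True]) (use assms in simp)
    thus ?thesis using assms True by (simp add: emb_nth fls_nth_germ)
  next
    case False
    then obtain m where "k = int m" by (metis nonneg_int_cases not_less)
    moreover have "int m div int N = int (m div N)" by (simp add: zdiv_int)
    ultimately show ?thesis using assms by (simp add: emb_nth fls_nth_germ germ_ramify.rep_eq)
  qed
qed

lemma germ_ramify_0 [simp]: "germ_ramify N 0 = 0"
  by transfer (simp add: fps_eq_iff)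

lemma coeff_ramify [simp]: "coeff (ramify N L) i = germ_ramify N (coeff L i)"
  by (simp add: ramify_def coeff_map_poly)

context
  fixes n e :: nat and d :: int and L :: "'a :: valued_field qop"
  assumes n: "n \<ge> 1" and e: "e \<ge> 1" and L: "L \<noteq> 0"
begin

lemma ramify_nth: "fls_nth (mfls (to_fract (coeff (ramify (n * e) L) i))) k =
    (if int e dvd k then fls_nth (emb n (to_fract (coeff L i))) (k div int e) else 0)"
proof -
  have "int (n * e) dvd k \<longleftrightarrow> int e dvd k \<and> int n dvd k div int e"
    using e by (auto simp: dvd_div_iff_mult mult.commute intro: dvd_mult_left)
  moreover have "n * e \<ge> 1" using n e by (metis nat_mult_1 mult_le_mono)
  moreover have "k div int (n * e) = k div int e div int n" by (simp add: zdiv_zmult2_eq mult.commute)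
  ultimately show ?thesis using n by (simp only: coeff_ramify mfls_ramify emb_nth) auto
qed

lemma ramify_nonzero: "ramify (n * e) L \<noteq> 0"
proof -
  obtain i where i: "coeff L i \<noteq> 0" using L by (auto simp: poly_eq_iff)
  have ne: "n * e \<ge> 1" using n e by (metis nat_mult_1 mult_le_mono)
  have "emb (n * e) (to_fract (coeff L i)) \<noteq> 0"
  proof
    assume z: "emb (n * e) (to_fract (coeff L i)) = 0"
    have "fls_nth (mfls (to_fract (coeff L i))) k = fls_nth (emb (n * e) (to_fract (coeff L i))) (int (n * e) * k)" for k
      using n e by (simp add: emb_nth[OF ne])
    hence "mfls (to_fract (coeff L i)) = 0" unfolding z by (intro fls_eqI) simp
    thus False using i by simp
  qed
  hence "coeff (ramify (n * e) L) i \<noteq> 0" using mfls_ramify[OF ne, of "coeff L i"] by auto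
  thus ?thesis by (metis coeff_0)
qed

text \<open>Substituting t^(ne) for x multiplies all orders by ne, so the slope d/n becomes the
  integer de and its edge has the same leading coefficients; p^e is the n-th root of q that
  matches.\<close>

lemma chi_ramify:
  assumes p: "p \<noteq> 0"
  shows "chi 1 (d * int e) p (to_mero (ramify (n * e) L)) = chi n d (p ^ e) (to_mero L)"
proof -
  let ?R = "to_mero (ramify (n * e) L)"
  define W where "W = wt 1 (d * int e) ?R"
  define V where "V = wt n d (to_mero L)"
  define r where "r = (\<lambda>i k. fls_nth (mfls (to_fract (coeff (ramify (n * e) L) i))) k)"
  define s where "s = (\<lambda>i k. fls_nth (emb n (to_fract (coeff L i))) k)"
  have rs: "r i k = (if int e dvd k then s i (k div int e) else 0)" for i k unfolding r_def s_def by (rule ramify_nth)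
  have rl: "r i k = 0" if "k < W + d * int e * int i" for i k
    using emb_lower[of 1 1 1 k "d * int e" ?R i] that by (simp add: W_def r_def emb_nth)
  have sl: "s i k = 0" if "k < V + d * int i" for i k
    using emb_lower[OF n refl one_neq_zero, of k d "to_mero L" i] that by (simp add: V_def s_def)
  obtain i where i: "r i (W + d * int e * int i) \<noteq> 0"
    using wt_attained[of ?R 1 "d * int e"] ramify_nonzero
    by (metis (no_types, opaque_lifting) W_def coeff_to_mero diff_add_cancel mfls_eq_0_iff mult_1 nth_fls_subdegree_nonzero of_nat_1 r_def to_mero_eq_0_iff)
  obtain j where j: "s j (V + d * int j) \<noteq> 0"
  proof -
    obtain j where j: "coeff (to_mero L) j \<noteq> 0" "V = int n * fls_subdegree (mfls (coeff (to_mero L) j)) - d * int j"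
      using wt_attained[of "to_mero L" n d] L by (auto simp: V_def)
    hence "s j (V + d * int j) \<noteq> 0" using n by (simp add: s_def emb_nth)
    thus ?thesis by (rule that)
  qed
  have "\<not> V * int e < W"
  proof
    assume "V * int e < W"
    hence "r j ((V + d * int j) * int e) = 0" by (intro rl) (simp add: algebra_simps)
    thus False using j e by (simp add: rs)
  qed
  moreover have "\<not> W < V * int e"
  proof
    assume h: "W < V * int e"
    have dv: "int e dvd W + d * int e * int i" and "s i ((W + d * int e * int i) div int e) \<noteq> 0" using i by (auto simp: rs split: if_splits)
    hence "\<not> (W + d * int e * int i) div int e < V + d * int i" using sl by blast
    moreover obtain t where t: "W + d * int e * int i = int e * t" using dv by blast
    ultimately have "V + d * int i \<le> t" using e by simp
    hence "int e * (V + d * int i) \<le> int e * t" using e by (intro mult_left_mono) auto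
    thus False using h t by (simp add: algebra_simps)
  qed
  ultimately have WV: "W = V * int e" by simp
  have pe: "p ^ e \<noteq> 0" using p by simp
  show ?thesis
  proof (rule poly_eqI)
    fix i
    have eq: "W + d * int e * int i = int e * (V + d * int i)" by (simp add: WV algebra_simps)
    have "coeff (chi 1 (d * int e) p ?R) i = r i (W + d * int e * int i) * p powi (- (d * int e) * tri i)"
      unfolding coeff_chi[OF order_refl power_one_right p] slope_coeff_0[OF order_refl power_one_right p] by (simp add: emb_nth W_def r_def)
    also have "\<dots> = s i (V + d * int i) * (p ^ e) powi (- d * tri i)"
      unfolding eq using e p by (simp add: rs power_int_mult[symmetric] mult_ac flip: power_int_of_nat)
    also have "\<dots> = coeff (chi n d (p ^ e) (to_mero L)) i"
      unfolding coeff_chi[OF n refl pe] slope_coeff_0[OF n refl pe] by (simp add: V_def s_def)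
    finally show "coeff (chi 1 (d * int e) p ?R) i = coeff (chi n d (p ^ e) (to_mero L)) i" .
  qed
qed

end

definition nz_roots :: "'a :: idom poly \<Rightarrow> 'a set" where
  "nz_roots f = {z. z \<noteq> 0 \<and> poly f z = 0}"

lemma finite_nz_roots: "f \<noteq> 0 \<Longrightarrow> finite (nz_roots f)"
  unfolding nz_roots_def by (rule finite_subset[OF _ poly_roots_finite[of f]]) auto

lemma absv_prod: "absv (prod f B :: 'a :: valued_field) = (\<Prod>x\<in>B. absv (f x))"
  by (induction B rule: infinite_finite_induct) (auto simp: absv_mult)

context
  fixes q :: "'a :: base_field" assumes q: "absv q = 1"
begin

lemma q_nonzero: "q \<noteq> 0" using q by auto

text \<open>The coefficients are inverses of products over \<Lambda> of products of divisors. Each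
  factor is bounded above by a geometric sequence, so a lower bound for the whole product is
  equivalent to lower bounds for every factor.\<close>

lemma convergent_phi_iff:
  assumes fin: "finite \<Lambda>" and \<Lambda>: "\<And>z k. z \<in> \<Lambda> \<Longrightarrow> q ^ k * z \<noteq> 1"
  shows "convergent_coeffs (phi_coeff q \<Lambda>) \<longleftrightarrow> (\<forall>z\<in>\<Lambda>. tame q z)"
proof -
  have ph: "absv (phi_coeff q \<Lambda> N) = inverse (\<Prod>z\<in>\<Lambda>. \<Prod>k<N. divisor q z k)" for N
  proof -
    have "absv (\<Prod>z\<in>\<Lambda>. qpoch z q N) = (\<Prod>z\<in>\<Lambda>. \<Prod>k<N. absv (1 - q ^ k * z))" by (simp add: qpoch_def absv_prod)
    also have "\<dots> = (\<Prod>z\<in>\<Lambda>. \<Prod>k<N. divisor q z k)" using \<Lambda> by (intro prod.cong) (auto simp: divisor_def)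
    finally show ?thesis by (simp add: phi_coeff_def absv_inverse flip: inverse_eq_divide)
  qed
  show ?thesis
  proof
    assume "convergent_coeffs (phi_coeff q \<Lambda>)"
    then obtain A B where AB: "A > 0" "B \<ge> 1" "\<And>n. absv (phi_coeff q \<Lambda> n) \<le> A * B ^ n" by (rule convergent_coeffsE) blast
    show "\<forall>z\<in>\<Lambda>. tame q z"
    proof
      fix z assume z: "z \<in> \<Lambda>"
      define G where "G = (\<Prod>w\<in>\<Lambda> - {z}. 1 + absv w)"
      have G: "G \<ge> 1" unfolding G_def by (intro prod_ge_1) (simp add: absv_nonneg)
      \<comment> \<open>G bounds the remaining factors at each step, and max A 1 absorbs the
        constant A as soon as N \<ge> 1.\<close>
      define c where "c = 1 / (max A 1 * B * G)"
      have mB: "max A 1 * B \<ge> 1" using AB(2) mult_mono[of 1 "max A 1" 1 B] by simp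
      have c: "c > 0" using AB G by (simp add: c_def)
      have "c ^ N \<le> (\<Prod>k<N. divisor q z k)" for N
      proof (cases N)
        case (Suc M)
        define D where "D = (\<Prod>k<N. divisor q z k)"
        have D: "D > 0" unfolding D_def by (intro prod_pos) simp
        have "(\<Prod>w\<in>\<Lambda> - {z}. \<Prod>k<N. divisor q w k) \<le> (\<Prod>w\<in>\<Lambda> - {z}. \<Prod>k<N. 1 + absv w)"
          by (intro prod_mono conjI prod_nonneg) (auto simp: less_imp_le divisor_le[OF q] absv_nonneg)
        also have "\<dots> = G ^ N" by (simp add: G_def prod_power_distrib)
        finally have E: "(\<Prod>w\<in>\<Lambda>. \<Prod>k<N. divisor q w k) \<le> D * G ^ N"
          unfolding prod.remove[OF fin z] D_def[symmetric] using D by (intro mult_left_mono) auto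
        have pos: "(\<Prod>w\<in>\<Lambda>. \<Prod>k<N. divisor q w k) > 0" by (intro prod_pos) simp
        have "1 \<le> (A * B ^ N) * (\<Prod>w\<in>\<Lambda>. \<Prod>k<N. divisor q w k)"
          using AB(3)[of N] pos unfolding ph by (simp add: field_simps)
        also have "\<dots> \<le> (max A 1 ^ N * B ^ N) * (D * G ^ N)"
        proof (intro mult_mono E)
          have "max A 1 \<le> max A 1 ^ N" using Suc by (intro self_le_power) auto
          thus "A \<le> max A 1 ^ N" by simp
        qed (use AB pos in \<open>auto simp: less_imp_le\<close>)
        also have "\<dots> = D * (max A 1 * B * G) ^ N" by (simp add: power_mult_distrib)
        finally have "1 \<le> D * (max A 1 * B * G) ^ N" .
        moreover have "(max A 1 * B * G) ^ N > 0" using AB(2) G by (intro zero_less_power mult_pos_pos) auto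
        ultimately show ?thesis unfolding c_def D_def[symmetric] power_one_over by (simp only: pos_divide_le_eq inverse_eq_divide)
      qed simp
      thus "tame q z" unfolding tame_def using c by blast
    qed
  next
    assume "\<forall>z\<in>\<Lambda>. tame q z"
    hence "\<forall>z\<in>\<Lambda>. \<exists>c>0. \<forall>N. c ^ N \<le> (\<Prod>k<N. divisor q z k)" by (simp add: tame_def)
    then obtain c where c: "\<And>z. z \<in> \<Lambda> \<Longrightarrow> c z > 0" "\<And>z N. z \<in> \<Lambda> \<Longrightarrow> c z ^ N \<le> (\<Prod>k<N. divisor q z k)" by metis
    define C where "C = (\<Prod>z\<in>\<Lambda>. c z)"
    have C: "C > 0" unfolding C_def using c by (intro prod_pos) auto
    show "convergent_coeffs (phi_coeff q \<Lambda>)"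
    proof (rule convergent_coeffsI)
      show "inverse C > 0" using C by simp
      fix N
      have "C ^ N \<le> (\<Prod>z\<in>\<Lambda>. \<Prod>k<N. divisor q z k)"
        unfolding C_def prod_power_distrib using c by (intro prod_mono) (auto simp: less_imp_le)
      hence "inverse (\<Prod>z\<in>\<Lambda>. \<Prod>k<N. divisor q z k) \<le> inverse (C ^ N)" using C by (intro le_imp_inverse_le) auto
      thus "absv (phi_coeff q \<Lambda> N) \<le> 1 * inverse C ^ N" unfolding ph by (simp add: power_inverse)
    qed
  qed
qed

text \<open>The standing assumption is the case \<rho> = q, shifted by one power of q to \<rho> =
  1.\<close>

lemma tame_one_iff:
  assumes "non_root_of_unity q"
  shows "convergent_coeffs (\<lambda>n. 1 / qpoch q q n) \<longleftrightarrow> tame q 1"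
proof -
  have "q ^ k * q \<noteq> 1" for k using assms unfolding non_root_of_unity_def by (metis One_nat_def Suc_le_mono le0 power_Suc2)
  moreover have "phi_coeff q {q} = (\<lambda>n. 1 / qpoch q q n)" by (simp add: phi_coeff_def fun_eq_iff)
  ultimately show ?thesis using convergent_phi_iff[of "{q}"] tame_shift[OF q, of 1 1] by simp
qed

text \<open>1 - q^k is 1 - p^k times a sum of N terms of norm 1, so the divisors for the root p are
  at most a factor N smaller than those for q.\<close>

lemma tame_one_root:
  assumes p: "p ^ N = q" "N \<ge> 1" "absv p = 1" "non_root_of_unity p" and t: "tame q 1"
  shows "tame p 1"
proof -
  obtain c where c: "c > 0" "\<And>M. c ^ M \<le> (\<Prod>k<M. divisor q 1 k)" using t by (auto simp: tame_def)
  have le: "divisor q 1 k \<le> real N * divisor p 1 k" for k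
  proof (cases "k = 0")
    case False
    hence nz: "p ^ k \<noteq> 1" "q ^ k \<noteq> 1" using p non_root_of_unity_power[OF p(4,2)] by (auto simp: non_root_of_unity_def)
    have "q ^ k = (p ^ k) ^ N" unfolding p(1)[symmetric] by (simp add: mult.commute flip: power_mult)
    hence "1 - q ^ k = (1 - p ^ k) * (\<Sum>j<N. (p ^ k) ^ j)" by (simp only: one_diff_power_eq)
    hence "absv (1 - q ^ k) = absv (1 - p ^ k) * absv (\<Sum>j<N. (p ^ k) ^ j)" by (simp add: absv_mult)
    also have "\<dots> \<le> absv (1 - p ^ k) * real N"
      using absv_sum_le[of "\<lambda>j. (p ^ k) ^ j" "{..<N}"] p(3) by (intro mult_left_mono) (auto simp: absv_power absv_nonneg)
    finally show ?thesis using nz by (simp add: divisor_def mult.commute)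
  qed (use p(2) in \<open>simp add: divisor_def\<close>)
  have "(c / real N) ^ M \<le> (\<Prod>k<M. divisor p 1 k)" for M
  proof -
    have "c ^ M \<le> (\<Prod>k<M. real N * divisor p 1 k)"
      by (rule order_trans[OF c(2)], rule prod_mono) (auto intro: le simp: less_imp_le)
    thus ?thesis using p(2) by (simp add: prod.distrib power_divide field_simps)
  qed
  thus ?thesis unfolding tame_def using c(1) p(2) by (intro exI[of _ "c / real N"]) auto
qed

text \<open>1 - q^k \<rho>^n is, up to sign, the value of X^n - 1 at \<rho> p^k, and splits into
  factors governed by the ratios \<rho>/\<omega> with \<omega>^n = 1. If \<rho>^n is resonant, the
  claim reduces to tameness of 1.\<close>

lemma tame_nth_power:
  assumes p: "p ^ n = q" "n \<ge> 1" "absv p = 1" "non_root_of_unity p" and \<rho>: "\<rho> \<noteq> 0"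
    and t: "\<And>\<omega>. \<omega> ^ n = 1 \<Longrightarrow> tame p (\<rho> / \<omega>)"
  shows "tame q (\<rho> ^ n)"
proof (cases "\<exists>k. q ^ k * \<rho> ^ n = 1")
  case True
  then obtain k where k: "q ^ k * \<rho> ^ n = 1" ..
  have "(p ^ k * \<rho>) ^ n = 1" using k unfolding p(1)[symmetric] by (simp add: power_mult_distrib mult.commute flip: power_mult)
  hence "tame p (p powi - int k)" using t[of "p ^ k * \<rho>"] \<rho> by (simp add: power_int_minus inverse_eq_divide)
  hence "tame p 1" using tame_shift[OF p(3), of "- int k" 1] by simp
  hence "tame q 1" using tame_subsequence[OF p(3) _ p(2)] p(1) by blast
  moreover have "\<rho> ^ n = q powi (- int k) * 1" using k q_nonzero by (simp add: power_int_minus field_simps)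
  ultimately show ?thesis using tame_shift[OF q] by metis
next
  case False
  define X where "X = monom 1 n - (1 :: 'a poly)"
  have pX: "poly X z = z ^ n - 1" for z by (simp add: X_def poly_monom)
  have "poly X 0 = - 1" using p(2) by (simp add: pX power_0_left)
  hence X0: "X \<noteq> 0" by auto
  have Xk: "poly X (\<rho> * p ^ k) = q ^ k * \<rho> ^ n - 1" for k
    unfolding pX p(1)[symmetric] by (simp add: power_mult_distrib mult.commute flip: power_mult)
  obtain \<delta> where \<delta>: "geometric \<delta>" "\<And>k. k \<ge> 1 \<Longrightarrow> \<delta> k = absv (poly X (\<rho> * p ^ k))"
  proof (rule geometric_poly[OF X0 \<rho> p(3)])
    show "poly X (\<rho> * p ^ k) \<noteq> 0" for k using False unfolding Xk by auto
    show "tame p (\<rho> / w)" if "poly X w = 0" for w using t[of w] that by (simp add: pX)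
  qed blast
  have pos: "\<delta> k > 0" for k using \<delta>(1) by (simp add: geometric_def)
  \<comment> \<open>Only the index 0 needs adjusting, since there \<delta> is not known to be the
    value of the polynomial.\<close>
  define c where "c = min 1 (divisor q (\<rho> ^ n) 0 / \<delta> 0)"
  have c: "c > 0" using pos[of 0] by (simp add: c_def)
  have "geometric (\<lambda>k. c * \<delta> k)" using c \<delta>(1) by (intro geometric_mult geometric_const)
  then obtain b where b: "b > 0" "\<And>N. b ^ N \<le> (\<Prod>k<N. c * \<delta> k)" by (auto simp: geometric_def)
  have "c * \<delta> k \<le> divisor q (\<rho> ^ n) k" for k
  proof (cases "k = 0")
    case True
    thus ?thesis using pos[of 0] by (simp add: c_def min_def field_simps)
  next
    case k: False
    have "divisor q (\<rho> ^ n) k = absv (- (q ^ k * \<rho> ^ n - 1))" using False by (simp add: divisor_def)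
    hence "divisor q (\<rho> ^ n) k = \<delta> k" unfolding absv_uminus using \<delta>(2)[of k] k by (simp add: Xk)
    thus ?thesis using pos[of k] by (simp add: c_def mult_le_cancel_right1)
  qed
  hence "(\<Prod>k<N. c * \<delta> k) \<le> (\<Prod>k<N. divisor q (\<rho> ^ n) k)" for N
    using c pos by (intro prod_mono) (auto simp: less_imp_le)
  hence "b ^ N \<le> (\<Prod>k<N. divisor q (\<rho> ^ n) k)" for N using b(2) order_trans by blast
  thus ?thesis unfolding tame_def using b(1) by blast
qed

end

text \<open>The exponents occurring in \<open>chi\<close> are congruent modulo n, so its nonzero
  roots are permuted by the n-th roots of unity. This supplies all the ratios that
  \<open>tame_nth_power\<close> asks for.\<close>

lemma chi_root_rotate:
  fixes L :: "'a :: base_field mero poly"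
  assumes nd: "(n, d) \<in> slopes" and p: "p \<noteq> 0" and \<omega>: "\<omega> ^ n = 1" and z: "z \<in> nz_roots (chi n d p L)"
  shows "\<omega> * z \<in> nz_roots (chi n d p L)"
proof -
  let ?X = "chi n d p L"
  have n: "n \<ge> 1" "coprime (int n) d" using nd by (auto simp: slopes_def)
  have \<omega>0: "\<omega> \<noteq> 0" using \<omega> n by (auto simp: power_0_left)
  show ?thesis
  proof (cases "?X = 0")
    case False
    define i0 where "i0 = order 0 ?X"
    have i0: "coeff ?X i0 \<noteq> 0" "\<And>i. coeff ?X i \<noteq> 0 \<Longrightarrow> i0 \<le> i"
      using coeff_order_0[OF False] by (auto simp: i0_def not_less[symmetric])
    have cf: "coeff ?X i * \<omega> ^ i = \<omega> ^ i0 * coeff ?X i" for i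
    proof (cases "coeff ?X i = 0")
      case False
      have "int n dvd int i - int i0" by (rule chi_support_dvd[OF n p False i0(1)])
      hence "int n dvd int (i - i0)" using i0(2)[OF False] by (simp add: of_nat_diff)
      hence "n dvd i - i0" by (simp only: int_dvd_int_iff)
      then obtain t where t: "i - i0 = n * t" by (auto simp: dvd_def)
      hence "i = i0 + n * t" using i0(2)[OF False] by simp
      thus ?thesis by (simp add: power_add power_mult \<omega>)
    qed simp
    have "poly ?X (\<omega> * z) = \<omega> ^ i0 * poly ?X z"
      unfolding poly_altdef sum_distrib_left power_mult_distrib mult.assoc[symmetric] cf by (rule refl)
    thus ?thesis using z \<omega>0 by (simp add: nz_roots_def)
  qed (use z \<omega>0 in \<open>simp add: nz_roots_def\<close>)
qed

definition tame_roots :: "'a :: base_field \<Rightarrow> 'a poly \<Rightarrow> bool" where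
  "tame_roots p f \<longleftrightarrow> (\<forall>y\<in>nz_roots f. \<forall>z\<in>nz_roots f. tame p (y / z))"

text \<open>Almost admissibility for operators with coefficients in \<open>K\<close>, quantified
  over all pairs (n, d): if d/n is not a slope there are no nonzero roots and the condition is
  empty. In this form it is inherited by factors (\<open>aadm_skew_mult\<close>).\<close>

definition aadm :: "(nat \<Rightarrow> 'a :: base_field) \<Rightarrow> 'a mero poly \<Rightarrow> bool" where
  "aadm qr L \<longleftrightarrow> (\<forall>(n, d) \<in> slopes. \<exists>e\<ge>1. tame_roots (qr (n * e)) (chi n d (qr (n * e) ^ e) L))"

locale base_roots =
  fixes q :: "'a :: base_field" and qr :: "nat \<Rightarrow> 'a"
  assumes q1: "absv q = 1" and qn: "non_root_of_unity q"
    and qr: "\<And>n. n \<ge> 1 \<Longrightarrow> qr n ^ n = q" and tame_one: "tame q 1"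
begin

lemma qr_props:
  assumes "N \<ge> 1" shows "absv (qr N) = 1" "non_root_of_unity (qr N)" "qr N \<noteq> 0" "tame (qr N) 1"
proof -
  have "absv (qr N) ^ N = 1" using qr[OF assms] q1 by (metis absv_power)
  thus a: "absv (qr N) = 1" using assms absv_nonneg[of "qr N"] power_eq_imp_eq_base[of "absv (qr N)" N 1] by simp
  show b: "non_root_of_unity (qr N)" using non_root_of_unity_root[of "qr N" N] qr[OF assms] qn assms by simp
  thus "qr N \<noteq> 0" by (rule non_root_of_unityD)
  show "tame (qr N) 1" by (rule tame_one_root[OF q1 qr[OF assms] assms a b tame_one])
qed

lemma root_power: "n \<ge> 1 \<Longrightarrow> e \<ge> 1 \<Longrightarrow> (qr (n * e) ^ e) ^ n = q"
  using qr[of "n * e"] by (simp add: mult.commute flip: power_mult)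

lemma aadm_skew_mult:
  assumes a: "aadm qr (skew_mult q P R)" and P: "P \<noteq> 0" and R: "R \<noteq> 0"
  shows "aadm qr P" "aadm qr R"
proof -
  have "\<exists>e\<ge>1. tame_roots (qr (n * e)) (chi n d (qr (n * e) ^ e) X)"
    if nd: "(n, d) \<in> slopes" and X: "X = P \<or> X = R" for n d X
  proof -
    have n: "n \<ge> 1" using nd by (simp add: slopes_def)
    obtain e where e: "e \<ge> 1" and t: "tame_roots (qr (n * e)) (chi n d (qr (n * e) ^ e) (skew_mult q P R))"
      using a nd unfolding aadm_def by blast
    have ne: "n * e \<ge> 1" using n e by (metis nat_mult_1 mult_le_mono)
    define p where "p = qr (n * e) ^ e"
    have p: "p ^ n = q" "p \<noteq> 0" "non_root_of_unity p"
      unfolding p_def using root_power[OF n e] qr_props[OF ne] non_root_of_unity_power e by auto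
    obtain m where m: "\<And>z. poly (chi n d p X) z = 0 \<Longrightarrow> poly (chi n d p (skew_mult q P R)) (z * p powi (- m)) = 0"
      using chi_root_transfer[OF n p P R X] by blast
    have "tame (qr (n * e)) (y / z)" if yz: "y \<in> nz_roots (chi n d p X)" "z \<in> nz_roots (chi n d p X)" for y z
    proof -
      have "x * p powi (- m) \<in> nz_roots (chi n d p (skew_mult q P R))" if "x \<in> nz_roots (chi n d p X)" for x
        using that m p(2) by (simp add: nz_roots_def)
      hence "tame (qr (n * e)) ((y * p powi (- m)) / (z * p powi (- m)))" using t yz unfolding p_def tame_roots_def by blast
      thus ?thesis using p(2) by simp
    qed
    thus ?thesis using e unfolding p_def tame_roots_def by blast
  qed
  thus "aadm qr P" "aadm qr R" unfolding aadm_def by blast+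
qed

lemma no_slope_no_roots:
  assumes "L \<noteq> 0" "n \<ge> 1" "p \<noteq> 0" "nwidth n d L = 0" shows "nz_roots (chi n d p L) = {}"
proof -
  let ?X = "chi n d p L"
  have X: "?X \<noteq> 0" by (rule chi_nonzero[OF assms(2) refl assms(3) assms(1)])
  have w: "degree ?X = order 0 ?X" using width_chi[OF assms(2,3), of d L] assms(4) coeff_order_0(3)[OF X] by (simp add: width_def)
  have "coeff ?X i = coeff (monom (lead_coeff ?X) (degree ?X)) i" for i
    using coeff_order_0(2)[OF X, of i] w by (cases i "degree ?X" rule: linorder_cases) (auto simp: coeff_eq_0)
  hence "?X = monom (lead_coeff ?X) (degree ?X)" by (rule poly_eqI)
  hence "poly ?X z = lead_coeff ?X * z ^ degree ?X" for z by (metis poly_monom)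
  thus ?thesis using X by (auto simp: nz_roots_def)
qed

text \<open>A ramification that makes the slope d/n integral has index ne, and
  \<open>chi_ramify\<close> computes the exponents there as roots of \<open>chi\<close>. Convergence
  of \<phi> then means tameness of the ratios.\<close>

lemma almost_admissible_op_iff:
  fixes L :: "'a qop"
  assumes L: "L \<noteq> 0"
  shows "almost_admissible_op qr L \<longleftrightarrow> aadm qr (to_mero L)"
proof -
  let ?C = "\<lambda>n d e. tame_roots (qr (n * e)) (chi n d (qr (n * e) ^ e) (to_mero L))"
  have adm: "admissible_slope (qr (n * e)) (ramify (n * e) L) (d * int e) \<longleftrightarrow> nwidth n d (to_mero L) > 0 \<and> ?C n d e"
    if nd: "(n, d) \<in> slopes" and e: "e \<ge> 1" for n d e
  proof -
    have n: "n \<ge> 1" using nd by (simp add: slopes_def)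
    have ne: "n * e \<ge> 1" using n e by (metis nat_mult_1 mult_le_mono)
    define p where "p = qr (n * e)"
    note pp = qr_props[OF ne, folded p_def]
    define Z where "Z = nz_roots (chi n d (p ^ e) (to_mero L))"
    have R0: "ramify (n * e) L \<noteq> 0" by (rule ramify_nonzero[OF n e L])
    have X0: "chi n d (p ^ e) (to_mero L) \<noteq> 0" using chi_nonzero[OF n refl, of "p ^ e" "to_mero L" d] pp L by simp
    have "(1, d * int e) \<in> slopes" by (simp add: slopes_def)
    from newton_slopes_iff[OF this, of _ "ramify (n * e) L"]
    have s: "of_int (d * int e) \<in> fst ` newton_slopes (ramify (n * e) L) \<longleftrightarrow> nwidth 1 (d * int e) (to_mero (ramify (n * e) L)) > 0"
      by force
    have w: "nwidth 1 (d * int e) (to_mero (ramify (n * e) L)) = nwidth n d (to_mero L)"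
      unfolding nwidth_def using chi_ramify[OF n e L one_neq_zero, of d] by simp
    have ex: "z \<in># exponents p (d * int e) (ramify (n * e) L) \<longleftrightarrow> z \<in> Z" for z
      unfolding exponents_def char_poly_chi[OF pp(3) R0] p_def[symmetric] chi_ramify[OF n e L pp(3)]
      using X0 by (auto simp: Z_def nz_roots_def)
    define \<Lambda> where "\<Lambda> = exponent_ratios p (exponents p (d * int e) (ramify (n * e) L))"
    have \<Lambda>: "\<Lambda> = {y * inverse z | y z. y \<in> Z \<and> z \<in> Z \<and> y * inverse z \<notin> {p powi k | k. k \<le> 0}}"
      by (simp add: \<Lambda>_def exponent_ratios_def ex)
    have "finite Z" unfolding Z_def using X0 by (rule finite_nz_roots)
    hence "finite ((\<lambda>(y, z). y * inverse z) ` (Z \<times> Z))" by simp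
    hence fin: "finite \<Lambda>" by (rule finite_subset[rotated]) (auto simp: \<Lambda>)
    have ne1: "p ^ k * z \<noteq> 1" if "z \<in> \<Lambda>" for z k
    proof
      assume h: "p ^ k * z = 1"
      have "z = p powi (- int k)" using h pp(3) by (simp add: power_int_minus field_simps)
      hence "z \<in> {p powi k | k. k \<le> 0}" by (auto intro!: exI[of _ "- int k"])
      thus False using that unfolding \<Lambda> by (auto simp del: power_int_of_nat)
    qed
    have cv: "convergent_coeffs (phi_coeff p \<Lambda>) \<longleftrightarrow> (\<forall>z\<in>\<Lambda>. tame p z)"
      by (rule convergent_phi_iff[OF pp(1) fin]) (rule ne1)
    have "(\<forall>z\<in>\<Lambda>. tame p z) \<longleftrightarrow> (\<forall>y\<in>Z. \<forall>z\<in>Z. tame p (y / z))"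
    proof
      assume h: "\<forall>z\<in>\<Lambda>. tame p z"
      show "\<forall>y\<in>Z. \<forall>z\<in>Z. tame p (y / z)"
      proof (intro ballI)
        fix y z assume yz: "y \<in> Z" "z \<in> Z"
        \<comment> \<open>Ratios that are powers of p with exponent \<le> 0 are left out of
          \<Lambda>; they are tame because 1 is, which is inherited from the standing
          assumption.\<close>
        show "tame p (y / z)"
        proof (cases "y * inverse z \<in> {p powi k | k. k \<le> 0}")
          case True
          then obtain k where "y / z = p powi k * 1" by (auto simp: divide_inverse)
          thus ?thesis using tame_shift[OF pp(1), of k 1] pp(4) by simp
        qed (use h yz in \<open>auto simp: \<Lambda> divide_inverse\<close>)
      qed
    qed (auto simp: \<Lambda> divide_inverse)
    thus ?thesis unfolding admissible_slope_def p_def[symmetric] \<Lambda>_def[symmetric] cv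
      using s w by (simp add: Z_def tame_roots_def)
  qed
  have sl: "almost_admissible_slope qr L (real_of_int d / real n) \<longleftrightarrow> nwidth n d (to_mero L) > 0 \<and> (\<exists>e\<ge>1. ?C n d e)"
    if nd: "(n, d) \<in> slopes" for n d
  proof -
    have n: "n \<ge> 1" "coprime (int n) d" using nd by (auto simp: slopes_def)
    have "almost_admissible_slope qr L (real_of_int d / real n) \<longleftrightarrow>
        (\<exists>e\<ge>1. admissible_slope (qr (n * e)) (ramify (n * e) L) (d * int e))"
    proof
      assume "almost_admissible_slope qr L (real_of_int d / real n)"
      then obtain N m where N: "N \<ge> 1" "real N * (real_of_int d / real n) = real_of_int m" "admissible_slope (qr N) (ramify N L) m"
        by (auto simp: almost_admissible_slope_def)
      have "real_of_int (int N * d) = real_of_int (m * int n)" using N(2) n by (simp add: field_simps)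
      hence e1: "int N * d = m * int n" by linarith
      hence "int n dvd int N * d" by simp
      hence "int n dvd int N" using n(2) by (simp add: coprime_dvd_mult_left_iff)
      hence "n dvd N" by (simp only: int_dvd_int_iff)
      then obtain e where e: "N = n * e" by (auto simp: dvd_def)
      have "e \<ge> 1" using e N(1) by (cases e) auto
      moreover have "m = d * int e" using e1 e n by (simp add: mult.commute)
      ultimately show "\<exists>e\<ge>1. admissible_slope (qr (n * e)) (ramify (n * e) L) (d * int e)" using N(3) e by blast
    next
      assume "\<exists>e\<ge>1. admissible_slope (qr (n * e)) (ramify (n * e) L) (d * int e)"
      then obtain e where e: "e \<ge> 1" "admissible_slope (qr (n * e)) (ramify (n * e) L) (d * int e)" by blast
      have "n * e \<ge> 1" using n e by (metis nat_mult_1 mult_le_mono)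
      moreover have "real (n * e) * (real_of_int d / real n) = real_of_int (d * int e)" using n by simp
      ultimately show "almost_admissible_slope qr L (real_of_int d / real n)" unfolding almost_admissible_slope_def using e(2) by blast
    qed
    thus ?thesis using adm[OF nd] by blast
  qed
  show ?thesis
  proof
    assume a: "almost_admissible_op qr L"
    have "\<exists>e\<ge>1. ?C n d e" if nd: "(n, d) \<in> slopes" for n d
    proof (cases "nwidth n d (to_mero L) = 0")
      case True
      have n: "n \<ge> 1" using nd by (simp add: slopes_def)
      have "nz_roots (chi n d (qr (n * 1) ^ 1) (to_mero L)) = {}"
        using no_slope_no_roots[OF _ n _ True] qr_props(3)[OF n] L by simp
      thus ?thesis by (intro exI[of _ 1]) (simp add: tame_roots_def)
    next
      case False
      hence "(real_of_int d / real n, real (nwidth n d (to_mero L))) \<in> newton_slopes L" unfolding newton_slopes_iff[OF nd] by simp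
      hence "almost_admissible_slope qr L (real_of_int d / real n)" using a unfolding almost_admissible_op_def by force
      thus ?thesis using sl[OF nd] by blast
    qed
    thus "aadm qr (to_mero L)" unfolding aadm_def by blast
  next
    assume a: "aadm qr (to_mero L)"
    show "almost_admissible_op qr L"
      unfolding almost_admissible_op_def
    proof
      fix \<mu> assume "\<mu> \<in> fst ` newton_slopes L"
      then obtain r where r: "(\<mu>, r) \<in> newton_slopes L" by auto
      obtain n d where nd: "(n, d) \<in> slopes" "\<mu> = real_of_int d / real n" using newton_slopes_rational[OF r] by blast
      have "\<exists>e\<ge>1. ?C n d e" using a nd(1) unfolding aadm_def by blast
      moreover have "nwidth n d (to_mero L) > 0" using r newton_slopes_iff[OF nd(1), of r L] nd(2) by auto
      ultimately show "almost_admissible_slope qr L \<mu>" unfolding nd(2) sl[OF nd(1)] by blast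
    qed
  qed
qed

text \<open>The eigenvalues are the numbers z^n p^(-d tri(n)) times powers of q, for the roots z of
  \<open>chi\<close>. Their ratios are n-th powers of ratios of roots, up to powers of q, hence tame
  by \<open>tame_nth_power\<close> and \<open>chi_root_rotate\<close>.\<close>

lemma exponent_system_exists:
  assumes a: "aadm qr L" and L: "L \<noteq> 0"
  obtains A where "exponent_system q A" "exponent_system.controls q A L"
proof -
  have "\<forall>nd\<in>slopes. \<exists>p. p ^ fst nd = q \<and> absv p = 1 \<and> non_root_of_unity p \<and>
     tame_roots p (chi (fst nd) (snd nd) p L)"
  proof
    fix nd assume "nd \<in> slopes"
    then obtain n d where nd: "nd = (n, d)" "(n, d) \<in> slopes" by (cases nd) auto
    have n: "n \<ge> 1" using nd by (simp add: slopes_def)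
    obtain e where e: "e \<ge> 1" and t: "tame_roots (qr (n * e)) (chi n d (qr (n * e) ^ e) L)"
      using a nd unfolding aadm_def by blast
    have ne: "n * e \<ge> 1" using n e by (metis nat_mult_1 mult_le_mono)
    note Q = qr_props[OF ne]
    show "\<exists>p. p ^ fst nd = q \<and> absv p = 1 \<and> non_root_of_unity p \<and>
     tame_roots p (chi (fst nd) (snd nd) p L)"
      using root_power[OF n e] Q non_root_of_unity_power[OF Q(2) e] t tame_subsequence[OF Q(1) _ e]
      by (intro exI[of _ "qr (n * e) ^ e"]) (auto simp: nd(1) absv_power tame_roots_def)
  qed
  then obtain P where P: "\<And>nd. nd \<in> slopes \<Longrightarrow> P nd ^ fst nd = q \<and> absv (P nd) = 1 \<and> non_root_of_unity (P nd) \<and>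
     tame_roots (P nd) (chi (fst nd) (snd nd) (P nd) L)"
    by metis
  define A where "A = (\<lambda>n d. if (n, d) \<in> slopes then
     {z ^ n * P (n, d) powi (- d * tri n) * q powi j | z j. z \<in> nz_roots (chi n d (P (n, d)) L)} else {})"
  have q0: "q \<noteq> 0" using qn by (rule non_root_of_unityD)
  have es: "exponent_system q A"
  proof
    fix \<eta> n d assume h: "\<eta> \<in> A n d"
    hence nd: "(n, d) \<in> slopes" by (auto simp: A_def split: if_splits)
    have p0: "P (n, d) \<noteq> 0" using P[OF nd] non_root_of_unityD by auto
    obtain z j where zj: "\<eta> = z ^ n * P (n, d) powi (- d * tri n) * q powi j" "z \<in> nz_roots (chi n d (P (n, d)) L)"
      using h nd by (auto simp: A_def)
    show "\<eta> \<noteq> 0" using zj p0 q0 by (auto simp: nz_roots_def)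
    show "q powi k * \<eta> \<in> A n d" for k
      unfolding A_def using nd zj q0 by (auto intro!: exI[of _ z] exI[of _ "k + j"] simp: power_int_add)
    fix \<xi> assume "\<xi> \<in> A n d"
    then obtain w i where wi: "\<xi> = w ^ n * P (n, d) powi (- d * tri n) * q powi i" "w \<in> nz_roots (chi n d (P (n, d)) L)"
      using nd by (auto simp: A_def)
    have n: "n \<ge> 1" using nd by (simp add: slopes_def)
    have zw: "z \<noteq> 0" "w \<noteq> 0" using zj wi by (auto simp: nz_roots_def)
    have "tame q ((z / w) ^ n)"
    proof (rule tame_nth_power[OF q1 _ n])
      show "tame (P (n, d)) (z / w / \<omega>)" if "\<omega> ^ n = 1" for \<omega>
      proof -
        have "tame (P (n, d)) (z / (\<omega> * w))" using P[OF nd] zj(2) chi_root_rotate[OF nd p0 that wi(2)] by (simp add: tame_roots_def)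
        thus ?thesis by (simp add: mult.commute)
      qed
    qed (use P[OF nd] zw in auto)
    moreover have "\<eta> / \<xi> = q powi (j - i) * (z / w) ^ n"
      using zw p0 q0 by (simp add: zj(1) wi(1) power_int_diff power_divide field_simps)
    ultimately show "tame q (\<eta> / \<xi>)" using tame_shift[OF q1] by simp
  qed
  moreover have "exponent_system.controls q A L"
    unfolding exponent_system.controls_def[OF es]
  proof (intro allI impI)
    fix n d assume "n \<ge> 1" "coprime (int n) d"
    hence nd: "(n, d) \<in> slopes" by (simp add: slopes_def)
    have "z ^ n * P (n, d) powi (- d * tri n) \<in> A n d" if "z \<in> nz_roots (chi n d (P (n, d)) L)" for z
    proof -
      have "z ^ n * P (n, d) powi (- d * tri n) * q powi 0 \<in> A n d" unfolding A_def using nd that by (simp del: power_int_0_right) blast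
      thus ?thesis by simp
    qed
    thus "\<exists>p. p ^ n = q \<and>
           (\<forall>z. z \<noteq> 0 \<longrightarrow> poly (chi n d p L) z = 0 \<longrightarrow> z ^ n * p powi (- d * tri n) \<in> A n d) \<and>
           (\<forall>z w. z \<noteq> 0 \<longrightarrow> w \<noteq> 0 \<longrightarrow> poly (chi n d p L) z = 0 \<longrightarrow> poly (chi n d p L) w = 0 \<longrightarrow> tame p (z / w))"
      using P[OF nd] by (intro exI[of _ "P (n, d)"]) (auto simp: nz_roots_def tame_roots_def)
  qed
  ultimately show ?thesis by (rule that)
qed

end

section \<open>Presentations by operators and cyclic vectors\<close>

section \<open>Operators presenting a module\<close>

lemma skew_mult_const:
  assumes "q \<noteq> 0" shows "skew_mult q (smult g 1) R = smult g R"
  unfolding skew_mult_smult[OF assms] skew_mult_1[OF assms] by (rule refl)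

lemma skew_mult_monom_right:
  fixes q :: "'a :: valued_field"
  assumes q0: "q \<noteq> 0" shows "coeff (skew_mult q P (monom 1 l)) k = (if k < l then 0 else coeff P (k - l))"
proof -
  have "coeff (skew_mult q P (monom 1 l)) k = (\<Sum>i\<le>degree P. if i = k - l then (if k < l then 0 else coeff P (k - l)) else 0)"
    unfolding coeff_skew_mult[OF q0] using q0 by (intro sum.cong) auto
  thus ?thesis by (auto simp: coeff_eq_0)
qed

lemma skew_mult_monom_left:
  fixes q :: "'a :: valued_field"
  assumes q0: "q \<noteq> 0"
  shows "ore_mult q (single (int k) 1) (ore_of 0 P) = ore_of 0 (skew_mult q (monom 1 k) P)"
proof -
  have "single (int k) 1 = ore_of 0 (monom (1 :: 'a mero) k)"
    by (intro poly_mapping_eqI) (auto simp: lookup_single when_def)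
  thus ?thesis by (simp add: ore_mult_ore_of[OF q0])
qed

lemma clear_denominators:
  fixes R :: "'a :: valued_field mero poly"
  obtains g L where "g \<noteq> 0" "to_mero L = smult g R"
proof -
  define k where "k = (\<Sum>i\<le>degree R. \<bar>fls_subdegree (mfls (coeff R i))\<bar>)"
  have "\<exists>a. coeff R i * mero_X powi k = to_fract a" for i
  proof -
    have "fls_nth (mfls (coeff R i * mero_X powi k)) j = 0" if "j < 0" for j
    proof (cases "i \<le> degree R")
      case True
      have "\<bar>fls_subdegree (mfls (coeff R i))\<bar> \<le> k"
        unfolding k_def using True by (intro member_le_sum) auto
      hence "j - k < fls_subdegree (mfls (coeff R i))" using that by linarith
      thus ?thesis unfolding mfls_X_powi by (rule fls_eq0_below_subdegree)
    qed (simp add: coeff_eq_0)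
    thus ?thesis using germ_of_mero by metis
  qed
  then obtain a where a: "\<And>i. coeff R i * mero_X powi k = to_fract (a i)" by metis
  define L where "L = poly_of_list (map a [0..<Suc (degree R)])"
  have a0: "a i = 0" if "\<not> i \<le> degree R" for i using a[of i] that by (simp add: coeff_eq_0)
  have "coeff L i = a i" for i
    by (cases "i \<le> degree R") (simp_all add: L_def nth_default_nth nth_default_beyond a0 del: upt_Suc)
  hence "to_mero L = smult (mero_X powi k) R" by (intro poly_eqI) (simp add: a[symmetric])
  thus ?thesis by (intro that[of "mero_X powi k"]) auto
qed

context qdm
begin

lemma cyc_smult:
  assumes "cyc smul q \<Sigma> f R N" and g: "g \<noteq> 0" shows "cyc smul q \<Sigma> f (smult g R) N"
proof -
  have "(\<exists>S. P = skew_mult q S R) \<longleftrightarrow> (\<exists>S. P = skew_mult q S (smult g R))" for P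
  proof
    assume "\<exists>S. P = skew_mult q S R"
    then obtain S where "P = skew_mult q S R" ..
    also have "R = skew_mult q (smult (1 / g) 1) (smult g R)" unfolding skew_mult_const[OF q0] using g by simp
    also have "skew_mult q S \<dots> = skew_mult q (skew_mult q S (smult (1 / g) 1)) (smult g R)" by (simp add: skew_mult_assoc[OF q0])
    finally show "\<exists>S. P = skew_mult q S (smult g R)" ..
  next
    assume "\<exists>S. P = skew_mult q S (smult g R)"
    then obtain S where "P = skew_mult q S (smult g R)" ..
    also have "smult g R = skew_mult q (smult g 1) R" by (rule skew_mult_const[OF q0, symmetric])
    also have "skew_mult q S \<dots> = skew_mult q (skew_mult q S (smult g 1)) R" by (simp add: skew_mult_assoc[OF q0])
    finally show "\<exists>S. P = skew_mult q S R" ..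
  qed
  moreover have "coeff (smult g R) 0 \<noteq> 0 \<longleftrightarrow> coeff R 0 \<noteq> 0" using g by simp
  ultimately show ?thesis using assms(1) unfolding cyc_def by blast
qed

lemma sigma_pow_image: "\<Sigma> ` N = N \<Longrightarrow> (\<Sigma> ^^ k) ` N = N"
  by (induction k) (simp_all only: funpow.simps image_comp[symmetric] image_id id_apply)

lemma app_shift: "v \<in> M \<Longrightarrow> app (skew_mult q (monom 1 k) P) v = (\<Sigma> ^^ k) (app P v)"
  by (simp add: act_skew_mult act_monom)

text \<open>Low coefficients of L may vanish. Writing L = L0 \<sigma>^l with L0 of nonzero constant
  coefficient, the class of \<sigma>^l is a cyclic vector with annihilator generated by L0.\<close>

theorem presented_cyc:
  assumes pres: "presented_by smul q M \<Sigma> L"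
  obtains e l L0 where "cyc smul q \<Sigma> e L0 M" "to_mero L = skew_mult q L0 (monom 1 l)"
proof -
  let ?rel = "left_ideal_rel q L"
  have L: "L \<noteq> 0" using pres by (simp add: presented_by_def)
  define l where "l = (LEAST i. coeff L i \<noteq> 0)"
  have l: "coeff L l \<noteq> 0" "\<And>i. i < l \<Longrightarrow> coeff L i = 0"
  proof -
    show "coeff L l \<noteq> 0" unfolding l_def by (rule LeastI[of _ "degree L"]) (use L in simp)
    show "coeff L i = 0" if "i < l" for i using not_less_Least[OF that[unfolded l_def]] by simp
  qed
  define L0 where "L0 = poly_shift l (to_mero L)"
  have c0: "coeff L0 0 \<noteq> 0" using l by (simp add: L0_def coeff_poly_shift)
  have LL: "to_mero L = skew_mult q L0 (monom 1 l)"
    using l by (intro poly_eqI) (simp add: skew_mult_monom_right[OF q0] L0_def coeff_poly_shift)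
  have Lo: "to_ore L = ore_of (int l) L0"
    using l by (intro poly_mapping_eqI) (auto simp: to_ore_conv L0_def coeff_poly_shift nat_diff_distrib)
  define I where "I = range (\<lambda>R. ore_mult q R (ore_of (int l) L0))"
  have I: "X - Y \<in> I" if "X \<in> I" "Y \<in> I" for X Y using that by (auto simp: I_def simp flip: ore_mult_diff[OF q0])
  have rel: "?rel `` {P} = {Q. P - Q \<in> I}" for P by (auto simp: left_ideal_rel_def I_def Lo)
  obtain F where bij: "bij_betw F M (UNIV // ?rel)"
    and Fa: "\<And>m n P Q. m \<in> M \<Longrightarrow> n \<in> M \<Longrightarrow> P \<in> F m \<Longrightarrow> Q \<in> F n \<Longrightarrow> P + Q \<in> F (m + n)"
    and Fc: "\<And>c m P. m \<in> M \<Longrightarrow> P \<in> F m \<Longrightarrow> ore_mult q (ore_const c) P \<in> F (smul c m)"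
    and Fs: "\<And>m P. m \<in> M \<Longrightarrow> P \<in> F m \<Longrightarrow> ore_mult q ore_sigma P \<in> F (\<Sigma> m)"
    using pres unfolding presented_by_def by blast
  have cls: "\<exists>P0. F m = {Q. P0 - Q \<in> I}" if "m \<in> M" for m
    using bij_betwE[OF bij] that rel by (force simp: quotient_def)
  have "X - X \<in> I" if "X = ore_mult q 0 (ore_of (int l) L0)" for X by (rule I) (auto simp: I_def that)
  hence I0: "0 \<in> I" by simp
  have D: "P - Q \<in> I" if m: "m \<in> M" and PQ: "P \<in> F m" "Q \<in> F m" for m P Q
  proof -
    obtain P0 where "F m = {Q. P0 - Q \<in> I}" using cls[OF m] ..
    hence "P0 - P \<in> I" "P0 - Q \<in> I" using PQ by auto
    from I[OF this(2,1)] have "(P0 - Q) - (P0 - P) \<in> I" .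
    thus ?thesis by simp
  qed
  have E: "Q \<in> F m" if m: "m \<in> M" and PQ: "P \<in> F m" "Q - P \<in> I" for m P Q
  proof -
    obtain P0 where P0: "F m = {Q. P0 - Q \<in> I}" using cls[OF m] ..
    hence "P0 - P \<in> I" using PQ by auto
    from I[OF this PQ(2)] have "(P0 - P) - (Q - P) \<in> I" .
    thus ?thesis using P0 by simp
  qed
  have ne: "\<exists>Q. Q \<in> F m" if "m \<in> M" for m using cls[OF that] I0 by (metis diff_self mem_Collect_eq)
  have F0: "0 \<in> F 0"
  proof -
    obtain P where "P \<in> F 0" using ne[OF M_0] ..
    from Fc[OF M_0 this, of 0] show ?thesis
      using poly_mapping_eqI[of "ore_mult q (ore_const 0) P" 0] by (simp add: const_ore_mult_lookup[OF q0])
  qed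
  have inj: "m = n" if mn: "m \<in> M" "n \<in> M" and P: "P \<in> F m" "P \<in> F n" for m n P
  proof -
    have "Q \<in> F n" if "Q \<in> F m" for Q using E[OF mn(2) P(2)] D[OF mn(1) that P(1)] .
    moreover have "Q \<in> F m" if "Q \<in> F n" for Q using E[OF mn(1) P(1)] D[OF mn(2) that P(2)] .
    ultimately have "F m = F n" by blast
    thus ?thesis using bij mn by (auto simp: bij_betw_def inj_on_def)
  qed
  \<comment> \<open>For this e the element P e corresponds to the class of P \<sigma>^l, so
    \<open>left_ideal_ore_of\<close> describes its annihilator.\<close>
  have "?rel `` {ore_of (int l) 1} \<in> UNIV // ?rel" by (simp add: quotientI)
  then obtain e where e: "e \<in> M" "F e = ?rel `` {ore_of (int l) 1}" using bij by (metis bij_betw_imp_surj_on imageE)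
  have e1: "ore_of (int l) 1 \<in> F e" unfolding e(2) rel using I0 by simp
  have mono: "single (int i + int l) c \<in> F (smul c ((\<Sigma> ^^ i) e))" for i c
  proof -
    have "single (int i + int l) 1 \<in> F ((\<Sigma> ^^ i) e)"
    proof (induction i)
      case (Suc i)
      have "ore_mult q ore_sigma (single (int i + int l) 1) = single (int (Suc i) + int l) 1"
        using q0 by (simp add: ore_sigma_def ore_mult_single add.assoc)
      thus ?case using Fs[OF _ Suc] e by simp
    qed (use e1 in \<open>simp add: ore_of_def\<close>)
    from Fc[OF pow_closed[OF e(1)] this, of c] show ?thesis using q0 by (simp add: ore_const_def ore_mult_single)
  qed
  have key: "ore_of (int l) P \<in> F (app P e)" for P
  proof -
    have "finite J \<Longrightarrow> (\<Sum>i\<in>J. single (int i + int l) (coeff P i)) \<in> F (\<Sum>i\<in>J. smul (coeff P i) ((\<Sigma> ^^ i) e))" for J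
      by (induction J rule: finite_induct) (auto intro!: Fa M_sum mono F0 simp: e)
    thus ?thesis by (simp add: ore_of_def act_def)
  qed
  define N where "N = range (\<lambda>P. app P e)"
  have NM: "N \<subseteq> M" using e by (auto simp: N_def)
  have cyc: "cyc smul q \<Sigma> e L0 N"
    unfolding cyc_def
  proof (intro conjI allI)
    show "e \<in> N" unfolding N_def by (metis act_1 rangeI)
    fix P
    have "app P e = 0 \<longleftrightarrow> ore_of (int l) P \<in> I"
    proof
      assume "app P e = 0"
      thus "ore_of (int l) P \<in> I" using D[OF M_0 _ F0, of "ore_of (int l) P"] key[of P] by simp
    next
      assume "ore_of (int l) P \<in> I"
      hence "ore_of (int l) P \<in> F 0" using E[OF M_0 F0, of "ore_of (int l) P"] by simp
      thus "app P e = 0" using inj[of "app P e" 0] key[of P] e(1) by simp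
    qed
    thus "app P e = 0 \<longleftrightarrow> (\<exists>S. P = skew_mult q S L0)"
      using left_ideal_ore_of[OF q0 c0, of "int l" P] by (auto simp: I_def)
  qed (use c0 N_def in auto)
  have "M \<subseteq> N"
  proof
    fix m assume m: "m \<in> M"
    obtain Q where Q: "Q \<in> F m" using ne[OF m] ..
    \<comment> \<open>Multiplying by a high power of \<sigma> removes the powers below \<sigma>^l;
      the surjectivity of \<Sigma> on N allows this power to be undone.\<close>
    have sh: "(ore_mult q ore_sigma ^^ k) Q \<in> F ((\<Sigma> ^^ k) m) \<and>
       (\<forall>i. lookup ((ore_mult q ore_sigma ^^ k) Q) i \<noteq> 0 \<longrightarrow> lookup Q (i - int k) \<noteq> 0)" for k
    proof (induction k)
      case (Suc k)
      thus ?case using Fs[of "(\<Sigma> ^^ k) m"] m q0 by (auto simp: sigma_ore_mult_lookup[OF q0] algebra_simps)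
    qed (use Q in simp)
    define k where "k = nat (int l - Min (insert 0 (keys Q)))"
    have "int l \<le> i" if "i \<in> keys ((ore_mult q ore_sigma ^^ k) Q)" for i
    proof -
      have "i - int k \<in> keys Q" using that sh[of k] by (auto simp: in_keys_iff)
      hence "Min (insert 0 (keys Q)) \<le> i - int k" by (intro Min_le) auto
      moreover have "int l - Min (insert 0 (keys Q)) \<le> int k" unfolding k_def by linarith
      ultimately show ?thesis by linarith
    qed
    then obtain P where P: "(ore_mult q ore_sigma ^^ k) Q = ore_of (int l) P" by (rule ore_of_surj)
    have "(\<Sigma> ^^ k) m = app P e"
      using inj[OF _ _ _ key[of P]] sh[of k] m e(1) P by (metis act_closed pow_closed)
    hence "(\<Sigma> ^^ k) m \<in> (\<Sigma> ^^ k) ` N" unfolding sigma_pow_image[OF cyc_image[OF cyc NM]] by (simp add: N_def)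
    then obtain n where "n \<in> N" "(\<Sigma> ^^ k) m = (\<Sigma> ^^ k) n" by blast
    thus "m \<in> N" using sigma_pow_inj[of m n k] m NM by blast
  qed
  hence "cyc smul q \<Sigma> e L0 M" using cyc NM by (metis subset_antisym)
  thus ?thesis using LL by (rule that)
qed

text \<open>Evaluation at f extends from skew polynomials to Laurent skew polynomials because
  \<Sigma> is invertible on N; its kernel is the ideal generated by L, and its fibres are the
  cosets.\<close>

theorem cyc_presented:
  assumes cyc: "cyc smul q \<Sigma> f (to_mero L) N" and NM: "N \<subseteq> M"
  shows "presented_by smul q N \<Sigma> L"
proof -
  let ?sh = "\<lambda>k. ore_mult q (single (int k) 1)"
  have f: "f \<in> M" and N: "N = range (\<lambda>P. app P f)" using cyc NM by (auto simp: cyc_def)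
  have st: "stable N" by (rule cyc_stable[OF cyc NM])
  have im: "(\<Sigma> ^^ k) ` N = N" for k by (rule sigma_pow_image[OF cyc_image[OF cyc NM]])
  have sub: "subspace N" using st by (simp add: stable_def)
  have lk: "lookup (?sh k Q) i = mero_dilate (q ^ k) (lookup Q (i - int k))" for k Q i
    by (simp add: single_ore_mult_lookup[OF q0])
  have shsh: "?sh j (?sh k Q) = ?sh (j + k) Q" for j k Q
  proof (rule poly_mapping_eqI)
    show "lookup (?sh j (?sh k Q)) i = lookup (?sh (j + k) Q) i" for i
      unfolding lk using q0 by (simp add: mero_dilate_dilate power_add algebra_simps)
  qed
  have large: "\<exists>k0. \<forall>k\<ge>k0. \<exists>P. ?sh k Q = ore_of 0 P" for Q
  proof (rule exI, intro allI impI)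
    fix k assume k: "nat (- Min (insert 0 (keys Q))) \<le> k"
    have "0 \<le> i" if "i \<in> keys (?sh k Q)" for i
    proof -
      have "i - int k \<in> keys Q" using that q0 by (auto simp: in_keys_iff lk)
      hence "Min (insert 0 (keys Q)) \<le> i - int k" by (intro Min_le) auto
      thus ?thesis using k by linarith
    qed
    thus "\<exists>P. ?sh k Q = ore_of 0 P" using ore_of_surj by metis
  qed
  \<comment> \<open>The value of Q is the m with \<Sigma>^k m = (\<sigma>^k Q) f. It exists since
    \<Sigma>^k maps N onto N, and all k with polynomial \<sigma>^k Q give the same m since \<Sigma>
    is injective.\<close>
  have "\<exists>m\<in>N. \<forall>k P. ?sh k Q = ore_of 0 P \<longrightarrow> (\<Sigma> ^^ k) m = app P f" for Q
  proof -
    obtain k0 P0 where P0: "?sh k0 Q = ore_of 0 P0" using large[of Q] by blast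
    have "app P0 f \<in> (\<Sigma> ^^ k0) ` N" unfolding im by (simp add: N)
    then obtain m where m: "m \<in> N" "app P0 f = (\<Sigma> ^^ k0) m" by blast
    have "(\<Sigma> ^^ k) m = app P f" if P: "?sh k Q = ore_of 0 P" for k P
    proof (rule sigma_pow_inj)
      have "ore_of 0 (skew_mult q (monom 1 k0) P) = ore_of 0 (skew_mult q (monom 1 k) P0)"
        unfolding skew_mult_monom_left[OF q0, symmetric] P[symmetric] P0[symmetric] shsh by (simp add: add.commute)
      hence "app (skew_mult q (monom 1 k0) P) f = app (skew_mult q (monom 1 k) P0) f" by (simp only: ore_of_inj)
      thus "(\<Sigma> ^^ k0) ((\<Sigma> ^^ k) m) = (\<Sigma> ^^ k0) (app P f)"
        unfolding app_shift[OF f] m(2) by (metis add.commute comp_apply funpow_add)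
    qed (use m NM f in auto)
    thus ?thesis using m by blast
  qed
  then obtain ev where ev: "\<And>Q. ev Q \<in> N" "\<And>Q k P. ?sh k Q = ore_of 0 P \<Longrightarrow> (\<Sigma> ^^ k) (ev Q) = app P f" by metis
  have evM: "ev Q \<in> M" for Q using ev(1) NM by blast
  have ev_add: "ev (P + Q) = ev P + ev Q" for P Q
  proof -
    obtain k1 k2 where "\<forall>k\<ge>k1. \<exists>X. ?sh k P = ore_of 0 X" "\<forall>k\<ge>k2. \<exists>X. ?sh k Q = ore_of 0 X" using large by metis
    then obtain k X Y where XY: "?sh k P = ore_of 0 X" "?sh k Q = ore_of 0 Y" by (meson max.cobounded1 max.cobounded2)
    have "?sh k (P + Q) = ?sh k P + ?sh k Q" using q0 by (intro poly_mapping_eqI) (simp add: lk lookup_add mero_dilate_add)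
    also have "\<dots> = ore_of 0 (X + Y)" unfolding XY by (intro poly_mapping_eqI) (simp add: lookup_add)
    finally have "(\<Sigma> ^^ k) (ev (P + Q)) = (\<Sigma> ^^ k) (ev P + ev Q)" using ev(2) XY evM by (simp add: act_add pow_add)
    thus ?thesis using sigma_pow_inj evM by (metis M_add)
  qed
  have ev_const: "ev (ore_mult q (ore_const c) Q) = smul c (ev Q)" for c Q
  proof -
    obtain k X where X: "?sh k Q = ore_of 0 X" using large by blast
    have "lookup (?sh k (ore_mult q (ore_const c) Q)) i = lookup (ore_of 0 (smult (mero_dilate (q ^ k) c) X)) i" for i
      using q0 arg_cong[OF X, of "\<lambda>Z. lookup Z i"]
      by (auto simp: lk const_ore_mult_lookup[OF q0] mero_dilate_mult split: if_splits)
    hence "?sh k (ore_mult q (ore_const c) Q) = ore_of 0 (smult (mero_dilate (q ^ k) c) X)" by (intro poly_mapping_eqI)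
    hence "(\<Sigma> ^^ k) (ev (ore_mult q (ore_const c) Q)) = (\<Sigma> ^^ k) (smul c (ev Q))" using ev(2)[OF X] ev(2) evM by (simp add: act_smult pow_scale)
    thus ?thesis using sigma_pow_inj evM by (metis M_scale)
  qed
  have ev_sigma: "ev (ore_mult q ore_sigma Q) = \<Sigma> (ev Q)" for Q
  proof -
    have s: "ore_mult q ore_sigma Q = ?sh 1 Q" by (simp add: ore_sigma_def)
    obtain k X where X: "?sh k (?sh 1 Q) = ore_of 0 X" using large by blast
    hence "(\<Sigma> ^^ Suc k) (ev Q) = app X f" using ev(2)[of "Suc k" Q X] by (simp only: shsh add.commute plus_1_eq_Suc)
    hence "(\<Sigma> ^^ k) (\<Sigma> (ev Q)) = (\<Sigma> ^^ k) (ev (ore_mult q ore_sigma Q))" unfolding s ev(2)[OF X] by (simp add: funpow_swap1)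
    thus ?thesis using sigma_pow_inj evM closed by metis
  qed
  have ev_0: "ev X = 0 \<longleftrightarrow> (\<exists>R. X = ore_mult q R (to_ore L))" for X
  proof -
    obtain k P where P: "?sh k X = ore_of 0 P" using large by blast
    have "ev X = 0 \<longleftrightarrow> app P f = 0" using ev(2)[OF P] sigma_pow_inj[of "ev X" 0 k] evM by auto
    also have "\<dots> \<longleftrightarrow> (\<exists>R. ?sh k X = ore_mult q R (to_ore L))"
      unfolding cyc_zero[OF cyc] P to_ore_conv using cyc left_ideal_ore_of[OF q0] by (metis cyc_def)
    also have "\<dots> \<longleftrightarrow> (\<exists>R. X = ore_mult q R (to_ore L))"
    proof
      assume "\<exists>R. ?sh k X = ore_mult q R (to_ore L)"
      then obtain R where R: "?sh k X = ore_mult q R (to_ore L)" ..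
      have "X = ore_mult q (single (- int k) 1) (?sh k X)"
        using q0 by (intro poly_mapping_eqI) (simp add: single_ore_mult_lookup[OF q0] mero_dilate_dilate power_int_minus)
      also have "\<dots> = ore_mult q (ore_mult q (single (- int k) 1) R) (to_ore L)" unfolding R by (rule single_ore_mult_assoc[OF q0])
      finally show "\<exists>R. X = ore_mult q R (to_ore L)" ..
    next
      assume "\<exists>R. X = ore_mult q R (to_ore L)"
      thus "\<exists>R. ?sh k X = ore_mult q R (to_ore L)" using single_ore_mult_assoc[OF q0] by blast
    qed
    finally show ?thesis .
  qed
  have rel: "left_ideal_rel q L `` {P} = {Q. ev Q = ev P}" for P
  proof -
    have "ev P = ev (P - Q) + ev Q" for Q using ev_add[of "P - Q" Q] by simp
    hence "ev Q = ev P \<longleftrightarrow> ev (P - Q) = 0" for Q by (metis add_cancel_left_left)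
    thus ?thesis by (auto simp: left_ideal_rel_def ev_0)
  qed
  have surj: "\<exists>P. ev P = m" if m: "m \<in> N" for m
  proof -
    obtain P where P: "m = app P f" using m N by blast
    have "?sh 0 (ore_of 0 P) = ore_of 0 P" by (intro poly_mapping_eqI) (simp only: lk, simp)
    thus ?thesis using ev(2)[of 0 "ore_of 0 P" P] P by (intro exI[of _ "ore_of 0 P"]) simp
  qed
  have "bij_betw (\<lambda>m. {Q. ev Q = m}) N (UNIV // left_ideal_rel q L)"
  proof (rule bij_betwI')
    show "{Q. ev Q = m} = {Q. ev Q = n} \<longleftrightarrow> m = n" if "m \<in> N" "n \<in> N" for m n using surj[OF that(1)] by auto
    show "{Q. ev Q = m} \<in> UNIV // left_ideal_rel q L" if "m \<in> N" for m
      using surj[OF that] rel by (metis UNIV_I quotientI)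
    show "\<exists>m\<in>N. Y = {Q. ev Q = m}" if Y: "Y \<in> UNIV // left_ideal_rel q L" for Y
    proof -
      obtain P where "Y = left_ideal_rel q L `` {P}" using Y unfolding quotient_def by blast
      thus ?thesis unfolding rel using ev(1) by blast
    qed
  qed
  moreover have "L \<noteq> 0" using cyc_nonzero[OF cyc] by simp
  ultimately show ?thesis
    unfolding presented_by_def by (intro conjI exI[of _ "\<lambda>m. {Q. ev Q = m}"]) (auto simp: ev_add ev_const ev_sigma)
qed

end

section \<open>Assembling the decomposition by slopes and into indecomposables\<close>

section \<open>The slope decomposition\<close>

locale admissible_module = controlled smul q M \<Sigma> A e L + base_roots q qr
  for smul :: "'a :: base_field mero \<Rightarrow> 'b :: ab_group_add \<Rightarrow> 'b" and q :: 'a and M \<Sigma> A e L and qr :: "nat \<Rightarrow> 'a" +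
  assumes adm: "aadm qr L"
begin

text \<open>The operator of a submodule is a left factor of L, so it inherits both conditions;
  multiplying it by a nonzero element of \<open>K\<close> clears denominators and keeps the cyclic
  vector.\<close>

lemma stable_presented:
  assumes Z: "stable Z"
  obtains f X where "cyc smul q \<Sigma> f (to_mero X) Z" "controls (to_mero X)" "almost_admissible_op qr X"
    "presented_by smul q Z \<Sigma> X"
proof -
  have ZM: "Z \<subseteq> M" using Z by (simp add: stable_def)
  obtain R P where R: "L = skew_mult q R P" "cyc smul q \<Sigma> (app P e) R Z" "R \<noteq> 0" "P \<noteq> 0" "controls R"
    using stable_cyc[OF Z] by blast
  obtain g X where g: "g \<noteq> 0" "to_mero X = smult g R" by (rule clear_denominators)
  have RX: "R = skew_mult q (smult (1 / g) 1) (to_mero X)" unfolding skew_mult_const[OF q0] g(2) using g(1) by simp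
  have nz: "smult (1 / g) 1 \<noteq> 0" "to_mero X \<noteq> 0" using g R(3) by auto
  hence X0: "X \<noteq> 0" by simp
  have "aadm qr R" using aadm_skew_mult(1)[OF _ R(3,4)] adm R(1) by simp
  hence "aadm qr (to_mero X)" using aadm_skew_mult(2)[OF _ nz(1,2)] RX by metis
  moreover have "controls (to_mero X)" using controls_skew_mult(2)[OF qn _ nz(1,2)] R(5) RX by metis
  moreover have c: "cyc smul q \<Sigma> (app P e) (to_mero X) Z" unfolding g(2) by (rule cyc_smult[OF R(2) g(1)])
  ultimately show ?thesis using that almost_admissible_op_iff[OF X0] cyc_presented[OF c ZM] by blast
qed

lemma stable_admissible: "stable Z \<Longrightarrow> almost_admissible_module smul qr q Z \<Sigma>"
  using stable_presented[of Z] stable_q_submodule[of Z Z]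
  by (metis almost_admissible_module_def order_refl q_submodule_def)

lemma slope_dim:
  assumes c: "cyc smul q \<Sigma> f X Z" and ZM: "Z \<subseteq> M" and nd: "(n, d) \<in> slopes"
  shows "nwidth n d X = dim (eig_span A {(n, d)} Z)"
proof -
  have n: "n \<ge> 1" using nd by (simp add: slopes_def)
  show ?thesis
    using slope_width[OF c ZM stable_generated[OF cyc_stable[OF c ZM]] nd qr[OF n]] width_chi[OF n qr_props(3)[OF n], of d X] by simp
qed

text \<open>By \<open>slope_dim\<close> a slope of the operator is one whose span is nonzero, and
  spans of two different slopes meet in zero, so only d/n remains.\<close>

lemma pure:
  assumes Z: "stable Z" "Z \<noteq> {0}" and nd: "(n, d) \<in> slopes" "eig_span A {(n, d)} Z = Z"
  shows "pure_module smul q Z \<Sigma> (real_of_int d / real n)"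
proof -
  have ZM: "Z \<subseteq> M" using Z by (simp add: stable_def)
  obtain f X where X: "cyc smul q \<Sigma> f (to_mero X) Z" "controls (to_mero X)" "presented_by smul q Z \<Sigma> X"
    using stable_presented[OF Z(1)] by blast
  have d0: "dim Z > 0" using stable_dim_0[OF Z(1)] Z(2) by simp
  have "fst ` newton_slopes X = {real_of_int d / real n}"
  proof (intro equalityI subsetI)
    fix \<mu> assume "\<mu> \<in> fst ` newton_slopes X"
    then obtain r where r: "(\<mu>, r) \<in> newton_slopes X" by auto
    obtain n' d' where n': "(n', d') \<in> slopes" "\<mu> = real_of_int d' / real n'" by (rule newton_slopes_rational[OF r])
    have "nwidth n' d' (to_mero X) > 0" using r newton_slopes_iff[OF n'(1), of r X] n'(2) by auto
    hence pos: "dim (eig_span A {(n', d')} Z) > 0" unfolding slope_dim[OF X(1) ZM n'(1)] .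
    have "(n', d') = (n, d)"
    proof (rule ccontr)
      assume "(n', d') \<noteq> (n, d)"
      hence "eig_span A {(n', d')} Z \<inter> eig_span A {(n, d)} Z = {0}"
        using n'(1) nd(1) by (intro eig_span_disjoint[OF X(2,1) ZM]) auto
      hence "eig_span A {(n', d')} Z = {0}" using eig_span_stable(2)[OF Z(1), of "{(n', d')}"] nd(2) by auto
      thus False using pos stable_dim_0[OF stable_zero] by simp
    qed
    thus "\<mu> \<in> {real_of_int d / real n}" using n'(2) by simp
  next
    fix \<mu> assume "\<mu> \<in> {real_of_int d / real n}"
    moreover have "(real_of_int d / real n, real (nwidth n d (to_mero X))) \<in> newton_slopes X"
      unfolding newton_slopes_iff[OF nd(1)] slope_dim[OF X(1) ZM nd(1)] nd(2) using d0 by simp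
    ultimately show "\<mu> \<in> fst ` newton_slopes X" by force
  qed
  thus ?thesis using X(3) by (auto simp: pure_module_def pure_of_slope_def)
qed

lemma indecomposable_summand:
  assumes P: "stable P" and ind: "indecomposable_module smul q \<Sigma> P"
  shows "\<exists>S. simple_module smul q \<Sigma> S \<and> almost_admissible_module smul qr q S \<Sigma> \<and> iterated_self_extension smul q \<Sigma> S P"
proof -
  obtain n d \<nu> y where y: "(n, d) \<in> slopes" "eig_span A {(n, d)} P = P" "\<nu> \<in> A n d" "y \<in> P" "y \<noteq> 0" "shop n d \<nu> y = 0"
    by (rule indecomposable_single_slope[OF P ind])
  interpret C: indecomposable_class smul q M \<Sigma> A e L P n d \<nu>
    using P ind y(1,3) indecomposable_single_class[OF P ind y] by unfold_locales
  show ?thesis using C.indecomposable_structure stable_admissible by metis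
qed

lemma dsum_member_stable: "dsum Ps Z \<Longrightarrow> P \<in> set Ps \<Longrightarrow> stable P"
  by (induction Ps arbitrary: Z) auto

lemma decomposition:
  assumes Z: "stable Z"
  shows "\<exists>(l :: nat) P. internal_direct_sum {1..l} P Z \<and>
    (\<forall>j\<in>{1..l}. q_submodule smul q \<Sigma> (P j) Z \<and> almost_admissible_module smul qr q (P j) \<Sigma> \<and>
       indecomposable_module smul q \<Sigma> (P j) \<and>
       (\<exists>S. simple_module smul q \<Sigma> S \<and> almost_admissible_module smul qr q S \<Sigma> \<and> iterated_self_extension smul q \<Sigma> S (P j)))"
proof -
  obtain Ps where Ps: "dsum Ps Z" "\<And>P. P \<in> set Ps \<Longrightarrow> indecomposable_module smul q \<Sigma> P"
    using indecomposable_decomposition[OF Z] by blast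
  define P where "P = (\<lambda>j. Ps ! (j - Suc 0))"
  have mem: "P j \<in> set Ps" if "j \<in> {1..length Ps}" for j unfolding P_def using that by (intro nth_mem) auto
  have "internal_direct_sum {1..length Ps} P Z" using dsum_internal[OF Ps(1), of 0] by (simp add: P_def)
  moreover have "q_submodule smul q \<Sigma> (P j) Z \<and> almost_admissible_module smul qr q (P j) \<Sigma> \<and>
       indecomposable_module smul q \<Sigma> (P j) \<and>
       (\<exists>S. simple_module smul q \<Sigma> S \<and> almost_admissible_module smul qr q S \<Sigma> \<and> iterated_self_extension smul q \<Sigma> S (P j))"
    if j: "j \<in> {1..length Ps}" for j
  proof -
    have st: "stable (P j)" by (rule dsum_member_stable[OF Ps(1) mem[OF j]])
    have i: "indecomposable_module smul q \<Sigma> (P j)" by (rule Ps(2)[OF mem[OF j]])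
    show ?thesis by (intro conjI stable_q_submodule[OF st dsum_subset[OF Ps(1) mem[OF j]]] stable_admissible[OF st] i indecomposable_summand[OF st i])
  qed
  ultimately show ?thesis by blast
qed

lemma slopes_direct_sum:
  assumes "finite I" "inj_on s I" "s ` I \<subseteq> slopes"
  shows "internal_direct_sum I (\<lambda>i. eig_span A {s i} M) (eig_span A (s ` I) M)"
  using assms
proof (induction I rule: finite_induct)
  case empty
  have "eig_span A {} M = {0}" by (simp add: eig_span_def eig_gens_def)
  thus ?case by (auto simp: internal_direct_sum_def bij_betw_def inj_on_def)
next
  case (insert i I)
  have M: "stable M" by (rule cyc_stable[OF cyclic order_refl])
  have "eig_span A {s i} M \<inter> eig_span A (s ` I) M = {0}"
    using insert by (intro eig_span_disjoint[OF ctrl cyclic order_refl]) auto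
  hence "internal_direct_sum (insert i I) (\<lambda>i. eig_span A {s i} M) (set_sum (eig_span A {s i} M) (eig_span A (s ` I) M))"
    using insert by (intro internal_direct_sum_insert) (auto intro: eig_span_stable(1)[OF M])
  moreover have "set_sum (eig_span A {s i} M) (eig_span A (s ` I) M) = eig_span A (s ` insert i I) M"
    using eig_span_Un[where S = "{s i}" and S' = "s ` I" and N = M] by (simp add: set_sum_def)
  ultimately show ?case by simp
qed

text \<open>The Newton polygon may be given by a different presenting operator than the admissible
  one. Both have the same widths, because these are the dimensions of spans that depend only on the
  module.\<close>

lemma slope_decomposition:
  assumes ns: "module_has_newton_slopes smul q M \<Sigma> {(\<mu> i, real (r i)) | i. i \<in> {1..k :: nat}}"
    and mono: "strict_mono_on {1..k} \<mu>"
  obtains s where "\<And>i. i \<in> {1..k} \<Longrightarrow> s i \<in> slopes \<and> \<mu> i = real_of_int (snd (s i)) / real (fst (s i)) \<and>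
      dim (eig_span A {s i} M) = r i \<and> r i > 0"
    "internal_direct_sum {1..k} (\<lambda>i. eig_span A {s i} M) M"
proof -
  have M: "stable M" by (rule cyc_stable[OF cyclic order_refl])
  obtain X where X: "presented_by smul q M \<Sigma> X" "newton_slopes X = {(\<mu> i, real (r i)) | i. i \<in> {1..k}}"
    using ns by (auto simp: module_has_newton_slopes_def)
  obtain f l Y where Y: "cyc smul q \<Sigma> f Y M" "to_mero X = skew_mult q Y (monom 1 l)"
    by (rule presented_cyc[OF X(1)])
  have dims: "nwidth n d (to_mero X) = dim (eig_span A {(n, d)} M)" if nd: "(n, d) \<in> slopes" for n d
  proof -
    have n: "n \<ge> 1" using nd by (simp add: slopes_def)
    note Q = qr[OF n] qr_props(3)[OF n] qr_props(2)[OF n]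
    have Y0: "Y \<noteq> 0" by (rule cyc_nonzero[OF Y(1)])
    have m0: "monom 1 l \<noteq> (0 :: 'a mero poly)" by simp
    have nz: "chi n d (qr n) Y \<noteq> 0" "chi n d (qr n) (monom 1 l) \<noteq> 0"
      using chi_nonzero[OF n refl Q(2)] Y0 m0 by blast+
    \<comment> \<open>The factor \<sigma>^l has a single coefficient, so it contributes no
      width.\<close>
    have iff: "coeff (chi n d (qr n) (monom 1 l)) i \<noteq> 0 \<longleftrightarrow> i = l" for i
      unfolding chi_coeff_iff_min[OF n Q(2)] by (auto split: if_splits)
    have "width (chi n d (qr n) (monom 1 l)) = l - l" by (rule width_eqI) (simp_all add: iff)
    moreover have "width (chi n d (qr n) (to_mero X)) = width (chi n d (qr n) Y) + width (chi n d (qr n) (monom 1 l))"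
      unfolding Y(2) chi_skew_mult(2)[OF n Q Y0 m0] using nz Q(2)
      by (subst width_mult) (auto simp: pcompose_eq_0_iff width_pcompose)
    ultimately show ?thesis using width_chi[OF n Q(2)] slope_dim[OF Y(1) order_refl nd] by simp
  qed
  have "\<exists>nd. nd \<in> slopes \<and> \<mu> i = real_of_int (snd nd) / real (fst nd) \<and> dim (eig_span A {nd} M) = r i \<and> r i > 0"
    if i: "i \<in> {1..k}" for i
  proof -
    have *: "(\<mu> i, real (r i)) \<in> newton_slopes X" using X(2) i by blast
    obtain n d where nd: "(n, d) \<in> slopes" "\<mu> i = real_of_int d / real n" by (rule newton_slopes_rational[OF *])
    thus ?thesis using * newton_slopes_iff[OF nd(1), of "real (r i)" X] dims[OF nd(1)] by (intro exI[of _ "(n, d)"]) auto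
  qed
  then obtain s where s: "\<And>i. i \<in> {1..k} \<Longrightarrow> s i \<in> slopes \<and> \<mu> i = real_of_int (snd (s i)) / real (fst (s i)) \<and>
      dim (eig_span A {s i} M) = r i \<and> r i > 0" by metis
  have "inj_on s {1..k}"
  proof (rule inj_onI)
    fix i j assume "i \<in> {1..k}" "j \<in> {1..k}" "s i = s j"
    thus "i = j" using s strict_mono_on_imp_inj_on[OF mono] by (metis inj_onD)
  qed
  from slopes_direct_sum[OF _ this] have ds: "internal_direct_sum {1..k} (\<lambda>i. eig_span A {s i} M) (eig_span A (s ` {1..k}) M)"
    using s by blast
  have "eig_gens A slopes M \<subseteq> eig_span A (s ` {1..k}) M"
  proof
    fix v assume "v \<in> eig_gens A slopes M"
    then obtain n d \<eta> where v: "v \<in> M" "(n, d) \<in> slopes" "\<eta> \<in> A n d" "v \<in> gen_eig n d \<eta>" by (auto simp: eig_gens_def)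
    hence ve: "v \<in> eig_span A {(n, d)} M" unfolding eig_span_def by (intro span_base) (auto simp: eig_gens_def)
    have st: "stable (eig_span A {(n, d)} M)" by (rule eig_span_stable(1)[OF M])
    show "v \<in> eig_span A (s ` {1..k}) M"
    proof (cases "v = 0")
      case True
      thus ?thesis by (simp add: eig_span_def span_zero)
    next
      case False
      hence "dim (eig_span A {(n, d)} M) > 0" using stable_dim_0[OF st] ve by auto
      hence "(real_of_int d / real n, real (nwidth n d (to_mero X))) \<in> newton_slopes X"
        unfolding newton_slopes_iff[OF v(2)] dims[OF v(2)] by simp
      then obtain i where i: "i \<in> {1..k}" "\<mu> i = real_of_int d / real n" unfolding X(2) by auto
      obtain n' d' where si: "s i = (n', d')" "(n', d') \<in> slopes" using s[OF i(1)] by (metis surj_pair)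
      have "n \<ge> 1" "n' \<ge> 1" using v(2) si(2) by (auto simp: slopes_def)
      moreover have "real_of_int d / real n = real_of_int d' / real n'" using s[OF i(1)] si(1) i(2) by simp
      ultimately have "real_of_int (d * int n') = real_of_int (d' * int n)" by (simp add: field_simps)
      hence "d * int n' = d' * int n" by (rule of_int_eq_iff[THEN iffD1])
      hence "(n, d) = s i" using slopes_unique[of n n' d d'] v(2) si by (auto simp: slopes_def)
      with i(1) have "(n, d) \<in> s ` {1..k}" by (rule rev_image_eqI)
      hence "eig_gens A {(n, d)} M \<subseteq> eig_gens A (s ` {1..k}) M" unfolding eig_gens_def by blast
      hence "eig_span A {(n, d)} M \<subseteq> eig_span A (s ` {1..k}) M" unfolding eig_span_def by (rule span_mono)
      thus ?thesis using ve by blast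
    qed
  qed
  hence "eig_span A slopes M \<subseteq> eig_span A (s ` {1..k}) M" unfolding eig_span_def[of A slopes] by (rule span_minimal) (simp add: eig_span_def)
  moreover have "eig_span A (s ` {1..k}) M \<subseteq> M" by (rule eig_span_stable(2)[OF M])
  ultimately have "eig_span A (s ` {1..k}) M = M" using stable_generated[OF M] by simp
  thus ?thesis using that[of s] s ds by simp
qed

end

theorem theorem3p14:
  fixes q :: "'a :: base_field" and qr :: "nat \<Rightarrow> 'a"
    and smul :: "'a mero \<Rightarrow> 'b :: ab_group_add \<Rightarrow> 'b"
    and M :: "'b set" and \<Sigma> :: "'b \<Rightarrow> 'b"
    and k :: nat and \<mu> :: "nat \<Rightarrow> real" and r :: "nat \<Rightarrow> nat"
  assumes "absv q = 1"
    and "\<And>n. n \<ge> 1 \<Longrightarrow> q ^ n \<noteq> 1"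
    and "\<And>n. n \<ge> 1 \<Longrightarrow> qr n ^ n = q"
    and "convergent_coeffs (\<lambda>n. 1 / qpoch q q n)"
    and "q_difference_module smul q M \<Sigma>"
    and "almost_admissible_module smul qr q M \<Sigma>"
    and "module_has_newton_slopes smul q M \<Sigma> {(\<mu> i, real (r i)) | i. i \<in> {1..k}}"
    and "strict_mono_on {1..k} \<mu>"
  shows "\<exists>N :: nat \<Rightarrow> 'b set.
    internal_direct_sum {1..k} N M \<and>
    (\<forall>i\<in>{1..k}.
       q_submodule smul q \<Sigma> (N i) M \<and>
       almost_admissible_module smul qr q (N i) \<Sigma> \<and>
       pure_module smul q (N i) \<Sigma> (\<mu> i) \<and>
       vector_space.dim smul (N i) = r i \<and>
       (\<exists>(l :: nat) P.
          internal_direct_sum {1..l} P (N i) \<and>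
          (\<forall>j\<in>{1..l}.
             q_submodule smul q \<Sigma> (P j) (N i) \<and>
             almost_admissible_module smul qr q (P j) \<Sigma> \<and>
             indecomposable_module smul q \<Sigma> (P j) \<and>
             (\<exists>S. simple_module smul q \<Sigma> S \<and>
                  almost_admissible_module smul qr q S \<Sigma> \<and>
                  iterated_self_extension smul q \<Sigma> S (P j)))))"
proof -
  have qn: "non_root_of_unity q" using assms(1,2) by (auto simp: non_root_of_unity_def)
  have t1: "tame q 1" using tame_one_iff[OF assms(1) qn] assms(4) by simp
  interpret base_roots q qr using assms(1,3) qn t1 by unfold_locales
  interpret qdm smul q M \<Sigma> using assms(1,5) qn by (intro qdm.intro qdm_axioms.intro)
  obtain X where X: "presented_by smul q M \<Sigma> X" "almost_admissible_op qr X"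
    using assms(6) by (auto simp: almost_admissible_module_def)
  obtain e l L where L: "cyc smul q \<Sigma> e L M" "to_mero X = skew_mult q L (monom 1 l)" by (rule presented_cyc[OF X(1)])
  have nz: "X \<noteq> 0" "L \<noteq> 0" using X(1) cyc_nonzero[OF L(1)] by (auto simp: presented_by_def)
  have "aadm qr (to_mero X)" using X(2) almost_admissible_op_iff[OF nz(1)] by simp
  \<comment> \<open>The right factor \<sigma>^l is split off from the presenting operator, and
    admissibility passes to the remaining factor.\<close>
  hence aL: "aadm qr L" unfolding L(2) by (rule aadm_skew_mult(1)) (use nz in auto)
  obtain A where A: "exponent_system q A" "exponent_system.controls q A L" by (rule exponent_system_exists[OF aL nz(2)])
  interpret admissible_module smul q M \<Sigma> A e L qr
    by (intro admissible_module.intro controlled.intro qdm_exponents.intro controlled_axioms.intro admissible_module_axioms.intro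
        qdm_axioms base_roots_axioms A L(1) aL)
  have M: "stable M" by (rule cyc_stable[OF L(1) order_refl])
  obtain s where s: "\<And>i. i \<in> {1..k} \<Longrightarrow> s i \<in> slopes \<and> \<mu> i = real_of_int (snd (s i)) / real (fst (s i)) \<and>
      dim (eig_span A {s i} M) = r i \<and> r i > 0" and ds: "internal_direct_sum {1..k} (\<lambda>i. eig_span A {s i} M) M"
    using slope_decomposition[OF assms(7,8)] by metis
  have st: "stable (eig_span A {s i} M)" "eig_span A {s i} M \<subseteq> M" for i using eig_span_stable[OF M] by blast+
  have pu: "pure_module smul q (eig_span A {s i} M) \<Sigma> (\<mu> i)" if i: "i \<in> {1..k}" for i
  proof -
    have "eig_span A {s i} M \<noteq> {0}" using s[OF i] stable_dim_0[OF st(1)[of i]] by auto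
    thus ?thesis using pure[OF st(1)[of i], of "fst (s i)" "snd (s i)"] s[OF i] eig_span_idem[OF M, of "{s i}"] by simp
  qed
  have "dim (eig_span A {s i} M) = r i" if "i \<in> {1..k}" for i using s[OF that] by blast
  thus ?thesis
    by (intro exI[of _ "\<lambda>i. eig_span A {s i} M"] conjI ballI ds pu stable_q_submodule[OF st] stable_admissible[OF st(1)] decomposition[OF st(1)])
qed

end
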